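(* Let $\phi:\mathbb{N}\to\mathbb{C}$ be a Besicovitch almost periodic sequence, and let $(X,\mathcal{B},\mu,T)$ be a measure preserving system whose discrete spectrum satisfies $\sigma(T)\cap\langle\sigma(\phi)\rangle=\{0\}$. Then for any $k\in\mathbb{N}$ and any $f_1,\ldots,f_k\in L^\infty(X)$, $$\lim_{N\to\infty}\frac1N\sum_{n=1}^N\phi(n)\prod_{j=1}^kT^{jn}f_j=\left(\lim_{N\to\infty}\frac1N\sum_{n=1}^N\phi(n)\right)\left(\lim_{N\to\infty}\frac1N\sum_{n=1}^N\prod_{j=1}^kT^{jn}f_j\right)$$ in $L^2(X)$.
   Context: A measure preserving system $(X,\mathcal{B},\mu,T)$ is a probability space $(X,\mathcal{B},\mu)$ with a measure preserving transformation $T:X\to X$ (not assumed ergodic here); $T^nf:=f\circ T^n$. Let $\mathbb{T}=\mathbb{R}/\mathbb{Z}$ and $e(\theta)=e^{2\pi i\theta}$. The discrete spectrum $\sigma(T)$ is the set of $\theta\in\mathbb{T}$ for which there is a non-zero $f\in L^2(X)$ with $f\circ T=e(\theta)f$. For $I\subset\mathbb{T}$, $\langle I\rangle$ is the subgroup of $\mathbb{T}$ generated by $I$. A bounded sequence $\phi:\mathbb{N}\to\mathbb{C}$ is Besicovitch almost periodic if for every $\epsilon>0$ there is a trigonometric polynomial $\rho(n)=\sum_{j=1}^tc_je(\theta_jn)$, with $t\in\mathbb{N}$, $\theta_1,\dots,\theta_t\in\mathbb{T}$, $c_1,\dots,c_t\in\mathbb{C}$, such that $\limsup_{N\to\infty}\frac1N\sum_{n=1}^N|\phi(n)-\rho(n)|<\epsilon$.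 The spectrum $\sigma(\phi)$ of a bounded sequence $\phi$ is the set of $\theta\in\mathbb{T}$ for which $\limsup_{N\to\infty}\left|\frac1N\sum_{n=1}^N\phi(n)e(-\theta n)\right|>0$. *)

theory Defs
  imports "HOL-Probability.Probability" "HOL-Computational_Algebra.Group_Closure"
begin

section \<open>The circle group \<open>\<real>/\<int>\<close>\<close>

quotient_type circle = real / "\<lambda>x y. x - y \<in> \<int>"
proof (rule equivpI)
  show "reflp (\<lambda>x y::real. x - y \<in> \<int>)"
    by (simp add: reflp_def)
  show "symp (\<lambda>x y::real. x - y \<in> \<int>)"
    by (metis (mono_tags, lifting) Ints_minus minus_diff_eq sympI)
  show "transp (\<lambda>x y::real. x - y \<in> \<int>)"
  proof (rule transpI)
    fix x y z :: real
    assume "x - y \<in> \<int>" "y - z \<in> \<int>"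
    then have "(x - y) + (y - z) \<in> \<int>" by (rule Ints_add)
    then show "x - z \<in> \<int>" by simp
  qed
qed

instantiation circle :: ab_group_add
begin

lift_definition zero_circle :: circle is "0 :: real" .

lift_definition plus_circle :: "circle \<Rightarrow> circle \<Rightarrow> circle" is "(+) :: real \<Rightarrow> real \<Rightarrow> real"
proof -
  fix a b c d :: real
  assume "a - b \<in> \<int>" "c - d \<in> \<int>"
  then have "(a - b) + (c - d) \<in> \<int>" by (rule Ints_add)
  then show "(a + c) - (b + d) \<in> \<int>" by (simp add: algebra_simps)
qed

lift_definition minus_circle :: "circle \<Rightarrow> circle \<Rightarrow> circle" is "(-) :: real \<Rightarrow> real \<Rightarrow> real"
proof -
  fix a b c d :: real
  assume "a - b \<in> \<int>" "c - d \<in> \<int>"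
  then have "(a - b) - (c - d) \<in> \<int>" by (rule Ints_diff)
  then show "(a - c) - (b - d) \<in> \<int>" by (simp add: algebra_simps)
qed

lift_definition uminus_circle :: "circle \<Rightarrow> circle" is "uminus :: real \<Rightarrow> real"
proof -
  fix a b :: real
  assume "a - b \<in> \<int>"
  then have "- (a - b) \<in> \<int>" by (rule Ints_minus)
  then show "- a - (- b) \<in> \<int>" by (simp add: algebra_simps)
qed

instance
  by standard (transfer, simp)+

end

lift_definition circle_mult :: "nat \<Rightarrow> circle \<Rightarrow> circle" is "\<lambda>n x. real n * x"
proof -
  fix n :: nat and a b :: real
  assume "a - b \<in> \<int>"
  then have "real n * (a - b) \<in> \<int>" by (intro Ints_mult) auto
  then show "real n * a - real n * b \<in> \<int>" by (simp add: algebra_simps)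
qed

lift_definition e :: "circle \<Rightarrow> complex" is "\<lambda>x. exp (2 * pi * \<i> * complex_of_real x)"
proof -
  fix a b :: real
  assume "a - b \<in> \<int>"
  then obtain m :: int where "a - b = of_int m" by (auto elim: Ints_cases)
  then have "a = b + of_int m" by simp
  then show "exp (2 * pi * \<i> * complex_of_real a) = exp (2 * pi * \<i> * complex_of_real b)"
    unfolding exp_eq by (intro exI[of _ m]) (simp add: algebra_simps)
qed


section \<open>Besicovitch almost periodic sequences\<close>

text \<open>Sequences are indexed by \<open>n \<ge> 1\<close>: only the values there enter
  the averages, and the value at 0 plays no role (in particular not for boundedness).\<close>

definition average :: "(nat \<Rightarrow> complex) \<Rightarrow> nat \<Rightarrow> complex" where
  "average u N = (\<Sum>n = 1..N. u n) / of_nat N"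

definition trig_polynomial :: "(nat \<Rightarrow> complex) \<Rightarrow> bool" where
  "trig_polynomial \<rho> \<longleftrightarrow>
     (\<exists>(t::nat) (\<theta> :: nat \<Rightarrow> circle) (c :: nat \<Rightarrow> complex).
        \<rho> = (\<lambda>n. \<Sum>j = 1..t. c j * e (circle_mult n (\<theta> j))))"

definition besicovitch_almost_periodic :: "(nat \<Rightarrow> complex) \<Rightarrow> bool" where
  "besicovitch_almost_periodic \<phi> \<longleftrightarrow>
     bounded (range \<phi>) \<and>
     (\<forall>\<epsilon>::real. \<epsilon> > 0 \<longrightarrow>
        (\<exists>\<rho>. trig_polynomial \<rho> \<and>
           limsup (\<lambda>N. ereal ((\<Sum>n = 1..N. norm (\<phi> n - \<rho> n)) / real N)) < ereal \<epsilon>))"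

definition seq_spectrum :: "(nat \<Rightarrow> complex) \<Rightarrow> circle set" where
  "seq_spectrum \<phi> =
     {\<theta>. limsup (\<lambda>N. ereal (norm (average (\<lambda>n. \<phi> n * e (- circle_mult n \<theta>)) N))) > 0}"


section \<open>Measure preserving systems\<close>

text \<open>Elements of \<open>L\<^sup>2\<close> and \<open>L\<^sup>\<infinity>\<close> are represented by measurable functions, with equality almost
  everywhere in place of equality of classes.\<close>

locale measure_preserving_system = prob_space M for M :: "'a measure" +
  fixes T :: "'a \<Rightarrow> 'a"
  assumes measurable_T: "T \<in> measurable M M"
    and distr_T: "distr M M T = M"

definition L2 :: "'a measure \<Rightarrow> ('a \<Rightarrow> complex) set" where
  "L2 M = {f \<in> borel_measurable M. integrable M (\<lambda>x. (norm (f x))\<^sup>2)}"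

definition L2_norm :: "'a measure \<Rightarrow> ('a \<Rightarrow> complex) \<Rightarrow> real" where
  "L2_norm M f = sqrt (\<integral>x. (norm (f x))\<^sup>2 \<partial>M)"

definition Linfty :: "'a measure \<Rightarrow> ('a \<Rightarrow> complex) set" where
  "Linfty M = {f \<in> borel_measurable M. \<exists>C::real. AE x in M. norm (f x) \<le> C}"

text \<open>Membership in \<open>L\<^sup>2\<close> is part of the definition, so that the Bochner integral in
  \<^const>\<open>L2_norm\<close> is never taken of a non-integrable function.\<close>

definition L2_tendsto :: "'a measure \<Rightarrow> (nat \<Rightarrow> 'a \<Rightarrow> complex) \<Rightarrow> ('a \<Rightarrow> complex) \<Rightarrow> bool" where
  "L2_tendsto M F g \<longleftrightarrow>
     (\<forall>N. F N \<in> L2 M) \<and> g \<in> L2 M \<and> (\<lambda>N. L2_norm M (\<lambda>x. F N x - g x)) \<longlonglongrightarrow> 0"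

definition koopman :: "('a \<Rightarrow> 'a) \<Rightarrow> nat \<Rightarrow> ('a \<Rightarrow> complex) \<Rightarrow> 'a \<Rightarrow> complex" where
  "koopman T n f = f \<circ> (T ^^ n)"

definition discrete_spectrum :: "'a measure \<Rightarrow> ('a \<Rightarrow> 'a) \<Rightarrow> circle set" where
  "discrete_spectrum M T =
     {\<theta>. \<exists>f \<in> L2 M. \<not> (AE x in M. f x = 0) \<and> (AE x in M. f (T x) = e \<theta> * f x)}"

end

theory Submission
  imports Defs "HOL-Library.Function_Algebras"
begin

text \<open>
  The averages are analysed by removing the last function \<open>f\<^sub>k\<close>. By van der Corput's inequality they are
  small when the uniformity seminorm of order \<open>k\<close> of \<open>f\<^sub>k\<close> is small, also in the presence of a phase
  \<open>e(n\<theta>)\<close> if \<open>k \<ge> 2\<close>. Otherwise \<open>f\<^sub>k\<close> is close to a combination of products of dual functions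
  \<open>D = lim avg\<^sub>h \<Prod>\<^sub>\<omega> T\<^bsup>\<omega>\<cdot>h\<^esup> u\<close> (\<open>h \<in> \<int>\<^sup>k\<close>, \<open>0 \<noteq> \<omega> \<in> {0,1}\<^sup>k\<close>), and the substitution
  \<open>h\<^sub>i \<mapsto> h\<^sub>i - l\<close> expresses \<open>T\<^bsup>kl\<^esup> D\<close>, uniformly in \<open>l\<close>, as an average of products of functions
  \<open>T\<^bsup>jl\<^esup> g\<^sub>j\<close> with \<open>j < k\<close>. No phase is created, so the factor \<open>e(l\<theta>)\<close> survives and \<open>k\<close> drops by one. The
  uniformity in \<open>l\<close> rests on the convergence of cubic averages along all Folner sets of \<open>\<int>\<^sup>k\<close>, which
  is obtained by Walsh's metastable energy decrement argument.

  For \<open>k = 1\<close> the limit of the averages with phase \<open>e(n\<theta>)\<close> is an eigenfunction with eigenvalue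
  \<open>e(-\<theta>)\<close>, so it vanishes unless \<open>-\<theta> \<in> \<sigma>(T)\<close>. Finally \<open>\<phi>\<close> is approximated by trigonometric polynomials
  with frequencies in \<open>\<sigma>(\<phi>)\<close>, of which only the frequency \<open>0\<close> contributes to the limit.
\<close>

section \<open>Algebras of bounded functions with a shift and an invariant mean\<close>

text \<open>Instead of passing to a characteristic factor, the proof replaces the last function by a
  combination whose orbit is known for all \<open>l\<close> at once. The Folner set behind it is
  translated by \<open>(-l,...,-l)\<close> with \<open>l\<close> unbounded, so convergence of cubic
  averages along centred boxes would not do; this forces arbitrary Folner sets. The induction on the
  number of forms needs a bound independent of the mean, because a finite family of functions is
  treated as one function under a mixture of means. Hence the algebra and the mean are abstract: the
  same lemmas are applied to mixtures, to bounded functions on the space, and to an invertible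
  extension of the given system. The approximation is an \<open>L2\<close> one, whereas the
  remainder has to be bounded pointwise; truncation by polynomials restores the bound and keeps a
  structured function structured. The approximating trigonometric polynomials must have frequencies
  in \<sigma>(\<phi>), since the hypothesis says nothing about eigenvalues outside the group
  generated by it.\<close>

locale shift_algebra =
  fixes A :: "('w \<Rightarrow> complex) set" and \<sigma> :: "int \<Rightarrow> 'w \<Rightarrow> 'w"
  assumes const_A: "(\<lambda>w. c) \<in> A"
    and add_A: "a \<in> A \<Longrightarrow> b \<in> A \<Longrightarrow> (\<lambda>w. a w + b w) \<in> A"
    and mult_A: "a \<in> A \<Longrightarrow> b \<in> A \<Longrightarrow> (\<lambda>w. a w * b w) \<in> A"
    and cnj_A: "a \<in> A \<Longrightarrow> (\<lambda>w. cnj (a w)) \<in> A"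
    and bdd_A: "a \<in> A \<Longrightarrow> \<exists>C. \<forall>w. norm (a w) \<le> C"
    and shift_A: "a \<in> A \<Longrightarrow> (\<lambda>w. a (\<sigma> m w)) \<in> A"
    and shift_shift: "\<sigma> m (\<sigma> n w) = \<sigma> (m + n) w"
    and shift_zero: "\<sigma> 0 w = w"
begin

definition S :: "int \<Rightarrow> ('w \<Rightarrow> complex) \<Rightarrow> 'w \<Rightarrow> complex" where
  "S m a = (\<lambda>w. a (\<sigma> m w))"

lemma S_A: "a \<in> A \<Longrightarrow> S m a \<in> A"
  unfolding S_def by (rule shift_A)

lemma S_S [simp]: "S m (S n a) = S (m + n) a"
  by (simp add: S_def shift_shift add.commute)

lemma S_0 [simp]: "S 0 a = a"
  by (simp add: S_def shift_zero)

lemma S_add: "S m (\<lambda>w. a w + b w) = (\<lambda>w. S m a w + S m b w)"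
  and S_diff: "S m (\<lambda>w. a w - b w) = (\<lambda>w. S m a w - S m b w)"
  and S_mult: "S m (\<lambda>w. a w * b w) = (\<lambda>w. S m a w * S m b w)"
  and S_divide: "S m (\<lambda>w. a w / b w) = (\<lambda>w. S m a w / S m b w)"
  and S_cnj: "S m (\<lambda>w. cnj (a w)) = (\<lambda>w. cnj (S m a w))"
  and S_sum: "S m (\<lambda>w. \<Sum>i\<in>I. g i w) = (\<lambda>w. \<Sum>i\<in>I. S m (g i) w)"
  and S_prod: "S m (\<lambda>w. \<Prod>i\<in>I. g i w) = (\<lambda>w. \<Prod>i\<in>I. S m (g i) w)"
  and S_const [simp]: "S m (\<lambda>w. c) = (\<lambda>w. c)"
  by (simp_all add: S_def)

lemmas S_simps = S_add S_diff S_mult S_divide S_cnj S_sum S_prod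

lemma S_bound: "(\<And>w. norm (a w) \<le> C) \<Longrightarrow> norm (S m a w) \<le> C"
  by (simp add: S_def)

lemma scale_A: "a \<in> A \<Longrightarrow> (\<lambda>w. c * a w) \<in> A"
  by (intro mult_A const_A)

lemma divide_A: "a \<in> A \<Longrightarrow> (\<lambda>w. a w / c) \<in> A"
  using scale_A[of a "inverse c"] by (simp add: field_simps)

lemma uminus_A: "a \<in> A \<Longrightarrow> (\<lambda>w. - a w) \<in> A"
  using scale_A[of a "-1"] by simp

lemma diff_A: "a \<in> A \<Longrightarrow> b \<in> A \<Longrightarrow> (\<lambda>w. a w - b w) \<in> A"
  using add_A[of a "\<lambda>w. - b w"] uminus_A by simp

lemma sum_A: "(\<And>i. i \<in> I \<Longrightarrow> g i \<in> A) \<Longrightarrow> (\<lambda>w. \<Sum>i\<in>I. g i w) \<in> A"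
  by (induction I rule: infinite_finite_induct) (auto intro: const_A add_A)

lemma prod_A: "(\<And>i. i \<in> I \<Longrightarrow> g i \<in> A) \<Longrightarrow> (\<lambda>w. \<Prod>i\<in>I. g i w) \<in> A"
  by (induction I rule: infinite_finite_induct) (auto intro: const_A mult_A)

lemma power_A: "a \<in> A \<Longrightarrow> (\<lambda>w. a w ^ n) \<in> A"
  by (induction n) (auto intro: const_A mult_A)

lemmas A_intros = const_A add_A mult_A cnj_A S_A divide_A uminus_A diff_A sum_A prod_A power_A

end

lemma norm_prod_le_1:
  fixes g :: "'i \<Rightarrow> complex"
  assumes "\<And>i. i \<in> I \<Longrightarrow> norm (g i) \<le> 1"
  shows "norm (\<Prod>i\<in>I. g i) \<le> 1"
  unfolding prod_norm[symmetric] using assms by (intro prod_le_1) auto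

section \<open>The inner product of an invariant mean\<close>

locale invariant_mean = shift_algebra A \<sigma>
  for A :: "('w \<Rightarrow> complex) set" and \<sigma> :: "int \<Rightarrow> 'w \<Rightarrow> 'w" +
  fixes \<tau> :: "('w \<Rightarrow> complex) \<Rightarrow> complex"
  assumes tau_add: "a \<in> A \<Longrightarrow> b \<in> A \<Longrightarrow> \<tau> (\<lambda>w. a w + b w) = \<tau> a + \<tau> b"
    and tau_scale: "a \<in> A \<Longrightarrow> \<tau> (\<lambda>w. c * a w) = c * \<tau> a"
    and tau_cnj: "a \<in> A \<Longrightarrow> \<tau> (\<lambda>w. cnj (a w)) = cnj (\<tau> a)"
    and tau_pos: "a \<in> A \<Longrightarrow> (\<And>w. Im (a w) = 0) \<Longrightarrow> (\<And>w. 0 \<le> Re (a w)) \<Longrightarrow> 0 \<le> Re (\<tau> a)"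
    and tau_one: "\<tau> (\<lambda>w. 1) = 1"
    and tau_shift: "a \<in> A \<Longrightarrow> \<tau> (\<lambda>w. a (\<sigma> m w)) = \<tau> a"
begin

lemma tau_S: "a \<in> A \<Longrightarrow> \<tau> (S m a) = \<tau> a"
  by (simp add: S_def tau_shift)

lemma tau_zero: "\<tau> (\<lambda>w. 0) = 0"
  using tau_scale[OF const_A[of 1], of 0] by simp

lemma tau_diff: "a \<in> A \<Longrightarrow> b \<in> A \<Longrightarrow> \<tau> (\<lambda>w. a w - b w) = \<tau> a - \<tau> b"
  using tau_add[of a "\<lambda>w. (-1) * b w"] tau_scale[of b "-1"] scale_A[of b "-1"] by simp

lemma tau_sum: "(\<And>i. i \<in> I \<Longrightarrow> g i \<in> A) \<Longrightarrow> \<tau> (\<lambda>w. \<Sum>i\<in>I. g i w) = (\<Sum>i\<in>I. \<tau> (g i))"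
proof (induction I rule: infinite_finite_induct)
  case (insert x F)
  then show ?case by (simp add: tau_add sum_A)
qed (auto simp: tau_zero)

lemma tau_real: 
  assumes "a \<in> A" "\<And>w. Im (a w) = 0" shows "Im (\<tau> a) = 0"
proof -
  have "(\<lambda>w. cnj (a w)) = a" using assms(2) by (auto simp: complex_eq_iff)
  then show ?thesis using tau_cnj[OF assms(1)] by (metis Reals_cnj_iff complex_is_Real_iff)
qed

lemma tau_mono:
  assumes "a \<in> A" "b \<in> A" "\<And>w. Im (a w) = 0" "\<And>w. Im (b w) = 0" "\<And>w. Re (a w) \<le> Re (b w)"
  shows "Re (\<tau> a) \<le> Re (\<tau> b)"
proof -
  have "0 \<le> Re (\<tau> (\<lambda>w. b w - a w))" by (rule tau_pos) (use assms in \<open>auto intro: A_intros\<close>)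
  then show ?thesis using assms by (simp add: tau_diff)
qed

definition ip :: "('w \<Rightarrow> complex) \<Rightarrow> ('w \<Rightarrow> complex) \<Rightarrow> complex" where
  "ip a b = \<tau> (\<lambda>w. a w * cnj (b w))"

text \<open>Only a seminorm: null functions are not identified with zero, so degenerate vectors are
  treated separately.\<close>

definition nrm :: "('w \<Rightarrow> complex) \<Rightarrow> real" where
  "nrm a = sqrt (Re (ip a a))"

lemma ip_self_real: "a \<in> A \<Longrightarrow> Im (ip a a) = 0"
  unfolding ip_def by (rule tau_real) (auto intro: A_intros)

lemma ip_self_nonneg: "a \<in> A \<Longrightarrow> 0 \<le> Re (ip a a)"
  unfolding ip_def by (rule tau_pos) (auto intro: A_intros)

lemma nrm_ge_0 [simp]: "a \<in> A \<Longrightarrow> 0 \<le> nrm a"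
  unfolding nrm_def using ip_self_nonneg by simp

lemma nrm_square: "a \<in> A \<Longrightarrow> (nrm a)\<^sup>2 = Re (ip a a)"
  unfolding nrm_def using ip_self_nonneg by simp

lemma ip_self: "a \<in> A \<Longrightarrow> ip a a = complex_of_real ((nrm a)\<^sup>2)"
  using nrm_square ip_self_real by (simp add: complex_eq_iff)

lemma ip_add_left: "a \<in> A \<Longrightarrow> b \<in> A \<Longrightarrow> c \<in> A \<Longrightarrow> ip (\<lambda>w. a w + b w) c = ip a c + ip b c"
  unfolding ip_def by (simp add: ring_distribs tau_add A_intros)

lemma ip_diff_left: "a \<in> A \<Longrightarrow> b \<in> A \<Longrightarrow> c \<in> A \<Longrightarrow> ip (\<lambda>w. a w - b w) c = ip a c - ip b c"
  unfolding ip_def by (simp add: ring_distribs tau_diff A_intros)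

lemma ip_scale_left: "a \<in> A \<Longrightarrow> c \<in> A \<Longrightarrow> ip (\<lambda>w. z * a w) c = z * ip a c"
  unfolding ip_def using tau_scale[of "\<lambda>w. a w * cnj (c w)" z] by (simp add: A_intros mult.assoc)

lemma ip_cnj: "a \<in> A \<Longrightarrow> b \<in> A \<Longrightarrow> ip b a = cnj (ip a b)"
  unfolding ip_def by (subst tau_cnj[symmetric]) (auto intro: A_intros simp: mult.commute)

lemma ip_sum_left: "(\<And>i. i \<in> I \<Longrightarrow> g i \<in> A) \<Longrightarrow> c \<in> A \<Longrightarrow> ip (\<lambda>w. \<Sum>i\<in>I. g i w) c = (\<Sum>i\<in>I. ip (g i) c)"
  unfolding ip_def by (simp add: sum_distrib_right tau_sum A_intros)

lemma ip_add_right: "a \<in> A \<Longrightarrow> b \<in> A \<Longrightarrow> c \<in> A \<Longrightarrow> ip c (\<lambda>w. a w + b w) = ip c a + ip c b"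
  unfolding ip_def by (simp add: ring_distribs tau_add A_intros)

lemma ip_diff_right: "a \<in> A \<Longrightarrow> b \<in> A \<Longrightarrow> c \<in> A \<Longrightarrow> ip c (\<lambda>w. a w - b w) = ip c a - ip c b"
  unfolding ip_def by (simp add: ring_distribs tau_diff A_intros)

lemma ip_scale_right: "a \<in> A \<Longrightarrow> c \<in> A \<Longrightarrow> ip c (\<lambda>w. z * a w) = cnj z * ip c a"
  unfolding ip_def using tau_scale[of "\<lambda>w. c w * cnj (a w)" "cnj z"] by (simp add: A_intros mult_ac)

lemma ip_sum_right: "(\<And>i. i \<in> I \<Longrightarrow> g i \<in> A) \<Longrightarrow> c \<in> A \<Longrightarrow> ip c (\<lambda>w. \<Sum>i\<in>I. g i w) = (\<Sum>i\<in>I. ip c (g i))"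
  unfolding ip_def by (simp add: sum_distrib_left tau_sum A_intros)

lemma ip_S: "a \<in> A \<Longrightarrow> b \<in> A \<Longrightarrow> ip (S m a) (S m b) = ip a b"
  unfolding ip_def by (subst tau_S[symmetric, of _ m]) (auto intro: A_intros simp: S_simps)

lemma nrm_S: "a \<in> A \<Longrightarrow> nrm (S m a) = nrm a"
  by (simp add: nrm_def ip_S)

lemma nrm_diff_square:
  assumes "a \<in> A" "b \<in> A"
  shows "(nrm (\<lambda>w. a w - b w))\<^sup>2 = (nrm a)\<^sup>2 - 2 * Re (ip a b) + (nrm b)\<^sup>2"
proof -
  have "Re (ip b a) = Re (ip a b)" using ip_cnj[OF assms] by simp
  then show ?thesis using assms by (simp add: nrm_square A_intros ip_diff_left ip_diff_right)
qed

lemma nrm_add_square: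
  assumes "a \<in> A" "b \<in> A"
  shows "(nrm (\<lambda>w. a w + b w))\<^sup>2 = (nrm a)\<^sup>2 + 2 * Re (ip a b) + (nrm b)\<^sup>2"
proof -
  have "Re (ip b a) = Re (ip a b)" using ip_cnj[OF assms] by simp
  then show ?thesis using assms by (simp add: nrm_square A_intros ip_add_left ip_add_right)
qed

lemma nrm_scale: "a \<in> A \<Longrightarrow> nrm (\<lambda>w. z * a w) = norm z * nrm a"
proof -
  assume a: "a \<in> A"
  have "ip (\<lambda>w. z * a w) (\<lambda>w. z * a w) = (z * cnj z) * ip a a"
    using a by (simp add: ip_scale_left ip_scale_right scale_A)
  then have "Re (ip (\<lambda>w. z * a w) (\<lambda>w. z * a w)) = (norm z)\<^sup>2 * Re (ip a a)"
    by (simp add: complex_norm_square[symmetric] flip: of_real_power)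
  then show ?thesis unfolding nrm_def by (simp add: real_sqrt_mult)
qed

lemma nrm_const: "nrm (\<lambda>w. c) = norm c"
proof -
  have "\<tau> (\<lambda>w. (c * cnj c) * 1) = c * cnj c" using tau_scale[OF const_A[of 1], of "c * cnj c"] tau_one by simp
  then show ?thesis unfolding nrm_def ip_def
    by (simp add: complex_norm_square[symmetric] flip: of_real_power)
qed

lemma nrm_zero: "nrm (\<lambda>w. 0) = 0"
  using nrm_const[of 0] by simp

lemma Re_ip_le: 
  assumes "a \<in> A" "b \<in> A" shows "Re (ip a b) \<le> nrm a * nrm b"
proof -
  \<comment> \<open>The squared norm of \<open>t a - s b\<close>; two free scalars cover a null
    vector on either side.\<close>
  have *: "0 \<le> t\<^sup>2 * (nrm a)\<^sup>2 - 2 * t * s * Re (ip a b) + s\<^sup>2 * (nrm b)\<^sup>2" for t s :: real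
  proof -
    have "0 \<le> (nrm (\<lambda>w. of_real t * a w - of_real s * b w))\<^sup>2" by simp
    also have "\<dots> = t\<^sup>2 * (nrm a)\<^sup>2 - 2 * t * s * Re (ip a b) + s\<^sup>2 * (nrm b)\<^sup>2"
      using assms by (simp add: nrm_diff_square scale_A nrm_scale ip_scale_left ip_scale_right power_mult_distrib)
    finally show ?thesis .
  qed
  have n: "0 \<le> nrm a" "0 \<le> nrm b" using assms by auto
  show ?thesis
  proof (cases "nrm a = 0 \<or> nrm b = 0")
    case True
    have "Re (ip a b) \<le> 0"
    proof (rule ccontr)
      assume h: "\<not> Re (ip a b) \<le> 0"
      then have p: "Re (ip a b) > 0" by simp
      from True show False
      proof
        assume z: "nrm a = 0"
        \<comment> \<open>With \<open>nrm a = 0\<close> the form is linear in \<open>t\<close>, and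
          this value of \<open>t\<close> makes it \<open>-1\<close>.\<close>
        have "0 \<le> (nrm b)\<^sup>2 - 2 * (((nrm b)\<^sup>2 + 1) / (2 * Re (ip a b))) * Re (ip a b)"
          using *[of "((nrm b)\<^sup>2 + 1) / (2 * Re (ip a b))" 1] z by simp
        then show False using p by (simp add: field_simps)
      next
        assume z: "nrm b = 0"
        have "0 \<le> (nrm a)\<^sup>2 - 2 * (((nrm a)\<^sup>2 + 1) / (2 * Re (ip a b))) * Re (ip a b)"
          using *[of 1 "((nrm a)\<^sup>2 + 1) / (2 * Re (ip a b))"] z by simp
        then show False using p by (simp add: field_simps)
      qed
    qed
    then show ?thesis using True by auto
  next
    case False
    then have p: "nrm a > 0" "nrm b > 0" using n by auto
    have "0 \<le> 2 * (nrm a * nrm b) * (nrm a * nrm b - Re (ip a b))"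
      using *[of "nrm b" "nrm a"] by (simp add: algebra_simps power2_eq_square)
    moreover have "0 < 2 * (nrm a * nrm b)" using p by simp
    ultimately have "0 \<le> nrm a * nrm b - Re (ip a b)" by (simp only: zero_le_mult_iff) linarith
    then show ?thesis by simp
  qed
qed

lemma norm_ip_le:
  assumes "a \<in> A" "b \<in> A" shows "norm (ip a b) \<le> nrm a * nrm b"
proof (cases "ip a b = 0")
  case False
  \<comment> \<open>A unimodular factor that makes the inner product real and nonnegative.\<close>
  define z where "z = cnj (ip a b) / norm (ip a b)"
  have nz: "norm z = 1" using False by (simp add: z_def norm_divide)
  have "z * ip a b = of_real (norm (ip a b))"
    using False by (simp add: z_def mult.commute complex_norm_square[symmetric] power2_eq_square)
  then have "norm (ip a b) = Re (ip (\<lambda>w. z * a w) b)" using assms by (simp add: ip_scale_left)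
  also have "\<dots> \<le> nrm (\<lambda>w. z * a w) * nrm b" using assms by (intro Re_ip_le scale_A)
  finally show ?thesis using assms nz by (simp add: nrm_scale)
qed (use assms in auto)

lemma nrm_triangle:
  assumes "a \<in> A" "b \<in> A" shows "nrm (\<lambda>w. a w + b w) \<le> nrm a + nrm b"
proof (rule power2_le_imp_le)
  show "(nrm (\<lambda>w. a w + b w))\<^sup>2 \<le> (nrm a + nrm b)\<^sup>2"
    using assms Re_ip_le[OF assms] by (simp add: nrm_add_square power2_sum)
qed (use assms in auto)

lemma nrm_triangle_diff:
  assumes "a \<in> A" "b \<in> A" shows "nrm (\<lambda>w. a w - b w) \<le> nrm a + nrm b"
  using nrm_triangle[of a "\<lambda>w. (-1) * b w"] assms scale_A[of b "-1"] nrm_scale[of b "-1"] by simp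

lemma nrm_minus_commute:
  assumes "a \<in> A" "b \<in> A" shows "nrm (\<lambda>w. a w - b w) = nrm (\<lambda>w. b w - a w)"
  using nrm_scale[of "\<lambda>w. a w - b w" "-1"] assms by (simp add: A_intros)

lemma nrm_diff_triangle:
  assumes "a \<in> A" "b \<in> A" "c \<in> A" shows "nrm (\<lambda>w. a w - c w) \<le> nrm (\<lambda>w. a w - b w) + nrm (\<lambda>w. b w - c w)"
  using nrm_triangle[of "\<lambda>w. a w - b w" "\<lambda>w. b w - c w"] assms by (simp add: A_intros)

lemma nrm_sum:
  assumes "\<And>i. i \<in> I \<Longrightarrow> g i \<in> A"
  shows "nrm (\<lambda>w. \<Sum>i\<in>I. g i w) \<le> (\<Sum>i\<in>I. nrm (g i))"
  using assms
proof (induction I rule: infinite_finite_induct)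
  case (insert x F)
  have "nrm (\<lambda>w. \<Sum>i\<in>insert x F. g i w) \<le> nrm (g x) + nrm (\<lambda>w. \<Sum>i\<in>F. g i w)"
    using insert by (simp add: nrm_triangle sum_A)
  then show ?case using insert by auto
qed (auto simp: nrm_zero)

lemma nrm_mult_bdd:
  assumes "a \<in> A" "b \<in> A" "\<And>w. norm (a w) \<le> C"
  shows "nrm (\<lambda>w. a w * b w) \<le> C * nrm b"
proof (rule power2_le_imp_le)
  have C: "0 \<le> C" using norm_ge_zero order_trans assms(3) by blast
  then show "0 \<le> C * nrm b" using assms by simp
  have "Re (\<tau> (\<lambda>w. (a w * b w) * cnj (a w * b w))) \<le> Re (\<tau> (\<lambda>w. of_real (C\<^sup>2) * (b w * cnj (b w))))"
  proof (rule tau_mono)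
    fix w
    have "(norm (a w))\<^sup>2 * (norm (b w))\<^sup>2 \<le> C\<^sup>2 * (norm (b w))\<^sup>2"
      using assms(3)[of w] by (intro mult_right_mono power_mono) auto
    then show "Re ((a w * b w) * cnj (a w * b w)) \<le> Re (of_real (C\<^sup>2) * (b w * cnj (b w)))"
      by (simp only: complex_norm_square[symmetric] norm_mult power_mult_distrib) (simp flip: of_real_power of_real_mult)
  qed (use assms in \<open>auto intro!: A_intros simp: algebra_simps\<close>)
  also have "\<dots> = C\<^sup>2 * Re (\<tau> (\<lambda>w. b w * cnj (b w)))"
    using assms by (subst tau_scale) (auto intro: A_intros simp flip: of_real_power)
  finally show "(nrm (\<lambda>w. a w * b w))\<^sup>2 \<le> (C * nrm b)\<^sup>2"
    using assms by (simp add: nrm_square A_intros power_mult_distrib ip_def)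
qed

lemma nrm_le_bdd:
  assumes "a \<in> A" "\<And>w. norm (a w) \<le> C" shows "nrm a \<le> C"
  using nrm_mult_bdd[OF assms(1) const_A[of 1] assms(2)] nrm_const[of 1] by simp

lemma norm_tau_le:
  assumes "a \<in> A" shows "norm (\<tau> a) \<le> nrm a"
  using norm_ip_le[OF assms const_A[of 1]] nrm_const[of 1] by (simp add: ip_def)

lemma nrm_mean:
  assumes "finite W" "W \<noteq> {}" "\<And>i. i \<in> W \<Longrightarrow> g i \<in> A" "\<And>i. i \<in> W \<Longrightarrow> nrm (g i) \<le> C"
  shows "nrm (\<lambda>w. (\<Sum>i\<in>W. g i w) / of_nat (card W)) \<le> C"
proof -
  have c: "card W > 0" using assms by (simp add: card_gt_0_iff)
  have "nrm (\<lambda>w. (\<Sum>i\<in>W. g i w) / of_nat (card W)) = nrm (\<lambda>w. \<Sum>i\<in>W. g i w) / card W"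
    using nrm_scale[of "\<lambda>w. \<Sum>i\<in>W. g i w" "inverse (of_nat (card W))"] assms
    by (simp add: sum_A divide_inverse mult.commute norm_inverse)
  also have "\<dots> \<le> (\<Sum>i\<in>W. nrm (g i)) / card W"
    using assms by (intro divide_right_mono nrm_sum) auto
  also have "\<dots> \<le> (\<Sum>i\<in>W. C) / card W"
    using assms by (intro divide_right_mono sum_mono) auto
  also have "\<dots> = C" using c by simp
  finally show ?thesis .
qed

end

section \<open>Walsh's norm convergence theorem\<close>

text \<open>A single \<open>N\<close> fixes both the translations \<open>Q N\<close> and the
  precision \<open>1/N\<close>, so that for monotone \<open>Q\<close> a set good at a large scale is
  good at all smaller ones.\<close>

definition folner :: "(nat \<Rightarrow> 'g::ab_group_add set) \<Rightarrow> nat \<Rightarrow> 'g set \<Rightarrow> bool" where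
  "folner Q N W \<longleftrightarrow> finite W \<and> W \<noteq> {} \<and>
     (\<forall>l\<in>Q N. N * card ((\<lambda>m. m + l) ` W - W) \<le> card W)"

lemma folner_card_pos: "folner Q N W \<Longrightarrow> 0 < card W"
  by (simp add: folner_def card_gt_0_iff)

lemma folner_antimono:
  assumes "mono Q" "N \<le> N'" "folner Q N' W" shows "folner Q N W"
  unfolding folner_def
proof (intro conjI ballI)
  fix l assume "l \<in> Q N"
  then have "l \<in> Q N'" using assms by (auto dest: monoD)
  then have "N' * card ((\<lambda>m. m + l) ` W - W) \<le> card W" using assms by (auto simp: folner_def)
  moreover have "N * card ((\<lambda>m. m + l) ` W - W) \<le> N' * card ((\<lambda>m. m + l) ` W - W)"
    using assms by simp
  ultimately show "N * card ((\<lambda>m. m + l) ` W - W) \<le> card W" by linarith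
qed (use assms in \<open>auto simp: folner_def\<close>)

lemma folner_translate:
  assumes "folner Q N W" shows "folner Q N ((\<lambda>m. m + a) ` W)"
  unfolding folner_def
proof (intro conjI ballI)
  fix l assume l: "l \<in> Q N"
  have inj: "inj (\<lambda>m. m + a)" by (simp add: inj_on_def)
  have "(\<lambda>m. m + l) ` (\<lambda>m. m + a) ` W - (\<lambda>m. m + a) ` W = (\<lambda>m. m + a) ` ((\<lambda>m. m + l) ` W - W)"
    using image_set_diff[OF inj, of "(\<lambda>m. m + l) ` W" W] by (simp add: image_image add_ac)
  then show "N * card ((\<lambda>m. m + l) ` (\<lambda>m. m + a) ` W - (\<lambda>m. m + a) ` W) \<le> card ((\<lambda>m. m + a) ` W)"
    using assms l by (simp add: card_image inj_on_def folner_def)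
qed (use assms in \<open>auto simp: folner_def\<close>)

lemma folner_sum_shift:
  fixes \<phi> :: "'g::ab_group_add \<Rightarrow> complex"
  assumes W: "folner Q N W" and l: "l \<in> Q N" and N: "0 < N" and C: "\<And>m. norm (\<phi> m) \<le> C"
  shows "norm ((\<Sum>m\<in>W. \<phi> m) - (\<Sum>m\<in>W. \<phi> (m + l))) \<le> 2 * C * card W / N"
proof -
  let ?W = "(\<lambda>m. m + l) ` W"
  have fin: "finite W" "finite ?W" using W by (auto simp: folner_def)
  have C0: "0 \<le> C" using C norm_ge_zero order_trans by blast
  have card: "card ?W = card W" by (simp add: card_image inj_on_def)
  \<comment> \<open>Translation preserves cardinality, so as many points leave \<open>W\<close> as
    enter it; \<open>folner\<close> bounds only one of the two differences.\<close>
  have k: "card (W - ?W) = card (?W - W)"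
    using card fin by (metis Int_commute add_diff_cancel_left' card_Diff_subset_Int card_Int_Diff finite_Int)
  have "(\<Sum>m\<in>W. \<phi> (m + l)) = sum \<phi> ?W" by (simp add: sum.reindex inj_on_def)
  moreover have "sum \<phi> W = sum \<phi> (W \<inter> ?W) + sum \<phi> (W - ?W)" using fin by (metis sum.Int_Diff)
  moreover have "sum \<phi> ?W = sum \<phi> (W \<inter> ?W) + sum \<phi> (?W - W)" using fin by (metis Int_commute sum.Int_Diff)
  ultimately have "(\<Sum>m\<in>W. \<phi> m) - (\<Sum>m\<in>W. \<phi> (m + l)) = sum \<phi> (W - ?W) - sum \<phi> (?W - W)" by simp
  then have "norm ((\<Sum>m\<in>W. \<phi> m) - (\<Sum>m\<in>W. \<phi> (m + l))) \<le> norm (sum \<phi> (W - ?W)) + norm (sum \<phi> (?W - W))"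
    by (metis norm_triangle_ineq4)
  also have "\<dots> \<le> card (W - ?W) * C + card (?W - W) * C"
    using C by (intro add_mono sum_norm_le[THEN order_trans]) (auto simp: sum_bounded_above)
  also have "\<dots> = 2 * C * card (?W - W)" using k by simp
  also have "\<dots> \<le> 2 * C * (card W / N)"
  proof (intro mult_left_mono)
    have "N * card (?W - W) \<le> card W" using W l by (auto simp: folner_def)
    then have "real N * real (card (?W - W)) \<le> real (card W)" by (metis of_nat_le_iff of_nat_mult)
    then show "real (card (?W - W)) \<le> card W / N" using N by (simp add: field_simps)
  qed (use C0 in auto)
  finally show ?thesis by simp
qed

context shift_algebra
begin

definition unit_bdd :: "('w \<Rightarrow> complex) \<Rightarrow> bool" where
  "unit_bdd a \<longleftrightarrow> a \<in> A \<and> (\<forall>w. norm (a w) \<le> 1)"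

lemma unit_bddD: "unit_bdd a \<Longrightarrow> a \<in> A" "unit_bdd a \<Longrightarrow> norm (a w) \<le> 1"
  by (auto simp: unit_bdd_def)

lemma unit_bdd_mult: "unit_bdd a \<Longrightarrow> unit_bdd b \<Longrightarrow> unit_bdd (\<lambda>w. a w * b w)"
  by (auto simp: unit_bdd_def norm_mult A_intros intro: mult_le_one)

lemma unit_bdd_S: "unit_bdd a \<Longrightarrow> unit_bdd (S m a)"
  by (auto simp: unit_bdd_def A_intros intro: S_bound)

lemma unit_bdd_cnj: "unit_bdd a \<Longrightarrow> unit_bdd (\<lambda>w. cnj (a w))"
  by (auto simp: unit_bdd_def A_intros)

lemma unit_bdd_prod: "(\<And>i. i \<in> I \<Longrightarrow> unit_bdd (g i)) \<Longrightarrow> unit_bdd (\<lambda>w. \<Prod>i\<in>I. g i w)"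
  unfolding unit_bdd_def by (auto intro: prod_A norm_prod_le_1)

end

locale forms = shift_algebra A \<sigma>
  for A :: "('w \<Rightarrow> complex) set" and \<sigma> :: "int \<Rightarrow> 'w \<Rightarrow> 'w" +
  fixes \<l> :: "'j \<Rightarrow> 'g::ab_group_add \<Rightarrow> int" and Q :: "nat \<Rightarrow> 'g set"
  assumes form_add: "\<l> j (g + h) = \<l> j g + \<l> j h"
    and mono_Q: "mono Q"
begin

definition folner_avg :: "'j set \<Rightarrow> 'g set \<Rightarrow> ('j \<Rightarrow> 'w \<Rightarrow> complex) \<Rightarrow> 'w \<Rightarrow> complex" where
  "folner_avg J W f = (\<lambda>w. (\<Sum>h\<in>W. \<Prod>j\<in>J. S (\<l> j h) (f j) w) / of_nat (card W))"

text \<open>The function attached to \<open>x\<close> is an argument of its own because it will be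
  decomposed: the average is linear in \<open>u\<close> while the functions of \<open>J\<close> stay
  fixed.\<close>

definition folner_avg_last :: "'j set \<Rightarrow> 'j \<Rightarrow> 'g set \<Rightarrow> ('j \<Rightarrow> 'w \<Rightarrow> complex) \<Rightarrow> ('w \<Rightarrow> complex) \<Rightarrow> 'w \<Rightarrow> complex" where
  "folner_avg_last J x W f u = (\<lambda>w. (\<Sum>h\<in>W. S (\<l> x h) u w * (\<Prod>j\<in>J. S (\<l> j h) (f j) w)) / of_nat (card W))"

lemma folner_avg_A: "(\<And>j. j \<in> J \<Longrightarrow> f j \<in> A) \<Longrightarrow> folner_avg J W f \<in> A"
  unfolding folner_avg_def by (intro A_intros) auto

lemma folner_avg_last_A: "(\<And>j. j \<in> J \<Longrightarrow> f j \<in> A) \<Longrightarrow> u \<in> A \<Longrightarrow> folner_avg_last J x W f u \<in> A"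
  unfolding folner_avg_last_def by (intro A_intros) auto

lemma folner_avg_insert: "finite J \<Longrightarrow> x \<notin> J \<Longrightarrow> folner_avg (insert x J) W f = folner_avg_last J x W f (f x)"
  unfolding folner_avg_def folner_avg_last_def by simp

lemma folner_avg_last_diff: "folner_avg_last J x W f (\<lambda>w. u w - v w) = (\<lambda>w. folner_avg_last J x W f u w - folner_avg_last J x W f v w)"
  unfolding folner_avg_last_def by (simp add: S_simps ring_distribs sum_subtractf diff_divide_distrib)

lemma folner_avg_last_bound:
  assumes "\<And>j. j \<in> J \<Longrightarrow> unit_bdd (f j)" "\<And>w. norm (u w) \<le> C" "0 < card W"
  shows "norm (folner_avg_last J x W f u w) \<le> C"
proof -
  have C0: "0 \<le> C" using assms(2) norm_ge_zero order_trans by blast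
  have "norm (\<Sum>h\<in>W. S (\<l> x h) u w * (\<Prod>j\<in>J. S (\<l> j h) (f j) w)) \<le> card W * C"
  proof (rule sum_norm_le[THEN order_trans])
    fix h
    have "norm (S (\<l> x h) u w * (\<Prod>j\<in>J. S (\<l> j h) (f j) w)) \<le> C * 1"
      unfolding norm_mult using assms(1,2) C0
      by (intro mult_mono S_bound norm_prod_le_1) (auto intro: S_bound dest: unit_bddD)
    then show "norm (S (\<l> x h) u w * (\<Prod>j\<in>J. S (\<l> j h) (f j) w)) \<le> C" by simp
  qed simp
  then show ?thesis unfolding folner_avg_last_def using assms(3) by (simp add: norm_divide field_simps)
qed

end

locale forms_mean = forms A \<sigma> \<l> Q + invariant_mean A \<sigma> \<tau>
  for A :: "('w \<Rightarrow> complex) set" and \<sigma> :: "int \<Rightarrow> 'w \<Rightarrow> 'w"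
    and \<l> :: "'j \<Rightarrow> 'g::ab_group_add \<Rightarrow> int" and Q :: "nat \<Rightarrow> 'g set"
    and \<tau> :: "('w \<Rightarrow> complex) \<Rightarrow> complex"
begin

text \<open>A function is structured when the values of its orbit along the form \<open>x\<close> are, up to a small
  error, those of a bounded combination of products involving only the forms in \<open>J\<close>.\<close>

definition structured :: "'j set \<Rightarrow> 'j \<Rightarrow> nat \<Rightarrow> real \<Rightarrow> real \<Rightarrow> ('w \<Rightarrow> complex) \<Rightarrow> bool" where
  "structured J x L B \<eta> D \<longleftrightarrow> (\<exists>n (c::nat \<Rightarrow> real) b g.
     (\<forall>k<n. 0 \<le> c k) \<and> (\<Sum>k<n. c k) \<le> B \<and>
     (\<forall>k<n. unit_bdd (b k) \<and> (\<forall>j\<in>J. unit_bdd (g k j))) \<and>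
     (\<forall>l\<in>Q L. nrm (\<lambda>w. S (\<l> x l) D w -
        (\<Sum>k<n. of_real (c k) * b k w * (\<Prod>j\<in>J. S (\<l> j l) (g k j) w))) \<le> \<eta>))"

lemma structuredE:
  assumes "structured J x L B \<eta> D"
  obtains n :: nat and c b g where "\<And>k. k < n \<Longrightarrow> 0 \<le> c k" "(\<Sum>k<n. c k) \<le> B"
    "\<And>k. k < n \<Longrightarrow> unit_bdd (b k)" "\<And>k j. k < n \<Longrightarrow> j \<in> J \<Longrightarrow> unit_bdd (g k j)"
    "\<And>l. l \<in> Q L \<Longrightarrow> nrm (\<lambda>w. S (\<l> x l) D w -
        (\<Sum>k<n. of_real (c k) * b k w * (\<Prod>j\<in>J. S (\<l> j l) (g k j) w))) \<le> \<eta>"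
  using assms unfolding structured_def by blast

lemma structuredI:
  fixes n :: nat
  assumes "\<And>k. k < n \<Longrightarrow> 0 \<le> c k" "(\<Sum>k<n. c k) \<le> B"
    "\<And>k. k < n \<Longrightarrow> unit_bdd (b k)" "\<And>k j. k < n \<Longrightarrow> j \<in> J \<Longrightarrow> unit_bdd (g k j)"
    "\<And>l. l \<in> Q L \<Longrightarrow> nrm (\<lambda>w. S (\<l> x l) D w -
        (\<Sum>k<n. of_real (c k) * b k w * (\<Prod>j\<in>J. S (\<l> j l) (g k j) w))) \<le> \<eta>"
  shows "structured J x L B \<eta> D"
  unfolding structured_def
  by (rule exI[of _ n], rule exI[of _ c], rule exI[of _ b], rule exI[of _ g]) (use assms in simp)

lemma structured_zero: "0 \<le> B \<Longrightarrow> 0 \<le> \<eta> \<Longrightarrow> structured J x L B \<eta> (\<lambda>w. 0)"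
  unfolding structured_def by (intro exI[of _ "0::nat"]) (auto simp: nrm_zero)

lemma structured_mono:
  assumes "structured J x L B \<eta> D" "L' \<le> L" "B \<le> B'" "\<eta> \<le> \<eta>'"
  shows "structured J x L' B' \<eta>' D"
proof -
  obtain n :: nat and c b g where *: "\<And>k. k < n \<Longrightarrow> 0 \<le> c k" "(\<Sum>k<n. c k) \<le> B"
    "\<And>k. k < n \<Longrightarrow> unit_bdd (b k)" "\<And>k j. k < n \<Longrightarrow> j \<in> J \<Longrightarrow> unit_bdd (g k j)"
    "\<And>l. l \<in> Q L \<Longrightarrow> nrm (\<lambda>w. S (\<l> x l) D w -
        (\<Sum>k<n. of_real (c k) * b k w * (\<Prod>j\<in>J. S (\<l> j l) (g k j) w))) \<le> \<eta>"
    by (rule structuredE[OF assms(1)]) (rule that)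
  have "Q L' \<subseteq> Q L" using mono_Q assms(2) by (auto dest: monoD)
  then show ?thesis using assms(3,4)
    by (intro structuredI[where n = n and c = c and b = b and g = g])
      (auto intro: * order_trans[OF *(2)] order_trans[OF *(5)])
qed

lemma sum_lessThan_split: "(\<Sum>k<n + m. F k) = (\<Sum>k<n. F k) + (\<Sum>k<m. F (n + k))"
  for F :: "nat \<Rightarrow> 'z::comm_monoid_add"
  by (induction m) (auto simp: add.assoc)

lemma structured_add_scale:
  assumes D: "structured J x L B \<eta> D" "D \<in> A" and D': "structured J x L B' \<eta>' D'" "D' \<in> A" and t: "0 \<le> t"
  shows "structured J x L (B + t * B') (\<eta> + t * \<eta>') (\<lambda>w. D w + of_real t * D' w)"
proof -
  obtain n :: nat and c b g where 1: "\<And>k. k < n \<Longrightarrow> 0 \<le> c k" "(\<Sum>k<n. c k) \<le> B"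
    "\<And>k. k < n \<Longrightarrow> unit_bdd (b k)" "\<And>k j. k < n \<Longrightarrow> j \<in> J \<Longrightarrow> unit_bdd (g k j)"
    "\<And>l. l \<in> Q L \<Longrightarrow> nrm (\<lambda>w. S (\<l> x l) D w -
        (\<Sum>k<n. of_real (c k) * b k w * (\<Prod>j\<in>J. S (\<l> j l) (g k j) w))) \<le> \<eta>"
    by (rule structuredE[OF D(1)]) (rule that)
  obtain n' :: nat and c' b' g' where 2: "\<And>k. k < n' \<Longrightarrow> 0 \<le> c' k" "(\<Sum>k<n'. c' k) \<le> B'"
    "\<And>k. k < n' \<Longrightarrow> unit_bdd (b' k)" "\<And>k j. k < n' \<Longrightarrow> j \<in> J \<Longrightarrow> unit_bdd (g' k j)"
    "\<And>l. l \<in> Q L \<Longrightarrow> nrm (\<lambda>w. S (\<l> x l) D' w -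
        (\<Sum>k<n'. of_real (c' k) * b' k w * (\<Prod>j\<in>J. S (\<l> j l) (g' k j) w))) \<le> \<eta>'"
    by (rule structuredE[OF D'(1)]) (rule that)
  define c'' where "c'' k = (if k < n then c k else t * c' (k - n))" for k
  define b'' where "b'' k = (if k < n then b k else b' (k - n))" for k
  define g'' where "g'' k = (if k < n then g k else g' (k - n))" for k
  note d = c''_def b''_def g''_def
  have "0 \<le> c'' k" if "k < n + n'" for k using 1(1) 2(1) t that by (auto simp: d)
  moreover have "(\<Sum>k<n + n'. c'' k) \<le> B + t * B'"
    using 1 2 t by (auto simp: d sum_lessThan_split sum_distrib_left[symmetric] intro!: add_mono mult_left_mono)
  moreover have "unit_bdd (b'' k)" if "k < n + n'" for k using 1(3) 2(3) that by (auto simp: d)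
  moreover have "unit_bdd (g'' k j)" if "k < n + n'" "j \<in> J" for k j using 1(4) 2(4) that by (auto simp: d)
  moreover have "nrm (\<lambda>w. S (\<l> x l) (\<lambda>w. D w + of_real t * D' w) w -
        (\<Sum>k<n + n'. of_real (c'' k) * b'' k w * (\<Prod>j\<in>J. S (\<l> j l) (g'' k j) w))) \<le> \<eta> + t * \<eta>'"
    if l: "l \<in> Q L" for l
  proof -
    define X where "X w = S (\<l> x l) D w -
        (\<Sum>k<n. of_real (c k) * b k w * (\<Prod>j\<in>J. S (\<l> j l) (g k j) w))" for w
    define Y where "Y w = S (\<l> x l) D' w -
        (\<Sum>k<n'. of_real (c' k) * b' k w * (\<Prod>j\<in>J. S (\<l> j l) (g' k j) w))" for w
    have XA: "X \<in> A" unfolding X_def[abs_def] by (intro A_intros D(2) unit_bddD(1)) (auto intro: 1)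
    have YA: "Y \<in> A" unfolding Y_def[abs_def] by (intro A_intros D'(2) unit_bddD(1)) (auto intro: 2)
    have "S (\<l> x l) (\<lambda>w. D w + of_real t * D' w) w -
        (\<Sum>k<n + n'. of_real (c'' k) * b'' k w * (\<Prod>j\<in>J. S (\<l> j l) (g'' k j) w)) = X w + of_real t * Y w" for w
    proof -
      have "(\<Sum>k<n + n'. of_real (c'' k) * b'' k w * (\<Prod>j\<in>J. S (\<l> j l) (g'' k j) w)) =
        (\<Sum>k<n. of_real (c k) * b k w * (\<Prod>j\<in>J. S (\<l> j l) (g k j) w)) +
        of_real t * (\<Sum>k<n'. of_real (c' k) * b' k w * (\<Prod>j\<in>J. S (\<l> j l) (g' k j) w))"
        by (simp add: sum_lessThan_split d sum_distrib_left mult.assoc)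
      then show ?thesis unfolding X_def Y_def by (simp add: S_simps algebra_simps)
    qed
    then have "nrm (\<lambda>w. S (\<l> x l) (\<lambda>w. D w + of_real t * D' w) w -
        (\<Sum>k<n + n'. of_real (c'' k) * b'' k w * (\<Prod>j\<in>J. S (\<l> j l) (g'' k j) w))) \<le> nrm X + t * nrm Y"
      using nrm_triangle[OF XA scale_A[OF YA], of "of_real t"] nrm_scale[OF YA, of "of_real t"] t by simp
    also have "nrm X \<le> \<eta>" using 1(5) l by (simp add: X_def[abs_def])
    also have "nrm Y \<le> \<eta>'" using 2(5) l by (simp add: Y_def[abs_def])
    finally show ?thesis using t by (simp add: mult_left_mono)
  qed
  ultimately show ?thesis by (rule structuredI)
qed

text \<open>The adjoint of \<open>u \<mapsto> folner_avg_last J x V f u\<close>, applied to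
  \<open>b\<close>.\<close>

definition dual :: "'j set \<Rightarrow> 'j \<Rightarrow> 'g set \<Rightarrow> ('j \<Rightarrow> 'w \<Rightarrow> complex) \<Rightarrow> ('w \<Rightarrow> complex) \<Rightarrow> 'w \<Rightarrow> complex" where
  "dual J x V f b = (\<lambda>w. (\<Sum>m\<in>V. S (- \<l> x m) b w * (\<Prod>j\<in>J. S (\<l> j m - \<l> x m) (\<lambda>w. cnj (f j w)) w)) / of_nat (card V))"

lemma dual_A: "(\<And>j. j \<in> J \<Longrightarrow> unit_bdd (f j)) \<Longrightarrow> b \<in> A \<Longrightarrow> dual J x V f b \<in> A"
  unfolding dual_def by (intro A_intros) (auto dest: unit_bddD)

lemma nrm_dual:
  assumes "\<And>j. j \<in> J \<Longrightarrow> unit_bdd (f j)" "b \<in> A" "finite V" "V \<noteq> {}"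
  shows "nrm (dual J x V f b) \<le> nrm b"
  unfolding dual_def
proof (rule nrm_mean)
  fix m
  let ?P = "\<lambda>w. \<Prod>j\<in>J. S (\<l> j m - \<l> x m) (\<lambda>w. cnj (f j w)) w"
  have P: "unit_bdd ?P" using assms(1) by (intro unit_bdd_prod unit_bdd_S unit_bdd_cnj)
  show "(\<lambda>w. S (- \<l> x m) b w * ?P w) \<in> A" using assms P by (intro A_intros) (auto dest: unit_bddD)
  have "nrm (\<lambda>w. ?P w * S (- \<l> x m) b w) \<le> 1 * nrm (S (- \<l> x m) b)"
    using P assms by (intro nrm_mult_bdd S_A) (auto dest: unit_bddD)
  then show "nrm (\<lambda>w. S (- \<l> x m) b w * ?P w) \<le> nrm b" using assms by (simp add: mult.commute nrm_S)
qed (use assms in auto)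

lemma dual_bound:
  assumes "\<And>j. j \<in> J \<Longrightarrow> unit_bdd (f j)" "\<And>w. norm (b w) \<le> C" "0 < card V"
  shows "norm (dual J x V f b w) \<le> C"
proof -
  have C0: "0 \<le> C" using assms(2) norm_ge_zero order_trans by blast
  have "norm (\<Sum>m\<in>V. S (- \<l> x m) b w * (\<Prod>j\<in>J. S (\<l> j m - \<l> x m) (\<lambda>w. cnj (f j w)) w)) \<le> card V * C"
  proof (rule sum_norm_le[THEN order_trans])
    fix m
    have "norm (S (- \<l> x m) b w * (\<Prod>j\<in>J. S (\<l> j m - \<l> x m) (\<lambda>w. cnj (f j w)) w)) \<le> C * 1"
      unfolding norm_mult using assms(1,2) C0
      by (intro mult_mono S_bound norm_prod_le_1) (auto intro!: S_bound dest: unit_bddD)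
    then show "norm (S (- \<l> x m) b w * (\<Prod>j\<in>J. S (\<l> j m - \<l> x m) (\<lambda>w. cnj (f j w)) w)) \<le> C" by simp
  qed simp
  then show ?thesis unfolding dual_def using assms(3) by (simp add: norm_divide field_simps)
qed

lemma ip_folner_avg_last_dual:
  assumes f: "\<And>j. j \<in> J \<Longrightarrow> unit_bdd (f j)" and u: "u \<in> A" and b: "b \<in> A"
  shows "ip (folner_avg_last J x V f u) b = ip u (dual J x V f b)"
proof -
  have fA: "f j \<in> A" if "j \<in> J" for j using f[OF that] by (rule unit_bddD)
  \<comment> \<open>Invariance of the mean under the shift by \<open>- \<l> x h\<close> frees
    \<open>u\<close> of its own shift.\<close>
  have eq: "\<tau> (\<lambda>w. S (\<l> x h) u w * (\<Prod>j\<in>J. S (\<l> j h) (f j) w) * cnj (b w)) =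
     \<tau> (\<lambda>w. u w * (cnj (S (- \<l> x h) b w) * (\<Prod>j\<in>J. S (\<l> j h - \<l> x h) (f j) w)))" for h
    by (subst tau_S[symmetric, of _ "- \<l> x h"]) (auto intro!: A_intros fA u b simp: S_simps mult_ac)
  have "ip (folner_avg_last J x V f u) b = (\<Sum>h\<in>V. \<tau> (\<lambda>w. S (\<l> x h) u w * (\<Prod>j\<in>J. S (\<l> j h) (f j) w) * cnj (b w))) / of_nat (card V)"
  proof -
    have "ip (folner_avg_last J x V f u) b = ip (\<lambda>w. inverse (of_nat (card V)) * (\<Sum>h\<in>V. S (\<l> x h) u w * (\<Prod>j\<in>J. S (\<l> j h) (f j) w))) b"
      by (simp add: folner_avg_last_def divide_inverse mult.commute)
    also have "\<dots> = inverse (of_nat (card V)) * (\<Sum>h\<in>V. ip (\<lambda>w. S (\<l> x h) u w * (\<Prod>j\<in>J. S (\<l> j h) (f j) w)) b)"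
      by (subst ip_scale_left) (auto intro!: A_intros u b fA ip_sum_left)
    finally show ?thesis by (simp add: ip_def divide_inverse mult.commute)
  qed
  moreover have "ip u (dual J x V f b) = (\<Sum>h\<in>V. \<tau> (\<lambda>w. u w * (cnj (S (- \<l> x h) b w) * (\<Prod>j\<in>J. S (\<l> j h - \<l> x h) (f j) w)))) / of_nat (card V)"
  proof -
    have "ip u (dual J x V f b) = ip u (\<lambda>w. inverse (of_nat (card V)) * (\<Sum>m\<in>V. S (- \<l> x m) b w * (\<Prod>j\<in>J. S (\<l> j m - \<l> x m) (\<lambda>w. cnj (f j w)) w)))"
      by (simp add: dual_def divide_inverse mult.commute)
    also have "\<dots> = inverse (of_nat (card V)) * (\<Sum>m\<in>V. ip u (\<lambda>w. S (- \<l> x m) b w * (\<Prod>j\<in>J. S (\<l> j m - \<l> x m) (\<lambda>w. cnj (f j w)) w)))"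
      by (subst ip_scale_right) (auto intro!: A_intros u b fA ip_sum_right)
    finally show ?thesis by (simp add: ip_def divide_inverse mult.commute S_cnj)
  qed
  ultimately show ?thesis using eq by simp
qed

text \<open>The substitution \<open>m \<mapsto> m + l\<close> in the average defining the dual function removes the form \<open>x\<close>.\<close>

lemma structured_dual:
  assumes f: "\<And>j. j \<in> J \<Longrightarrow> unit_bdd (f j)" and b: "b \<in> A" "\<And>w. norm (b w) \<le> K" and K: "0 < K"
    and V: "folner Q N V" and N: "0 < N" "L \<le> N"
  shows "structured J x L K (2 * K / N) (dual J x V f b)"
proof -
  have fin: "finite V" "V \<noteq> {}" and cV: "0 < card V" using V folner_card_pos by (auto simp: folner_def)
  obtain h where h: "bij_betw h {..<card V} V"
    using ex_bij_betw_nat_finite[OF fin(1)] by (auto simp: lessThan_atLeast0)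
  \<comment> \<open>The bound \<open>K\<close> moves from \<open>b\<close> into the weights: the
    functions become bounded by \<open>1\<close> and the weights sum to \<open>K\<close>.\<close>
  define c where "c k = K / card V" for k :: nat
  define b' where "b' k w = S (- \<l> x (h k)) b w / of_real K" for k w
  define g where "g k j = S (\<l> j (h k) - \<l> x (h k)) (\<lambda>w. cnj (f j w))" for k j
  have "unit_bdd (b' k)" for k
    unfolding unit_bdd_def b'_def[abs_def] using b K S_bound[of b K]
    by (auto intro!: A_intros simp: norm_divide)
  moreover have "unit_bdd (g k j)" if "j \<in> J" for k j
    unfolding g_def by (intro unit_bdd_S unit_bdd_cnj f that)
  moreover have "(\<Sum>k<card V. c k) \<le> K" using cV by (simp add: c_def)
  moreover have "\<forall>k. 0 \<le> c k" using K by (simp add: c_def)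
  moreover have "nrm (\<lambda>w. S (\<l> x l) (dual J x V f b) w -
        (\<Sum>k<card V. of_real (c k) * b' k w * (\<Prod>j\<in>J. S (\<l> j l) (g k j) w))) \<le> 2 * K / N"
    if l: "l \<in> Q L" for l
  proof (rule nrm_le_bdd)
    show "(\<lambda>w. S (\<l> x l) (dual J x V f b) w -
        (\<Sum>k<card V. of_real (c k) * b' k w * (\<Prod>j\<in>J. S (\<l> j l) (g k j) w))) \<in> A"
      unfolding b'_def g_def using f b by (intro A_intros dual_A) (auto dest: unit_bddD)
    fix w
    \<comment> \<open>\<open>\<Phi> m\<close> is the summand after the shift by
      \<open>\<l> x l\<close>. In \<open>\<Phi> (m + l)\<close> the value \<open>\<l> x l\<close>
      cancels and only \<open>\<l> j l\<close> is left, as the representation requires.\<close>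
    define \<Phi> where "\<Phi> m = S (\<l> x l - \<l> x m) b w * (\<Prod>j\<in>J. S (\<l> x l + (\<l> j m - \<l> x m)) (\<lambda>w. cnj (f j w)) w)" for m
    have 1: "S (\<l> x l) (dual J x V f b) w = (\<Sum>m\<in>V. \<Phi> m) / of_nat (card V)"
      by (simp add: dual_def S_simps \<Phi>_def)
    have "(\<Sum>k<card V. of_real (c k) * b' k w * (\<Prod>j\<in>J. S (\<l> j l) (g k j) w)) = (\<Sum>k<card V. \<Phi> (h k + l)) / of_nat (card V)"
      unfolding sum_divide_distrib
    proof (rule sum.cong[OF refl])
      fix k
      have "S (\<l> x l + (\<l> j (h k + l) - \<l> x (h k + l))) (\<lambda>w. cnj (f j w)) w = S (\<l> j l) (g k j) w" for j
        by (simp add: g_def form_add add.commute add.left_commute)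
      moreover have "S (\<l> x l - \<l> x (h k + l)) b w = S (- \<l> x (h k)) b w" by (simp add: form_add)
      ultimately show "of_real (c k) * b' k w * (\<Prod>j\<in>J. S (\<l> j l) (g k j) w) = \<Phi> (h k + l) / of_nat (card V)"
        using K by (simp add: \<Phi>_def c_def b'_def)
    qed
    also have "\<dots> = (\<Sum>m\<in>V. \<Phi> (m + l)) / of_nat (card V)"
      using sum.reindex_bij_betw[OF h, of "\<lambda>m. \<Phi> (m + l)"] by simp
    finally have 2: "(\<Sum>k<card V. of_real (c k) * b' k w * (\<Prod>j\<in>J. S (\<l> j l) (g k j) w)) = (\<Sum>m\<in>V. \<Phi> (m + l)) / of_nat (card V)" .
    have "norm (\<Phi> m) \<le> K" for m
    proof -
      have "norm (\<Phi> m) \<le> K * 1" unfolding \<Phi>_def norm_mult using f b K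
        by (intro mult_mono S_bound norm_prod_le_1) (auto intro!: S_bound dest: unit_bddD)
      then show ?thesis by simp
    qed
    moreover have "l \<in> Q N" using l N(2) mono_Q by (auto dest: monoD)
    ultimately have "norm ((\<Sum>m\<in>V. \<Phi> m) - (\<Sum>m\<in>V. \<Phi> (m + l))) \<le> 2 * K * card V / N"
      using folner_sum_shift[OF V] N(1) by blast
    then show "norm (S (\<l> x l) (dual J x V f b) w -
        (\<Sum>k<card V. of_real (c k) * b' k w * (\<Prod>j\<in>J. S (\<l> j l) (g k j) w))) \<le> 2 * K / N"
      unfolding 1 2 using cV by (simp add: diff_divide_distrib[symmetric] norm_divide field_simps)
  qed
  ultimately show ?thesis
    by (intro structuredI[where n = "card V" and c = c and b = b' and g = g]) auto
qed

lemma nrm_folner_avg_last_le: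
  assumes "\<And>j. j \<in> J \<Longrightarrow> unit_bdd (f j)" "u \<in> A" "finite V" "V \<noteq> {}"
  shows "nrm (folner_avg_last J x V f u) \<le> nrm u"
  unfolding folner_avg_last_def
proof (rule nrm_mean)
  fix m
  let ?P = "\<lambda>w. \<Prod>j\<in>J. S (\<l> j m) (f j) w"
  have P: "unit_bdd ?P" using assms(1) by (intro unit_bdd_prod unit_bdd_S)
  show "(\<lambda>w. S (\<l> x m) u w * ?P w) \<in> A" using assms P by (intro A_intros) (auto dest: unit_bddD)
  have "nrm (\<lambda>w. ?P w * S (\<l> x m) u w) \<le> 1 * nrm (S (\<l> x m) u)"
    using P assms by (intro nrm_mult_bdd S_A) (auto dest: unit_bddD)
  then show "nrm (\<lambda>w. S (\<l> x m) u w * ?P w) \<le> nrm u" using assms by (simp add: mult.commute nrm_S)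
qed (use assms in auto)

text \<open>On a structured function the average along \<open>x\<close> turns into averages over
  \<open>J\<close> of the products \<open>f j * g k j\<close>. The error survives averaging because
  the factors multiplied to it are bounded by \<open>1\<close>.\<close>

lemma nrm_folner_avg_last_structured:
  assumes f: "\<And>j. j \<in> J \<Longrightarrow> unit_bdd (f j)" and D: "D \<in> A"
    and bg: "\<And>k::nat. k < n \<Longrightarrow> unit_bdd (b k)" "\<And>k j. k < n \<Longrightarrow> j \<in> J \<Longrightarrow> unit_bdd (g k j)"
    and l: "\<And>l. l \<in> W \<Longrightarrow> nrm (\<lambda>w. S (\<l> x l) D w -
        (\<Sum>k<n. of_real (c k) * b k w * (\<Prod>j\<in>J. S (\<l> j l) (g k j) w))) \<le> \<eta>"
    and W: "finite W" "W \<noteq> {}" and \<eta>: "0 \<le> \<eta>"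
  shows "nrm (\<lambda>w. folner_avg_last J x W f D w - (\<Sum>k<n. of_real (c k) * b k w * folner_avg J W (\<lambda>j w. f j w * g k j w) w)) \<le> \<eta>"
proof -
  define R where "R h w = S (\<l> x h) D w - (\<Sum>k<n. of_real (c k) * b k w * (\<Prod>j\<in>J. S (\<l> j h) (g k j) w))" for h w
  define P where "P h w = (\<Prod>j\<in>J. S (\<l> j h) (f j) w)" for h w
  have RA: "R h \<in> A" for h unfolding R_def[abs_def] by (intro A_intros D unit_bddD(1)) (auto intro: bg)
  have P: "unit_bdd (P h)" for h unfolding P_def[abs_def] using f by (intro unit_bdd_prod unit_bdd_S)
  have "folner_avg_last J x W f D w - (\<Sum>k<n. of_real (c k) * b k w * folner_avg J W (\<lambda>j w. f j w * g k j w) w) = (\<Sum>h\<in>W. P h w * R h w) / of_nat (card W)" for w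
  proof -
    have "(\<Sum>k<n. of_real (c k) * b k w * folner_avg J W (\<lambda>j w. f j w * g k j w) w) =
      (\<Sum>k<n. \<Sum>h\<in>W. of_real (c k) * b k w * (P h w * (\<Prod>j\<in>J. S (\<l> j h) (g k j) w))) / of_nat (card W)"
      by (simp add: folner_avg_def S_simps prod.distrib P_def sum_distrib_left sum_divide_distrib)
    also have "\<dots> = (\<Sum>h\<in>W. P h w * (\<Sum>k<n. of_real (c k) * b k w * (\<Prod>j\<in>J. S (\<l> j h) (g k j) w))) / of_nat (card W)"
      by (subst sum.swap) (simp add: sum_distrib_left mult_ac)
    finally show ?thesis
      by (simp add: folner_avg_last_def R_def P_def[symmetric] right_diff_distrib sum_subtractf diff_divide_distrib mult.commute)
  qed
  moreover have "nrm (\<lambda>w. (\<Sum>h\<in>W. P h w * R h w) / of_nat (card W)) \<le> \<eta>"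
  proof (rule nrm_mean)
    fix h assume h: "h \<in> W"
    show "(\<lambda>w. P h w * R h w) \<in> A" using P RA by (intro A_intros) (auto dest: unit_bddD)
    have "nrm (\<lambda>w. P h w * R h w) \<le> 1 * nrm (R h)"
      using P RA by (intro nrm_mult_bdd) (auto dest: unit_bddD)
    also have "nrm (R h) \<le> \<eta>" using l[OF h] by (simp add: R_def[abs_def])
    finally show "nrm (\<lambda>w. P h w * R h w) \<le> \<eta>" by simp
  qed (use W in auto)
  ultimately show ?thesis by simp
qed

end

section \<open>Metastability and the energy decrement\<close>

context forms
begin

text \<open>The window \<open>Q (F N)\<close> makes finite information suffice: structure is known
  only for translations in some \<open>Q M\<close>, and both averaging sets have to lie
  there.\<close>

definition admissible :: "(nat \<Rightarrow> nat) \<Rightarrow> nat \<Rightarrow> 'g set \<Rightarrow> 'g set \<Rightarrow> bool" where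
  "admissible F N W W' \<longleftrightarrow> folner Q N W \<and> folner Q N W' \<and> W \<subseteq> Q (F N) \<and> W' \<subseteq> Q (F N)"

text \<open>Metastability: the bound \<open>M\<close> does not depend on the mean or on the functions, which is
  what makes the induction on the number of forms work.\<close>

definition metastable :: "'j set \<Rightarrow> bool" where
  "metastable J \<longleftrightarrow> (\<forall>\<epsilon>>0. \<forall>F. \<exists>M. \<forall>\<tau> f. invariant_mean A \<sigma> \<tau> \<longrightarrow> (\<forall>j\<in>J. unit_bdd (f j)) \<longrightarrow>
     (\<exists>N\<le>M. \<forall>W W'. admissible F N W W' \<longrightarrow>
        invariant_mean.nrm \<tau> (\<lambda>w. folner_avg J W f w - folner_avg J W' f w) \<le> \<epsilon>))"

end

context forms_mean
begin

text \<open>One scale has to serve the whole family, whatever its size \<open>n\<close>; this is why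
  a weighted sum of norms is controlled. The lower bound \<open>L\<close> guarantees a scale fine
  enough for the next step of the decrement.\<close>

definition ensemble_stable :: "'j set \<Rightarrow> real \<Rightarrow> (nat \<Rightarrow> nat) \<Rightarrow> nat \<Rightarrow> nat \<Rightarrow> bool" where
  "ensemble_stable J \<epsilon> F L M \<longleftrightarrow> (\<forall>(n::nat) c g. (\<forall>k<n. 0 \<le> c k) \<longrightarrow> (\<Sum>k<n. c k) \<le> 1 \<longrightarrow>
     (\<forall>k<n. \<forall>j\<in>J. unit_bdd (g k j)) \<longrightarrow>
     (\<exists>N. L \<le> N \<and> N \<le> M \<and> (\<forall>W W'. admissible F N W W' \<longrightarrow>
        (\<Sum>k<n. c k * nrm (\<lambda>w. folner_avg J W (g k) w - folner_avg J W' (g k) w)) \<le> \<epsilon>)))"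

text \<open>\<open>D\<close> is the structured part collected so far and \<open>n\<close> counts the
  steps still affordable: each lowers the energy of \<open>f x - D\<close> by
  \<open>(\<epsilon>\<^sup>2 / 16)\<^sup>2\<close>. For \<open>n = 0\<close> the remainder is null
  and its averages vanish in norm.\<close>

definition reach :: "'j set \<Rightarrow> 'j \<Rightarrow> (nat \<Rightarrow> nat) \<Rightarrow> real \<Rightarrow> nat \<Rightarrow> real \<Rightarrow> real \<Rightarrow> nat \<Rightarrow> bool" where
  "reach J x F \<epsilon> M B \<eta> n \<longleftrightarrow> (\<forall>f D. (\<forall>j\<in>J. unit_bdd (f j)) \<longrightarrow> unit_bdd (f x) \<longrightarrow> D \<in> A \<longrightarrow>
     (\<forall>w. norm (D w) \<le> B) \<longrightarrow> structured J x M B \<eta> D \<longrightarrow> nrm (\<lambda>w. f x w - D w) \<le> 1 \<longrightarrow>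
     (nrm (\<lambda>w. f x w - D w))\<^sup>2 \<le> real n * (\<epsilon>\<^sup>2 / 16)\<^sup>2 \<longrightarrow>
     (\<exists>N\<le>M. \<forall>W W'. admissible F N W W' \<longrightarrow>
        nrm (\<lambda>w. folner_avg_last J x W f (f x) w - folner_avg_last J x W' f (f x) w) \<le> \<epsilon>))"

lemma nrm_sum_scaled:
  fixes n :: nat
  assumes "\<And>k. k < n \<Longrightarrow> unit_bdd (b k)" "\<And>k. k < n \<Longrightarrow> v k \<in> A" "\<And>k. k < n \<Longrightarrow> 0 \<le> c k"
  shows "nrm (\<lambda>w. \<Sum>k<n. of_real (c k) * b k w * v k w) \<le> (\<Sum>k<n. c k * nrm (v k))"
proof -
  have bv: "(\<lambda>w. b k w * v k w) \<in> A" if "k < n" for k using assms that by (intro mult_A unit_bddD(1)[OF assms(1)]) auto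
  have "nrm (\<lambda>w. \<Sum>k<n. of_real (c k) * b k w * v k w) \<le> (\<Sum>k<n. nrm (\<lambda>w. of_real (c k) * b k w * v k w))"
    using bv by (intro nrm_sum) (auto simp: mult.assoc intro: scale_A)
  also have "\<dots> \<le> (\<Sum>k<n. c k * nrm (v k))"
  proof (rule sum_mono)
    fix k assume k: "k \<in> {..<n}"
    have "nrm (\<lambda>w. of_real (c k) * b k w * v k w) = c k * nrm (\<lambda>w. b k w * v k w)"
      using bv[of k] k assms(3)[of k] nrm_scale[of "\<lambda>w. b k w * v k w" "of_real (c k)"] by (simp add: mult.assoc)
    also have "nrm (\<lambda>w. b k w * v k w) \<le> 1 * nrm (v k)"
      using k assms unit_bddD[OF assms(1)] by (intro nrm_mult_bdd) auto
    finally show "nrm (\<lambda>w. of_real (c k) * b k w * v k w) \<le> c k * nrm (v k)"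
      using assms(3)[of k] k by (simp add: mult_left_mono)
  qed
  finally show ?thesis .
qed

text \<open>Passing from \<open>D\<close> to its representation costs \<open>\<eta>\<close> for each
  of the two sets. What remains is a weighted family of averages over \<open>J\<close>, to which
  \<open>ens\<close> applies once the weights are divided by \<open>B\<close>.\<close>

lemma structured_stable:
  assumes ens: "ensemble_stable J (\<epsilon> / B) F L M2" and B: "0 < B"
    and f: "\<And>j. j \<in> J \<Longrightarrow> unit_bdd (f j)" and D: "D \<in> A" "structured J x M B \<eta> D"
    and M: "\<And>N. N \<le> M2 \<Longrightarrow> F N \<le> M" and \<eta>: "0 \<le> \<eta>"
  obtains N where "L \<le> N" "N \<le> M2" "\<And>W W'. admissible F N W W' \<Longrightarrow>
    nrm (\<lambda>w. folner_avg_last J x W f D w - folner_avg_last J x W' f D w) \<le> 2 * \<eta> + \<epsilon>"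
proof -
  obtain n :: nat and c b g where c: "\<And>k. k < n \<Longrightarrow> 0 \<le> c k" "(\<Sum>k<n. c k) \<le> B"
    and b: "\<And>k. k < n \<Longrightarrow> unit_bdd (b k)" and g: "\<And>k j. k < n \<Longrightarrow> j \<in> J \<Longrightarrow> unit_bdd (g k j)"
    and l: "\<And>l. l \<in> Q M \<Longrightarrow> nrm (\<lambda>w. S (\<l> x l) D w -
        (\<Sum>k<n. of_real (c k) * b k w * (\<Prod>j\<in>J. S (\<l> j l) (g k j) w))) \<le> \<eta>"
    by (rule structuredE[OF D(2)]) (rule that)
  let ?fg = "\<lambda>k j w. f j w * g k j w"
  have fg: "unit_bdd (?fg k j)" if "k < n" "j \<in> J" for k j using f g that by (intro unit_bdd_mult) auto
  have "\<exists>N. L \<le> N \<and> N \<le> M2 \<and> (\<forall>W W'. admissible F N W W' \<longrightarrow>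
        (\<Sum>k<n. c k / B * nrm (\<lambda>w. folner_avg J W (?fg k) w - folner_avg J W' (?fg k) w)) \<le> \<epsilon> / B)"
    using c B fg by (intro ens[unfolded ensemble_stable_def, rule_format])
      (auto simp: sum_divide_distrib[symmetric])
  then obtain N where N: "L \<le> N" "N \<le> M2" and W: "\<And>W W'. admissible F N W W' \<Longrightarrow>
        (\<Sum>k<n. c k / B * nrm (\<lambda>w. folner_avg J W (?fg k) w - folner_avg J W' (?fg k) w)) \<le> \<epsilon> / B" by blast
  show ?thesis
  proof (rule that[OF N])
    fix W W' assume ad: "admissible F N W W'"
    have QM: "Q (F N) \<subseteq> Q M" using M[OF N(2)] mono_Q by (auto dest: monoD)
    have app: "nrm (\<lambda>w. folner_avg_last J x V f D w - (\<Sum>k<n. of_real (c k) * b k w * folner_avg J V (?fg k) w)) \<le> \<eta>"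
      if "folner Q N V" "V \<subseteq> Q (F N)" for V
      using that QM l by (intro nrm_folner_avg_last_structured f D b g \<eta>) (auto simp: folner_def)
    have AWA: "folner_avg J V (?fg k) \<in> A" if "k < n" for V k using fg that by (intro folner_avg_A unit_bddD(1)) auto
    have RA: "(\<lambda>w. \<Sum>k<n. of_real (c k) * b k w * folner_avg J V (?fg k) w) \<in> A" for V
      using AWA b by (intro A_intros) (auto intro: unit_bddD(1))
    have BA: "folner_avg_last J x V f D \<in> A" for V using f D by (intro folner_avg_last_A) (auto intro: unit_bddD(1))
    let ?R = "\<lambda>V w. \<Sum>k<n. of_real (c k) * b k w * folner_avg J V (?fg k) w"
    have "nrm (\<lambda>w. folner_avg_last J x W f D w - folner_avg_last J x W' f D w) \<le>
       nrm (\<lambda>w. folner_avg_last J x W f D w - ?R W w) + nrm (\<lambda>w. ?R W w - folner_avg_last J x W' f D w)"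
      by (intro nrm_diff_triangle BA RA)
    also have "nrm (\<lambda>w. ?R W w - folner_avg_last J x W' f D w) \<le> nrm (\<lambda>w. ?R W w - ?R W' w) + nrm (\<lambda>w. ?R W' w - folner_avg_last J x W' f D w)"
      by (intro nrm_diff_triangle BA RA)
    also have "nrm (\<lambda>w. ?R W' w - folner_avg_last J x W' f D w) = nrm (\<lambda>w. folner_avg_last J x W' f D w - ?R W' w)"
      by (intro nrm_minus_commute BA RA)
    also have "nrm (\<lambda>w. folner_avg_last J x W f D w - ?R W w) \<le> \<eta>" using ad by (intro app) (auto simp: admissible_def)
    also have "nrm (\<lambda>w. folner_avg_last J x W' f D w - ?R W' w) \<le> \<eta>" using ad by (intro app) (auto simp: admissible_def)
    also have "nrm (\<lambda>w. ?R W w - ?R W' w) \<le> \<epsilon>"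
    proof -
      have "(\<lambda>w. ?R W w - ?R W' w) = (\<lambda>w. \<Sum>k<n. of_real (c k) * b k w * (folner_avg J W (?fg k) w - folner_avg J W' (?fg k) w))"
        by (simp add: sum_subtractf[symmetric] right_diff_distrib)
      then have "nrm (\<lambda>w. ?R W w - ?R W' w) \<le> (\<Sum>k<n. c k * nrm (\<lambda>w. folner_avg J W (?fg k) w - folner_avg J W' (?fg k) w))"
        using nrm_sum_scaled[of n b "\<lambda>k w. folner_avg J W (?fg k) w - folner_avg J W' (?fg k) w" c] b c AWA
        by (simp add: A_intros)
      also have "\<dots> \<le> \<epsilon>" using W[OF ad] B by (simp add: sum_divide_distrib[symmetric] field_simps)
      finally show ?thesis .
    qed
    finally show "nrm (\<lambda>w. folner_avg_last J x W f D w - folner_avg_last J x W' f D w) \<le> 2 * \<eta> + \<epsilon>" by simp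
  qed
qed

text \<open>One step of the energy decrement: either the unstructured part \<open>u\<close> has small averages over
  all sets at the present scale, or it correlates with a dual function, which is moved into \<open>D\<close>.\<close>

lemma reach_step:
  assumes ens: "ensemble_stable J (\<epsilon> / 8 / B) F L M2" and B: "1 \<le> B" and \<epsilon>: "0 < \<epsilon>" "\<epsilon> \<le> 1"
    and \<eta>: "0 \<le> \<eta>" "\<eta> \<le> \<epsilon> / 8" and M: "\<And>N. N \<le> M2 \<Longrightarrow> F N \<le> M" "M2 \<le> M"
    and next': "0 < n \<Longrightarrow> reach J x F \<epsilon> M1 (2 * B + 1) \<eta>' (n - 1)" and M1: "M1 \<le> L" "M1 \<le> M"
    and L: "0 < L" "\<eta> + 2 * (1 + B) / L \<le> \<eta>'"
  shows "reach J x F \<epsilon> M B \<eta> n"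
  unfolding reach_def
proof (intro allI impI)
  fix f D
  assume f: "\<forall>j\<in>J. unit_bdd (f j)" and fx: "unit_bdd (f x)" and D: "D \<in> A" "\<forall>w. norm (D w) \<le> B"
    "structured J x M B \<eta> D" and u1: "nrm (\<lambda>w. f x w - D w) \<le> 1"
    and en: "(nrm (\<lambda>w. f x w - D w))\<^sup>2 \<le> real n * (\<epsilon>\<^sup>2 / 16)\<^sup>2"
  define u where "u w = f x w - D w" for w
  \<comment> \<open>The square of \<open>\<epsilon>/4\<close>: this is the correlation of
    \<open>u\<close> with the dual function in the second case, and subtracting
    \<open>\<gamma>\<close> times a function of norm at most \<open>1\<close> with that correlation
    lowers the energy by \<open>\<gamma>\<^sup>2\<close>.\<close>
  define \<gamma> where "\<gamma> = \<epsilon>\<^sup>2 / 16"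
  have f': "\<And>j. j \<in> J \<Longrightarrow> unit_bdd (f j)" using f by auto
  have uA: "u \<in> A" unfolding u_def[abs_def] by (intro diff_A unit_bddD(1)[OF fx] D)
  have ubd: "norm (u w) \<le> 1 + B" for w
    using norm_triangle_ineq4[of "f x w" "D w"] unit_bddD(2)[OF fx, of w] D(2)[rule_format, of w] by (simp add: u_def)
  have u1: "nrm u \<le> 1" using u1 by (simp add: u_def[abs_def])
  have en: "(nrm u)\<^sup>2 \<le> real n * \<gamma>\<^sup>2" using en by (simp add: u_def[abs_def] \<gamma>_def)
  obtain N where N: "L \<le> N" "N \<le> M2" and NW: "\<And>W W'. admissible F N W W' \<Longrightarrow>
    nrm (\<lambda>w. folner_avg_last J x W f D w - folner_avg_last J x W' f D w) \<le> 2 * \<eta> + \<epsilon> / 8"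
  proof (rule structured_stable[OF ens _ f' D(1,3) M(1) \<eta>(1)])
    show "0 < B" using B by simp
  qed (use that in auto)
  show "\<exists>N\<le>M. \<forall>W W'. admissible F N W W' \<longrightarrow>
        nrm (\<lambda>w. folner_avg_last J x W f (f x) w - folner_avg_last J x W' f (f x) w) \<le> \<epsilon>"
  \<comment> \<open>If all averages of \<open>u\<close> are small, the errors add up to
    \<open>2 * (\<epsilon>/4) + 2 * \<eta> + \<epsilon>/8\<close>, which is at most
    \<open>\<epsilon>\<close>.\<close>
  proof (cases "\<forall>V. folner Q N V \<longrightarrow> V \<subseteq> Q (F N) \<longrightarrow> nrm (folner_avg_last J x V f u) \<le> \<epsilon> / 4")
    case True
    show ?thesis
    proof (intro exI[of _ N] conjI allI impI)
      show "N \<le> M" using N M by simp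
      fix W W' assume ad: "admissible F N W W'"
      have BA: "folner_avg_last J x V f v \<in> A" if "v \<in> A" for V v using f' that by (intro folner_avg_last_A) (auto intro: unit_bddD(1))
      have eq: "f x = (\<lambda>w. u w - (\<lambda>w. - D w) w)" by (simp add: u_def fun_eq_iff)
      have neg: "folner_avg_last J x V f (\<lambda>w. - D w) = (\<lambda>w. - folner_avg_last J x V f D w)" for V
        using folner_avg_last_diff[of J x V f "\<lambda>w. 0" D] by (simp add: folner_avg_last_def)
      have "folner_avg_last J x V f (f x) = (\<lambda>w. folner_avg_last J x V f u w + folner_avg_last J x V f D w)" for V
        using folner_avg_last_diff[of J x V f u "\<lambda>w. - D w"] neg[of V] by (subst eq) (simp add: fun_eq_iff)
      then have "nrm (\<lambda>w. folner_avg_last J x W f (f x) w - folner_avg_last J x W' f (f x) w) =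
         nrm (\<lambda>w. (folner_avg_last J x W f u w - folner_avg_last J x W' f u w) + (folner_avg_last J x W f D w - folner_avg_last J x W' f D w))"
        by (simp add: algebra_simps)
      also have "\<dots> \<le> nrm (\<lambda>w. folner_avg_last J x W f u w - folner_avg_last J x W' f u w) + nrm (\<lambda>w. folner_avg_last J x W f D w - folner_avg_last J x W' f D w)"
        by (intro nrm_triangle A_intros BA uA D)
      also have "nrm (\<lambda>w. folner_avg_last J x W f u w - folner_avg_last J x W' f u w) \<le> nrm (folner_avg_last J x W f u) + nrm (folner_avg_last J x W' f u)"
        by (intro nrm_triangle_diff BA uA)
      also have "nrm (folner_avg_last J x W f u) \<le> \<epsilon> / 4" using True ad by (auto simp: admissible_def)
      also have "nrm (folner_avg_last J x W' f u) \<le> \<epsilon> / 4" using True ad by (auto simp: admissible_def)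
      also have "nrm (\<lambda>w. folner_avg_last J x W f D w - folner_avg_last J x W' f D w) \<le> 2 * \<eta> + \<epsilon> / 8" by (rule NW[OF ad])
      finally show "nrm (\<lambda>w. folner_avg_last J x W f (f x) w - folner_avg_last J x W' f (f x) w) \<le> \<epsilon>" using \<eta> \<epsilon> by simp
    qed
  next
    case False
    then obtain V where V: "folner Q N V" "\<epsilon> / 4 < nrm (folner_avg_last J x V f u)" by (auto simp: not_le)
    have fV: "finite V" "V \<noteq> {}" "0 < card V" using V folner_card_pos by (auto simp: folner_def)
    define b where "b = folner_avg_last J x V f u"
    define s where "s = dual J x V f b"
    have bA: "b \<in> A" unfolding b_def using f' uA by (intro folner_avg_last_A) (auto intro: unit_bddD(1))
    have sA: "s \<in> A" unfolding s_def using f' bA by (intro dual_A) auto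
    have bu: "nrm b \<le> nrm u" unfolding b_def using f' uA fV by (intro nrm_folner_avg_last_le) auto
    have "nrm s \<le> nrm b" unfolding s_def using f' bA fV by (intro nrm_dual) auto
    with bu u1 have s1: "nrm s \<le> 1" by simp
    have "0 < nrm u" using bu V(2) \<epsilon> unfolding b_def by linarith
    \<comment> \<open>An exhausted budget would make \<open>u\<close> null, contrary to its large
      average over \<open>V\<close>.\<close>
    then have n0: "0 < n" using en by (cases n) auto
    have bb: "norm (b w) \<le> 1 + B" for w unfolding b_def using f' ubd fV by (intro folner_avg_last_bound) auto
    have sb: "norm (s w) \<le> 1 + B" for w unfolding s_def using f' bb fV by (intro dual_bound) auto
    have \<gamma>: "0 < \<gamma>" "\<gamma> \<le> 1" using \<epsilon> by (auto simp: \<gamma>_def power_le_one divide_le_eq_1 intro: order_trans[of _ 1])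
    have "ip u s = ip b b" using ip_folner_avg_last_dual[of J f u b x V] f' uA bA unfolding s_def b_def by simp
    then have "Re (ip u s) = (nrm b)\<^sup>2" using nrm_square[OF bA] by simp
    moreover have "\<gamma> \<le> (nrm b)\<^sup>2"
    proof -
      have "(\<epsilon> / 4)\<^sup>2 \<le> (nrm b)\<^sup>2" using V(2) \<epsilon> by (intro power_mono) (auto simp: b_def)
      then show ?thesis by (simp add: \<gamma>_def power_divide)
    qed
    ultimately have us: "\<gamma> \<le> Re (ip u s)" by simp
    define D' where "D' w = D w + of_real \<gamma> * s w" for w
    have D'A: "D' \<in> A" unfolding D'_def[abs_def] by (intro A_intros D sA)
    have "(nrm (\<lambda>w. f x w - D' w))\<^sup>2 = (nrm (\<lambda>w. u w - of_real \<gamma> * s w))\<^sup>2"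
      by (simp add: u_def D'_def algebra_simps)
    also have "\<dots> = (nrm u)\<^sup>2 - 2 * \<gamma> * Re (ip u s) + \<gamma>\<^sup>2 * (nrm s)\<^sup>2"
      using uA sA by (simp add: nrm_diff_square scale_A nrm_scale ip_scale_right power_mult_distrib)
    also have "\<dots> \<le> (nrm u)\<^sup>2 - 2 * \<gamma> * \<gamma> + \<gamma>\<^sup>2 * 1"
    proof -
      have "\<gamma> * \<gamma> \<le> \<gamma> * Re (ip u s)" using us \<gamma> by (intro mult_left_mono) auto
      moreover have "\<gamma>\<^sup>2 * (nrm s)\<^sup>2 \<le> \<gamma>\<^sup>2 * 1" using s1 sA by (intro mult_left_mono power_le_one) auto
      ultimately show ?thesis by linarith
    qed
    finally have dec: "(nrm (\<lambda>w. f x w - D' w))\<^sup>2 \<le> (nrm u)\<^sup>2 - \<gamma>\<^sup>2" by (simp add: power2_eq_square)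
    have "(nrm (\<lambda>w. f x w - D' w))\<^sup>2 \<le> real (n - 1) * \<gamma>\<^sup>2"
      using dec en n0 by (simp add: of_nat_diff left_diff_distrib)
    moreover have "nrm (\<lambda>w. f x w - D' w) \<le> 1"
    proof (rule power2_le_imp_le)
      have "(nrm u)\<^sup>2 \<le> 1" using u1 uA by (simp add: power_le_one)
      then show "(nrm (\<lambda>w. f x w - D' w))\<^sup>2 \<le> 1\<^sup>2" using dec zero_le_power2[of \<gamma>] unfolding power_one by linarith
    qed simp
    \<comment> \<open>\<open>D\<close> is bounded by \<open>B\<close> and the added dual function by
      \<open>1 + B\<close>; hence the growth from \<open>B\<close> to
      \<open>2 * B + 1\<close>.\<close>
    moreover have "norm (D' w) \<le> 2 * B + 1" for w
    proof -
      have "norm (D' w) \<le> norm (D w) + \<gamma> * norm (s w)" unfolding D'_def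
        using norm_triangle_ineq[of "D w" "of_real \<gamma> * s w"] \<gamma> by (simp add: norm_mult)
      moreover have "\<gamma> * norm (s w) \<le> 1 * (1 + B)" using \<gamma> sb by (intro mult_mono) auto
      ultimately show ?thesis using D(2)[rule_format, of w] by simp
    qed
    moreover have "structured J x M1 (2 * B + 1) \<eta>' D'"
    proof -
      \<comment> \<open>\<open>V\<close> lives at a scale \<open>N \<ge> L\<close>, so the error of
        the new dual function is at most \<open>2 * (1 + B) / L\<close> and fits into the gap
        between \<open>\<eta>\<close> and \<open>\<eta>'\<close>.\<close>
      have st: "structured J x M1 (1 + B) (2 * (1 + B) / N) s"
        unfolding s_def using f' bA bb B V(1) L N M1 by (intro structured_dual) auto
      have "structured J x M1 (B + \<gamma> * (1 + B)) (\<eta> + \<gamma> * (2 * (1 + B) / N)) D'"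
        unfolding D'_def[abs_def] using \<gamma> sA D
        by (intro structured_add_scale st structured_mono[OF D(3)] M1) auto
      moreover have "\<gamma> * (1 + B) \<le> 1 * (1 + B)" using \<gamma> B by (intro mult_right_mono) auto
      moreover have "\<gamma> * (2 * (1 + B) / N) \<le> 1 * (2 * (1 + B) / L)"
        using \<gamma> B N L by (intro mult_mono divide_left_mono) auto
      ultimately show ?thesis using L(2) by (elim structured_mono) auto
    qed
    ultimately have "\<exists>N\<le>M1. \<forall>W W'. admissible F N W W' \<longrightarrow>
        nrm (\<lambda>w. folner_avg_last J x W f (f x) w - folner_avg_last J x W' f (f x) w) \<le> \<epsilon>"
      using f fx D'A by (intro next'[OF n0, unfolded reach_def, rule_format]) (auto simp: \<gamma>_def)
    then show ?thesis using M1(2) by (meson order_trans)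
  qed
qed

end

text \<open>Adjoining a coordinate in \<open>nat\<close> turns a finite family of functions into a single one, so that
  metastability extends to finite weighted families.\<close>

definition amplify :: "('w \<Rightarrow> complex) set \<Rightarrow> ('w \<times> nat \<Rightarrow> complex) set" where
  "amplify A = {a. (\<forall>i. (\<lambda>w. a (w, i)) \<in> A) \<and> (\<exists>C. \<forall>z. norm (a z) \<le> C)}"

definition amplify_shift :: "(int \<Rightarrow> 'w \<Rightarrow> 'w) \<Rightarrow> int \<Rightarrow> 'w \<times> nat \<Rightarrow> 'w \<times> nat" where
  "amplify_shift \<sigma> m = (\<lambda>z. (\<sigma> m (fst z), snd z))"

lemma (in shift_algebra) shift_algebra_amplify: "shift_algebra (amplify A) (amplify_shift \<sigma>)"
proof
  fix a b :: "'w \<times> nat \<Rightarrow> complex" assume a: "a \<in> amplify A" and b: "b \<in> amplify A"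
  then obtain C C' where C: "\<And>z. norm (a z) \<le> C" "\<And>z. norm (b z) \<le> C'" by (auto simp: amplify_def)
  have "norm (a z + b z) \<le> C + C'" for z using C by (meson add_mono norm_triangle_le)
  then show "(\<lambda>z. a z + b z) \<in> amplify A" using a b by (auto simp: amplify_def intro: A_intros)
  have "norm (a z * b z) \<le> C * C'" for z
    unfolding norm_mult using C by (intro mult_mono) (auto intro: order_trans[OF norm_ge_zero])
  then show "(\<lambda>z. a z * b z) \<in> amplify A" using a b by (auto simp: amplify_def intro: A_intros)
qed (auto simp: amplify_def amplify_shift_def shift_shift shift_zero intro: A_intros shift_A)

text \<open>The induction takes place in an amplified algebra from the outset: amplifying once more
  yields nothing new up to a pairing of indices, so families and mixtures of means stay within the
  same algebra.\<close>

locale amplified_forms = base: shift_algebra A0 \<sigma>0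
  for A0 :: "('w \<Rightarrow> complex) set" and \<sigma>0 :: "int \<Rightarrow> 'w \<Rightarrow> 'w" +
  fixes \<l> :: "'j \<Rightarrow> 'g::ab_group_add \<Rightarrow> int" and Q :: "nat \<Rightarrow> 'g set"
  assumes form_add': "\<l> j (g + h) = \<l> j g + \<l> j h"
    and mono_Q': "mono Q"

sublocale amplified_forms \<subseteq> forms "amplify A0" "amplify_shift \<sigma>0" \<l> Q
  by (intro forms.intro base.shift_algebra_amplify forms_axioms.intro form_add' mono_Q')

section \<open>Finite families as single functions, and the induction on the number of forms\<close>

context amplified_forms
begin

text \<open>The pairing hides a second index in the \<open>nat\<close> coordinate;
  \<open>slice k\<close> recovers the \<open>k\<close>-th member of a family stored in one
  function.\<close>

definition slice :: "nat \<Rightarrow> ('w \<times> nat \<Rightarrow> complex) \<Rightarrow> 'w \<times> nat \<Rightarrow> complex" where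
  "slice k a = (\<lambda>z. a (fst z, prod_encode (snd z, k)))"

lemma slice_A: "a \<in> amplify A0 \<Longrightarrow> slice k a \<in> amplify A0"
  by (auto simp: slice_def amplify_def)

lemma slice_S: "slice k (S m a) = S m (slice k a)"
  by (simp add: slice_def S_def amplify_shift_def)

lemma slice_folner_avg: "slice k (folner_avg J W f) = folner_avg J W (\<lambda>j. slice k (f j))"
proof -
  have "folner_avg J W f (fst z, prod_encode (snd z, k)) = folner_avg J W (\<lambda>j. slice k (f j)) z" for z
    unfolding folner_avg_def slice_S[symmetric] by (simp add: slice_def)
  then show ?thesis by (simp add: slice_def[of k "folner_avg J W f"])
qed

text \<open>The family is stored in one function \<open>G\<close>. Under the mixture of the means of
  its slices, the squared norm of the difference of averages of \<open>G\<close> is the weighted sum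
  of the squared norms for the members, so metastability for one tuple suffices.\<close>

lemma ensemble_stable_of_metastable:
  assumes "metastable J" and \<epsilon>: "0 < \<epsilon>"
  shows "\<exists>M. \<forall>\<tau>. invariant_mean (amplify A0) (amplify_shift \<sigma>0) \<tau> \<longrightarrow>
     forms_mean.ensemble_stable (amplify A0) (amplify_shift \<sigma>0) \<l> Q \<tau> J \<epsilon> F L M"
proof -
  \<comment> \<open>With \<open>max N L\<close> in place of \<open>N\<close>, any scale supplied by
    metastability becomes one that is at least \<open>L\<close>.\<close>
  define F' where "F' N = F (max N L)" for N
  obtain M0 where M0: "\<And>\<tau> f. invariant_mean (amplify A0) (amplify_shift \<sigma>0) \<tau> \<Longrightarrow> (\<forall>j\<in>J. unit_bdd (f j)) \<Longrightarrow>
     (\<exists>N\<le>M0. \<forall>W W'. admissible F' N W W' \<longrightarrow>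
        invariant_mean.nrm \<tau> (\<lambda>w. folner_avg J W f w - folner_avg J W' f w) \<le> \<epsilon>)"
    using assms(1)[unfolded metastable_def, rule_format, OF \<epsilon>, of F'] by blast
  show ?thesis
  proof (intro exI[of _ "max M0 L"] allI impI)
    fix \<tau> assume im: "invariant_mean (amplify A0) (amplify_shift \<sigma>0) \<tau>"
    interpret forms_mean "amplify A0" "amplify_shift \<sigma>0" \<l> Q \<tau>
      by (intro forms_mean.intro forms_axioms im)
    show "ensemble_stable J \<epsilon> F L (max M0 L)"
      unfolding ensemble_stable_def
    proof (intro allI impI)
      fix n :: nat and c :: "nat \<Rightarrow> real" and g :: "nat \<Rightarrow> 'j \<Rightarrow> 'w \<times> nat \<Rightarrow> complex"
      assume c: "\<forall>k<n. 0 \<le> c k" "sum c {..<n} \<le> 1" and g: "\<forall>k<n. \<forall>j\<in>J. unit_bdd (g k j)"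
      \<comment> \<open>A mean has total mass \<open>1\<close>; the missing weight goes to index
        \<open>n\<close>, where the stored function vanishes.\<close>
      define c' where "c' k = (if k < n then c k else 1 - sum c {..<n})" for k
      have c'0: "0 \<le> c' k" for k using c by (auto simp: c'_def)
      have "(\<Sum>k<Suc n. c' k) = 1" by (simp add: c'_def)
      define \<tau>' where "\<tau>' a = (\<Sum>k<Suc n. of_real (c' k) * \<tau> (slice k a))" for a
      have im': "invariant_mean (amplify A0) (amplify_shift \<sigma>0) \<tau>'"
      proof
        fix a b :: "'w \<times> nat \<Rightarrow> complex" and z m
        assume a: "a \<in> amplify A0"
        show "\<tau>' (\<lambda>w. z * a w) = z * \<tau>' a"
        proof -
          have "\<tau> (slice k (\<lambda>w. z * a w)) = z * \<tau> (slice k a)" for k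
            using tau_scale[OF slice_A[OF a], of z k] by (simp add: slice_def)
          then show ?thesis unfolding \<tau>'_def sum_distrib_left by (simp add: mult.left_commute)
        qed
        show "\<tau>' (\<lambda>w. cnj (a w)) = cnj (\<tau>' a)"
        proof -
          have "\<tau> (slice k (\<lambda>w. cnj (a w))) = cnj (\<tau> (slice k a))" for k
            using tau_cnj[OF slice_A[OF a], of k] by (simp add: slice_def)
          then show ?thesis unfolding \<tau>'_def by simp
        qed
        show "\<tau>' (\<lambda>w. a (amplify_shift \<sigma>0 m w)) = \<tau>' a"
        proof -
          have "\<tau> (slice k (S m a)) = \<tau> (slice k a)" for k
            unfolding slice_S by (rule tau_S[OF slice_A[OF a]])
          then show ?thesis unfolding \<tau>'_def S_def[symmetric] by simp
        qed
        {
          assume b: "b \<in> amplify A0"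
          have "\<tau> (slice k (\<lambda>w. a w + b w)) = \<tau> (slice k a) + \<tau> (slice k b)" for k
            using tau_add[OF slice_A[OF a] slice_A[OF b], of k k] by (simp add: slice_def)
          then show "\<tau>' (\<lambda>w. a w + b w) = \<tau>' a + \<tau>' b" unfolding \<tau>'_def by (simp add: ring_distribs sum.distrib)
        }
        {
          assume "\<And>w. Im (a w) = 0" "\<And>w. 0 \<le> Re (a w)"
          then have "0 \<le> Re (\<tau> (slice k a))" for k
            by (intro tau_pos slice_A a) (auto simp: slice_def)
          then show "0 \<le> Re (\<tau>' a)" unfolding \<tau>'_def using c'0 by (auto intro!: sum_nonneg add_nonneg_nonneg)
        }
      next
        have "\<tau> (slice k (\<lambda>w. 1)) = 1" for k using tau_one by (simp add: slice_def)
        then have "\<tau>' (\<lambda>w. 1) = of_real (\<Sum>k<Suc n. c' k)"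
          unfolding \<tau>'_def of_real_sum by (intro sum.cong refl) simp
        then show "\<tau>' (\<lambda>w. 1) = 1" using \<open>(\<Sum>k<Suc n. c' k) = 1\<close> by (metis of_real_1)
      qed
      then interpret m': invariant_mean "amplify A0" "amplify_shift \<sigma>0" \<tau>' .
      define G where "G j = (\<lambda>z. let (i, k) = prod_decode (snd z) in if k < n then g k j (fst z, i) else 0)" for j
      have G: "\<forall>j\<in>J. unit_bdd (G j)"
      proof
        fix j assume j: "j \<in> J"
        have "norm (G j z) \<le> 1" for z using g j unit_bddD(2)
          by (auto simp: G_def Let_def split: prod.split)
        moreover have "(\<lambda>w. G j (w, i)) \<in> A0" for i
        proof (cases "snd (prod_decode i) < n")
          case True
          then have "g (snd (prod_decode i)) j \<in> amplify A0" using g j by (auto intro: unit_bddD(1))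
          then show ?thesis using True by (auto simp: G_def amplify_def case_prod_unfold Let_def)
        next
          case False
          then show ?thesis by (simp add: G_def case_prod_unfold Let_def base.const_A)
        qed
        ultimately have "G j \<in> amplify A0" unfolding amplify_def by blast
        then show "unit_bdd (G j)" using \<open>\<And>z. norm (G j z) \<le> 1\<close> by (simp add: unit_bdd_def)
      qed
      have sG: "slice k (G j) = g k j" if "k < n" for k j using that by (simp add: slice_def G_def)
      have GA: "folner_avg J W G \<in> amplify A0" for W using G by (intro folner_avg_A) (auto intro: unit_bddD(1))
      obtain N where N: "N \<le> M0" and NW: "\<And>W W'. admissible F' N W W' \<Longrightarrow>
        m'.nrm (\<lambda>w. folner_avg J W G w - folner_avg J W' G w) \<le> \<epsilon>"
        using M0[OF im' G] by blast
      show "\<exists>N. L \<le> N \<and> N \<le> max M0 L \<and> (\<forall>W W'. admissible F N W W' \<longrightarrow>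
        (\<Sum>k<n. c k * nrm (\<lambda>w. folner_avg J W (g k) w - folner_avg J W' (g k) w)) \<le> \<epsilon>)"
      proof (intro exI[of _ "max N L"] conjI allI impI)
        fix W W' assume "admissible F (max N L) W W'"
        then have "admissible F' N W W'"
          unfolding admissible_def F'_def using folner_antimono[OF mono_Q, of N "max N L"] by auto
        note le = NW[OF this]
        define d where "d = (\<lambda>w. folner_avg J W G w - folner_avg J W' G w)"
        have dA: "d \<in> amplify A0" unfolding d_def by (intro A_intros GA)
        define x where "x k = nrm (\<lambda>w. folner_avg J W (g k) w - folner_avg J W' (g k) w)" for k
        have "slice k d = (\<lambda>w. folner_avg J W (g k) w - folner_avg J W' (g k) w)" if "k < n" for k
        proof -
          have "slice k d = (\<lambda>w. slice k (folner_avg J W G) w - slice k (folner_avg J W' G) w)"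
            by (simp add: d_def slice_def)
          then show ?thesis using that by (simp add: slice_folner_avg sG)
        qed
        then have x: "x k = nrm (slice k d)" if "k < n" for k using that by (simp add: x_def)
        have "(m'.nrm d)\<^sup>2 = Re (\<tau>' (\<lambda>w. d w * cnj (d w)))"
          using dA by (simp add: m'.nrm_square m'.ip_def)
        also have "\<dots> = (\<Sum>k<Suc n. c' k * (nrm (slice k d))\<^sup>2)"
        proof -
          have "slice k (\<lambda>w. d w * cnj (d w)) = (\<lambda>w. slice k d w * cnj (slice k d w))" for k
            by (simp add: slice_def)
          then have "\<tau> (slice k (\<lambda>w. d w * cnj (d w))) = of_real ((nrm (slice k d))\<^sup>2)" for k
            using ip_self[OF slice_A[OF dA], of k] by (simp add: ip_def)
          then show ?thesis unfolding \<tau>'_def by (simp flip: of_real_mult of_real_sum)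
        qed
        finally have sq: "(\<Sum>k<Suc n. c' k * (nrm (slice k d))\<^sup>2) = (m'.nrm d)\<^sup>2" by simp
        have "(\<Sum>k<n. c k * (x k)\<^sup>2) = (\<Sum>k<n. c' k * (nrm (slice k d))\<^sup>2)" by (simp add: c'_def x)
        also have "\<dots> \<le> (\<Sum>k<Suc n. c' k * (nrm (slice k d))\<^sup>2)" using c'0 by simp
        also have "\<dots> \<le> \<epsilon>\<^sup>2" unfolding sq using le dA by (intro power_mono) (auto simp: d_def)
        finally have sum2: "(\<Sum>k<n. c k * (x k)\<^sup>2) \<le> \<epsilon>\<^sup>2" .
        \<comment> \<open>From weighted squares back to the weighted sum by the inequality between
          arithmetic and geometric mean, as the weights sum to at most \<open>1\<close>.\<close>
        have "(\<Sum>k<n. c k * x k) \<le> (\<Sum>k<n. c k * (((x k)\<^sup>2 / \<epsilon> + \<epsilon>) / 2))"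
        proof (intro sum_mono mult_left_mono)
          fix k
          have "0 \<le> (x k - \<epsilon>)\<^sup>2" by simp
          then have "2 * \<epsilon> * x k \<le> (x k)\<^sup>2 + \<epsilon>\<^sup>2" by (simp add: power2_diff mult_ac)
          then show "x k \<le> ((x k)\<^sup>2 / \<epsilon> + \<epsilon>) / 2" using \<epsilon> by (simp add: field_simps power2_eq_square)
        qed (use c in auto)
        also have "\<dots> = ((\<Sum>k<n. c k * (x k)\<^sup>2) / \<epsilon> + \<epsilon> * (\<Sum>k<n. c k)) / 2"
          by (simp add: sum_divide_distrib sum_distrib_left sum.distrib[symmetric] algebra_simps add_divide_distrib)
        also have "\<dots> \<le> (\<epsilon>\<^sup>2 / \<epsilon> + \<epsilon> * 1) / 2"
          using sum2 c \<epsilon> by (intro divide_right_mono add_mono mult_left_mono) auto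
        also have "\<dots> = \<epsilon>" using \<epsilon> by (simp add: power2_eq_square)
        finally show "(\<Sum>k<n. c k * nrm (\<lambda>w. folner_avg J W (g k) w - folner_avg J W' (g k) w)) \<le> \<epsilon>" by (simp add: x_def)
      qed (use N in auto)
    qed
  qed
qed

text \<open>The scales are chosen backwards: first the bound \<open>M1\<close> for the remaining
  steps, then \<open>L\<close>, then the ensemble bound \<open>M2\<close>, and finally
  \<open>M\<close>. None of them depends on the mean or on the functions. Halving the distance to
  \<open>\<epsilon>/8\<close> at each step keeps the errors below it.\<close>

lemma reach_exists:
  assumes "metastable J" and \<epsilon>: "0 < \<epsilon>" "\<epsilon> \<le> 1" and "1 \<le> B" "0 \<le> \<eta>" "\<eta> < \<epsilon> / 8"
  shows "\<exists>M. \<forall>\<tau>. invariant_mean (amplify A0) (amplify_shift \<sigma>0) \<tau> \<longrightarrow>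
     forms_mean.reach (amplify A0) (amplify_shift \<sigma>0) \<l> Q \<tau> J x F \<epsilon> M B \<eta> n"
  using assms(4-)
proof (induction n arbitrary: B \<eta>)
  case 0
  \<comment> \<open>No step follows here, so \<open>M1 = 0\<close> and the value given to
    \<open>\<eta>'\<close> are placeholders.\<close>
  define L where "L = (1::nat)"
  obtain M2 where M2: "\<And>\<tau>. invariant_mean (amplify A0) (amplify_shift \<sigma>0) \<tau> \<Longrightarrow>
     forms_mean.ensemble_stable (amplify A0) (amplify_shift \<sigma>0) \<l> Q \<tau> J (\<epsilon> / 8 / B) F L M2"
    using ensemble_stable_of_metastable[OF assms(1), of "\<epsilon> / 8 / B" F L] 0 \<epsilon> by auto
  show ?case
  proof (intro exI[of _ "max M2 (Max (F ` {..M2}))"] allI impI)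
    fix \<tau> assume im: "invariant_mean (amplify A0) (amplify_shift \<sigma>0) \<tau>"
    interpret forms_mean "amplify A0" "amplify_shift \<sigma>0" \<l> Q \<tau>
      by (intro forms_mean.intro forms_axioms im)
    show "reach J x F \<epsilon> (max M2 (Max (F ` {..M2}))) B \<eta> 0"
      using 0 \<epsilon>
      by (intro reach_step[where ?M1.0 = 0 and \<eta>' = "\<eta> + 2 * (1 + B) / L", OF M2[OF im]])
        (auto simp: L_def le_max_iff_disj)
  qed
next
  case (Suc n)
  define \<eta>' where "\<eta>' = (\<eta> + \<epsilon> / 8) / 2"
  have \<eta>': "0 \<le> \<eta>'" "\<eta>' < \<epsilon> / 8" "0 < \<eta>' - \<eta>" using Suc.prems by (auto simp: \<eta>'_def)
  obtain M1 where M1: "\<And>\<tau>. invariant_mean (amplify A0) (amplify_shift \<sigma>0) \<tau> \<Longrightarrow>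
     forms_mean.reach (amplify A0) (amplify_shift \<sigma>0) \<l> Q \<tau> J x F \<epsilon> M1 (2 * B + 1) \<eta>' n"
    using Suc.IH[of "2 * B + 1" \<eta>'] Suc.prems \<eta>' by auto
  define L where "L = max (max M1 1) (nat \<lceil>2 * (1 + B) / (\<eta>' - \<eta>)\<rceil>)"
  have "2 * (1 + B) / (\<eta>' - \<eta>) \<le> L" unfolding L_def by linarith
  then have L: "0 < L" "M1 \<le> L" "\<eta> + 2 * (1 + B) / L \<le> \<eta>'"
    using \<eta>'(3) by (auto simp: L_def field_simps)
  obtain M2 where M2: "\<And>\<tau>. invariant_mean (amplify A0) (amplify_shift \<sigma>0) \<tau> \<Longrightarrow>
     forms_mean.ensemble_stable (amplify A0) (amplify_shift \<sigma>0) \<l> Q \<tau> J (\<epsilon> / 8 / B) F L M2"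
    using ensemble_stable_of_metastable[OF assms(1), of "\<epsilon> / 8 / B" F L] Suc.prems \<epsilon> by auto
  define M where "M = max M1 (max M2 (Max (F ` {..M2})))"
  show ?case
  proof (intro exI[of _ M] allI impI)
    fix \<tau> assume im: "invariant_mean (amplify A0) (amplify_shift \<sigma>0) \<tau>"
    interpret forms_mean "amplify A0" "amplify_shift \<sigma>0" \<l> Q \<tau>
      by (intro forms_mean.intro forms_axioms im)
    show "reach J x F \<epsilon> M B \<eta> (Suc n)"
      using Suc.prems \<epsilon> L M1[OF im]
      by (intro reach_step[where ?M1.0 = M1 and \<eta>' = \<eta>', OF M2[OF im]])
        (auto simp: M_def le_max_iff_disj)
  qed
qed

lemma metastable_insert:
  assumes "metastable J" "finite J" "x \<notin> J"
  shows "metastable (insert x J)"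
  unfolding metastable_def
proof (intro allI impI)
  fix \<epsilon>0 :: real and F assume \<epsilon>0: "0 < \<epsilon>0"
  define \<epsilon> where "\<epsilon> = min \<epsilon>0 1"
  have \<epsilon>: "0 < \<epsilon>" "\<epsilon> \<le> 1" "\<epsilon> \<le> \<epsilon>0" using \<epsilon>0 by (auto simp: \<epsilon>_def)
  have "0 < (\<epsilon>\<^sup>2 / 16)\<^sup>2" using \<epsilon> by simp
  \<comment> \<open>The decrement starts from \<open>D = 0\<close>, where the energy is at most
    \<open>1\<close>; this budget covers all of it.\<close>
  then obtain n where n: "1 < real n * (\<epsilon>\<^sup>2 / 16)\<^sup>2" using ex_less_of_nat_mult by blast
  obtain M where M: "\<And>\<tau>. invariant_mean (amplify A0) (amplify_shift \<sigma>0) \<tau> \<Longrightarrow>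
     forms_mean.reach (amplify A0) (amplify_shift \<sigma>0) \<l> Q \<tau> J x F \<epsilon> M 1 0 n"
    using reach_exists[OF assms(1) \<epsilon>(1,2), of 1 0 x F n] \<epsilon> by auto
  show "\<exists>M. \<forall>\<tau> f. invariant_mean (amplify A0) (amplify_shift \<sigma>0) \<tau> \<longrightarrow> (\<forall>j\<in>insert x J. unit_bdd (f j)) \<longrightarrow>
     (\<exists>N\<le>M. \<forall>W W'. admissible F N W W' \<longrightarrow>
        invariant_mean.nrm \<tau> (\<lambda>w. folner_avg (insert x J) W f w - folner_avg (insert x J) W' f w) \<le> \<epsilon>0)"
  proof (rule exI[of _ M], intro allI impI)
    fix \<tau> f assume im: "invariant_mean (amplify A0) (amplify_shift \<sigma>0) \<tau>" and f: "\<forall>j\<in>insert x J. unit_bdd (f j)"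
    interpret forms_mean "amplify A0" "amplify_shift \<sigma>0" \<l> Q \<tau>
      by (intro forms_mean.intro forms_axioms im)
    have fx: "nrm (f x) \<le> 1" using f by (intro nrm_le_bdd unit_bddD) auto
    then have "(nrm (f x))\<^sup>2 \<le> 1" using f by (intro power_le_one nrm_ge_0 unit_bddD(1)) auto
    then have "\<exists>N\<le>M. \<forall>W W'. admissible F N W W' \<longrightarrow>
        nrm (\<lambda>w. folner_avg_last J x W f (f x) w - folner_avg_last J x W' f (f x) w) \<le> \<epsilon>"
      using f fx n by (intro M[OF im, unfolded reach_def, rule_format, of f "\<lambda>w. 0"] structured_zero)
        (auto intro: A_intros)
    then show "\<exists>N\<le>M. \<forall>W W'. admissible F N W W' \<longrightarrow>
        nrm (\<lambda>w. folner_avg (insert x J) W f w - folner_avg (insert x J) W' f w) \<le> \<epsilon>0"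
      unfolding folner_avg_insert[OF assms(2,3)] using \<epsilon>(3) by (meson order_trans)
  qed
qed

lemma metastable_empty: "metastable {}"
  unfolding metastable_def
proof (intro allI impI, rule exI[of _ 0], intro allI impI)
  fix \<epsilon> :: real and F \<tau> and f :: "'j \<Rightarrow> 'w \<times> nat \<Rightarrow> complex"
  assume \<epsilon>: "0 < \<epsilon>" and im: "invariant_mean (amplify A0) (amplify_shift \<sigma>0) \<tau>"
  then interpret m: invariant_mean "amplify A0" "amplify_shift \<sigma>0" \<tau> by blast
  have "folner_avg {} W f = (\<lambda>w. 1)" if "folner Q N W" for N W
    using folner_card_pos[OF that] by (simp add: folner_avg_def)
  then show "\<exists>N\<le>0. \<forall>W W'. admissible F N W W' \<longrightarrow> m.nrm (\<lambda>w. folner_avg {} W f w - folner_avg {} W' f w) \<le> \<epsilon>"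
    using \<epsilon> by (auto simp: admissible_def m.nrm_zero)
qed

lemma metastable_finite: "finite J \<Longrightarrow> metastable J"
  by (induction J rule: finite_induct) (auto intro: metastable_empty metastable_insert)

text \<open>If the claim failed, there would be a bad pair of sets for every \<open>N\<close>. With
  \<open>F N\<close> so large that \<open>Q (F N)\<close> contains the pair chosen for
  \<open>N\<close>, metastability for this \<open>F\<close> is violated.\<close>

theorem folner_avg_uniformly_Cauchy:
  assumes im: "invariant_mean (amplify A0) (amplify_shift \<sigma>0) \<tau>" and J: "finite J"
    and f: "\<And>j. j \<in> J \<Longrightarrow> unit_bdd (f j)" and \<epsilon>: "0 < \<epsilon>"
  shows "\<exists>N. \<forall>W W'. folner Q N W \<longrightarrow> folner Q N W' \<longrightarrow> W \<subseteq> (\<Union>n. Q n) \<longrightarrow> W' \<subseteq> (\<Union>n. Q n) \<longrightarrow>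
    invariant_mean.nrm \<tau> (\<lambda>w. folner_avg J W f w - folner_avg J W' f w) \<le> \<epsilon>"
proof (rule ccontr)
  assume neg: "\<not> ?thesis"
  define bad where "bad N W W' \<longleftrightarrow> folner Q N W \<and> folner Q N W' \<and> W \<subseteq> (\<Union>n. Q n) \<and> W' \<subseteq> (\<Union>n. Q n) \<and>
    \<not> invariant_mean.nrm \<tau> (\<lambda>w. folner_avg J W f w - folner_avg J W' f w) \<le> \<epsilon>" for N W W'
  have "\<forall>N. \<exists>W W'. bad N W W'" using neg unfolding bad_def by blast
  then obtain W W' where W: "\<And>N. bad N (W N) (W' N)" by metis
  have cover: "\<exists>m. V \<subseteq> Q m" if "finite V" "V \<subseteq> (\<Union>n. Q n)" for V
    using that
  proof (induction V rule: finite_induct)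
    case (insert v V)
    then obtain m m' where "v \<in> Q m" "V \<subseteq> Q m'" by auto
    then have "insert v V \<subseteq> Q (max m m')"
      using monoD[OF mono_Q, of m "max m m'"] monoD[OF mono_Q, of m' "max m m'"] by auto
    then show ?case by blast
  qed simp
  have "finite (W N \<union> W' N)" "W N \<union> W' N \<subseteq> (\<Union>n. Q n)" for N
    using W[of N] unfolding bad_def folner_def by blast+
  then have "\<exists>m. W N \<union> W' N \<subseteq> Q m" for N by (rule cover)
  then obtain F where F: "\<And>N. W N \<union> W' N \<subseteq> Q (F N)" by metis
  obtain M where "\<And>\<tau> f. invariant_mean (amplify A0) (amplify_shift \<sigma>0) \<tau> \<Longrightarrow> \<forall>j\<in>J. unit_bdd (f j) \<Longrightarrow>
     \<exists>N\<le>M. \<forall>W W'. admissible F N W W' \<longrightarrow>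
        invariant_mean.nrm \<tau> (\<lambda>w. folner_avg J W f w - folner_avg J W' f w) \<le> \<epsilon>"
    using metastable_finite[OF J, unfolded metastable_def, rule_format, OF \<epsilon>, of F] by blast
  from this[OF im, of f] f obtain N where "\<And>V V'. admissible F N V V' \<Longrightarrow> invariant_mean.nrm \<tau> (\<lambda>w. folner_avg J V f w - folner_avg J V' f w) \<le> \<epsilon>"
    by auto
  moreover have "admissible F N (W N) (W' N)" using W[of N] F[of N] by (auto simp: admissible_def bad_def)
  ultimately show False using W[of N] unfolding bad_def by blast
qed

end

section \<open>Cubic averages and uniformity seminorms\<close>

definition cform :: "nat set \<Rightarrow> (nat \<Rightarrow> int) \<Rightarrow> int" where
  "cform \<omega> h = (\<Sum>i\<in>\<omega>. h i)"

definition box :: "nat \<Rightarrow> nat \<Rightarrow> (nat \<Rightarrow> int) set" where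
  "box k N = {h. (\<forall>i<k. \<bar>h i\<bar> \<le> int N) \<and> (\<forall>i\<ge>k. h i = 0)}"

text \<open>The lattice of rank \<open>k\<close> is the group of integer sequences vanishing from
  \<open>k\<close> on; one type for all ranks permits induction on \<open>k\<close>.\<close>

definition lattice_folner :: "nat \<Rightarrow> nat \<Rightarrow> (nat \<Rightarrow> int) set \<Rightarrow> bool" where
  "lattice_folner k N W \<longleftrightarrow> folner (box k) N W \<and> (\<forall>h\<in>W. \<forall>i\<ge>k. h i = 0)"

lemma cform_add: "cform \<omega> (g + h) = cform \<omega> g + cform \<omega> h"
  by (simp add: cform_def sum.distrib)

lemma mono_box: "mono (box k)"
  by (rule monoI) (auto simp: box_def intro: order_trans)

lemma Union_box: "(\<Union>n. box k n) = {h. \<forall>i\<ge>k. h i = 0}"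
proof (intro equalityI subsetI)
  fix h :: "nat \<Rightarrow> int" assume h: "h \<in> {h. \<forall>i\<ge>k. h i = 0}"
  have "\<bar>h i\<bar> \<le> int (nat (\<Sum>i<k. \<bar>h i\<bar>))" if "i < k" for i
    using member_le_sum[of i "{..<k}" "\<lambda>i. \<bar>h i\<bar>"] that by (simp add: sum_nonneg)
  then have "h \<in> box k (nat (\<Sum>i<k. \<bar>h i\<bar>))" using h by (simp add: box_def)
  then show "h \<in> (\<Union>n. box k n)" by blast
qed (auto simp: box_def)

lemma lattice_folner_antimono: "N \<le> N' \<Longrightarrow> lattice_folner k N' W \<Longrightarrow> lattice_folner k N W"
  unfolding lattice_folner_def using folner_antimono[OF mono_box] by blast

lemma lattice_folner_zero: "lattice_folner 0 N {0}"
proof -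
  have "box 0 N = {0}" by (auto simp: box_def fun_eq_iff)
  then show ?thesis by (simp add: lattice_folner_def folner_def)
qed

section \<open>Folner sets of product form\<close>

definition prism :: "nat \<Rightarrow> (nat \<Rightarrow> int) set \<Rightarrow> int set \<Rightarrow> (nat \<Rightarrow> int) set" where
  "prism k W I = (\<lambda>(h, t). h(k := t)) ` (W \<times> I)"

lemma inj_on_prism:
  fixes k :: nat
  assumes "\<forall>h\<in>W. \<forall>i\<ge>k. h i = 0" shows "inj_on (\<lambda>(h, t). h(k := t :: int)) (W \<times> I)"
proof (rule inj_onI, clarsimp)
  fix h t h' t' assume h: "h \<in> W" "h' \<in> W" "h(k := t) = h'(k := t' :: int)"
  have "h i = h' i" for i
  proof (cases "i = k")
    case True
    then show ?thesis using assms h(1,2) by (metis order_refl)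
  next
    case False
    then show ?thesis using fun_cong[OF h(3), of i] by simp
  qed
  then show "h = h' \<and> t = t'" using fun_cong[OF h(3), of k] by auto
qed

text \<open>The points leaving a product lie over points leaving \<open>W\<close> or over points
  leaving the interval; the two factors \<open>2\<close> allot half of the permitted boundary to
  each. The position \<open>a\<close> is free, which later gives uniformity over all
  windows.\<close>

lemma lattice_folner_prism:
  assumes W: "lattice_folner k N' W" and N': "2 * N \<le> N'" and H: "2 * N\<^sup>2 \<le> H" "0 < H"
  shows "lattice_folner (Suc k) N (prism k W {a..<a + int H})"
proof -
  define I where "I = {a..<a + int H}"
  have cI: "card I = H" "finite I" "I \<noteq> {}" using H by (auto simp: I_def)
  have fW: "finite W" "W \<noteq> {}" and W0: "\<forall>h\<in>W. \<forall>i\<ge>k. h i = 0"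
    using W by (auto simp: lattice_folner_def folner_def)
  have cP: "card (prism k W I) = card W * H"
    unfolding prism_def using inj_on_prism[OF W0] cI by (simp add: card_image card_cartesian_product)
  have "N * card ((\<lambda>m. m + l) ` prism k W I - prism k W I) \<le> card (prism k W I)" if l: "l \<in> box (Suc k) N" for l
  proof -
    define l0 where "l0 = l(k := 0)"
    define s where "s = l k"
    have "l0 \<in> box k N" using l by (auto simp: box_def l0_def)
    moreover have "box k N \<subseteq> box k N'" using monoD[OF mono_box, of N N'] N' by simp
    ultimately have l0: "N' * card ((\<lambda>m. m + l0) ` W - W) \<le> card W"
      using W by (auto simp: lattice_folner_def folner_def)
    have s: "\<bar>s\<bar> \<le> int N" using l by (auto simp: box_def s_def)
    define X where "X = (\<lambda>m. m + l0) ` W - W"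
    define Y where "Y = (\<lambda>t. t + s) ` I - I"
    have fX: "finite X" "finite Y" using fW cI by (auto simp: X_def Y_def)
    have cY: "card Y \<le> N"
    proof -
      have "Y \<subseteq> {a + s..<a} \<union> {a + int H..<a + int H + s}" by (auto simp: Y_def I_def)
      then have "card Y \<le> card ({a + s..<a} \<union> {a + int H..<a + int H + s})" by (intro card_mono) auto
      also have "\<dots> \<le> nat (- s) + nat s" by (rule order_trans[OF card_Un_le]) simp
      also have "\<dots> \<le> N" using s by linarith
      finally show ?thesis .
    qed
    have "(\<lambda>m. m + l) ` prism k W I - prism k W I \<subseteq> (\<lambda>(h, t). h(k := t)) ` (X \<times> (\<lambda>t. t + s) ` I \<union> W \<times> Y)"
    proof
      fix g assume g: "g \<in> (\<lambda>m. m + l) ` prism k W I - prism k W I"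
      then obtain h t where h: "h \<in> W" "t \<in> I" "g = h(k := t) + l" by (auto simp: prism_def)
      have g2: "g = (h + l0)(k := t + s)" using h by (auto simp: fun_eq_iff l0_def s_def)
      show "g \<in> (\<lambda>(h, t). h(k := t)) ` (X \<times> (\<lambda>t. t + s) ` I \<union> W \<times> Y)"
      proof (cases "h + l0 \<in> W")
        case True
        have "t + s \<notin> I"
        proof
          assume "t + s \<in> I"
          then have "g \<in> prism k W I" unfolding prism_def using True g2
            by (intro image_eqI[of _ _ "(h + l0, t + s)"]) auto
          then show False using g by blast
        qed
        then have "(h + l0, t + s) \<in> W \<times> Y" using True h by (auto simp: Y_def)
        then show ?thesis using g2 by (intro image_eqI[of _ _ "(h + l0, t + s)"]) auto
      next
        case False
        then have "(h + l0, t + s) \<in> X \<times> (\<lambda>t. t + s) ` I" using h by (auto simp: X_def)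
        then show ?thesis using g2 by (intro image_eqI[of _ _ "(h + l0, t + s)"]) auto
      qed
    qed
    then have "card ((\<lambda>m. m + l) ` prism k W I - prism k W I) \<le> card (X \<times> (\<lambda>t. t + s) ` I \<union> W \<times> Y)"
      using fX fW cI by (intro order_trans[OF card_mono card_image_le]) auto
    also have "\<dots> \<le> card X * H + card W * card Y"
      by (rule order_trans[OF card_Un_le]) (simp add: card_cartesian_product card_image inj_on_def cI)
    also have "\<dots> \<le> card X * H + card W * N" using cY by simp
    finally have "2 * N * card ((\<lambda>m. m + l) ` prism k W I - prism k W I) \<le> 2 * N * (card X * H + card W * N)"
      by (rule mult_le_mono2)
    also have "\<dots> = (2 * N * card X) * H + card W * (2 * N\<^sup>2)" by (simp add: algebra_simps power2_eq_square)
    also have "\<dots> \<le> card W * H + card W * H"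
    proof (intro add_mono mult_le_mono le_refl H(1))
      show "2 * N * card X \<le> card W" using l0 N' mult_le_mono1[of "2 * N" N' "card X"] unfolding X_def by linarith
    qed
    finally show ?thesis unfolding cP by simp
  qed
  then show ?thesis unfolding lattice_folner_def folner_def I_def[symmetric]
    using fW cI W0 by (auto simp: prism_def)
qed

lemma lattice_folner_exists: "\<exists>W. lattice_folner k N W"
proof (induction k arbitrary: N)
  case 0
  then show ?case using lattice_folner_zero by blast
next
  case (Suc k)
  obtain W where "lattice_folner k (2 * N) W" using Suc by blast
  then have "lattice_folner (Suc k) N (prism k W {0..<0 + int (2 * N\<^sup>2 + 1)})"
    by (rule lattice_folner_prism) auto
  then show ?case by blast
qed

lemma Pow_lessThan_Suc: "Pow {..<Suc k} = Pow {..<k} \<union> insert k ` Pow {..<k}"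
  by (simp add: lessThan_Suc Pow_insert)

section \<open>Cubes and dual cubes\<close>

context shift_algebra
begin

definition cube :: "nat \<Rightarrow> (nat \<Rightarrow> int) \<Rightarrow> ('w \<Rightarrow> complex) \<Rightarrow> 'w \<Rightarrow> complex" where
  "cube k h u = (\<lambda>w. \<Prod>\<omega>\<in>Pow {..<k}. S (cform \<omega> h) u w)"

text \<open>The empty vertex carries no shift; with it removed, the cube average becomes an inner
  product with \<open>u\<close>.\<close>

definition dual_cube :: "nat \<Rightarrow> (nat \<Rightarrow> int) set \<Rightarrow> ('w \<Rightarrow> complex) \<Rightarrow> 'w \<Rightarrow> complex" where
  "dual_cube k W u = (\<lambda>w. (\<Sum>h\<in>W. \<Prod>\<omega>\<in>Pow {..<k} - {{}}. S (cform \<omega> h) u w) / of_nat (card W))"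

text \<open>Real values spare the alternating conjugations of the cube. Complex functions return in
  \<open>null_weights_Suc\<close> through their real and imaginary parts.\<close>

definition real_bdd :: "('w \<Rightarrow> complex) \<Rightarrow> bool" where
  "real_bdd u \<longleftrightarrow> unit_bdd u \<and> (\<forall>w. Im (u w) = 0)"

lemma real_bddD: "real_bdd u \<Longrightarrow> unit_bdd u" "real_bdd u \<Longrightarrow> u \<in> A" "real_bdd u \<Longrightarrow> cnj (u w) = u w"
  by (auto simp: real_bdd_def complex_eq_iff intro: unit_bddD)

lemma real_bdd_S: "real_bdd u \<Longrightarrow> real_bdd (S m u)"
  unfolding real_bdd_def by (auto simp: unit_bdd_S) (simp add: S_def)

lemma real_bdd_mult: "real_bdd u \<Longrightarrow> real_bdd v \<Longrightarrow> real_bdd (\<lambda>w. u w * v w)"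
  unfolding real_bdd_def by (auto simp: unit_bdd_mult)

lemma cube_A: "u \<in> A \<Longrightarrow> cube k h u \<in> A"
  unfolding cube_def by (intro A_intros)

lemma dual_cube_A: "u \<in> A \<Longrightarrow> dual_cube k W u \<in> A"
  unfolding dual_cube_def by (intro A_intros)

lemma cube_S: "cube k h (S m u) = S m (cube k h u)"
  by (simp add: cube_def S_simps add.commute)

lemma cube_0: "cube 0 h u = u"
  by (simp add: cube_def cform_def)

text \<open>The vertices that contain \<open>k\<close> form a copy of those that do not, shifted by
  \<open>t\<close>.\<close>

lemma cube_Suc: "cube (Suc k) (h(k := t)) u = cube k h (\<lambda>w. u w * S t u w)"
proof
  fix w
  have fin: "finite \<omega>" "k \<notin> \<omega>" if "\<omega> \<in> Pow {..<k}" for \<omega> using that by (auto intro: finite_subset)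
  have c1: "cform \<omega> (h(k := t)) = cform \<omega> h" if "\<omega> \<in> Pow {..<k}" for \<omega>
    unfolding cform_def using fin[OF that] by (intro sum.cong) auto
  have c2: "cform (insert k \<omega>) (h(k := t)) = t + cform \<omega> h" if "\<omega> \<in> Pow {..<k}" for \<omega>
    using c1[OF that] fin[OF that] by (simp add: cform_def)
  have inj: "inj_on (insert k) (Pow {..<k})"
    by (intro inj_onI) (metis fin(2) insert_ident)
  have "(\<Prod>\<omega>\<in>Pow {..<Suc k}. S (cform \<omega> (h(k := t))) u w) =
    (\<Prod>\<omega>\<in>Pow {..<k}. S (cform \<omega> (h(k := t))) u w) * (\<Prod>\<omega>\<in>insert k ` Pow {..<k}. S (cform \<omega> (h(k := t))) u w)"
    unfolding Pow_lessThan_Suc by (rule prod.union_disjoint) auto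
  also have "\<dots> = (\<Prod>\<omega>\<in>Pow {..<k}. S (cform \<omega> h) u w) * (\<Prod>\<omega>\<in>Pow {..<k}. S (t + cform \<omega> h) u w)"
    unfolding prod.reindex[OF inj] comp_def by (intro arg_cong2[where f = "(*)"] prod.cong refl) (simp_all add: c1 c2)
  finally show "cube (Suc k) (h(k := t)) u w = cube k h (\<lambda>w. u w * S t u w) w"
    by (simp add: cube_def S_simps prod.distrib add.commute)
qed

end

text \<open>Convergence of dual cubes along all Folner sets is an assumption here;
  \<open>cubic_mean_amplify\<close> derives it from Walsh's theorem for every mean on an amplified
  algebra.\<close>

locale cubic_mean = invariant_mean A \<sigma> \<tau>
  for A :: "('w \<Rightarrow> complex) set" and \<sigma> :: "int \<Rightarrow> 'w \<Rightarrow> 'w" and \<tau> :: "('w \<Rightarrow> complex) \<Rightarrow> complex" +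
  assumes dual_cube_Cauchy: "real_bdd u \<Longrightarrow> 0 < \<epsilon> \<Longrightarrow> \<exists>N. \<forall>W W'. lattice_folner k N W \<longrightarrow> lattice_folner k N W' \<longrightarrow>
    nrm (\<lambda>w. dual_cube k W u w - dual_cube k W' u w) \<le> \<epsilon>"
begin

definition cube_avg :: "nat \<Rightarrow> (nat \<Rightarrow> int) set \<Rightarrow> ('w \<Rightarrow> complex) \<Rightarrow> real" where
  "cube_avg k W u = (\<Sum>h\<in>W. Re (\<tau> (cube k h u))) / card W"

lemma cube_avg_eq_ip:
  assumes u: "real_bdd u"
  shows "cube_avg k W u = Re (ip (dual_cube k W u) u)"
proof -
  have uA: "u \<in> A" by (rule real_bddD[OF u])
  have cube: "cube k h u = (\<lambda>w. (\<Prod>\<omega>\<in>Pow {..<k} - {{}}. S (cform \<omega> h) u w) * cnj (u w))" for h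
    using prod.remove[of "Pow {..<k}" "{}" "\<lambda>\<omega>. S (cform \<omega> h) u w" for w] real_bddD(3)[OF u]
    by (simp add: cube_def cform_def mult.commute)
  have "ip (dual_cube k W u) u = ip (\<lambda>w. inverse (of_nat (card W)) * (\<Sum>h\<in>W. \<Prod>\<omega>\<in>Pow {..<k} - {{}}. S (cform \<omega> h) u w)) u"
    by (simp add: dual_cube_def divide_inverse mult.commute)
  also have "\<dots> = inverse (of_nat (card W)) * (\<Sum>h\<in>W. ip (\<lambda>w. \<Prod>\<omega>\<in>Pow {..<k} - {{}}. S (cform \<omega> h) u w) u)"
    by (subst ip_scale_left) (auto intro!: A_intros uA ip_sum_left)
  also have "\<dots> = (\<Sum>h\<in>W. \<tau> (cube k h u)) / of_nat (card W)"
    unfolding cube by (simp add: ip_def divide_inverse mult.commute)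
  finally show ?thesis by (simp add: cube_avg_def Re_divide_of_nat)
qed

lemma cube_avg_Cauchy:
  assumes u: "real_bdd u" and \<epsilon>: "0 < \<epsilon>"
  shows "\<exists>N. \<forall>W W'. lattice_folner k N W \<longrightarrow> lattice_folner k N W' \<longrightarrow> \<bar>cube_avg k W u - cube_avg k W' u\<bar> \<le> \<epsilon>"
proof -
  obtain N where N: "\<And>W W'. lattice_folner k N W \<Longrightarrow> lattice_folner k N W' \<Longrightarrow>
    nrm (\<lambda>w. dual_cube k W u w - dual_cube k W' u w) \<le> \<epsilon>"
    using dual_cube_Cauchy[OF u \<epsilon>] by blast
  have uA: "u \<in> A" by (rule real_bddD[OF u])
  show ?thesis
  proof (intro exI[of _ N] allI impI)
    fix W W' assume W: "lattice_folner k N W" "lattice_folner k N W'"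
    let ?d = "\<lambda>w. dual_cube k W u w - dual_cube k W' u w"
    have dA: "?d \<in> A" by (intro A_intros dual_cube_A uA)
    have "cube_avg k W u - cube_avg k W' u = Re (ip ?d u)"
      using uA by (simp add: cube_avg_eq_ip[OF u] ip_diff_left dual_cube_A)
    also have "\<bar>\<dots>\<bar> \<le> nrm ?d * nrm u"
      using norm_ip_le[OF dA uA] abs_Re_le_cmod[of "ip ?d u"] by linarith
    also have "\<dots> \<le> nrm ?d * 1"
      using dA uA nrm_le_bdd[OF uA unit_bddD(2)[OF real_bddD(1)[OF u]]] by (intro mult_left_mono) auto
    also have "\<dots> \<le> \<epsilon>" using N[OF W] by simp
    finally show "\<bar>cube_avg k W u - cube_avg k W' u\<bar> \<le> \<epsilon>" .
  qed
qed

lemma cube_avg_limit_exists: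
  assumes u: "real_bdd u"
  shows "\<exists>x. \<forall>\<epsilon>>0. \<exists>N. \<forall>W. lattice_folner k N W \<longrightarrow> \<bar>cube_avg k W u - x\<bar> \<le> \<epsilon>"
proof -
  obtain V where V: "\<And>n. lattice_folner k n (V n)" using lattice_folner_exists by metis
  have Vm: "lattice_folner k N (V n)" if "N \<le> n" for N n by (rule lattice_folner_antimono[OF that V])
  have "Cauchy (\<lambda>n. cube_avg k (V n) u)"
  proof (rule metric_CauchyI)
    fix r :: real assume "0 < r"
    then obtain N where "\<And>W W'. lattice_folner k N W \<Longrightarrow> lattice_folner k N W' \<Longrightarrow> \<bar>cube_avg k W u - cube_avg k W' u\<bar> \<le> r / 2"
      using cube_avg_Cauchy[OF u, of "r / 2" k] by auto
    then have "\<forall>m\<ge>N. \<forall>n\<ge>N. \<bar>cube_avg k (V m) u - cube_avg k (V n) u\<bar> \<le> r / 2" using Vm by blast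
    then show "\<exists>M. \<forall>m\<ge>M. \<forall>n\<ge>M. dist (cube_avg k (V m) u) (cube_avg k (V n) u) < r"
      using \<open>0 < r\<close> by (intro exI[of _ N]) (force simp: dist_real_def)
  qed
  then obtain x where x: "(\<lambda>n. cube_avg k (V n) u) \<longlonglongrightarrow> x" using Cauchy_convergent convergent_def by blast
  have "\<exists>N. \<forall>W. lattice_folner k N W \<longrightarrow> \<bar>cube_avg k W u - x\<bar> \<le> \<epsilon>" if \<epsilon>: "0 < \<epsilon>" for \<epsilon>
  proof -
    obtain N where N: "\<And>W W'. lattice_folner k N W \<Longrightarrow> lattice_folner k N W' \<Longrightarrow> \<bar>cube_avg k W u - cube_avg k W' u\<bar> \<le> \<epsilon>"
      using cube_avg_Cauchy[OF u \<epsilon>] by blast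
    have "\<bar>cube_avg k W u - x\<bar> \<le> \<epsilon>" if W: "lattice_folner k N W" for W
    proof (rule LIMSEQ_le_const2[of "\<lambda>n. \<bar>cube_avg k W u - cube_avg k (V n) u\<bar>"])
      show "(\<lambda>n. \<bar>cube_avg k W u - cube_avg k (V n) u\<bar>) \<longlonglongrightarrow> \<bar>cube_avg k W u - x\<bar>"
        by (intro tendsto_intros x)
      show "\<exists>M. \<forall>n\<ge>M. \<bar>cube_avg k W u - cube_avg k (V n) u\<bar> \<le> \<epsilon>"
        using N[OF W Vm] by blast
    qed
    then show ?thesis by blast
  qed
  then show ?thesis by blast
qed

text \<open>For \<open>k \<ge> 1\<close> this is the Gowers-Host-Kra seminorm of order
  \<open>k\<close> raised to the power \<open>2^k\<close>, as a single limit over Folner sets of the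
  lattice instead of an iterated limit.\<close>

definition U :: "nat \<Rightarrow> ('w \<Rightarrow> complex) \<Rightarrow> real" where
  "U k u = (SOME x. \<forall>\<epsilon>>0. \<exists>N. \<forall>W. lattice_folner k N W \<longrightarrow> \<bar>cube_avg k W u - x\<bar> \<le> \<epsilon>)"

lemma U_approx:
  assumes "real_bdd u" "0 < \<epsilon>"
  obtains N where "\<And>W. lattice_folner k N W \<Longrightarrow> \<bar>cube_avg k W u - U k u\<bar> \<le> \<epsilon>"
  using someI_ex[OF cube_avg_limit_exists[OF assms(1)], of k, folded U_def] assms(2) by blast

lemma U_unique:
  assumes u: "real_bdd u" and x: "\<And>\<epsilon>. 0 < \<epsilon> \<Longrightarrow> \<exists>N. \<forall>W. lattice_folner k N W \<longrightarrow> \<bar>cube_avg k W u - x\<bar> \<le> \<epsilon>"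
  shows "U k u = x"
proof (rule ccontr)
  assume ne: "U k u \<noteq> x"
  define \<epsilon> where "\<epsilon> = \<bar>U k u - x\<bar> / 3"
  have \<epsilon>: "0 < \<epsilon>" using ne by (simp add: \<epsilon>_def)
  obtain N where N: "\<And>W. lattice_folner k N W \<Longrightarrow> \<bar>cube_avg k W u - x\<bar> \<le> \<epsilon>" using x[OF \<epsilon>] by blast
  obtain N' where N': "\<And>W. lattice_folner k N' W \<Longrightarrow> \<bar>cube_avg k W u - U k u\<bar> \<le> \<epsilon>"
    using U_approx[OF u \<epsilon>] by blast
  obtain W where "lattice_folner k (max N N') W" using lattice_folner_exists by blast
  then have "lattice_folner k N W" "lattice_folner k N' W" by (auto intro: lattice_folner_antimono[rotated])
  then have "\<bar>U k u - x\<bar> \<le> 2 * \<epsilon>" using N N' by (smt (verit))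
  then show False using \<epsilon> by (simp add: \<epsilon>_def)
qed

lemma U_0: assumes u: "real_bdd u" shows "U 0 u = Re (\<tau> u)"
proof (rule U_unique[OF u])
  fix \<epsilon> :: real assume \<epsilon>: "0 < \<epsilon>"
  have "cube_avg 0 W u = Re (\<tau> u)" if "lattice_folner 0 0 W" for W
    using that folner_card_pos[of "box 0" 0 W] by (simp add: cube_avg_def cube_0 lattice_folner_def)
  then show "\<exists>N. \<forall>W. lattice_folner 0 N W \<longrightarrow> \<bar>cube_avg 0 W u - Re (\<tau> u)\<bar> \<le> \<epsilon>" using \<epsilon> by (intro exI[of _ 0]) simp
qed

lemma U_S: "u \<in> A \<Longrightarrow> U k (S m u) = U k u"
  by (simp add: U_def cube_avg_def cube_S tau_S cube_A)

text \<open>The recursion of the seminorms, uniform in the position of the window. Both quantities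
  are compared with the cube average over a prism whose last side is the window.\<close>

lemma U_Suc:
  assumes u: "real_bdd u" and \<epsilon>: "0 < \<epsilon>"
  obtains H0 where "\<And>H a. H0 \<le> H \<Longrightarrow> 0 < H \<Longrightarrow>
    \<bar>(\<Sum>t\<in>{a..<a + int H}. U k (\<lambda>w. u w * S t u w)) / H - U (Suc k) u\<bar> \<le> \<epsilon>"
proof -
  have ut: "real_bdd (\<lambda>w. u w * S t u w)" for t using u by (intro real_bdd_mult real_bdd_S)
  have \<epsilon>2: "0 < \<epsilon> / 2" using \<epsilon> by simp
  obtain N where N: "\<And>W. lattice_folner (Suc k) N W \<Longrightarrow> \<bar>cube_avg (Suc k) W u - U (Suc k) u\<bar> \<le> \<epsilon> / 2"
    using U_approx[OF u \<epsilon>2] by blast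
  show ?thesis
  proof (rule that[of "2 * N\<^sup>2"])
    fix H :: nat and a assume H: "2 * N\<^sup>2 \<le> H" "0 < H"
    define I where "I = {a..<a + int H}"
    have "\<forall>t. \<exists>N. \<forall>W. lattice_folner k N W \<longrightarrow> \<bar>cube_avg k W (\<lambda>w. u w * S t u w) - U k (\<lambda>w. u w * S t u w)\<bar> \<le> \<epsilon> / 2"
      using U_approx[OF ut \<epsilon>2] by metis
    then obtain M where M: "\<And>t W. lattice_folner k (M t) W \<Longrightarrow>
      \<bar>cube_avg k W (\<lambda>w. u w * S t u w) - U k (\<lambda>w. u w * S t u w)\<bar> \<le> \<epsilon> / 2" by metis
    \<comment> \<open>The base may depend on the window: it has to be good for its finitely many
      \<open>t\<close> simultaneously, while the prism is only required to be good at the fixed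
      scale \<open>N\<close>.\<close>
    obtain W where W: "lattice_folner k (max (2 * N) (Max (M ` I))) W" using lattice_folner_exists by blast
    have cI: "card I = H" "finite I" using H by (auto simp: I_def)
    have W0: "\<forall>h\<in>W. \<forall>i\<ge>k. h i = 0" and cW: "0 < card W" "finite W"
      using W folner_card_pos by (auto simp: lattice_folner_def folner_def)
    have WM: "lattice_folner k (M t) W" if "t \<in> I" for t
      using that cI by (intro lattice_folner_antimono[OF _ W]) (simp add: le_max_iff_disj)
    have P: "lattice_folner (Suc k) N (prism k W I)" unfolding I_def
      using H by (intro lattice_folner_prism[OF W]) auto
    have "cube_avg (Suc k) (prism k W I) u = (\<Sum>t\<in>I. cube_avg k W (\<lambda>w. u w * S t u w)) / H"
    proof -
      have "(\<Sum>h\<in>prism k W I. Re (\<tau> (cube (Suc k) h u))) = (\<Sum>(h, t)\<in>W \<times> I. Re (\<tau> (cube (Suc k) (h(k := t)) u)))"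
        unfolding prism_def by (subst sum.reindex[OF inj_on_prism[OF W0]]) (simp add: case_prod_unfold)
      also have "\<dots> = (\<Sum>t\<in>I. \<Sum>h\<in>W. Re (\<tau> (cube k h (\<lambda>w. u w * S t u w))))"
        by (simp add: sum.cartesian_product[symmetric] cube_Suc sum.swap[of _ I])
      finally show ?thesis unfolding cube_avg_def prism_def using inj_on_prism[OF W0] cI
        by (simp add: card_image card_cartesian_product sum_divide_distrib[symmetric])
    qed
    moreover have "\<bar>(\<Sum>t\<in>I. cube_avg k W (\<lambda>w. u w * S t u w)) / H - (\<Sum>t\<in>I. U k (\<lambda>w. u w * S t u w)) / H\<bar> \<le> \<epsilon> / 2"
    proof -
      have "\<bar>(\<Sum>t\<in>I. cube_avg k W (\<lambda>w. u w * S t u w)) - (\<Sum>t\<in>I. U k (\<lambda>w. u w * S t u w))\<bar>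
        \<le> (\<Sum>t\<in>I. \<bar>cube_avg k W (\<lambda>w. u w * S t u w) - U k (\<lambda>w. u w * S t u w)\<bar>)"
        unfolding sum_subtractf[symmetric] by (rule sum_abs)
      also have "\<dots> \<le> H * (\<epsilon> / 2)" using sum_bounded_above[of I _ "\<epsilon> / 2"] M WM cI by auto
      finally show ?thesis using H by (simp add: diff_divide_distrib[symmetric] field_simps)
    qed
    ultimately show "\<bar>(\<Sum>t\<in>{a..<a + int H}. U k (\<lambda>w. u w * S t u w)) / H - U (Suc k) u\<bar> \<le> \<epsilon>"
      using N[OF P] unfolding I_def by linarith
  qed
qed

lemma nrm_mean_square:
  assumes "finite W" "W \<noteq> {}" "\<And>i. i \<in> W \<Longrightarrow> g i \<in> A"
  shows "(nrm (\<lambda>w. (\<Sum>i\<in>W. g i w) / of_nat (card W)))\<^sup>2 =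
     (\<Sum>i\<in>W. \<Sum>j\<in>W. Re (ip (g i) (g j))) / (card W)\<^sup>2"
proof -
  have sA: "(\<lambda>w. \<Sum>i\<in>W. g i w) \<in> A" using assms by (intro A_intros)
  have "nrm (\<lambda>w. (\<Sum>i\<in>W. g i w) / of_nat (card W)) = nrm (\<lambda>w. \<Sum>i\<in>W. g i w) / card W"
    using nrm_scale[OF sA, of "inverse (of_nat (card W))"] assms
    by (simp add: divide_inverse mult.commute norm_inverse)
  moreover have "(nrm (\<lambda>w. \<Sum>i\<in>W. g i w))\<^sup>2 = (\<Sum>i\<in>W. \<Sum>j\<in>W. Re (ip (g i) (g j)))"
    using sA assms by (simp add: nrm_square ip_sum_left ip_sum_right)
  ultimately show ?thesis by (simp add: power_divide)
qed

lemma sum_window_shift: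
  fixes b :: "int \<Rightarrow> real"
  shows "(\<Sum>s<H. b (int s + c)) = (\<Sum>t\<in>{c..<c + int H}. b t)"
  by (rule sum.reindex_bij_witness[of _ "\<lambda>t. nat (t - c)" "\<lambda>s. int s + c"]) auto

text \<open>For fixed \<open>i\<close> the differences \<open>j - i\<close> fill a window of length
  \<open>H\<close>. Thus the square is a mean of plain window averages, to which the uniformity of
  \<open>U_Suc\<close> applies, and no triangular weights appear.\<close>

lemma orbit_mean_square:
  assumes u: "real_bdd u" and H: "0 < H"
  shows "(nrm (\<lambda>w. (\<Sum>s<H. S (int s + c) u w) / of_nat H))\<^sup>2 =
     (\<Sum>s<H. (\<Sum>t\<in>{- int s..<- int s + int H}. Re (\<tau> (\<lambda>w. u w * S t u w))) / H) / H"
proof -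
  have uA: "u \<in> A" by (rule real_bddD[OF u])
  have ip: "ip (S (int j + c) u) (S (int i + c) u) = \<tau> (\<lambda>w. u w * S (int j - int i) u w)" for i j
  proof -
    have "S (int j + c) u = S (int i + c) (S (int j - int i) u)" unfolding S_S by (rule arg_cong[where f = "\<lambda>m. S m u"]) simp
    then have "ip (S (int j + c) u) (S (int i + c) u) = ip (S (int i + c) (S (int j - int i) u)) (S (int i + c) u)" by (simp only:)
    also have "\<dots> = ip (S (int j - int i) u) u" using uA by (intro ip_S S_A)
    finally show ?thesis using real_bddD(3)[OF u] by (simp add: ip_def mult.commute)
  qed
  have "(nrm (\<lambda>w. (\<Sum>s<H. S (int s + c) u w) / of_nat H))\<^sup>2 = (\<Sum>j<H. \<Sum>i<H. Re (ip (S (int j + c) u) (S (int i + c) u))) / H\<^sup>2"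
    using nrm_mean_square[of "{..<H}" "\<lambda>s. S (int s + c) u"] H uA
    by (simp add: S_A lessThan_empty_iff bot_nat_def)
  also have "\<dots> = (\<Sum>i<H. \<Sum>j<H. Re (\<tau> (\<lambda>w. u w * S (int j + - int i) u w))) / H\<^sup>2"
    unfolding ip by (subst sum.swap) simp
  also have "\<dots> = (\<Sum>i<H. \<Sum>t\<in>{- int i..<- int i + int H}. Re (\<tau> (\<lambda>w. u w * S t u w))) / H\<^sup>2"
    by (simp only: sum_window_shift[of "\<lambda>t. Re (\<tau> (\<lambda>w. u w * S t u w))"])
  finally show ?thesis by (simp add: sum_divide_distrib power2_eq_square)
qed

lemma mean_approx:
  fixes b :: "nat \<Rightarrow> real"
  assumes "\<And>s. s < H \<Longrightarrow> \<bar>b s - x\<bar> \<le> \<epsilon>" "0 < H"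
  shows "\<bar>(\<Sum>s<H. b s) / H - x\<bar> \<le> \<epsilon>"
proof -
  have "(\<Sum>s<H. b s) / H - x = (\<Sum>s<H. b s - x) / H" using assms(2) by (simp add: sum_subtractf field_simps)
  also have "\<bar>\<dots>\<bar> \<le> (\<Sum>s<H. \<bar>b s - x\<bar>) / H" by (simp add: divide_right_mono)
  also have "\<dots> \<le> (\<Sum>s<H. \<epsilon>) / H" using assms by (intro divide_right_mono sum_mono) auto
  finally show ?thesis using assms(2) by simp
qed

lemma orbit_mean_U1:
  assumes u: "real_bdd u" and \<epsilon>: "0 < \<epsilon>"
  obtains H0 where "\<And>H c. H0 \<le> H \<Longrightarrow> 0 < H \<Longrightarrow>
     \<bar>(nrm (\<lambda>w. (\<Sum>s<H. S (int s + c) u w) / of_nat H))\<^sup>2 - U 1 u\<bar> \<le> \<epsilon>"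
proof -
  have ut: "U 0 (\<lambda>w. u w * S t u w) = Re (\<tau> (\<lambda>w. u w * S t u w))" for t
    using u by (intro U_0 real_bdd_mult real_bdd_S)
  obtain H0 where H0: "\<And>H a. H0 \<le> H \<Longrightarrow> 0 < H \<Longrightarrow>
    \<bar>(\<Sum>t\<in>{a..<a + int H}. U 0 (\<lambda>w. u w * S t u w)) / H - U (Suc 0) u\<bar> \<le> \<epsilon>"
    using U_Suc[OF u \<epsilon>] by blast
  show ?thesis
  proof (rule that[of H0])
    fix H :: nat and c assume H: "H0 \<le> H" "0 < H"
    show "\<bar>(nrm (\<lambda>w. (\<Sum>s<H. S (int s + c) u w) / of_nat H))\<^sup>2 - U 1 u\<bar> \<le> \<epsilon>"
      unfolding orbit_mean_square[OF u H(2)] One_nat_def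
      by (rule mean_approx[OF H0[OF H, unfolded ut] H(2)])
  qed
qed

text \<open>At order \<open>1\<close> it is a limit of squared norms; at higher orders a limit of
  averages of values of lower order.\<close>

lemma U_nonneg: "real_bdd u \<Longrightarrow> 0 \<le> U (Suc k) u"
proof (induction k arbitrary: u)
  case 0
  show ?case
  proof (rule field_le_epsilon)
    fix \<epsilon> :: real assume "0 < \<epsilon>"
    then obtain H0 where "\<And>H c. H0 \<le> H \<Longrightarrow> 0 < H \<Longrightarrow>
       \<bar>(nrm (\<lambda>w. (\<Sum>s<H. S (int s + c) u w) / of_nat H))\<^sup>2 - U 1 u\<bar> \<le> \<epsilon>"
      using orbit_mean_U1[OF 0] by blast
    from this[of "Suc H0" 0] show "0 \<le> U (Suc 0) u + \<epsilon>"
      using zero_le_power2[of "nrm (\<lambda>w. (\<Sum>s<Suc H0. S (int s + 0) u w) / of_nat (Suc H0))"] by (simp only: One_nat_def) linarith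
  qed
next
  case (Suc k)
  show ?case
  proof (rule field_le_epsilon)
    fix \<epsilon> :: real assume "0 < \<epsilon>"
    then obtain H0 where H0: "\<And>H a. H0 \<le> H \<Longrightarrow> 0 < H \<Longrightarrow>
      \<bar>(\<Sum>t\<in>{a..<a + int H}. U (Suc k) (\<lambda>w. u w * S t u w)) / H - U (Suc (Suc k)) u\<bar> \<le> \<epsilon>"
      using U_Suc[OF Suc.prems] by blast
    have "0 \<le> (\<Sum>t\<in>{0..<0 + int (Suc H0)}. U (Suc k) (\<lambda>w. u w * S t u w)) / Suc H0"
      using Suc by (intro divide_nonneg_nonneg sum_nonneg Suc.IH real_bdd_mult real_bdd_S) auto
    then show "0 \<le> U (Suc (Suc k)) u + \<epsilon>" using H0[of "Suc H0" 0] by linarith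
  qed
qed

end

section \<open>Multiple averages are controlled by the uniformity seminorms\<close>

context shift_algebra
begin

definition linprod :: "nat \<Rightarrow> (nat \<Rightarrow> 'w \<Rightarrow> complex) \<Rightarrow> int \<Rightarrow> 'w \<Rightarrow> complex" where
  "linprod k f l = (\<lambda>w. \<Prod>j\<in>{1..k}. S (int j * l) (f j) w)"

definition lavg :: "complex \<Rightarrow> nat \<Rightarrow> (nat \<Rightarrow> 'w \<Rightarrow> complex) \<Rightarrow> nat \<Rightarrow> 'w \<Rightarrow> complex" where
  "lavg z k f L = (\<lambda>w. (\<Sum>l\<in>{1..L}. z ^ l * linprod k f (int l) w) / of_nat L)"

lemma linprod_A: "(\<And>j. j \<in> {1..k} \<Longrightarrow> f j \<in> A) \<Longrightarrow> linprod k f l \<in> A"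
  unfolding linprod_def by (intro A_intros) auto

lemma lavg_A: "(\<And>j. j \<in> {1..k} \<Longrightarrow> f j \<in> A) \<Longrightarrow> lavg z k f L \<in> A"
  unfolding lavg_def by (intro A_intros linprod_A) auto

lemma linprod_unit_bdd: "(\<And>j. j \<in> {1..k} \<Longrightarrow> unit_bdd (f j)) \<Longrightarrow> unit_bdd (linprod k f l)"
  unfolding linprod_def by (intro unit_bdd_prod unit_bdd_S) auto

lemma linprod_Suc: "linprod (Suc k) f l w = linprod k f l w * S (int (Suc k) * l) (f (Suc k)) w"
  by (simp add: linprod_def mult.commute)

text \<open>Taking a shift by \<open>l\<close> out of all factors freezes the first function and
  lowers every other speed by one; invariance of the mean then discards the common shift.\<close>

lemma linprod_first: "linprod (Suc k) f l w = S l (f 1) w * S l (linprod k (\<lambda>j. f (Suc j)) l) w"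
proof -
  have "linprod (Suc k) f l w = S (int 1 * l) (f 1) w * (\<Prod>j\<in>{2..Suc k}. S (int j * l) (f j) w)"
    unfolding linprod_def by (subst prod.atLeast_Suc_atMost) (auto simp: numeral_2_eq_2)
  also have "(\<Prod>j\<in>{2..Suc k}. S (int j * l) (f j) w) = (\<Prod>j\<in>{1..k}. S (int (Suc j) * l) (f (Suc j)) w)"
    by (rule prod.reindex_bij_witness[of _ Suc "\<lambda>j. j - 1"]) auto
  finally show ?thesis by (simp add: linprod_def S_simps algebra_simps)
qed

end

text \<open>Moving the window by one position exchanges a single term, at a cost of at most
  \<open>2\<close>.\<close>

lemma norm_sum_shift_le:
  fixes x :: "nat \<Rightarrow> complex"
  assumes "\<And>l. norm (x l) \<le> 1"
  shows "norm ((\<Sum>l\<in>{1..L}. x l) - (\<Sum>l\<in>{1..L}. x (l + h))) \<le> 2 * real h"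
proof (induction h)
  case (Suc h)
  have "(\<Sum>l\<in>{1..L}. x (l + h)) - (\<Sum>l\<in>{1..L}. x (l + Suc h)) = x (Suc h) - x (Suc (L + h))"
    by (induction L) (auto simp: algebra_simps)
  then have "norm ((\<Sum>l\<in>{1..L}. x (l + h)) - (\<Sum>l\<in>{1..L}. x (l + Suc h))) \<le> 2"
    using norm_triangle_ineq4[of "x (Suc h)" "x (Suc (L + h))"] assms[of "Suc h"] assms[of "Suc (L + h)"] by simp
  then have "norm (((\<Sum>l\<in>{1..L}. x l) - (\<Sum>l\<in>{1..L}. x (l + h))) + ((\<Sum>l\<in>{1..L}. x (l + h)) - (\<Sum>l\<in>{1..L}. x (l + Suc h)))) \<le> 2 * real h + 2"
    using Suc by (intro norm_triangle_le add_mono)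
  then show ?case by (simp add: algebra_simps)
qed simp

text \<open>Linearises the square root left by Cauchy-Schwarz, so that the estimates keep the form
  \<open>\<epsilon> + C * U\<close> required by the induction.\<close>

lemma le_of_square_le:
  fixes x \<epsilon> y :: real
  assumes "0 < \<epsilon>" "x\<^sup>2 \<le> \<epsilon>\<^sup>2 + y" "0 \<le> y"
  shows "x \<le> \<epsilon> + y / \<epsilon>"
proof (cases "x \<le> \<epsilon>")
  case True
  then show ?thesis using assms by (simp add: add_increasing2)
next
  case False
  then have "\<epsilon> * x \<le> x\<^sup>2" using assms by (simp add: power2_eq_square)
  then have "\<epsilon> * x \<le> \<epsilon> * (\<epsilon> + y / \<epsilon>)" using assms by (simp add: power2_eq_square algebra_simps)
  then show ?thesis using assms by (simp only: mult_le_cancel_left_pos)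
qed

context cubic_mean
begin

text \<open>\<open>C\<close> may depend on \<open>\<epsilon>\<close> but not on the functions; the
  decomposition can then make \<open>U\<close> small compared with
  \<open>\<epsilon> / C\<close>.\<close>

definition controlled :: "complex \<Rightarrow> nat \<Rightarrow> bool" where
  "controlled z k \<longleftrightarrow> (\<forall>\<epsilon>>0. \<exists>C\<ge>0. \<forall>f. (\<forall>j\<in>{1..k}. unit_bdd (f j)) \<longrightarrow> real_bdd (f k) \<longrightarrow>
     (\<forall>\<^sub>F L in sequentially. nrm (lavg z k f L) \<le> \<epsilon> + C * U k (f k)))"

lemma controlled_1: "controlled 1 1"
  unfolding controlled_def
proof (intro allI impI)
  fix \<epsilon> :: real assume \<epsilon>: "0 < \<epsilon>"
  show "\<exists>C\<ge>0. \<forall>f. (\<forall>j\<in>{1..1}. unit_bdd (f j)) \<longrightarrow> real_bdd (f 1) \<longrightarrow>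
     (\<forall>\<^sub>F L in sequentially. nrm (lavg 1 1 f L) \<le> \<epsilon> + C * U 1 (f 1))"
  proof (intro exI[of _ "1 / \<epsilon>"] conjI allI impI)
    fix f :: "nat \<Rightarrow> 'w \<Rightarrow> complex" assume u: "real_bdd (f 1)"
    obtain H0 where H0: "\<And>H c. H0 \<le> H \<Longrightarrow> 0 < H \<Longrightarrow>
       \<bar>(nrm (\<lambda>w. (\<Sum>s<H. S (int s + c) (f 1) w) / of_nat H))\<^sup>2 - U 1 (f 1)\<bar> \<le> \<epsilon>\<^sup>2"
      using orbit_mean_U1[OF u, of "\<epsilon>\<^sup>2"] \<epsilon> by auto
    have "nrm (lavg 1 1 f L) \<le> \<epsilon> + 1 / \<epsilon> * U 1 (f 1)" if "L \<ge> Suc H0" for L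
    proof -
      have "(\<Sum>l\<in>{1..L}. S (int l) (f 1) w) = (\<Sum>s<L. S (int s + 1) (f 1) w)" for w
        by (rule sum.reindex_bij_witness[of _ Suc "\<lambda>l. l - 1"]) (auto simp: add.commute of_nat_diff)
      then have "lavg 1 1 f L = (\<lambda>w. (\<Sum>s<L. S (int s + 1) (f 1) w) / of_nat L)"
        by (simp add: lavg_def linprod_def)
      then have "(nrm (lavg 1 1 f L))\<^sup>2 \<le> \<epsilon>\<^sup>2 + U 1 (f 1)" using H0[of L 1] that by auto
      moreover have "0 \<le> U 1 (f 1)" using U_nonneg[OF u, of 0] by simp
      ultimately show ?thesis using le_of_square_le[OF \<epsilon>] by simp
    qed
    then show "\<forall>\<^sub>F L in sequentially. nrm (lavg 1 1 f L) \<le> \<epsilon> + 1 / \<epsilon> * U 1 (f 1)"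
      using eventually_sequentially by blast
  qed (use \<epsilon> in auto)
qed

text \<open>The invariance of the mean removes the first function, so the
  averages on the right have one function less and no phase.\<close>

definition vdc_fun :: "(nat \<Rightarrow> 'w \<Rightarrow> complex) \<Rightarrow> nat \<Rightarrow> nat \<Rightarrow> nat \<Rightarrow> 'w \<Rightarrow> complex" where
  "vdc_fun f h h' j = (\<lambda>w. S (int j * int h) (f j) w * cnj (S (int j * int h') (f j) w))"

lemma vdc_correlation:
  assumes f: "\<And>j. j \<in> {1..Suc k} \<Longrightarrow> unit_bdd (f j)" and z: "norm z = 1" and L: "0 < L"
  shows "Re (\<Sum>l\<in>{1..L}. ip (\<lambda>w. z ^ (l + h) * linprod (Suc k) f (int (l + h)) w) (\<lambda>w. z ^ (l + h') * linprod (Suc k) f (int (l + h')) w)) / L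
    \<le> nrm (lavg 1 k (\<lambda>j. vdc_fun f h h' (Suc j)) L)"
proof -
  let ?G = "vdc_fun f h h'"
  have G: "unit_bdd (?G j)" if "j \<in> {1..Suc k}" for j
    unfolding vdc_fun_def using f that by (intro unit_bdd_mult unit_bdd_cnj unit_bdd_S) auto
  have lA: "linprod (Suc k) f l \<in> A" for l using f by (intro linprod_A unit_bddD(1)) auto
  have pA: "linprod k (\<lambda>j. ?G (Suc j)) l \<in> A" for l using G by (intro linprod_A unit_bddD(1)) auto
  have G1: "?G 1 \<in> A" "\<And>w. norm (?G 1 w) \<le> 1" using unit_bddD[OF G[of 1]] by auto
  \<comment> \<open>The phases of the two factors combine to a constant free of \<open>l\<close>,
    which is why the phase is gone after one application of van der Corput.\<close>
  define c where "c = z ^ h * cnj z ^ h'"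
  have nc: "norm c = 1" using z by (simp add: c_def norm_mult norm_power)
  have zz: "z ^ l * cnj z ^ l = 1" for l
    using z by (metis complex_norm_square of_real_1 one_power2 power_mult_distrib power_one)
  have ip: "ip (\<lambda>w. z ^ (l + h) * linprod (Suc k) f (int (l + h)) w) (\<lambda>w. z ^ (l + h') * linprod (Suc k) f (int (l + h')) w)
     = c * \<tau> (\<lambda>w. ?G 1 w * linprod k (\<lambda>j. ?G (Suc j)) (int l) w)" for l
  proof -
    have "ip (\<lambda>w. z ^ (l + h) * linprod (Suc k) f (int (l + h)) w) (\<lambda>w. z ^ (l + h') * linprod (Suc k) f (int (l + h')) w)
      = (z ^ l * cnj z ^ l) * c * ip (linprod (Suc k) f (int (l + h))) (linprod (Suc k) f (int (l + h')))"
      by (simp add: ip_scale_left ip_scale_right scale_A lA c_def power_add mult_ac)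
    also have "\<dots> = c * \<tau> (linprod (Suc k) ?G (int l))"
    proof -
      have "linprod (Suc k) f (int (l + h)) w * cnj (linprod (Suc k) f (int (l + h')) w) = linprod (Suc k) ?G (int l) w" for w
        unfolding linprod_def by (simp add: prod.distrib[symmetric] vdc_fun_def S_simps distrib_left del: prod.cl_ivl_Suc)
      then show ?thesis by (simp add: zz ip_def)
    qed
    also have "\<tau> (linprod (Suc k) ?G (int l)) = \<tau> (S (int l) (\<lambda>w. ?G 1 w * linprod k (\<lambda>j. ?G (Suc j)) (int l) w))"
      by (rule arg_cong[where f = \<tau>]) (simp add: S_mult linprod_first fun_eq_iff)
    also have "\<dots> = \<tau> (\<lambda>w. ?G 1 w * linprod k (\<lambda>j. ?G (Suc j)) (int l) w)"
      by (intro tau_S A_intros pA G1)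
    finally show ?thesis .
  qed
  have "(\<Sum>l\<in>{1..L}. ip (\<lambda>w. z ^ (l + h) * linprod (Suc k) f (int (l + h)) w) (\<lambda>w. z ^ (l + h') * linprod (Suc k) f (int (l + h')) w))
    = c * of_nat L * \<tau> (\<lambda>w. ?G 1 w * lavg 1 k (\<lambda>j. ?G (Suc j)) L w)"
  proof -
    have "(\<Sum>l\<in>{1..L}. \<tau> (\<lambda>w. ?G 1 w * linprod k (\<lambda>j. ?G (Suc j)) (int l) w)) =
      \<tau> (\<lambda>w. \<Sum>l\<in>{1..L}. ?G 1 w * linprod k (\<lambda>j. ?G (Suc j)) (int l) w)"
      by (subst tau_sum) (auto intro!: A_intros pA G1[unfolded One_nat_def])
    also have "(\<lambda>w. \<Sum>l\<in>{1..L}. ?G 1 w * linprod k (\<lambda>j. ?G (Suc j)) (int l) w) =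
      (\<lambda>w. of_nat L * (?G 1 w * lavg 1 k (\<lambda>j. ?G (Suc j)) L w))"
      using L by (simp add: lavg_def sum_distrib_left[symmetric])
    also have "\<tau> \<dots> = of_nat L * \<tau> (\<lambda>w. ?G 1 w * lavg 1 k (\<lambda>j. ?G (Suc j)) L w)"
      using G by (intro tau_scale mult_A G1 lavg_A unit_bddD(1)) auto
    finally show ?thesis unfolding ip by (simp add: sum_distrib_left[symmetric])
  qed
  then have "Re (\<Sum>l\<in>{1..L}. ip (\<lambda>w. z ^ (l + h) * linprod (Suc k) f (int (l + h)) w) (\<lambda>w. z ^ (l + h') * linprod (Suc k) f (int (l + h')) w)) \<le>
     norm (c * of_nat L * \<tau> (\<lambda>w. ?G 1 w * lavg 1 k (\<lambda>j. ?G (Suc j)) L w))"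
    by (metis complex_Re_le_cmod)
  also have "\<dots> = L * norm (\<tau> (\<lambda>w. ?G 1 w * lavg 1 k (\<lambda>j. ?G (Suc j)) L w))"
    using nc by (simp add: norm_mult)
  also have "\<dots> \<le> L * nrm (lavg 1 k (\<lambda>j. ?G (Suc j)) L)"
  proof (rule mult_left_mono)
    have la: "lavg 1 k (\<lambda>j. ?G (Suc j)) L \<in> A" using G by (intro lavg_A unit_bddD(1)) auto
    have "norm (\<tau> (\<lambda>w. ?G 1 w * lavg 1 k (\<lambda>j. ?G (Suc j)) L w)) \<le> nrm (\<lambda>w. ?G 1 w * lavg 1 k (\<lambda>j. ?G (Suc j)) L w)"
      by (intro norm_tau_le mult_A G1 la)
    also have "\<dots> \<le> 1 * nrm (lavg 1 k (\<lambda>j. ?G (Suc j)) L)" by (intro nrm_mult_bdd G1 la)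
    finally show "norm (\<tau> (\<lambda>w. ?G 1 w * lavg 1 k (\<lambda>j. ?G (Suc j)) L w)) \<le> nrm (lavg 1 k (\<lambda>j. ?G (Suc j)) L)" by simp
  qed simp
  finally show ?thesis using L by (simp add: field_simps)
qed

text \<open>Replacing each term by its mean over a window of length \<open>H\<close> costs at most
  \<open>2 * H / L\<close>. Cauchy-Schwarz in \<open>l\<close> and the expanded square of the window
  mean leave the correlations indexed by \<open>h\<close> and \<open>h'\<close>.\<close>

lemma van_der_Corput:
  assumes f: "\<And>j. j \<in> {1..Suc k} \<Longrightarrow> unit_bdd (f j)" and z: "norm z = 1" and L: "0 < L" and H: "0 < H"
  shows "nrm (lavg z (Suc k) f L) \<le> 2 * real H / real L +
    sqrt ((\<Sum>h<H. \<Sum>h'<H. nrm (lavg 1 k (\<lambda>j. vdc_fun f h h' (Suc j)) L)) / (real H)\<^sup>2)"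
proof -
  define v where "v l w = z ^ l * linprod (Suc k) f (int l) w" for l w
  have v1: "unit_bdd (v l)" for l
    using linprod_unit_bdd[where l = "int l", OF f] z
    unfolding unit_bdd_def v_def[abs_def] by (auto simp: norm_mult norm_power intro: scale_A)
  have vA: "v l \<in> A" for l using v1 by (rule unit_bddD)
  define g where "g l w = (\<Sum>h<H. v (l + h) w) / of_nat H" for l w
  define B where "B w = (\<Sum>l\<in>{1..L}. g l w) / of_nat L" for w
  have gA: "g l \<in> A" for l unfolding g_def[abs_def] by (intro A_intros vA)
  have BA: "B \<in> A" unfolding B_def[abs_def] by (intro A_intros gA)
  have lA: "lavg z (Suc k) f L \<in> A" using f by (intro lavg_A unit_bddD(1)) auto
  have lv: "lavg z (Suc k) f L = (\<lambda>w. (\<Sum>l\<in>{1..L}. v l w) / of_nat L)" by (simp add: lavg_def v_def)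
  have "nrm (\<lambda>w. lavg z (Suc k) f L w - B w) \<le> 2 * real H / real L"
  proof (rule nrm_le_bdd)
    fix w
    have "(\<Sum>l\<in>{1..L}. v l w) - (\<Sum>l\<in>{1..L}. g l w) = (\<Sum>h<H. (\<Sum>l\<in>{1..L}. v l w) - (\<Sum>l\<in>{1..L}. v (l + h) w)) / of_nat H"
    proof -
      have "(\<Sum>l\<in>{1..L}. g l w) = (\<Sum>h<H. \<Sum>l\<in>{1..L}. v (l + h) w) / of_nat H"
        unfolding g_def sum_divide_distrib[symmetric] by (subst sum.swap) simp
      then show ?thesis using H by (simp add: sum_subtractf diff_divide_distrib)
    qed
    also have "norm \<dots> \<le> 2 * H"
    proof -
      have "norm (\<Sum>h<H. (\<Sum>l\<in>{1..L}. v l w) - (\<Sum>l\<in>{1..L}. v (l + h) w)) \<le> (\<Sum>h<H. 2 * real H)"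
      proof (rule sum_norm_le)
        fix h assume "h \<in> {..<H}"
        then show "norm ((\<Sum>l\<in>{1..L}. v l w) - (\<Sum>l\<in>{1..L}. v (l + h) w)) \<le> 2 * real H"
          using norm_sum_shift_le[of "\<lambda>l. v l w" L h] unit_bddD(2)[OF v1, of _ w] by (auto intro: order_trans)
      qed
      then show ?thesis using H by (simp add: norm_divide field_simps)
    qed
    finally show "norm (lavg z (Suc k) f L w - B w) \<le> 2 * real H / real L"
      using L by (simp add: lv B_def diff_divide_distrib[symmetric] norm_divide divide_right_mono)
  qed (intro A_intros lA BA)
  moreover have "nrm B \<le> sqrt ((\<Sum>h<H. \<Sum>h'<H. nrm (lavg 1 k (\<lambda>j. vdc_fun f h h' (Suc j)) L)) / (real H)\<^sup>2)"
  proof (rule real_le_rsqrt)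
    have "nrm B \<le> (\<Sum>l\<in>{1..L}. nrm (g l)) / L"
    proof -
      have "nrm B = nrm (\<lambda>w. \<Sum>l\<in>{1..L}. g l w) / L"
        using nrm_scale[of "\<lambda>w. \<Sum>l\<in>{1..L}. g l w" "inverse (of_nat L)"] gA
        by (simp add: B_def[abs_def] divide_inverse mult.commute norm_inverse sum_A)
      then show ?thesis using nrm_sum[of "{1..L}" g] gA by (simp add: divide_right_mono)
    qed
    then have "(nrm B)\<^sup>2 \<le> ((\<Sum>l\<in>{1..L}. nrm (g l)) / L)\<^sup>2" using BA by (intro power_mono) auto
    also have "\<dots> \<le> (\<Sum>l\<in>{1..L}. (nrm (g l))\<^sup>2) / L"
    proof -
      have "(\<Sum>l\<in>{1..L}. nrm (g l))\<^sup>2 \<le> (\<Sum>l\<in>{1..L}. (nrm (g l))\<^sup>2) * L"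
        using sum_squared_le_sum_of_squares[of "\<lambda>l. nrm (g l)" "{1..L}"] by simp
      then show ?thesis using L by (simp add: power_divide field_simps power2_eq_square)
    qed
    also have "(\<Sum>l\<in>{1..L}. (nrm (g l))\<^sup>2) = (\<Sum>l\<in>{1..L}. (\<Sum>h<H. \<Sum>h'<H. Re (ip (v (l + h)) (v (l + h')))) / (real H)\<^sup>2)"
      unfolding g_def using nrm_mean_square[of "{..<H}" "\<lambda>h. v (l + h)" for l] vA H
      by (simp add: lessThan_empty_iff bot_nat_def)
    also have "\<dots> / L = (\<Sum>h<H. \<Sum>h'<H. (\<Sum>l\<in>{1..L}. Re (ip (v (l + h)) (v (l + h')))) / L) / (real H)\<^sup>2"
    proof -
      have "(\<Sum>l\<in>{1..L}. \<Sum>h<H. \<Sum>h'<H. Re (ip (v (l + h)) (v (l + h')))) = (\<Sum>h<H. \<Sum>h'<H. \<Sum>l\<in>{1..L}. Re (ip (v (l + h)) (v (l + h'))))"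
        by (subst sum.swap, rule sum.cong[OF refl], rule sum.swap)
      then show ?thesis by (simp add: sum_divide_distrib[symmetric])
    qed
    also have "\<dots> \<le> (\<Sum>h<H. \<Sum>h'<H. nrm (lavg 1 k (\<lambda>j. vdc_fun f h h' (Suc j)) L)) / (real H)\<^sup>2"
      using vdc_correlation[of k f z L, OF f z L] by (intro divide_right_mono sum_mono) (auto simp: v_def[abs_def])
    finally show "(nrm B)\<^sup>2 \<le> (\<Sum>h<H. \<Sum>h'<H. nrm (lavg 1 k (\<lambda>j. vdc_fun f h h' (Suc j)) L)) / (real H)\<^sup>2" .
  qed
  moreover have "nrm (lavg z (Suc k) f L) \<le> nrm (\<lambda>w. lavg z (Suc k) f L w - B w) + nrm B"
    using nrm_triangle[of "\<lambda>w. lavg z (Suc k) f L w - B w" B] lA BA by (simp add: A_intros)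
  ultimately show ?thesis by linarith
qed

text \<open>Only differences that are multiples of \<open>c\<close> occur. Since \<open>U k\<close>
  is nonnegative they may be completed to all integers of a window of length \<open>c * H\<close>,
  which costs the factor \<open>c\<close>.\<close>

lemma sum_U_differences:
  assumes u: "real_bdd u" and \<epsilon>: "0 < \<epsilon>" and k: "0 < k" and c: "0 < c"
  obtains H where "0 < H" "(\<Sum>h<H. \<Sum>h'<H. U k (\<lambda>w. S (int c * int h) u w * S (int c * int h') u w)) / (real H)\<^sup>2 \<le> c * (U (Suc k) u + \<epsilon>)"
proof -
  obtain k' where k': "k = Suc k'" using k by (cases k) auto
  define a where "a t = U k (\<lambda>w. u w * S t u w)" for t
  have a0: "0 \<le> a t" for t unfolding a_def k' using u by (intro U_nonneg real_bdd_mult real_bdd_S)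
  have uA: "u \<in> A" by (rule real_bddD[OF u])
  obtain H0 where H0: "\<And>H b. H0 \<le> H \<Longrightarrow> 0 < H \<Longrightarrow> \<bar>(\<Sum>t\<in>{b..<b + int H}. a t) / H - U (Suc k) u\<bar> \<le> \<epsilon>"
    using U_Suc[OF u \<epsilon>, of k] unfolding a_def by blast
  define H where "H = Suc H0"
  have Hpos: "0 < H" by (simp add: H_def)
  have cH: "H0 \<le> c * H" "0 < c * H" using c by (cases c; simp add: H_def)+
  have eq: "U k (\<lambda>w. S (int c * int h) u w * S (int c * int h') u w) = a (int c * (int h - int h'))" for h h'
  proof -
    have "(\<lambda>w. S (int c * int h) u w * S (int c * int h') u w) = S (int c * int h') (\<lambda>w. u w * S (int c * (int h - int h')) u w)"
      by (simp add: S_mult algebra_simps)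
    then show ?thesis unfolding a_def using U_S[OF mult_A[OF uA S_A[OF uA]]] by simp
  qed
  have "(\<Sum>h<H. a (int c * (int h - int h'))) \<le> c * H * (U (Suc k) u + \<epsilon>)" for h'
  proof -
    define b where "b = - (int c * int h')"
    have "(\<Sum>h<H. a (int c * (int h - int h'))) = sum a ((\<lambda>h. int c * int h + b) ` {..<H})"
      using c by (subst sum.reindex) (auto simp: inj_on_def b_def algebra_simps)
    also have "\<dots> \<le> sum a {b..<b + int (c * H)}"
      using a0 c by (intro sum_mono2) auto
    also have "\<dots> \<le> c * H * (U (Suc k) u + \<epsilon>)"
      using H0[OF cH, of b] cH by (simp add: abs_le_iff field_simps del: of_nat_mult)
    finally show ?thesis .
  qed
  then have "(\<Sum>h'<H. \<Sum>h<H. a (int c * (int h - int h'))) \<le> (\<Sum>h'<H. c * H * (U (Suc k) u + \<epsilon>))"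
    by (intro sum_mono)
  then have "(\<Sum>h<H. \<Sum>h'<H. a (int c * (int h - int h'))) \<le> H * (c * H * (U (Suc k) u + \<epsilon>))"
    by (subst sum.swap) simp
  then have "(\<Sum>h<H. \<Sum>h'<H. a (int c * (int h - int h'))) / (real H)\<^sup>2 \<le> H * (c * H * (U (Suc k) u + \<epsilon>)) / (real H)\<^sup>2"
    by (rule divide_right_mono) simp
  also have "\<dots> = c * (U (Suc k) u + \<epsilon>)" using Hpos by (simp add: power2_eq_square)
  finally show ?thesis using that[OF Hpos] by (simp add: eq)
qed

lemma controlled_Suc:
  assumes ctrl: "controlled 1 k" and k: "0 < k" and z: "norm z = 1"
  shows "controlled z (Suc k)"
  unfolding controlled_def
proof (intro allI impI)
  fix \<epsilon> :: real assume \<epsilon>: "0 < \<epsilon>"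
  \<comment> \<open>It enters twice, through \<open>ev\<close> and through \<open>HU\<close>, and
    \<open>2 * \<epsilon>1 = (\<epsilon> / 2)\<^sup>2\<close>. The other half of
    \<open>\<epsilon>\<close> is spent on \<open>2 * H / L\<close>.\<close>
  define \<epsilon>1 where "\<epsilon>1 = \<epsilon>\<^sup>2 / 8"
  have \<epsilon>1: "0 < \<epsilon>1" using \<epsilon> by (simp add: \<epsilon>1_def)
  obtain C where C: "0 \<le> C" and ev: "\<And>f. (\<forall>j\<in>{1..k}. unit_bdd (f j)) \<Longrightarrow> real_bdd (f k) \<Longrightarrow>
     (\<forall>\<^sub>F L in sequentially. nrm (lavg 1 k f L) \<le> \<epsilon>1 + C * U k (f k))"
    using ctrl \<epsilon>1 unfolding controlled_def by blast
  \<comment> \<open>The speed of the last function: its shifts for \<open>h\<close> and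
    \<open>h'\<close> differ by a multiple of \<open>c\<close>.\<close>
  define c where "c = Suc k"
  define D where "D = C * real c"
  have D: "0 \<le> D" using C by (simp add: D_def)
  show "\<exists>C\<ge>0. \<forall>f. (\<forall>j\<in>{1..Suc k}. unit_bdd (f j)) \<longrightarrow> real_bdd (f (Suc k)) \<longrightarrow>
     (\<forall>\<^sub>F L in sequentially. nrm (lavg z (Suc k) f L) \<le> \<epsilon> + C * U (Suc k) (f (Suc k)))"
  proof (intro exI[of _ "2 * D / \<epsilon>"] conjI allI impI)
    fix f assume f: "\<forall>j\<in>{1..Suc k}. unit_bdd (f j)" and u: "real_bdd (f (Suc k))"
    let ?u = "f (Suc k)"
    have "0 < \<epsilon>1 / (D + 1)" using \<epsilon>1 D by simp
    then obtain H where H: "0 < H" and HU: "(\<Sum>h<H. \<Sum>h'<H. U k (\<lambda>w. S (int c * int h) ?u w * S (int c * int h') ?u w)) / (real H)\<^sup>2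
       \<le> c * (U (Suc k) ?u + \<epsilon>1 / (D + 1))"
      using sum_U_differences[OF u _ k, of "\<epsilon>1 / (D + 1)" c] by (auto simp: c_def)
    have vf: "vdc_fun f h h' (Suc k) = (\<lambda>w. S (int c * int h) ?u w * S (int c * int h') ?u w)" for h h'
      using real_bddD(3)[OF real_bdd_S[OF u]] by (simp add: vdc_fun_def c_def)
    have "\<forall>\<^sub>F L in sequentially. nrm (lavg 1 k (\<lambda>j. vdc_fun f h h' (Suc j)) L) \<le> \<epsilon>1 + C * U k (\<lambda>w. S (int c * int h) ?u w * S (int c * int h') ?u w)" for h h'
      unfolding vf[symmetric]
    proof (rule ev)
      show "\<forall>j\<in>{1..k}. unit_bdd (vdc_fun f h h' (Suc j))"
        unfolding vdc_fun_def using f by (auto intro!: unit_bdd_mult unit_bdd_cnj unit_bdd_S)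
      show "real_bdd (vdc_fun f h h' (Suc k))" unfolding vf using u by (intro real_bdd_mult real_bdd_S)
    qed
    then have "\<forall>\<^sub>F L in sequentially. \<forall>h\<in>{..<H}. \<forall>h'\<in>{..<H}. nrm (lavg 1 k (\<lambda>j. vdc_fun f h h' (Suc j)) L) \<le> \<epsilon>1 + C * U k (\<lambda>w. S (int c * int h) ?u w * S (int c * int h') ?u w)"
      by (intro eventually_ball_finite ballI) auto
    moreover have "\<forall>\<^sub>F L in sequentially. L \<ge> max 1 (nat \<lceil>4 * H / \<epsilon>\<rceil>)" by (rule eventually_ge_at_top)
    ultimately show "\<forall>\<^sub>F L in sequentially. nrm (lavg z (Suc k) f L) \<le> \<epsilon> + 2 * D / \<epsilon> * U (Suc k) ?u"
    proof eventually_elim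
      case (elim L)
      have L: "0 < L" "4 * H / \<epsilon> \<le> L" using elim(2) by auto
      have U0: "0 \<le> U (Suc k) ?u" by (rule U_nonneg[OF u])
      have "(\<Sum>h<H. \<Sum>h'<H. nrm (lavg 1 k (\<lambda>j. vdc_fun f h h' (Suc j)) L)) / (real H)\<^sup>2
        \<le> (\<Sum>h<H. \<Sum>h'<H. \<epsilon>1 + C * U k (\<lambda>w. S (int c * int h) ?u w * S (int c * int h') ?u w)) / (real H)\<^sup>2"
        using elim(1) by (intro divide_right_mono sum_mono) auto
      also have "\<dots> = \<epsilon>1 + C * ((\<Sum>h<H. \<Sum>h'<H. U k (\<lambda>w. S (int c * int h) ?u w * S (int c * int h') ?u w)) / (real H)\<^sup>2)"
        using H by (simp add: sum.distrib sum_distrib_left[symmetric] add_divide_distrib power2_eq_square)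
      also have "\<dots> \<le> \<epsilon>1 + C * (c * (U (Suc k) ?u + \<epsilon>1 / (D + 1)))"
        using HU C by (intro add_left_mono mult_left_mono)
      also have "\<dots> = \<epsilon>1 + D * U (Suc k) ?u + \<epsilon>1 * (D / (D + 1))" by (simp add: D_def algebra_simps)
      also have "\<dots> \<le> \<epsilon>1 + D * U (Suc k) ?u + \<epsilon>1 * 1" using D \<epsilon>1 by (intro add_left_mono mult_left_mono) auto
      finally have sq: "(\<Sum>h<H. \<Sum>h'<H. nrm (lavg 1 k (\<lambda>j. vdc_fun f h h' (Suc j)) L)) / (real H)\<^sup>2 \<le> (\<epsilon> / 2)\<^sup>2 + D * U (Suc k) ?u"
        by (simp add: \<epsilon>1_def power_divide)
      let ?X = "(\<Sum>h<H. \<Sum>h'<H. nrm (lavg 1 k (\<lambda>j. vdc_fun f h h' (Suc j)) L)) / (real H)\<^sup>2"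
      have "vdc_fun f h h' (Suc j) \<in> A" if "j \<in> {1..k}" for h h' j
        using f that unfolding vdc_fun_def by (intro unit_bddD(1) unit_bdd_mult unit_bdd_cnj unit_bdd_S) auto
      then have "0 \<le> ?X" by (intro divide_nonneg_nonneg sum_nonneg nrm_ge_0 lavg_A) auto
      then have "sqrt ?X \<le> \<epsilon> / 2 + D * U (Suc k) ?u / (\<epsilon> / 2)"
        using sq D U0 \<epsilon> by (intro le_of_square_le) auto
      moreover have "2 * real H / real L \<le> \<epsilon> / 2" using L \<epsilon> H by (simp add: field_simps)
      moreover have "nrm (lavg z (Suc k) f L) \<le> 2 * real H / real L + sqrt ?X"
        using f by (intro van_der_Corput z L H) auto
      moreover have "D * U (Suc k) ?u / (\<epsilon> / 2) = 2 * D / \<epsilon> * U (Suc k) ?u" by simp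
      ultimately show ?case by linarith
    qed
  qed (use D \<epsilon> in auto)
qed

lemma controlled_no_phase: "0 < k \<Longrightarrow> controlled 1 k"
proof (induction k rule: nat_induct_non_zero)
  case (Suc n)
  then show ?case by (intro controlled_Suc) auto
qed (use controlled_1 in simp)

end

section \<open>Removing the last function\<close>

context shift_algebra
begin

text \<open>The sequences in \<open>l\<close> that remain once the last form is removed. They form
  an algebra closed under conjugation, as truncation by polynomials requires, and \<open>l\<close>
  enters only through shifts, so no phase is introduced.\<close>

inductive_set reps :: "nat \<Rightarrow> (int \<Rightarrow> 'w \<Rightarrow> complex) set" for k where
  reps_term: "b \<in> A \<Longrightarrow> (\<And>j. j \<in> {1..k} \<Longrightarrow> g j \<in> A) \<Longrightarrow> (\<lambda>l w. b w * linprod k g l w) \<in> reps k"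
| reps_add: "\<rho> \<in> reps k \<Longrightarrow> \<rho>' \<in> reps k \<Longrightarrow> (\<lambda>l w. \<rho> l w + \<rho>' l w) \<in> reps k"

lemma reps_A: "\<rho> \<in> reps k \<Longrightarrow> \<rho> l \<in> A"
  by (induction rule: reps.induct) (auto intro!: mult_A add_A linprod_A)

lemma linprod_mult: "linprod k (\<lambda>j w. g j w * g' j w) l w = linprod k g l w * linprod k g' l w"
  by (simp add: linprod_def S_simps prod.distrib)

lemma linprod_cnj: "linprod k (\<lambda>j w. cnj (g j w)) l w = cnj (linprod k g l w)"
  by (simp add: linprod_def S_simps)

lemma linprod_one: "linprod k (\<lambda>j w. 1) l w = 1"
  by (simp add: linprod_def)

lemma reps_mult_term:
  assumes "\<rho> \<in> reps k" "b \<in> A" "\<And>j. j \<in> {1..k} \<Longrightarrow> g j \<in> A"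
  shows "(\<lambda>l w. b w * linprod k g l w * \<rho> l w) \<in> reps k"
  using assms(1)
proof (induction rule: reps.induct)
  case (reps_term b' g')
  have "(\<lambda>l w. (b w * b' w) * linprod k (\<lambda>j w. g j w * g' j w) l w) \<in> reps k"
    using reps_term assms by (intro reps.reps_term mult_A) auto
  then show ?case by (simp add: linprod_mult mult_ac)
next
  case (reps_add \<rho> \<rho>')
  then show ?case using reps.reps_add[OF reps_add.IH] by (simp add: distrib_left)
qed

lemma reps_mult:
  assumes "\<rho> \<in> reps k" "\<rho>' \<in> reps k" shows "(\<lambda>l w. \<rho> l w * \<rho>' l w) \<in> reps k"
  using assms(1)
proof (induction rule: reps.induct)
  case (reps_term b g)
  then show ?case using reps_mult_term[OF assms(2)] by blast
next
  case (reps_add \<rho>1 \<rho>2)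
  then show ?case using reps.reps_add[OF reps_add.IH] by (simp add: distrib_right)
qed

lemma reps_base: "b \<in> A \<Longrightarrow> (\<lambda>l w. b w) \<in> reps k"
  using reps_term[of b k "\<lambda>j w. 1"] by (simp add: linprod_one const_A)

text \<open>Speed \<open>0\<close> occurs as well, for the full vertex of a cube; such a factor is
  absorbed into the fixed function \<open>b\<close>.\<close>

lemma reps_gen:
  assumes "v \<in> A" "m \<le> k" shows "(\<lambda>l. S (int m * l) v) \<in> reps k"
proof (cases "m = 0")
  case True
  then show ?thesis using reps_base[OF assms(1)] by simp
next
  case False
  define g where "g j = (if j = m then v else (\<lambda>w. 1))" for j
  have "linprod k g l w = S (int m * l) v w" for l w
  proof -
    have "linprod k g l w = (\<Prod>j\<in>{1..k}. if j = m then S (int m * l) v w else 1)"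
      unfolding linprod_def g_def by (intro prod.cong) auto
    then show ?thesis using False assms(2) by (simp add: prod.delta)
  qed
  moreover have "(\<lambda>l w. 1 * linprod k g l w) \<in> reps k"
    using assms by (intro reps_term) (auto simp: g_def const_A)
  ultimately show ?thesis by (simp add: fun_eq_iff[symmetric])
qed

lemma reps_scale: "\<rho> \<in> reps k \<Longrightarrow> (\<lambda>l w. c * \<rho> l w) \<in> reps k"
  using reps_mult[OF reps_base[OF const_A]] by blast

lemma reps_sum: "finite I \<Longrightarrow> (\<And>i. i \<in> I \<Longrightarrow> \<rho> i \<in> reps k) \<Longrightarrow> (\<lambda>l w. \<Sum>i\<in>I. \<rho> i l w) \<in> reps k"
  by (induction I rule: finite_induct) (auto intro: reps_base const_A reps_add)

lemma reps_prod: "finite I \<Longrightarrow> (\<And>i. i \<in> I \<Longrightarrow> \<rho> i \<in> reps k) \<Longrightarrow> (\<lambda>l w. \<Prod>i\<in>I. \<rho> i l w) \<in> reps k"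
  by (induction I rule: finite_induct) (auto intro: reps_base const_A reps_mult)

lemma reps_cnj: "\<rho> \<in> reps k \<Longrightarrow> (\<lambda>l w. cnj (\<rho> l w)) \<in> reps k"
proof (induction rule: reps.induct)
  case (reps_term b g)
  then have "(\<lambda>l w. cnj (b w) * linprod k (\<lambda>j w. cnj (g j w)) l w) \<in> reps k"
    by (intro reps.reps_term cnj_A) auto
  then show ?case by (simp add: linprod_cnj)
qed (auto intro: reps.reps_add)

lemma of_real_Re: "of_real (Re z) = (1 / 2) * (z + cnj z)"
  by (simp add: complex_eq_iff)

lemma reps_Re: "\<rho> \<in> reps k \<Longrightarrow> (\<lambda>l w. of_real (Re (\<rho> l w))) \<in> reps k"
  unfolding of_real_Re by (intro reps_scale reps_add reps_cnj)

lemma Re_A: "a \<in> A \<Longrightarrow> (\<lambda>w. of_real (Re (a w))) \<in> A"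
  unfolding of_real_Re by (intro scale_A add_A cnj_A)

lemma bounded_linear_real: "bounded_linear p \<Longrightarrow> p x = x * p 1" for p :: "real \<Rightarrow> real"
  using linear_scale[OF bounded_linear.linear, of p x 1] by simp

lemma reps_polynomial:
  fixes p :: "real \<Rightarrow> real"
  assumes "real_polynomial_function p" "\<rho> \<in> reps k"
  shows "(\<lambda>l w. of_real (p (Re (\<rho> l w)))) \<in> reps k"
  using assms(1)
proof (induction rule: real_polynomial_function.induct)
  case (linear p)
  then show ?case using reps_scale[OF reps_Re[OF assms(2)], of "of_real (p 1)"]
    by (subst bounded_linear_real[OF linear]) (simp add: mult.commute)
qed (auto intro: reps_add reps_mult reps_base const_A)

lemma polynomial_A:
  fixes p :: "real \<Rightarrow> real"
  assumes "real_polynomial_function p" "a \<in> A"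
  shows "(\<lambda>w. of_real (p (Re (a w)))) \<in> A"
  using assms(1)
proof (induction rule: real_polynomial_function.induct)
  case (linear p)
  then show ?case using scale_A[OF Re_A[OF assms(2)], of "of_real (p 1)"]
    by (subst bounded_linear_real[OF linear]) (simp add: mult.commute)
qed (auto intro: A_intros)

lemma finite_bound_A:
  assumes "finite I" "\<And>i. i \<in> I \<Longrightarrow> f i \<in> A"
  obtains C where "1 \<le> C" "\<And>i w. i \<in> I \<Longrightarrow> norm (f i w) \<le> C"
proof -
  have "\<exists>C\<ge>1. \<forall>i\<in>I. \<forall>w. norm (f i w) \<le> C" using assms
  proof (induction I rule: finite_induct)
    case (insert x I)
    then obtain C where C: "1 \<le> C" "\<And>i w. i \<in> I \<Longrightarrow> norm (f i w) \<le> C" by auto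
    obtain C' where "\<And>w. norm (f x w) \<le> C'" using insert bdd_A[of "f x"] by auto
    then have "\<forall>i\<in>insert x I. \<forall>w. norm (f i w) \<le> max C C'" using C(2) by (auto simp: le_max_iff_disj)
    then show ?case using C(1) by (intro exI[of _ "max C C'"]) auto
  qed (auto intro: exI[of _ 1])
  then show ?thesis using that by blast
qed

lemma reps_bdd: "\<rho> \<in> reps k \<Longrightarrow> \<exists>B\<ge>0. \<forall>l w. norm (\<rho> l w) \<le> B"
proof (induction rule: reps.induct)
  case (reps_term b g)
  obtain C where C: "1 \<le> C" "\<And>i w. i \<in> {1..k} \<Longrightarrow> norm (g i w) \<le> C"
    using finite_bound_A[of "{1..k}" g] reps_term(2) by blast
  obtain C' where C': "\<And>w. norm (b w) \<le> C'" using bdd_A[OF reps_term(1)] by blast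
  have "norm (linprod k g l w) \<le> C ^ k" for l w
  proof -
    have "norm (linprod k g l w) \<le> (\<Prod>j\<in>{1..k}. C)"
      unfolding linprod_def prod_norm[symmetric] using C by (intro prod_mono) (auto intro: S_bound)
    then show ?thesis by simp
  qed
  then have "norm (b w * linprod k g l w) \<le> C' * C ^ k" for l w
    unfolding norm_mult using C' norm_ge_zero order_trans by (intro mult_mono) blast+
  moreover from this have "0 \<le> C' * C ^ k" using norm_ge_zero order_trans by blast
  ultimately show ?case by blast
next
  case (reps_add \<rho> \<rho>')
  then obtain B B' where B: "0 \<le> B" "0 \<le> B'" "\<And>l w. norm (\<rho> l w) \<le> B" "\<And>l w. norm (\<rho>' l w) \<le> B'" by blast
  then have "norm (\<rho> l w + \<rho>' l w) \<le> B + B'" for l w by (intro norm_triangle_le add_mono)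
  then show ?case using B(1,2) by (intro exI[of _ "B + B'"]) auto
qed

end

definition clip :: "real \<Rightarrow> real \<Rightarrow> real" where
  "clip r x = max (- r) (min r x)"

lemma clip_bound: "0 \<le> r \<Longrightarrow> \<bar>clip r x\<bar> \<le> r"
  and clip_id: "\<bar>x\<bar> \<le> r \<Longrightarrow> clip r x = x"
  and clip_Lipschitz: "\<bar>clip r x - clip r y\<bar> \<le> \<bar>x - y\<bar>"
  by (auto simp: clip_def max_def min_def)

text \<open>Clipping may lead out of the algebra, but a polynomial that approximates it uniformly on
  a bounded interval does not.\<close>

lemma clip_polynomial:
  assumes "0 < \<delta>"
  obtains p :: "real \<Rightarrow> real" where "real_polynomial_function p" "\<And>x. \<bar>x\<bar> \<le> B \<Longrightarrow> \<bar>p x - clip r x\<bar> \<le> \<delta>"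
proof -
  have "continuous_on {- B..B} (clip r)" unfolding clip_def[abs_def] by (intro continuous_intros)
  then obtain p where p: "real_polynomial_function p" "\<And>x. x \<in> {- B..B} \<Longrightarrow> \<bar>clip r x - p x\<bar> < \<delta>"
    using Stone_Weierstrass_real_polynomial_function[of "{- B..B}" "clip r" \<delta>] assms by auto
  have "\<bar>p x - clip r x\<bar> \<le> \<delta>" if "\<bar>x\<bar> \<le> B" for x
    using p(2)[of x] that by (simp add: abs_le_iff abs_less_iff)
  then show ?thesis using that p(1) by blast
qed

section \<open>Structured functions and their truncation\<close>

context invariant_mean
begin

lemma nrm_le_pointwise:
  assumes "a \<in> A" "b \<in> A" "\<And>w. (norm (a w))\<^sup>2 \<le> (norm (b w))\<^sup>2 + \<kappa>"
  shows "(nrm a)\<^sup>2 \<le> (nrm b)\<^sup>2 + \<kappa>"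
proof -
  have Re_cnj: "Re (z * cnj z) = (norm z)\<^sup>2" for z by (simp add: complex_mult_cnj cmod_power2)
  have "Re (\<tau> (\<lambda>w. a w * cnj (a w))) \<le> Re (\<tau> (\<lambda>w. b w * cnj (b w) + of_real \<kappa>))"
  proof (rule tau_mono)
    fix w show "Re (a w * cnj (a w)) \<le> Re (b w * cnj (b w) + of_real \<kappa>)"
      unfolding plus_complex.sel Re_cnj using assms(3)[of w] by simp
  qed (use assms in \<open>auto intro!: A_intros\<close>)
  also have "\<tau> (\<lambda>w. b w * cnj (b w) + of_real \<kappa>) = \<tau> (\<lambda>w. b w * cnj (b w)) + of_real \<kappa>"
    using assms tau_scale[OF const_A[of 1], of "of_real \<kappa>"] tau_one by (simp add: tau_add A_intros)
  finally show ?thesis using assms by (simp add: nrm_square ip_def)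
qed

text \<open>In contrast to \<open>structured\<close>, the error bound holds for every integer
  \<open>l\<close>, and the size of \<open>\<rho>\<close> is not recorded; \<open>reps_bdd\<close>
  supplies a bound where one is required.\<close>

definition structured_at :: "nat \<Rightarrow> real \<Rightarrow> ('w \<Rightarrow> complex) \<Rightarrow> bool" where
  "structured_at k \<eta> F \<longleftrightarrow> F \<in> A \<and> (\<forall>w. Im (F w) = 0) \<and>
     (\<exists>\<rho>\<in>reps k. \<forall>l. nrm (\<lambda>w. S (int (Suc k) * l) F w - \<rho> l w) \<le> \<eta>)"

lemma structured_atI:
  assumes "F \<in> A" "\<forall>w. Im (F w) = 0" "\<rho> \<in> reps k" "\<And>l. nrm (\<lambda>w. S (int (Suc k) * l) F w - \<rho> l w) \<le> \<eta>"
  shows "structured_at k \<eta> F"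
  unfolding structured_at_def by (intro conjI assms(1,2) bexI[of _ \<rho>] allI assms(3,4))

lemma structured_at_zero: "0 \<le> \<eta> \<Longrightarrow> structured_at k \<eta> (\<lambda>w. 0)"
  unfolding structured_at_def by (auto intro!: bexI[OF _ reps_base[OF const_A[of 0]]] const_A simp: nrm_zero)

lemma structured_at_mono: "structured_at k \<eta> F \<Longrightarrow> \<eta> \<le> \<eta>' \<Longrightarrow> structured_at k \<eta>' F"
  unfolding structured_at_def by (meson order_trans)

lemma structured_at_add_scale:
  assumes F: "structured_at k \<eta> F" and E: "structured_at k \<eta>' E" and t: "0 \<le> t"
  shows "structured_at k (\<eta> + t * \<eta>') (\<lambda>w. F w + of_real t * E w)"
proof -
  obtain \<rho> where \<rho>: "\<rho> \<in> reps k" "\<And>l. nrm (\<lambda>w. S (int (Suc k) * l) F w - \<rho> l w) \<le> \<eta>" and FA: "F \<in> A"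
    using F unfolding structured_at_def by blast
  obtain \<rho>' where \<rho>': "\<rho>' \<in> reps k" "\<And>l. nrm (\<lambda>w. S (int (Suc k) * l) E w - \<rho>' l w) \<le> \<eta>'" and EA: "E \<in> A"
    using E unfolding structured_at_def by blast
  have "nrm (\<lambda>w. S (int (Suc k) * l) (\<lambda>w. F w + of_real t * E w) w - (\<rho> l w + of_real t * \<rho>' l w)) \<le> \<eta> + t * \<eta>'" for l
  proof -
    let ?a = "\<lambda>w. S (int (Suc k) * l) F w - \<rho> l w" and ?b = "\<lambda>w. S (int (Suc k) * l) E w - \<rho>' l w"
    have A: "?a \<in> A" "?b \<in> A" by (intro A_intros FA EA reps_A[OF \<rho>(1)] reps_A[OF \<rho>'(1)])+
    have "(\<lambda>w. S (int (Suc k) * l) (\<lambda>w. F w + of_real t * E w) w - (\<rho> l w + of_real t * \<rho>' l w)) = (\<lambda>w. ?a w + of_real t * ?b w)"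
      by (simp add: S_simps algebra_simps)
    moreover have "nrm (\<lambda>w. ?a w + of_real t * ?b w) \<le> nrm ?a + t * nrm ?b"
      using nrm_triangle[OF A(1) scale_A[OF A(2), of "of_real t"]] nrm_scale[OF A(2), of "of_real t"] t
      by (simp del: of_nat_Suc)
    moreover have "t * nrm ?b \<le> t * \<eta>'" using \<rho>'(2) t by (rule mult_left_mono)
    ultimately show ?thesis using \<rho>(2)[of l] by (simp del: of_nat_Suc)
  qed
  moreover have "(\<lambda>l w. \<rho> l w + of_real t * \<rho>' l w) \<in> reps k" using \<rho> \<rho>' by (intro reps_add reps_scale)
  moreover have "(\<lambda>w. F w + of_real t * E w) \<in> A" by (intro A_intros FA EA)
  moreover have "\<forall>w. Im (F w + of_real t * E w) = 0" using F E by (simp add: structured_at_def)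
  ultimately show ?thesis by (intro structured_atI[of _ "\<lambda>l w. \<rho> l w + of_real t * \<rho>' l w"])
qed

text \<open>A polynomial close to the clipping function is
  almost 1-Lipschitz, so applying it to both sides does not amplify the error.\<close>

lemma structured_at_truncate:
  assumes F: "structured_at k \<eta> F" and f: "f \<in> A" "\<And>w. Im (f w) = 0" "\<And>w. norm (f w) \<le> r"
    and \<delta>: "0 < \<delta>" and r: "0 < r" and \<eta>: "0 \<le> \<eta>"
  obtains F' where "structured_at k (\<eta> + \<delta>) F'" "\<And>w. norm (F' w) \<le> r + \<delta>"
    "nrm (\<lambda>w. f w - F' w) \<le> nrm (\<lambda>w. f w - F w) + \<delta>"
proof -
  obtain \<rho>0 where \<rho>0: "\<rho>0 \<in> reps k" "\<And>l. nrm (\<lambda>w. S (int (Suc k) * l) F w - \<rho>0 l w) \<le> \<eta>"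
    and FA: "F \<in> A" and Fr: "\<And>w. Im (F w) = 0"
    using F unfolding structured_at_def by blast
  \<comment> \<open>\<open>F\<close> is real, so the real part of its representation is at least as
    close to it.\<close>
  define \<rho> where "\<rho> l w = complex_of_real (Re (\<rho>0 l w))" for l w
  have \<rho>: "\<rho> \<in> reps k" unfolding \<rho>_def[abs_def] by (intro reps_Re \<rho>0)
  obtain B1 where B1: "\<And>w. norm (F w) \<le> B1" using bdd_A[OF FA] by blast
  obtain B2 where B2: "0 \<le> B2" "\<And>l w. norm (\<rho> l w) \<le> B2" using reps_bdd[OF \<rho>] by blast
  define B where "B = max (max B1 B2) r"
  have B: "0 \<le> B" "\<And>w. norm (F w) \<le> B" "\<And>l w. norm (\<rho> l w) \<le> B" "r \<le> B"
    using B1 B2 r by (auto simp: B_def le_max_iff_disj)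
  \<comment> \<open>Chosen so that
    \<open>\<epsilon> * (\<epsilon> + 4 * B) \<le> \<delta>\<^sup>2\<close>: if
    \<open>a \<le> \<epsilon> + b\<close> and \<open>b \<le> 2 * B\<close> pointwise, the squares
    differ by at most this much, and hence the norms by at most \<open>\<delta>\<close>.\<close>
  define \<epsilon> where "\<epsilon> = min \<delta> (\<delta>\<^sup>2 / (\<delta> + 4 * B))"
  have p0: "0 < \<delta> + 4 * B" using B(1) \<delta> by simp
  have \<epsilon>: "0 < \<epsilon>" "\<epsilon> \<le> \<delta>" using p0 \<delta> by (auto simp: \<epsilon>_def)
  have "\<epsilon> * (\<epsilon> + 4 * B) \<le> (\<delta>\<^sup>2 / (\<delta> + 4 * B)) * (\<delta> + 4 * B)"
    using \<epsilon> B(1) by (intro mult_mono) (auto simp: \<epsilon>_def)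
  then have \<epsilon>\<delta>: "\<epsilon> * (\<epsilon> + 4 * B) \<le> \<delta>\<^sup>2" using p0 by simp
  have "0 < \<epsilon> / 2" using \<epsilon> by simp
  then obtain p where p: "real_polynomial_function p" "\<And>x. \<bar>x\<bar> \<le> B \<Longrightarrow> \<bar>p x - clip r x\<bar> \<le> \<epsilon> / 2"
    using clip_polynomial by blast
  have pL: "\<bar>p x - p y\<bar> \<le> \<epsilon> + \<bar>x - y\<bar>" if "\<bar>x\<bar> \<le> B" "\<bar>y\<bar> \<le> B" for x y
    using p(2)[OF that(1)] p(2)[OF that(2)] clip_Lipschitz[of r x y] by linarith
  have sq: "a\<^sup>2 \<le> b\<^sup>2 + \<delta>\<^sup>2" if "0 \<le> a" "a \<le> \<epsilon> + b" "0 \<le> b" "b \<le> 2 * B" for a b :: real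
  proof -
    have "a\<^sup>2 \<le> (\<epsilon> + b)\<^sup>2" using that by (intro power_mono) auto
    also have "\<dots> = b\<^sup>2 + \<epsilon> * (\<epsilon> + 2 * b)" by (simp add: power2_eq_square algebra_simps)
    also have "\<epsilon> * (\<epsilon> + 2 * b) \<le> \<epsilon> * (\<epsilon> + 4 * B)" using that \<epsilon> by (intro mult_left_mono) auto
    finally show ?thesis using \<epsilon>\<delta> by linarith
  qed
  have cmp: "nrm a \<le> nrm b + \<delta>"
    if "a \<in> A" "b \<in> A" "\<And>w. norm (a w) \<le> \<epsilon> + norm (b w)" "\<And>w. norm (b w) \<le> 2 * B" for a b
  proof (rule power2_le_imp_le)
    have "(nrm a)\<^sup>2 \<le> (nrm b)\<^sup>2 + \<delta>\<^sup>2" using that by (intro nrm_le_pointwise sq) auto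
    also have "\<dots> \<le> (nrm b + \<delta>)\<^sup>2" using that \<delta> by (simp add: power2_sum)
    finally show "(nrm a)\<^sup>2 \<le> (nrm b + \<delta>)\<^sup>2" .
  qed (use that \<delta> in auto)
  have Re_le: "\<bar>Re z\<bar> \<le> C" if "norm z \<le> C" for z C using abs_Re_le_cmod[of z] that by linarith
  define F' where "F' w = complex_of_real (p (Re (F w)))" for w
  have F'A: "F' \<in> A" unfolding F'_def[abs_def] by (intro polynomial_A p FA)
  define \<rho>' where "\<rho>' l w = complex_of_real (p (Re (\<rho> l w)))" for l w
  have \<rho>': "\<rho>' \<in> reps k" unfolding \<rho>'_def[abs_def] by (intro reps_polynomial p \<rho>)
  have "nrm (\<lambda>w. S (int (Suc k) * l) F' w - \<rho>' l w) \<le> \<eta> + \<delta>" for l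
  proof -
    let ?m = "int (Suc k) * l"
    have "nrm (\<lambda>w. S ?m F' w - \<rho>' l w) \<le> nrm (\<lambda>w. S ?m F w - \<rho> l w) + \<delta>"
    proof (rule cmp)
      fix w
      have b: "norm (S ?m F w) \<le> B" using B(2) by (rule S_bound)
      have "Im (S ?m F w) = 0" using Fr by (simp add: S_def)
      then have "norm (S ?m F w - \<rho> l w) = \<bar>Re (S ?m F w) - Re (\<rho> l w)\<bar>"
        by (simp add: cmod_def \<rho>_def)
      moreover have "norm (S ?m F' w - \<rho>' l w) = \<bar>p (Re (S ?m F w)) - p (Re (\<rho> l w))\<bar>"
        by (simp add: F'_def S_def \<rho>'_def flip: of_real_diff)
      ultimately show "norm (S ?m F' w - \<rho>' l w) \<le> \<epsilon> + norm (S ?m F w - \<rho> l w)"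
        using pL[OF Re_le[OF b] Re_le[OF B(3)[of l w]]] by simp
      show "norm (S ?m F w - \<rho> l w) \<le> 2 * B"
        using norm_triangle_ineq4[of "S ?m F w" "\<rho> l w"] b B(3)[of l w] by simp
    qed (intro A_intros F'A FA reps_A[OF \<rho>] reps_A[OF \<rho>'])+
    also have "nrm (\<lambda>w. S ?m F w - \<rho> l w) \<le> \<eta>"
    proof -
      have "(nrm (\<lambda>w. S ?m F w - \<rho> l w))\<^sup>2 \<le> (nrm (\<lambda>w. S ?m F w - \<rho>0 l w))\<^sup>2 + 0"
      proof (rule nrm_le_pointwise)
        fix w
        have "Im (S ?m F w) = 0" using Fr by (simp add: S_def)
        then show "(norm (S ?m F w - \<rho> l w))\<^sup>2 \<le> (norm (S ?m F w - \<rho>0 l w))\<^sup>2 + 0"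
          by (simp add: cmod_power2 \<rho>_def)
      qed (intro A_intros FA reps_A[OF \<rho>] reps_A[OF \<rho>0(1)])+
      also have "\<dots> \<le> \<eta>\<^sup>2"
        using \<rho>0(2)[of l] by (simp del: of_nat_Suc) (intro power_mono nrm_ge_0 A_intros FA reps_A[OF \<rho>0(1)])
      finally show ?thesis using \<eta> by (rule power2_le_imp_le)
    qed
    finally show ?thesis by simp
  qed
  then have 1: "structured_at k (\<eta> + \<delta>) F'"
    using F'A \<rho>' by (intro structured_atI[of _ \<rho>']) (auto simp: F'_def)
  have 2: "norm (F' w) \<le> r + \<delta>" for w
    using p(2)[OF Re_le[OF B(2)[of w]]] clip_bound[of r "Re (F w)"] r \<epsilon> unfolding F'_def norm_of_real by linarith
  have "nrm (\<lambda>w. f w - F' w) \<le> nrm (\<lambda>w. f w - F w) + \<delta>"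
  proof (rule cmp)
    fix w
    have fr: "f w = of_real (Re (f w))" "F w = of_real (Re (F w))" using f(2) Fr by (auto simp: complex_eq_iff)
    have "norm (f w - F w) = \<bar>Re (f w) - Re (F w)\<bar>" using f(2) Fr by (simp add: cmod_def)
    moreover have "norm (f w - F' w) = \<bar>Re (f w) - p (Re (F w))\<bar>" using f(2) by (simp add: cmod_def F'_def)
    moreover have "clip r (Re (f w)) = Re (f w)" by (intro clip_id Re_le f)
    ultimately show "norm (f w - F' w) \<le> \<epsilon> + norm (f w - F w)"
      using p(2)[OF Re_le[OF B(2)[of w]]] clip_Lipschitz[of r "Re (f w)" "Re (F w)"] \<epsilon> by linarith
    show "norm (f w - F w) \<le> 2 * B"
      using norm_triangle_ineq4[of "f w" "F w"] f(3)[of w] B(2)[of w] B(4) by linarith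
  qed (intro A_intros F'A FA f)+
  then show ?thesis using that 1 2 by blast
qed

end

lemma tendsto_0_of_le:
  fixes x :: "'n \<Rightarrow> real"
  assumes "\<And>\<epsilon>. 0 < \<epsilon> \<Longrightarrow> \<forall>\<^sub>F n in \<F>. x n \<le> c * \<epsilon>" "\<And>n. 0 \<le> x n" "0 < c"
  shows "(x \<longlongrightarrow> 0) \<F>"
proof (rule tendstoI)
  fix \<epsilon> :: real assume \<epsilon>: "0 < \<epsilon>"
  then have "\<forall>\<^sub>F n in \<F>. x n \<le> c * (\<epsilon> / (2 * c))" using assms(1)[of "\<epsilon> / (2 * c)"] assms(3) by simp
  then show "\<forall>\<^sub>F n in \<F>. dist (x n) 0 < \<epsilon>"
    by eventually_elim (use assms \<epsilon> in \<open>simp add: dist_real_def\<close>)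
qed

lemma tendsto_0_squeeze:
  fixes x y :: "'n \<Rightarrow> real"
  assumes "\<And>n. 0 \<le> x n" "\<And>n. x n \<le> y n" "(y \<longlongrightarrow> 0) \<F>"
  shows "(x \<longlongrightarrow> 0) \<F>"
  by (rule tendsto_sandwich[OF _ _ tendsto_const assms(3)]) (use assms in auto)

section \<open>Structured approximation of the last function and the induction on
  \<open>k\<close>\<close>

context cubic_mean
begin

text \<open>The translation adds \<open>- card \<omega> * l\<close> to the form of
  \<open>\<omega>\<close>, so the shift by \<open>(k + 1) * l\<close> leaves the speed
  \<open>k + 1 - card \<omega>\<close>. It is at most \<open>k\<close> because the empty vertex is
  absent.\<close>

lemma dual_cube_translate:
  assumes W: "lattice_folner (Suc k) N W" and u: "u \<in> A"
  defines "a \<equiv> \<lambda>l i. if i < Suc k then - l else 0"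
  shows "lattice_folner (Suc k) N ((\<lambda>h. h + a l) ` W)"
    and "(\<lambda>l. S (int (Suc k) * l) (dual_cube (Suc k) ((\<lambda>h. h + a l) ` W) u)) \<in> reps k"
proof -
  show "lattice_folner (Suc k) N ((\<lambda>h. h + a l) ` W)" for l
    using W folner_translate unfolding lattice_folner_def by (auto simp: a_def)
  have fin: "finite W" using W by (simp add: lattice_folner_def folner_def)
  let ?\<Omega> = "Pow {..<Suc k} - {{}}"
  have "cform \<omega> (h + a l) = cform \<omega> h - int (card \<omega>) * l" if "\<omega> \<in> ?\<Omega>" for \<omega> h l
  proof -
    have "cform \<omega> (a l) = (\<Sum>i\<in>\<omega>. - l)" unfolding cform_def a_def using that by (intro sum.cong) auto
    then show ?thesis by (simp add: cform_add)
  qed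
  moreover have "int (Suc k - card \<omega>) = int (Suc k) - int (card \<omega>)" "Suc k - card \<omega> \<le> k" if "\<omega> \<in> ?\<Omega>" for \<omega>
  proof -
    have "card \<omega> \<le> Suc k" using card_mono[of "{..<Suc k}" \<omega>] that by auto
    then show "int (Suc k - card \<omega>) = int (Suc k) - int (card \<omega>)" by (simp add: of_nat_diff)
    have "card \<omega> \<noteq> 0" using that finite_subset[of \<omega> "{..<Suc k}"] by auto
    then show "Suc k - card \<omega> \<le> k" by simp
  qed
  ultimately have exp: "int (Suc k) * l + cform \<omega> (h + a l) = int (Suc k - card \<omega>) * l + cform \<omega> h"
    and le: "Suc k - card \<omega> \<le> k" if "\<omega> \<in> ?\<Omega>" for \<omega> h l
    using that by (simp_all add: left_diff_distrib)
  have eq: "S (int (Suc k) * l) (dual_cube (Suc k) ((\<lambda>h. h + a l) ` W) u) w =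
    inverse (of_nat (card W)) * (\<Sum>h\<in>W. \<Prod>\<omega>\<in>?\<Omega>. S (int (Suc k - card \<omega>) * l) (S (cform \<omega> h) u) w)" for l w
  proof -
    have "S (int (Suc k) * l) (dual_cube (Suc k) ((\<lambda>h. h + a l) ` W) u) w =
      (\<Sum>h\<in>W. \<Prod>\<omega>\<in>?\<Omega>. S (int (Suc k) * l + cform \<omega> (h + a l)) u w) / of_nat (card W)"
    proof -
      have inj: "inj_on (\<lambda>h. h + a l) W" by (simp add: inj_on_def)
      have "dual_cube (Suc k) ((\<lambda>h. h + a l) ` W) u = (\<lambda>w. (\<Sum>h\<in>W. \<Prod>\<omega>\<in>?\<Omega>. S (cform \<omega> (h + a l)) u w) / of_nat (card W))"
        unfolding dual_cube_def card_image[OF inj] sum.reindex[OF inj] comp_def ..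
      then show ?thesis by (simp only: S_divide S_sum S_prod S_S S_const)
    qed
    also have "(\<Sum>h\<in>W. \<Prod>\<omega>\<in>?\<Omega>. S (int (Suc k) * l + cform \<omega> (h + a l)) u w) =
      (\<Sum>h\<in>W. \<Prod>\<omega>\<in>?\<Omega>. S (int (Suc k - card \<omega>) * l) (S (cform \<omega> h) u) w)"
      unfolding S_S by (intro sum.cong prod.cong refl) (simp only: exp)
    finally show ?thesis unfolding divide_inverse by (subst (asm) mult.commute)
  qed
  have "(\<lambda>l w. inverse (of_nat (card W)) * (\<Sum>h\<in>W. \<Prod>\<omega>\<in>?\<Omega>. S (int (Suc k - card \<omega>) * l) (S (cform \<omega> h) u) w)) \<in> reps k"
    by (intro reps_scale reps_sum reps_prod reps_gen S_A u le fin) auto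
  then show "(\<lambda>l. S (int (Suc k) * l) (dual_cube (Suc k) ((\<lambda>h. h + a l) ` W) u)) \<in> reps k"
    unfolding eq[symmetric] by simp
qed

text \<open>Translating the Folner set by \<open>-l\<close> in every coordinate turns the orbit of a dual cube along
  the last form into a combination of products of the preceding forms; uniform convergence of
  cubic averages makes the error uniform in \<open>l\<close>.\<close>

lemma structured_at_dual_cube:
  assumes u: "real_bdd u" and \<eta>: "0 < \<eta>"
  obtains N where "\<And>W. lattice_folner (Suc k) N W \<Longrightarrow> structured_at k \<eta> (dual_cube (Suc k) W u)"
proof -
  obtain N where N: "\<And>W W'. lattice_folner (Suc k) N W \<Longrightarrow> lattice_folner (Suc k) N W' \<Longrightarrow>
    nrm (\<lambda>w. dual_cube (Suc k) W u w - dual_cube (Suc k) W' u w) \<le> \<eta>"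
    using dual_cube_Cauchy[OF u \<eta>] by blast
  have uA: "u \<in> A" by (rule real_bddD[OF u])
  have "structured_at k \<eta> (dual_cube (Suc k) W u)" if W: "lattice_folner (Suc k) N W" for W
  proof -
    define a where "a = (\<lambda>l i. if i < Suc k then - l else (0::int))"
    have tr: "lattice_folner (Suc k) N ((\<lambda>h. h + a l) ` W)"
      "(\<lambda>l. S (int (Suc k) * l) (dual_cube (Suc k) ((\<lambda>h. h + a l) ` W) u)) \<in> reps k" for l
      using dual_cube_translate[OF W uA] by (simp_all only: a_def)
    have "nrm (\<lambda>w. S (int (Suc k) * l) (dual_cube (Suc k) W u) w -
       S (int (Suc k) * l) (dual_cube (Suc k) ((\<lambda>h. h + a l) ` W) u) w) \<le> \<eta>" for l
      unfolding S_diff[symmetric]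
      using N[OF W tr(1)] by (subst nrm_S) (intro A_intros dual_cube_A uA)
    moreover have "\<forall>w. Im (dual_cube (Suc k) W u w) = 0"
    proof
      fix w
      have "cnj (dual_cube (Suc k) W u w) = dual_cube (Suc k) W u w"
        using real_bddD(3)[OF real_bdd_S[OF u]] by (simp add: dual_cube_def)
      then show "Im (dual_cube (Suc k) W u w) = 0" by (simp add: complex_eq_iff)
    qed
    ultimately show ?thesis using tr(2) dual_cube_A[OF uA] by (intro structured_atI)
  qed
  then show ?thesis by (rule that)
qed

lemma dual_cube_bound:
  assumes u: "real_bdd u" and W: "lattice_folner k N W"
  shows "nrm (dual_cube k W u) \<le> 1"
  unfolding dual_cube_def
proof (rule nrm_mean)
  fix h
  have "unit_bdd (\<lambda>w. \<Prod>\<omega>\<in>Pow {..<k} - {{}}. S (cform \<omega> h) u w)"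
    using u by (intro unit_bdd_prod unit_bdd_S real_bddD(1))
  then show "(\<lambda>w. \<Prod>\<omega>\<in>Pow {..<k} - {{}}. S (cform \<omega> h) u w) \<in> A"
    "nrm (\<lambda>w. \<Prod>\<omega>\<in>Pow {..<k} - {{}}. S (cform \<omega> h) u w) \<le> 1"
    using unit_bddD by (auto intro: nrm_le_bdd)
qed (use W in \<open>auto simp: lattice_folner_def folner_def\<close>)

text \<open>There is no projection onto structured functions, because adding two of them adds their
  errors. Instead, the distance \<open>d \<eta>\<close> grows as \<open>\<eta>\<close> shrinks and
  is bounded, hence nearly constant below some \<open>\<eta>2\<close>. A nearly optimal
  \<open>F\<close> of precision much finer than \<open>\<eta>2\<close> stays nearly optimal when a
  term of precision \<open>\<eta>2 / 2\<close> is allowed.\<close>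

lemma near_minimizer:
  assumes f: "f \<in> A" "\<And>w. Im (f w) = 0" "\<And>w. norm (f w) \<le> 1 / 4"
    and \<eta>: "0 < \<eta>" and \<delta>: "0 < \<delta>" "\<delta> \<le> 1 / 4"
  obtains F \<eta>0 where "0 < \<eta>0" "structured_at k \<eta> F" "\<And>w. norm (F w) \<le> 1 / 2"
    "\<And>E t. structured_at k \<eta>0 E \<Longrightarrow> 0 \<le> t \<Longrightarrow> t \<le> 1 \<Longrightarrow>
      nrm (\<lambda>w. f w - F w) \<le> nrm (\<lambda>w. f w - (F w + of_real t * E w)) + 3 * \<delta>"
proof -
  define D where "D \<eta> = {nrm (\<lambda>w. f w - F w) |F. structured_at k \<eta> F}" for \<eta>
  define d where "d \<eta> = Inf (D \<eta>)" for \<eta>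
  have D0: "nrm f \<in> D \<eta>" if "0 \<le> \<eta>" for \<eta>
    using structured_at_zero[OF that, of k] unfolding D_def by (auto intro!: exI[of _ "\<lambda>w. 0"])
  have Dge: "0 \<le> x" if "x \<in> D \<eta>" for x \<eta>
    using that f unfolding D_def structured_at_def by (auto intro!: nrm_ge_0 A_intros)
  have bb: "bdd_below (D \<eta>)" for \<eta> using Dge by (intro bdd_belowI[of _ 0])
  have d_le: "d \<eta> \<le> nrm (\<lambda>w. f w - F w)" if "structured_at k \<eta> F" for \<eta> F
    unfolding d_def using that bb by (intro cInf_lower) (auto simp: D_def)
  have d_anti: "d \<eta>' \<le> d \<eta>" if "0 \<le> \<eta>" "\<eta> \<le> \<eta>'" for \<eta> \<eta>'
    unfolding d_def using D0[OF that(1)] bb that structured_at_mono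
    by (intro cInf_superset_mono) (auto simp: D_def)
  have d_ub: "d \<eta> \<le> nrm f" if "0 < \<eta>" for \<eta>
    unfolding d_def using D0[of \<eta>] that bb by (intro cInf_lower) auto
  define s where "s = Sup (d ` {0<..})"
  have ba: "bdd_above (d ` {0<..})" using d_ub by (intro bdd_aboveI[of _ "nrm f"]) auto
  obtain \<eta>1 where \<eta>1: "0 < \<eta>1" "s - \<delta> < d \<eta>1"
    using less_cSup_iff[OF _ ba, of "s - \<delta>"] \<delta> unfolding s_def by auto
  define \<eta>2 where "\<eta>2 = min \<eta> \<eta>1"
  have \<eta>2: "0 < \<eta>2" "\<eta>2 \<le> \<eta>" "s - \<delta> < d \<eta>2"
    using \<eta> \<eta>1 d_anti[of \<eta>2 \<eta>1] by (auto simp: \<eta>2_def)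
  \<comment> \<open>A quarter of \<open>\<eta>2\<close> for \<open>F0\<close>, a quarter for its
    truncation, and a half for the term to be added.\<close>
  define \<eta>3 where "\<eta>3 = \<eta>2 / 4"
  have \<eta>3: "0 < \<eta>3" using \<eta>2 by (simp add: \<eta>3_def)
  have ds: "d \<eta>3 \<le> s" unfolding s_def using \<eta>3 ba by (intro cSup_upper) auto
  have "D \<eta>3 \<noteq> {}" using D0[of \<eta>3] \<eta>3 by auto
  then obtain x where "x \<in> D \<eta>3" "x < d \<eta>3 + \<delta>"
    using cInf_lessD[of "D \<eta>3" "d \<eta>3 + \<delta>"] \<delta> unfolding d_def by auto
  then obtain F0 where F0: "structured_at k \<eta>3 F0" "nrm (\<lambda>w. f w - F0 w) < d \<eta>3 + \<delta>" by (auto simp: D_def)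
  define \<delta>' where "\<delta>' = min \<delta> \<eta>3"
  have \<delta>': "0 < \<delta>'" "\<delta>' \<le> \<delta>" "\<delta>' \<le> \<eta>3" using \<delta> \<eta>3 by (auto simp: \<delta>'_def)
  obtain F where F: "structured_at k (\<eta>3 + \<delta>') F" "\<And>w. norm (F w) \<le> 1 / 4 + \<delta>'"
    "nrm (\<lambda>w. f w - F w) \<le> nrm (\<lambda>w. f w - F0 w) + \<delta>'"
    using structured_at_truncate[OF F0(1) f \<delta>'(1), of thesis] \<eta>3 by auto
  have F': "structured_at k (\<eta>2 / 2) F" by (rule structured_at_mono[OF F(1)]) (use \<delta>' in \<open>simp add: \<eta>3_def\<close>)
  show ?thesis
  proof (rule that[of "\<eta>2 / 2" F])
    show "structured_at k \<eta> F" by (rule structured_at_mono[OF F']) (use \<eta>2 in simp)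
    show "norm (F w) \<le> 1 / 2" for w using F(2)[of w] \<delta>' \<delta> by simp
    fix E and t :: real assume E: "structured_at k (\<eta>2 / 2) E" and t: "0 \<le> t" "t \<le> 1"
    have "structured_at k (\<eta>2 / 2 + t * (\<eta>2 / 2)) (\<lambda>w. F w + of_real t * E w)"
      by (rule structured_at_add_scale[OF F' E t(1)])
    then have "structured_at k \<eta>2 (\<lambda>w. F w + of_real t * E w)"
    proof (rule structured_at_mono)
      have "t * (\<eta>2 / 2) \<le> 1 * (\<eta>2 / 2)" using t \<eta>2 by (intro mult_right_mono) auto
      then show "\<eta>2 / 2 + t * (\<eta>2 / 2) \<le> \<eta>2" by simp
    qed
    \<comment> \<open>One \<open>\<delta>\<close> comes from
      \<open>s - \<delta> < d \<eta>2\<close>, one from the choice of \<open>F0\<close>, and one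
      from the truncation.\<close>
    from d_le[OF this] show "nrm (\<lambda>w. f w - F w) \<le> nrm (\<lambda>w. f w - (F w + of_real t * E w)) + 3 * \<delta>"
      using F(3) F0(2) ds \<eta>2(3) \<delta>'(2) by linarith
  qed (use \<eta>2 in simp)
qed

text \<open>Near-minimality is tested against the dual cube \<open>E\<close> of the remainder
  \<open>u\<close> itself. The inner product of \<open>u\<close> and \<open>E\<close> is a cube
  average close to \<open>U (Suc k) u\<close>; if it were large, \<open>F + t * E\<close> would be a
  distinctly better approximation.\<close>

lemma decomposition:
  assumes f: "f \<in> A" "\<And>w. Im (f w) = 0" "\<And>w. norm (f w) \<le> 1 / 4"
    and \<eta>: "0 < \<eta>" and r: "0 < r"
  obtains F where "structured_at k \<eta> F" "real_bdd (\<lambda>w. f w - F w)" "U (Suc k) (\<lambda>w. f w - F w) \<le> r"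
proof -
  \<comment> \<open>The variation below yields \<open>Re (ip u E) \<le> 11 * t\<close>, and the
    approximation of \<open>U\<close> adds \<open>t\<close>. The choice
    \<open>\<delta> = t\<^sup>2\<close> makes the defect of the minimizer of second order in
    \<open>t\<close>.\<close>
  define t where "t = min (r / 13) (1 / 2)"
  have t: "0 < t" "t \<le> 1 / 2" "13 * t \<le> r" using r by (auto simp: t_def min_def)
  define \<delta> where "\<delta> = t\<^sup>2"
  have "t\<^sup>2 \<le> (1 / 2)\<^sup>2" using t by (intro power_mono) auto
  then have \<delta>: "0 < \<delta>" "\<delta> \<le> 1 / 4" using t by (auto simp: \<delta>_def power_divide)
  obtain F \<eta>0 where \<eta>0: "0 < \<eta>0" and F: "structured_at k \<eta> F" "\<And>w. norm (F w) \<le> 1 / 2"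
    and min: "\<And>E t. structured_at k \<eta>0 E \<Longrightarrow> 0 \<le> t \<Longrightarrow> t \<le> 1 \<Longrightarrow>
      nrm (\<lambda>w. f w - F w) \<le> nrm (\<lambda>w. f w - (F w + of_real t * E w)) + 3 * \<delta>"
    using near_minimizer[OF f \<eta> \<delta>, of k thesis] by blast
  define u where "u = (\<lambda>w. f w - F w)"
  have FA: "F \<in> A" using F by (simp add: structured_at_def)
  have uA: "u \<in> A" unfolding u_def by (intro A_intros f FA)
  have ub: "norm (u w) \<le> 1" for w
    using norm_triangle_ineq4[of "f w" "F w"] f(3)[of w] F(2)[of w] by (simp add: u_def)
  have u: "real_bdd u" unfolding real_bdd_def unit_bdd_def using uA ub f(2) F(1)
    by (auto simp: structured_at_def u_def)
  have u1: "nrm u \<le> 1" by (rule nrm_le_bdd[OF uA ub])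
  obtain N where N: "\<And>W. lattice_folner (Suc k) N W \<Longrightarrow> structured_at k \<eta>0 (dual_cube (Suc k) W u)"
    using structured_at_dual_cube[OF u \<eta>0] by blast
  obtain N' where N': "\<And>W. lattice_folner (Suc k) N' W \<Longrightarrow> \<bar>cube_avg (Suc k) W u - U (Suc k) u\<bar> \<le> t"
    using U_approx[OF u t(1)] by blast
  obtain W where "lattice_folner (Suc k) (max N N') W" using lattice_folner_exists by blast
  then have W: "lattice_folner (Suc k) N W" "lattice_folner (Suc k) N' W"
    by (auto intro: lattice_folner_antimono[rotated])
  define E where "E = dual_cube (Suc k) W u"
  have EA: "E \<in> A" unfolding E_def by (rule dual_cube_A[OF uA])
  have E1: "nrm E \<le> 1" unfolding E_def by (rule dual_cube_bound[OF u W(1)])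
  define y where "y = nrm (\<lambda>w. u w - of_real t * E w)"
  have "nrm (\<lambda>w. f w - (F w + of_real t * E w)) = y" by (simp add: y_def u_def algebra_simps)
  then have uy: "nrm u \<le> y + 3 * \<delta>"
    using min[OF N[OF W(1)], of t] t unfolding E_def u_def[symmetric] by simp
  have y0: "0 \<le> y" unfolding y_def by (intro nrm_ge_0 A_intros uA EA)
  have "y \<le> nrm u + t * nrm E"
    unfolding y_def using nrm_triangle_diff[OF uA scale_A[OF EA, of "of_real t"]] nrm_scale[OF EA, of "of_real t"] t by simp
  also have "\<dots> \<le> 1 + 1 * 1" using u1 E1 t EA by (intro add_mono mult_mono) auto
  finally have y2: "y \<le> 2" by simp
  have ysq: "y\<^sup>2 = (nrm u)\<^sup>2 - 2 * t * Re (ip u E) + t\<^sup>2 * (nrm E)\<^sup>2"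
    unfolding y_def using uA EA t by (simp add: nrm_diff_square scale_A nrm_scale ip_scale_right power_mult_distrib)
  have "(nrm u)\<^sup>2 \<le> (y + 3 * \<delta>)\<^sup>2" using uy uA by (intro power_mono) auto
  also have "\<dots> = y\<^sup>2 + 6 * (\<delta> * y) + 9 * (\<delta> * \<delta>)" by (simp add: power2_eq_square algebra_simps)
  also have "\<dots> \<le> y\<^sup>2 + 6 * (\<delta> * 2) + 9 * (\<delta> * 1)"
    using y2 \<delta> by (intro add_mono mult_left_mono) auto
  finally have "2 * t * Re (ip u E) \<le> t\<^sup>2 * (nrm E)\<^sup>2 + 21 * t\<^sup>2" using ysq by (simp add: \<delta>_def)
  also have "t\<^sup>2 * (nrm E)\<^sup>2 \<le> t\<^sup>2 * 1" using E1 EA by (intro mult_left_mono power_le_one) auto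
  finally have "t * Re (ip u E) \<le> t * (11 * t)" by (simp add: power2_eq_square)
  then have "Re (ip u E) \<le> 11 * t" using t by simp
  moreover have "Re (ip u E) = cube_avg (Suc k) W u"
    using cube_avg_eq_ip[OF u] ip_cnj[OF EA uA] by (simp add: E_def)
  ultimately have "U (Suc k) u \<le> r" using N'[OF W(2)] t by linarith
  then show ?thesis using that F(1) u unfolding u_def by blast
qed

text \<open>General weights along a filter let one induction serve twice: with a phase, to show that
  averages vanish, and with \<open>diff_weight\<close>, to show that they are Cauchy.\<close>

definition wavg :: "('n \<Rightarrow> nat set) \<Rightarrow> ('n \<Rightarrow> nat \<Rightarrow> complex) \<Rightarrow> nat \<Rightarrow> (nat \<Rightarrow> 'w \<Rightarrow> complex) \<Rightarrow> 'n \<Rightarrow> 'w \<Rightarrow> complex" where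
  "wavg s \<mu> k f n = (\<lambda>w. \<Sum>l\<in>s n. \<mu> n l * linprod k f (int l) w)"

definition null_weights :: "'n filter \<Rightarrow> ('n \<Rightarrow> nat set) \<Rightarrow> ('n \<Rightarrow> nat \<Rightarrow> complex) \<Rightarrow> nat \<Rightarrow> bool" where
  "null_weights \<F> s \<mu> k \<longleftrightarrow> (\<forall>f. (\<forall>j\<in>{1..k}. unit_bdd (f j)) \<longrightarrow> ((\<lambda>n. nrm (wavg s \<mu> k f n)) \<longlongrightarrow> 0) \<F>)"

lemma wavg_A: "(\<And>j. j \<in> {1..k} \<Longrightarrow> f j \<in> A) \<Longrightarrow> wavg s \<mu> k f n \<in> A"
  unfolding wavg_def by (intro A_intros linprod_A) auto

lemma null_weights_bounded:
  assumes null: "null_weights \<F> s \<mu> k" and f: "\<And>j. j \<in> {1..k} \<Longrightarrow> f j \<in> A"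
  shows "((\<lambda>n. nrm (wavg s \<mu> k f n)) \<longlongrightarrow> 0) \<F>"
proof -
  obtain C where C: "1 \<le> C" "\<And>j w. j \<in> {1..k} \<Longrightarrow> norm (f j w) \<le> C"
    using finite_bound_A[of "{1..k}" f] f by blast
  define g where "g j w = f j w / of_real C" for j w
  have g: "unit_bdd (g j)" if "j \<in> {1..k}" for j
    using C(1) C(2)[OF that] f[OF that] by (auto simp: unit_bdd_def g_def[abs_def] norm_divide intro: divide_A)
  have "linprod k f l w = of_real C ^ k * linprod k g l w" for l w
    using C(1) by (simp add: linprod_def g_def[abs_def] S_simps S_const prod_dividef)
  then have "wavg s \<mu> k f n = (\<lambda>w. of_real C ^ k * wavg s \<mu> k g n w)" for n
    by (simp add: wavg_def sum_distrib_left mult.left_commute)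
  then have "nrm (wavg s \<mu> k f n) = C ^ k * nrm (wavg s \<mu> k g n)" for n
    using C(1) nrm_scale[OF wavg_A[of k g s \<mu> n], of "of_real C ^ k"] g by (simp add: norm_power unit_bddD)
  moreover have "((\<lambda>n. C ^ k * nrm (wavg s \<mu> k g n)) \<longlongrightarrow> C ^ k * 0) \<F>"
    using null g unfolding null_weights_def by (intro tendsto_mult tendsto_const) blast
  ultimately show ?thesis by simp
qed

text \<open>In a generator the factor \<open>b\<close> does not depend on \<open>l\<close> and
  leaves the sum, while the \<open>g j\<close> are absorbed into the \<open>f j\<close>; a weighted
  sum with \<open>k\<close> functions remains.\<close>

lemma null_weights_reps:
  assumes null: "null_weights \<F> s \<mu> k" and f: "\<And>j. j \<in> {1..k} \<Longrightarrow> f j \<in> A" and \<rho>: "\<rho> \<in> reps k"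
  shows "((\<lambda>n. nrm (\<lambda>w. \<Sum>l\<in>s n. \<mu> n l * linprod k f (int l) w * \<rho> (int l) w)) \<longlongrightarrow> 0) \<F>"
  using \<rho>
proof (induction rule: reps.induct)
  case (reps_term b g)
  obtain C where C: "\<And>w. norm (b w) \<le> C" using bdd_A[OF reps_term(1)] by blast
  let ?h = "\<lambda>j w. f j w * g j w"
  have hA: "wavg s \<mu> k ?h n \<in> A" for n using f reps_term by (intro wavg_A mult_A) auto
  have "(\<lambda>w. \<Sum>l\<in>s n. \<mu> n l * linprod k f (int l) w * (b w * linprod k g (int l) w)) = (\<lambda>w. b w * wavg s \<mu> k ?h n w)" for n
    by (simp add: wavg_def linprod_mult sum_distrib_left mult_ac)
  then have le: "nrm (\<lambda>w. \<Sum>l\<in>s n. \<mu> n l * linprod k f (int l) w * (b w * linprod k g (int l) w)) \<le> C * nrm (wavg s \<mu> k ?h n)" for n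
    using nrm_mult_bdd[OF reps_term(1) hA C] by simp
  have "((\<lambda>n. C * nrm (wavg s \<mu> k ?h n)) \<longlongrightarrow> C * 0) \<F>"
    using f reps_term by (intro tendsto_mult tendsto_const null_weights_bounded[OF null] mult_A) auto
  then have "((\<lambda>n. C * nrm (wavg s \<mu> k ?h n)) \<longlongrightarrow> 0) \<F>" by simp
  then show ?case
    by (rule tendsto_0_squeeze[rotated 2]) (auto intro!: le nrm_ge_0 A_intros linprod_A f reps_term)
next
  case (reps_add \<rho> \<rho>')
  let ?a = "\<lambda>\<rho> n w. \<Sum>l\<in>s n. \<mu> n l * linprod k f (int l) w * \<rho> (int l) w"
  have A: "?a \<rho> n \<in> A" "?a \<rho>' n \<in> A" for n
    by (auto intro!: A_intros linprod_A f reps_A[OF reps_add.hyps(1)] reps_A[OF reps_add.hyps(2)])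
  have eq: "?a (\<lambda>l w. \<rho> l w + \<rho>' l w) n = (\<lambda>w. ?a \<rho> n w + ?a \<rho>' n w)" for n
    by (simp add: distrib_left sum.distrib)
  have "((\<lambda>n. nrm (?a \<rho> n) + nrm (?a \<rho>' n)) \<longlongrightarrow> 0 + 0) \<F>" by (intro tendsto_add reps_add.IH)
  then have "((\<lambda>n. nrm (?a \<rho> n) + nrm (?a \<rho>' n)) \<longlongrightarrow> 0) \<F>" by simp
  then show ?case unfolding eq
    by (rule tendsto_0_squeeze[rotated 2]) (intro nrm_triangle nrm_ge_0 add_A A)+
qed

definition wavg_last :: "('n \<Rightarrow> nat set) \<Rightarrow> ('n \<Rightarrow> nat \<Rightarrow> complex) \<Rightarrow> nat \<Rightarrow> (nat \<Rightarrow> 'w \<Rightarrow> complex) \<Rightarrow> ('w \<Rightarrow> complex) \<Rightarrow> 'n \<Rightarrow> 'w \<Rightarrow> complex" where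
  "wavg_last s \<mu> k f v n = (\<lambda>w. \<Sum>l\<in>s n. \<mu> n l * linprod k f (int l) w * S (int (Suc k) * int l) v w)"

lemma wavg_last_A: "(\<And>j. j \<in> {1..k} \<Longrightarrow> f j \<in> A) \<Longrightarrow> v \<in> A \<Longrightarrow> wavg_last s \<mu> k f v n \<in> A"
  unfolding wavg_last_def by (intro A_intros linprod_A) auto

lemma wavg_eq_last: "wavg s \<mu> (Suc k) f n = wavg_last s \<mu> k f (f (Suc k)) n"
  unfolding wavg_def wavg_last_def by (simp only: linprod_Suc mult.assoc)

text \<open>Of the two parts given by \<open>decomposition\<close>, the remainder is estimated by
  \<open>ctrl\<close> and the structured part by the case of \<open>k\<close> functions.\<close>

lemma wavg_last_real:
  assumes null: "null_weights \<F> s \<mu> k"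
    and l1: "\<And>n. (\<Sum>l\<in>s n. norm (\<mu> n l)) \<le> 2"
    and ctrl: "\<And>\<epsilon>. 0 < \<epsilon> \<Longrightarrow> \<exists>C\<ge>0. \<forall>f. (\<forall>j\<in>{1..Suc k}. unit_bdd (f j)) \<longrightarrow> real_bdd (f (Suc k)) \<longrightarrow>
       (\<forall>\<^sub>F n in \<F>. nrm (wavg s \<mu> (Suc k) f n) \<le> \<epsilon> + C * U (Suc k) (f (Suc k)))"
    and f: "\<And>j. j \<in> {1..k} \<Longrightarrow> unit_bdd (f j)"
    and v: "v \<in> A" "\<And>w. Im (v w) = 0" "\<And>w. norm (v w) \<le> 1 / 4"
  shows "((\<lambda>n. nrm (wavg_last s \<mu> k f v n)) \<longlongrightarrow> 0) \<F>"
\<comment> \<open>Twice \<open>\<epsilon>\<close> for the remainder, twice \<open>\<epsilon>\<close>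
  for the error of the representation under weights of total size at most \<open>2\<close>, once
  \<open>\<epsilon>\<close> for the vanishing sum.\<close>
proof (rule tendsto_0_of_le[where c = 5])
  have fA: "f j \<in> A" if "j \<in> {1..k}" for j using f[OF that] by (rule unit_bddD)
  show "0 \<le> nrm (wavg_last s \<mu> k f v n)" for n by (intro nrm_ge_0 wavg_last_A fA v)
  fix \<epsilon> :: real assume \<epsilon>: "0 < \<epsilon>"
  obtain C where C: "0 \<le> C" "\<And>f. (\<forall>j\<in>{1..Suc k}. unit_bdd (f j)) \<Longrightarrow> real_bdd (f (Suc k)) \<Longrightarrow>
       (\<forall>\<^sub>F n in \<F>. nrm (wavg s \<mu> (Suc k) f n) \<le> \<epsilon> + C * U (Suc k) (f (Suc k)))"
    using ctrl[OF \<epsilon>] by blast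
  have "0 < \<epsilon> / (C + 1)" using C \<epsilon> by simp
  then obtain F where F: "structured_at k \<epsilon> F" and u: "real_bdd (\<lambda>w. v w - F w)" and Uu: "U (Suc k) (\<lambda>w. v w - F w) \<le> \<epsilon> / (C + 1)"
    using decomposition[OF v \<epsilon>] by blast
  define u where "u = (\<lambda>w. v w - F w)"
  have uA: "u \<in> A" unfolding u_def by (rule real_bddD[OF u])
  obtain \<rho> where FA: "F \<in> A" and \<rho>: "\<rho> \<in> reps k" "\<And>l. nrm (\<lambda>w. S (int (Suc k) * l) F w - \<rho> l w) \<le> \<epsilon>"
    using F unfolding structured_at_def by blast
  have uev: "\<forall>\<^sub>F n in \<F>. nrm (wavg_last s \<mu> k f u n) \<le> 2 * \<epsilon>"
  proof -
    define g where "g j = (if j \<le> k then f j else u)" for j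
    have "\<forall>\<^sub>F n in \<F>. nrm (wavg s \<mu> (Suc k) g n) \<le> \<epsilon> + C * U (Suc k) (g (Suc k))"
      using f u by (intro C) (auto simp: g_def u_def dest: real_bddD(1))
    moreover have "linprod k g l = linprod k f l" for l
      unfolding linprod_def by (intro ext prod.cong) (auto simp: g_def)
    then have "wavg s \<mu> (Suc k) g n = wavg_last s \<mu> k f u n" for n
      unfolding wavg_eq_last by (simp add: wavg_last_def g_def)
    moreover have "C * U (Suc k) (g (Suc k)) \<le> \<epsilon>"
    proof -
      have "C * U (Suc k) u \<le> C * (\<epsilon> / (C + 1))" using Uu C unfolding u_def by (intro mult_left_mono)
      also have "\<dots> = \<epsilon> * (C / (C + 1))" by simp
      also have "\<dots> \<le> \<epsilon> * 1" using C \<epsilon> by (intro mult_left_mono) auto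
      finally show ?thesis by (simp add: g_def)
    qed
    ultimately show ?thesis by (auto elim!: eventually_mono)
  qed
  let ?R = "\<lambda>n w. \<Sum>l\<in>s n. \<mu> n l * linprod k f (int l) w * \<rho> (int l) w"
  have RA: "?R n \<in> A" for n by (intro A_intros linprod_A fA reps_A[OF \<rho>(1)])
  have Fle: "nrm (wavg_last s \<mu> k f F n) \<le> 2 * \<epsilon> + nrm (?R n)" for n
  proof -
    define d where "d l = (\<lambda>w. S (int (Suc k) * int l) F w - \<rho> (int l) w)" for l
    have dA: "d l \<in> A" for l unfolding d_def by (intro A_intros FA reps_A[OF \<rho>(1)])
    have "wavg_last s \<mu> k f F n = (\<lambda>w. (\<Sum>l\<in>s n. \<mu> n l * (linprod k f (int l) w * d l w)) + ?R n w)"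
      by (simp add: wavg_last_def d_def right_diff_distrib sum_subtractf mult.assoc del: of_nat_Suc)
    then have "nrm (wavg_last s \<mu> k f F n) \<le> nrm (\<lambda>w. \<Sum>l\<in>s n. \<mu> n l * (linprod k f (int l) w * d l w)) + nrm (?R n)"
      by (simp only:) (intro nrm_triangle RA A_intros linprod_A fA dA)
    also have "nrm (\<lambda>w. \<Sum>l\<in>s n. \<mu> n l * (linprod k f (int l) w * d l w)) \<le> (\<Sum>l\<in>s n. nrm (\<lambda>w. \<mu> n l * (linprod k f (int l) w * d l w)))"
      by (intro nrm_sum A_intros linprod_A fA dA)
    also have "\<dots> \<le> (\<Sum>l\<in>s n. norm (\<mu> n l) * \<epsilon>)"
    proof (rule sum_mono)
      fix l
      have "nrm (\<lambda>w. linprod k f (int l) w * d l w) \<le> 1 * nrm (d l)"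
        by (intro nrm_mult_bdd linprod_A fA dA unit_bddD(2)[OF linprod_unit_bdd] f)
      also have "nrm (d l) \<le> \<epsilon>" unfolding d_def by (rule \<rho>(2))
      finally have "nrm (\<lambda>w. linprod k f (int l) w * d l w) \<le> \<epsilon>" by simp
      then show "nrm (\<lambda>w. \<mu> n l * (linprod k f (int l) w * d l w)) \<le> norm (\<mu> n l) * \<epsilon>"
        by (subst nrm_scale) (auto intro!: mult_left_mono mult_A linprod_A fA dA)
    qed
    also have "\<dots> \<le> 2 * \<epsilon>" unfolding sum_distrib_right[symmetric] using l1 \<epsilon> by (intro mult_right_mono) auto
    finally show ?thesis by simp
  qed
  have "((\<lambda>n. nrm (?R n)) \<longlongrightarrow> 0) \<F>" by (rule null_weights_reps[OF null fA \<rho>(1)])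
  then have "\<forall>\<^sub>F n in \<F>. nrm (?R n) < \<epsilon>" using \<epsilon> by (rule order_tendstoD)
  with uev show "\<forall>\<^sub>F n in \<F>. nrm (wavg_last s \<mu> k f v n) \<le> 5 * \<epsilon>"
  proof eventually_elim
    case (elim n)
    have "wavg_last s \<mu> k f v n = (\<lambda>w. wavg_last s \<mu> k f u n w + wavg_last s \<mu> k f F n w)"
      by (simp add: wavg_last_def u_def S_simps right_diff_distrib sum_subtractf)
    then have "nrm (wavg_last s \<mu> k f v n) \<le> nrm (wavg_last s \<mu> k f u n) + nrm (wavg_last s \<mu> k f F n)"
      by (simp only:) (intro nrm_triangle wavg_last_A fA uA FA)
    then show ?case using elim Fle[of n] by linarith
  qed
qed simp

lemma null_weights_Suc:
  assumes null: "null_weights \<F> s \<mu> k"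
    and l1: "\<And>n. (\<Sum>l\<in>s n. norm (\<mu> n l)) \<le> 2"
    and ctrl: "\<And>\<epsilon>. 0 < \<epsilon> \<Longrightarrow> \<exists>C\<ge>0. \<forall>f. (\<forall>j\<in>{1..Suc k}. unit_bdd (f j)) \<longrightarrow> real_bdd (f (Suc k)) \<longrightarrow>
       (\<forall>\<^sub>F n in \<F>. nrm (wavg s \<mu> (Suc k) f n) \<le> \<epsilon> + C * U (Suc k) (f (Suc k)))"
  shows "null_weights \<F> s \<mu> (Suc k)"
  unfolding null_weights_def
proof (intro allI impI)
  fix f assume f: "\<forall>j\<in>{1..Suc k}. unit_bdd (f j)"
  define v where "v = f (Suc k)"
  have vA: "v \<in> A" and v1: "\<And>w. norm (v w) \<le> 1" using f unit_bddD unfolding v_def by auto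
  \<comment> \<open>Real and imaginary part, scaled to the bound \<open>1/4\<close> for which
    \<open>decomposition\<close> keeps the remainder bounded by \<open>1\<close>.\<close>
  define v1 where "v1 w = complex_of_real (Re (v w)) / 4" for w
  define v2 where "v2 w = complex_of_real (Re (- \<i> * v w)) / 4" for w
  have A: "v1 \<in> A" "v2 \<in> A" unfolding v1_def[abs_def] v2_def[abs_def] by (intro divide_A Re_A scale_A vA)+
  have fA: "f j \<in> A" if "j \<in> {1..k}" for j using f that by (intro unit_bddD(1)) auto
  have split: "v w = 4 * v1 w + 4 * \<i> * v2 w" for w by (simp add: v1_def v2_def complex_eq_iff)
  have b: "norm (v1 w) \<le> 1 / 4" "norm (v2 w) \<le> 1 / 4" for w
    using abs_Re_le_cmod[of "v w"] abs_Re_le_cmod[of "- \<i> * v w"] v1[of w]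
    by (auto simp: v1_def v2_def norm_divide norm_mult)
  have t: "((\<lambda>n. nrm (wavg_last s \<mu> k f v' n)) \<longlongrightarrow> 0) \<F>" if "v' \<in> {v1, v2}" for v'
    using that f b A by (intro wavg_last_real[OF null l1 ctrl]) (auto simp: v1_def v2_def)
  have "wavg_last s \<mu> k f v n = (\<lambda>w. 4 * wavg_last s \<mu> k f v1 n w + 4 * \<i> * wavg_last s \<mu> k f v2 n w)" for n
  proof
    fix w
    have "S m v w = 4 * S m v1 w + 4 * \<i> * S m v2 w" for m using split by (simp add: S_def)
    then show "wavg_last s \<mu> k f v n w = 4 * wavg_last s \<mu> k f v1 n w + 4 * \<i> * wavg_last s \<mu> k f v2 n w"
      by (simp add: wavg_last_def sum_distrib_left sum.distrib[symmetric] algebra_simps del: of_nat_Suc)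
  qed
  moreover have wA: "wavg_last s \<mu> k f v1 n \<in> A" "wavg_last s \<mu> k f v2 n \<in> A" for n
    by (rule wavg_last_A[OF fA A(1)], simp, rule wavg_last_A[OF fA A(2)], simp)
  ultimately have le: "nrm (wavg_last s \<mu> k f v n) \<le> 4 * nrm (wavg_last s \<mu> k f v1 n) + 4 * nrm (wavg_last s \<mu> k f v2 n)" for n
    using nrm_triangle[OF scale_A[OF wA(1)[of n], of 4] scale_A[OF wA(2)[of n], of "4 * \<i>"]]
      nrm_scale[OF wA(1)[of n], of 4] nrm_scale[OF wA(2)[of n], of "4 * \<i>"]
    by (simp add: norm_mult)
  have "((\<lambda>n. 4 * nrm (wavg_last s \<mu> k f v1 n) + 4 * nrm (wavg_last s \<mu> k f v2 n)) \<longlongrightarrow> 4 * 0 + 4 * 0) \<F>"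
    by (intro tendsto_intros t) auto
  then have "((\<lambda>n. 4 * nrm (wavg_last s \<mu> k f v1 n) + 4 * nrm (wavg_last s \<mu> k f v2 n)) \<longlongrightarrow> 0) \<F>" by simp
  then show "((\<lambda>n. nrm (wavg s \<mu> (Suc k) f n)) \<longlongrightarrow> 0) \<F>"
    unfolding wavg_eq_last v_def[symmetric]
    by (rule tendsto_0_squeeze[rotated 2]) (intro le nrm_ge_0 wavg_last_A fA vA; simp)+
qed

end

section \<open>Convergence of multiple averages\<close>

context cubic_mean
begin

lemma wavg_phase: "wavg (\<lambda>L. {1..L}) (\<lambda>L l. z ^ l / of_nat L) k f L = lavg z k f L"
  by (simp add: wavg_def lavg_def sum_divide_distrib)

text \<open>The seminorm of order \<open>1\<close> does not control averages with a phase, so the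
  case \<open>k = 1\<close> enters as the hypothesis \<open>null1\<close>, to be supplied by the
  spectrum. From \<open>k = 2\<close> on, \<open>controlled_Suc\<close> admits every phase.\<close>

theorem lavg_null:
  assumes z: "norm z = 1" and k: "0 < k"
    and null1: "\<And>u. unit_bdd u \<Longrightarrow> (\<lambda>L. nrm (lavg z 1 (\<lambda>_. u) L)) \<longlonglongrightarrow> 0"
  shows "null_weights sequentially (\<lambda>L. {1..L}) (\<lambda>L l. z ^ l / of_nat L) k"
  using k
proof (induction k rule: nat_induct_non_zero)
  case 1
  show ?case unfolding null_weights_def wavg_phase
  proof (intro allI impI)
    fix f :: "nat \<Rightarrow> 'w \<Rightarrow> complex" assume "\<forall>j\<in>{1..1}. unit_bdd (f j)"
    moreover have "lavg z 1 f L = lavg z 1 (\<lambda>_. f 1) L" for L by (simp add: lavg_def linprod_def)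
    ultimately show "(\<lambda>L. nrm (lavg z 1 f L)) \<longlonglongrightarrow> 0" using null1[of "f 1"] by simp
  qed
next
  case (Suc k)
  show ?case
  proof (rule null_weights_Suc[OF Suc.IH])
    fix L show "(\<Sum>l\<in>{1..L}. norm (z ^ l / of_nat L)) \<le> 2"
      using z by (simp add: norm_divide norm_power)
  next
    fix \<epsilon> :: real assume "0 < \<epsilon>"
    then show "\<exists>C\<ge>0. \<forall>f. (\<forall>j\<in>{1..Suc k}. unit_bdd (f j)) \<longrightarrow> real_bdd (f (Suc k)) \<longrightarrow>
       (\<forall>\<^sub>F n in sequentially. nrm (wavg (\<lambda>L. {1..L}) (\<lambda>L l. z ^ l / of_nat L) (Suc k) f n) \<le> \<epsilon> + C * U (Suc k) (f (Suc k)))"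
      using controlled_Suc[OF controlled_no_phase[OF Suc.hyps] Suc.hyps z] unfolding controlled_def wavg_phase by blast
  qed
qed

text \<open>The weights of the difference of two averages, of lengths \<open>fst p\<close> and
  \<open>snd p\<close>. Their absolute values sum to at most \<open>2\<close>, whence the bound in
  \<open>null_weights_Suc\<close>.\<close>

definition diff_weight :: "nat \<times> nat \<Rightarrow> nat \<Rightarrow> complex" where
  "diff_weight p l = (if l \<le> fst p then 1 / of_nat (fst p) else 0) - (if l \<le> snd p then 1 / of_nat (snd p) else 0)"

lemma sum_cutoff:
  fixes x :: "nat \<Rightarrow> complex"
  assumes "m \<le> n"
  shows "(\<Sum>l\<in>{1..n}. (if l \<le> m then 1 / of_nat m else 0) * x l) = (\<Sum>l\<in>{1..m}. x l) / of_nat m"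
proof -
  have "(\<Sum>l\<in>{1..n}. (if l \<le> m then 1 / of_nat m else 0) * x l) = (\<Sum>l\<in>{1..m}. x l / of_nat m)"
    by (rule sum.mono_neutral_cong_right) (use assms in auto)
  then show ?thesis by (simp add: sum_divide_distrib)
qed

lemma wavg_diff: "wavg (\<lambda>p. {1..max (fst p) (snd p)}) diff_weight k f p = (\<lambda>w. lavg 1 k f (fst p) w - lavg 1 k f (snd p) w)"
  unfolding wavg_def lavg_def diff_weight_def left_diff_distrib sum_subtractf
  by (subst (1 2) sum_cutoff) auto

text \<open>The induction can start at \<open>k = 0\<close>, where both averages equal
  \<open>1\<close>; the mean ergodic theorem is its first step.\<close>

theorem lavg_Cauchy:
  assumes f: "\<And>j. j \<in> {1..k} \<Longrightarrow> unit_bdd (f j)"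
  shows "((\<lambda>p. nrm (\<lambda>w. lavg 1 k f (fst p) w - lavg 1 k f (snd p) w)) \<longlongrightarrow> 0) (sequentially \<times>\<^sub>F sequentially)"
proof -
  let ?\<F> = "(sequentially \<times>\<^sub>F sequentially) :: (nat \<times> nat) filter"
  have fst: "\<forall>\<^sub>F p in ?\<F>. P (fst p)" and snd: "\<forall>\<^sub>F p in ?\<F>. P (snd p)" if "eventually P sequentially" for P
    using that filterlim_fst[of sequentially sequentially] filterlim_snd[of sequentially sequentially]
    by (auto simp: filterlim_iff)
  have "null_weights ?\<F> (\<lambda>p. {1..max (fst p) (snd p)}) diff_weight k"
  proof (induction k)
    case 0
    show ?case unfolding null_weights_def wavg_diff
    proof (intro allI impI)
      fix f :: "nat \<Rightarrow> 'w \<Rightarrow> complex"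
      have one: "lavg 1 0 f L = (\<lambda>w. 1)" if "0 < L" for L using that by (simp add: lavg_def linprod_def)
      have "\<forall>\<^sub>F p in ?\<F>. 0 < fst p" "\<forall>\<^sub>F p in ?\<F>. 0 < snd p"
        by (intro fst snd eventually_gt_at_top)+
      then have "\<forall>\<^sub>F p in ?\<F>. nrm (\<lambda>w. lavg 1 0 f (fst p) w - lavg 1 0 f (snd p) w) = 0"
        by eventually_elim (simp add: one nrm_zero)
      then show "((\<lambda>p. nrm (\<lambda>w. lavg 1 0 f (fst p) w - lavg 1 0 f (snd p) w)) \<longlongrightarrow> 0) ?\<F>"
        by (rule tendsto_eventually)
    qed
  next
    case (Suc k)
    show ?case
    proof (rule null_weights_Suc[OF Suc.IH])
      fix p :: "nat \<times> nat"
      have "(\<Sum>l\<in>{1..n}. norm (if l \<le> m then 1 / of_nat m else 0 :: complex)) \<le> 1" if "m \<le> n" for m n :: nat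
      proof -
        have "(\<Sum>l\<in>{1..n}. norm (if l \<le> m then 1 / of_nat m else 0 :: complex)) = (\<Sum>l\<in>{1..m}. 1 / real m)"
          by (rule sum.mono_neutral_cong_right) (use that in \<open>auto simp: norm_divide\<close>)
        then show ?thesis by simp
      qed
      note this[of "fst p" "max (fst p) (snd p)"] this[of "snd p" "max (fst p) (snd p)"]
      moreover have "(\<Sum>l\<in>{1..max (fst p) (snd p)}. norm (diff_weight p l)) \<le>
        (\<Sum>l\<in>{1..max (fst p) (snd p)}. norm (if l \<le> fst p then 1 / of_nat (fst p) else 0 :: complex)
           + norm (if l \<le> snd p then 1 / of_nat (snd p) else 0 :: complex))"
        unfolding diff_weight_def by (intro sum_mono norm_triangle_ineq4)
      ultimately show "(\<Sum>l\<in>{1..max (fst p) (snd p)}. norm (diff_weight p l)) \<le> 2"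
        unfolding sum.distrib by simp
    next
      fix \<epsilon> :: real assume \<epsilon>: "0 < \<epsilon>"
      have c: "controlled 1 (Suc k)" by (rule controlled_no_phase) simp
      have "0 < \<epsilon> / 2" using \<epsilon> by simp
      then obtain C where C: "0 \<le> C" "\<And>f. (\<forall>j\<in>{1..Suc k}. unit_bdd (f j)) \<Longrightarrow> real_bdd (f (Suc k)) \<Longrightarrow>
         (\<forall>\<^sub>F L in sequentially. nrm (lavg 1 (Suc k) f L) \<le> \<epsilon> / 2 + C * U (Suc k) (f (Suc k)))"
        using c unfolding controlled_def by blast
      show "\<exists>C\<ge>0. \<forall>f. (\<forall>j\<in>{1..Suc k}. unit_bdd (f j)) \<longrightarrow> real_bdd (f (Suc k)) \<longrightarrow>
         (\<forall>\<^sub>F p in ?\<F>. nrm (wavg (\<lambda>p. {1..max (fst p) (snd p)}) diff_weight (Suc k) f p) \<le> \<epsilon> + C * U (Suc k) (f (Suc k)))"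
      proof (intro exI[of _ "2 * C"] conjI allI impI)
        fix f assume f: "\<forall>j\<in>{1..Suc k}. unit_bdd (f j)" "real_bdd (f (Suc k))"
        have A: "lavg 1 (Suc k) f L \<in> A" for L using f by (intro lavg_A unit_bddD(1)) auto
        note ev = C(2)[OF f]
        show "\<forall>\<^sub>F p in ?\<F>. nrm (wavg (\<lambda>p. {1..max (fst p) (snd p)}) diff_weight (Suc k) f p) \<le> \<epsilon> + 2 * C * U (Suc k) (f (Suc k))"
          using fst[OF ev] snd[OF ev]
        proof eventually_elim
          case (elim p)
          have "nrm (wavg (\<lambda>p. {1..max (fst p) (snd p)}) diff_weight (Suc k) f p) \<le>
             nrm (lavg 1 (Suc k) f (fst p)) + nrm (lavg 1 (Suc k) f (snd p))"
            unfolding wavg_diff by (intro nrm_triangle_diff A)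
          then show ?case using elim by linarith
        qed
      qed (use C in simp)
    qed
  qed
  then show ?thesis using f unfolding null_weights_def wavg_diff by blast
qed

end

section \<open>The mean ergodic theorem with a phase\<close>

context invariant_mean
begin

definition orbit_avg :: "complex \<Rightarrow> ('w \<Rightarrow> complex) \<Rightarrow> nat \<Rightarrow> 'w \<Rightarrow> complex" where
  "orbit_avg z u L = (\<lambda>w. (\<Sum>l\<in>{1..L}. z ^ l * S (int l) u w) / of_nat L)"

lemma orbit_avg_A: "u \<in> A \<Longrightarrow> orbit_avg z u L \<in> A"
  unfolding orbit_avg_def by (intro A_intros)

lemma orbit_avg_shifted:
  assumes u: "unit_bdd u" and z: "norm z = 1" and R: "0 < R"
  shows "nrm (\<lambda>w. orbit_avg z u R w - z ^ s * S (int s) (orbit_avg z u R) w) \<le> 2 * real s / real R"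
proof (rule nrm_le_bdd)
  show "(\<lambda>w. orbit_avg z u R w - z ^ s * S (int s) (orbit_avg z u R) w) \<in> A"
    by (intro A_intros orbit_avg_A unit_bddD u)
  fix w
  have "z ^ s * S (int s) (orbit_avg z u R) w = (\<Sum>l\<in>{1..R}. z ^ (l + s) * S (int (l + s)) u w) / of_nat R"
    by (simp add: orbit_avg_def S_simps sum_distrib_left power_add mult_ac add.commute)
  then have "norm (orbit_avg z u R w - z ^ s * S (int s) (orbit_avg z u R) w) =
    norm ((\<Sum>l\<in>{1..R}. z ^ l * S (int l) u w) - (\<Sum>l\<in>{1..R}. z ^ (l + s) * S (int (l + s)) u w)) / R"
    by (simp add: orbit_avg_def diff_divide_distrib[symmetric] norm_divide)
  also have "\<dots> \<le> 2 * real s / R"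
  proof (rule divide_right_mono)
    have "norm (z ^ l * S (int l) u w) \<le> 1" for l
      using unit_bddD(2)[OF unit_bdd_S[OF u]] z by (simp add: norm_mult norm_power)
    then show "norm ((\<Sum>l\<in>{1..R}. z ^ l * S (int l) u w) - (\<Sum>l\<in>{1..R}. z ^ (l + s) * S (int (l + s)) u w)) \<le> 2 * real s"
      by (rule norm_sum_shift_le)
  qed simp
  finally show "norm (orbit_avg z u R w - z ^ s * S (int s) (orbit_avg z u R) w) \<le> 2 * real s / real R" .
qed

text \<open>Averaging any orbit average \<open>orbit_avg z u n\<close> once more along the orbit changes \<open>orbit_avg z u R\<close>
  little when \<open>R\<close> is large; hence the norm of \<open>orbit_avg z u R\<close> is asymptotically minimal.\<close>

lemma orbit_avg_minimal:
  assumes u: "unit_bdd u" and z: "norm z = 1" and R: "0 < R" and n: "0 < n" "0 < m"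
  shows "nrm (orbit_avg z u R) \<le> nrm (\<lambda>w. (orbit_avg z u n w + orbit_avg z u m w) / 2) + 2 * real (max n m) / real R"
proof -
  let ?c = "\<lambda>w. (orbit_avg z u n w + orbit_avg z u m w) / 2"
  have uA: "u \<in> A" using u by (rule unit_bddD)
  have cA: "?c \<in> A" by (intro A_intros orbit_avg_A uA)
  define avg where "avg v w = (\<Sum>r\<in>{1..R}. z ^ r * S (int r) v w) / of_nat R" for v w
  have avgA: "avg v \<in> A" if "v \<in> A" for v unfolding avg_def[abs_def] by (intro A_intros that)
  have avg_le: "nrm (avg v) \<le> nrm v" if v: "v \<in> A" for v
    unfolding avg_def[abs_def] using nrm_mean[of "{1..R}" "\<lambda>r w. z ^ r * S (int r) v w" "nrm v"] R v z
    by (simp add: nrm_scale S_A scale_A norm_power nrm_S)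
  \<comment> \<open>Orbit averages commute: averaging the short one along the long orbit is
    averaging the long one along the short orbit, which hardly moves it.\<close>
  have swap: "avg (orbit_avg z u n) w = (\<Sum>s\<in>{1..n}. z ^ s * S (int s) (orbit_avg z u R) w) / of_nat n" for w n
  proof -
    have "avg (orbit_avg z u n) w = (\<Sum>r\<in>{1..R}. \<Sum>s\<in>{1..n}. z ^ r * (z ^ s * S (int r + int s) u w)) / of_nat n / of_nat R"
      by (simp add: avg_def orbit_avg_def S_simps sum_distrib_left sum_divide_distrib mult_ac)
    also have "\<dots> = (\<Sum>s\<in>{1..n}. \<Sum>r\<in>{1..R}. z ^ s * (z ^ r * S (int s + int r) u w)) / of_nat R / of_nat n"
      by (subst sum.swap) (simp add: mult_ac add.commute)
    finally show ?thesis by (simp add: orbit_avg_def S_simps sum_distrib_left sum_divide_distrib mult_ac)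
  qed
  have close: "nrm (\<lambda>w. orbit_avg z u R w - avg (orbit_avg z u n) w) \<le> 2 * real n / R" if n: "0 < n" for n
  proof -
    have "orbit_avg z u R w - avg (orbit_avg z u n) w = (\<Sum>s\<in>{1..n}. orbit_avg z u R w - z ^ s * S (int s) (orbit_avg z u R) w) / of_nat (card {1..n})" for w
      using n by (simp add: swap sum_subtractf diff_divide_distrib)
    moreover have "nrm (\<lambda>w. (\<Sum>s\<in>{1..n}. orbit_avg z u R w - z ^ s * S (int s) (orbit_avg z u R) w) / of_nat (card {1..n})) \<le> 2 * real n / R"
    proof (rule nrm_mean)
      fix s assume "s \<in> {1..n}"
      then have "2 * real s / R \<le> 2 * real n / R" by (intro divide_right_mono) auto
      then show "nrm (\<lambda>w. orbit_avg z u R w - z ^ s * S (int s) (orbit_avg z u R) w) \<le> 2 * real n / R"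
        using orbit_avg_shifted[OF u z R, of s] by linarith
    qed (use n in \<open>auto intro!: A_intros orbit_avg_A uA\<close>)
    ultimately show ?thesis by simp
  qed
  have "nrm (\<lambda>w. orbit_avg z u R w - avg ?c w) \<le> 2 * real (max n m) / R"
  proof -
    let ?x = "\<lambda>n w. orbit_avg z u R w - avg (orbit_avg z u n) w"
    have "avg ?c w = (avg (orbit_avg z u n) w + avg (orbit_avg z u m) w) / 2" for w
      by (simp add: avg_def S_simps distrib_left sum.distrib sum_divide_distrib add_divide_distrib mult_ac)
    then have eq: "(\<lambda>w. orbit_avg z u R w - avg ?c w) = (\<lambda>w. (1 / 2) * (?x n w + ?x m w))"
      by (simp add: fun_eq_iff field_simps)
    have xA: "?x n \<in> A" for n by (intro A_intros avgA orbit_avg_A uA)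
    have "nrm (\<lambda>w. orbit_avg z u R w - avg ?c w) = 1 / 2 * nrm (\<lambda>w. ?x n w + ?x m w)"
      unfolding eq using nrm_scale[OF add_A[OF xA xA], of "1 / 2"] by simp
    also have "\<dots> \<le> 1 / 2 * (nrm (?x n) + nrm (?x m))" by (intro mult_left_mono nrm_triangle xA) simp
    also have "\<dots> \<le> 1 / 2 * (2 * real n / R + 2 * real m / R)" using close n by (intro mult_left_mono add_mono) auto
    also have "\<dots> = (real n + real m) / R" by (simp add: add_divide_distrib)
    also have "\<dots> \<le> 2 * real (max n m) / R" by (intro divide_right_mono) auto
    finally show ?thesis .
  qed
  moreover have "nrm (orbit_avg z u R) \<le> nrm (\<lambda>w. orbit_avg z u R w - avg ?c w) + nrm (avg ?c)"
    using nrm_triangle[of "\<lambda>w. orbit_avg z u R w - avg ?c w" "avg ?c"] by (simp add: A_intros avgA cA orbit_avg_A uA)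
  moreover have "nrm (avg ?c) \<le> nrm ?c" by (rule avg_le[OF cA])
  ultimately show ?thesis by linarith
qed

text \<open>The norms of long averages are close to the infimum \<open>\<beta>\<close>, and those of
  their midpoints are not below it; the parallelogram law makes the differences small.\<close>

theorem orbit_avg_Cauchy:
  assumes u: "unit_bdd u" and z: "norm z = 1" and \<epsilon>: "0 < \<epsilon>"
  obtains N where "\<And>n m. N \<le> n \<Longrightarrow> N \<le> m \<Longrightarrow> nrm (\<lambda>w. orbit_avg z u n w - orbit_avg z u m w) \<le> \<epsilon>"
proof -
  have uA: "u \<in> A" using u by (rule unit_bddD)
  define a where "a n = nrm (orbit_avg z u n)" for n
  define \<beta> where "\<beta> = Inf (a ` {0<..})"
  have a0: "0 \<le> a n" for n unfolding a_def by (intro nrm_ge_0 orbit_avg_A uA)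
  have bb: "bdd_below (a ` {0<..})" using a0 by (intro bdd_belowI[of _ 0]) auto
  have lower: "\<beta> \<le> a n" if "0 < n" for n unfolding \<beta>_def using that bb by (intro cInf_lower) auto
  have \<beta>0: "0 \<le> \<beta>" unfolding \<beta>_def using a0 by (intro cInf_greatest) auto
  \<comment> \<open>Makes \<open>4 * (\<delta> * (2 * \<beta> + \<delta>))\<close>, the bound
    produced by the parallelogram law, at most \<open>\<epsilon>\<^sup>2\<close>.\<close>
  define \<delta> where "\<delta> = min 1 (\<epsilon>\<^sup>2 / (4 * (2 * \<beta> + 1)))"
  have p4: "0 < 4 * (2 * \<beta> + 1)" using \<beta>0 by simp
  have \<delta>: "0 < \<delta>" "\<delta> \<le> 1" unfolding \<delta>_def using divide_pos_pos[OF zero_less_power[OF \<epsilon>] p4, of 2] by simp_all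
  have "\<delta> \<le> \<epsilon>\<^sup>2 / (4 * (2 * \<beta> + 1))" by (simp add: \<delta>_def)
  then have \<delta>\<epsilon>: "4 * (\<delta> * (2 * \<beta> + 1)) \<le> \<epsilon>\<^sup>2"
    unfolding pos_le_divide_eq[OF p4] by (simp only: mult.left_commute mult.assoc)
  obtain n0 where n0: "0 < n0" "a n0 < \<beta> + \<delta> / 2"
    using cInf_lessD[of "a ` {0<..}" "\<beta> + \<delta> / 2"] \<delta> unfolding \<beta>_def by auto
  define N where "N = max 1 (nat \<lceil>4 * real n0 / \<delta>\<rceil>)"
  have upper: "a n \<le> \<beta> + \<delta>" and npos: "0 < n" if "N \<le> n" for n
  proof -
    have n: "0 < n" "4 * real n0 / \<delta> \<le> n" using that unfolding N_def by linarith+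
    have "(\<lambda>w. (orbit_avg z u n0 w + orbit_avg z u n0 w) / 2) = orbit_avg z u n0" by simp
    then have "a n \<le> a n0 + 2 * real n0 / n"
      using orbit_avg_minimal[OF u z n(1) n0(1) n0(1)] by (simp add: a_def)
    moreover have "2 * real n0 / n \<le> \<delta> / 2" using n \<delta> by (simp add: field_simps)
    ultimately show "a n \<le> \<beta> + \<delta>" using n0 by linarith
    show "0 < n" by fact
  qed
  show ?thesis
  proof (rule that[of N])
    fix n m assume nm: "N \<le> n" "N \<le> m"
    define x where "x = orbit_avg z u n"
    define y where "y = orbit_avg z u m"
    have xyA: "x \<in> A" "y \<in> A" unfolding x_def y_def by (intro orbit_avg_A uA)+
    define c where "c = nrm (\<lambda>w. (x w + y w) / 2)"
    have "\<beta> \<le> c"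
    proof (rule field_le_epsilon)
      fix r :: real assume r: "0 < r"
      define R where "R = max 1 (nat \<lceil>2 * real (max n m) / r\<rceil>)"
      have R: "0 < R" "2 * real (max n m) / r \<le> R" unfolding R_def by linarith+
      have "a R \<le> c + 2 * real (max n m) / R"
        unfolding a_def c_def x_def y_def using nm npos by (intro orbit_avg_minimal[OF u z R(1)]) auto
      moreover have "2 * real (max n m) / R \<le> r" using R r by (simp add: field_simps)
      ultimately show "\<beta> \<le> c + r" using lower[OF R(1)] by linarith
    qed
    then have c2: "\<beta>\<^sup>2 \<le> c\<^sup>2" using \<beta>0 by (intro power_mono)
    have "nrm (\<lambda>w. x w + y w) = 2 * c"
      using nrm_scale[OF add_A[OF xyA], of "1 / 2"] by (simp add: c_def)
    then have "4 * c\<^sup>2 = (nrm x)\<^sup>2 + 2 * Re (ip x y) + (nrm y)\<^sup>2"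
      using nrm_add_square[OF xyA] by (simp add: power_mult_distrib)
    then have "(nrm (\<lambda>w. x w - y w))\<^sup>2 = 2 * (nrm x)\<^sup>2 + 2 * (nrm y)\<^sup>2 - 4 * c\<^sup>2"
      using nrm_diff_square[OF xyA] by linarith
    also have "\<dots> \<le> 2 * (\<beta> + \<delta>)\<^sup>2 + 2 * (\<beta> + \<delta>)\<^sup>2 - 4 * \<beta>\<^sup>2"
    proof -
      have "(nrm x)\<^sup>2 \<le> (\<beta> + \<delta>)\<^sup>2" "(nrm y)\<^sup>2 \<le> (\<beta> + \<delta>)\<^sup>2"
        using upper[OF nm(1)] upper[OF nm(2)] xyA by (auto intro!: power_mono simp: a_def x_def y_def)
      then show ?thesis using c2 by linarith
    qed
    also have "\<dots> = 4 * (\<delta> * (2 * \<beta> + \<delta>))" by (simp add: power2_eq_square algebra_simps)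
    also have "\<dots> \<le> 4 * (\<delta> * (2 * \<beta> + 1))" using \<delta> by (intro mult_left_mono) auto
    also have "\<dots> \<le> \<epsilon>\<^sup>2" by (rule \<delta>\<epsilon>)
    finally have "nrm (\<lambda>w. x w - y w) \<le> \<epsilon>" by (rule power2_le_imp_le[OF _ less_imp_le[OF \<epsilon>]])
    then show "nrm (\<lambda>w. orbit_avg z u n w - orbit_avg z u m w) \<le> \<epsilon>" unfolding x_def y_def .
  qed
qed

end

section \<open>Bounded functions on a probability space\<close>

text \<open>Bounded everywhere and not just almost everywhere, because \<open>shift_algebra\<close>
  asks for pointwise bounds.\<close>

definition bounded_measurable :: "'a measure \<Rightarrow> ('a \<Rightarrow> complex) set" where
  "bounded_measurable M = {a \<in> borel_measurable M. \<exists>C. \<forall>x. norm (a x) \<le> C}"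

lemma borel_measurable_cnj [measurable]: "a \<in> borel_measurable M \<Longrightarrow> (\<lambda>x. cnj (a x)) \<in> borel_measurable M"
  by (rule borel_measurable_continuous_onI[THEN measurable_compose_rev]) (auto intro: continuous_intros)

context prob_space
begin

lemma bounded_measurableD [measurable_dest]: "a \<in> bounded_measurable M \<Longrightarrow> a \<in> borel_measurable M"
  by (simp add: bounded_measurable_def)

lemma bounded_measurable_integrable: "a \<in> bounded_measurable M \<Longrightarrow> integrable M a"
  unfolding bounded_measurable_def by (auto intro: integrable_const_bound)

text \<open>The trivial shift makes the calculus of \<open>ip\<close> and \<open>nrm\<close>
  available on the space itself; the dynamics enters through the germs.\<close>

lemma invariant_mean_integral: "invariant_mean (bounded_measurable M) (\<lambda>m x. x) (\<lambda>a. \<integral>x. a x \<partial>M)"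
proof
  fix a b :: "'a \<Rightarrow> complex" and c assume a: "a \<in> bounded_measurable M"
  then obtain C where C: "\<And>x. norm (a x) \<le> C" and am: "a \<in> borel_measurable M" by (auto simp: bounded_measurable_def)
  note ai = bounded_measurable_integrable[OF a]
  show "(\<lambda>x. cnj (a x)) \<in> bounded_measurable M" "\<exists>C. \<forall>x. norm (a x) \<le> C"
    using a by (auto simp: bounded_measurable_def)
  show "(\<integral>x. c * a x \<partial>M) = c * (\<integral>x. a x \<partial>M)" by simp
  show "(\<integral>x. cnj (a x) \<partial>M) = cnj (\<integral>x. a x \<partial>M)" by simp
  show "0 \<le> Re (\<integral>x. a x \<partial>M)" if "\<And>x. 0 \<le> Re (a x)"
  proof -
    have "Re (\<integral>x. a x \<partial>M) = (\<integral>x. Re (a x) \<partial>M)" using integral_Re[OF ai] by simp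
    then show ?thesis using that by simp
  qed
  show "a \<in> bounded_measurable M" by fact
  {
    assume b: "b \<in> bounded_measurable M"
    then obtain C' where C': "\<And>x. norm (b x) \<le> C'" and bm: "b \<in> borel_measurable M" by (auto simp: bounded_measurable_def)
    have "norm (a x + b x) \<le> C + C'" for x using C C' by (intro norm_triangle_le add_mono)
    then show "(\<lambda>x. a x + b x) \<in> bounded_measurable M" using am bm by (auto simp: bounded_measurable_def)
    have "norm (a x * b x) \<le> C * C'" for x
      unfolding norm_mult using C C' norm_ge_zero order_trans by (intro mult_mono) blast+
    then show "(\<lambda>x. a x * b x) \<in> bounded_measurable M" using am bm by (auto simp: bounded_measurable_def)
    show "(\<integral>x. a x + b x \<partial>M) = (\<integral>x. a x \<partial>M) + (\<integral>x. b x \<partial>M)"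
      using ai bounded_measurable_integrable[OF b] by (rule Bochner_Integration.integral_add)
  }
qed (auto simp: bounded_measurable_def prob_space)

sublocale L2: invariant_mean "bounded_measurable M" "\<lambda>m x. x" "\<lambda>a. \<integral>x. a x \<partial>M"
  by (rule invariant_mean_integral)

lemma nrm_eq_L2_norm: "a \<in> bounded_measurable M \<Longrightarrow> L2.nrm a = L2_norm M a"
proof -
  assume a: "a \<in> bounded_measurable M"
  have "(\<integral>x. a x * cnj (a x) \<partial>M) = (\<integral>x. complex_of_real ((norm (a x))\<^sup>2) \<partial>M)"
    by (simp only: complex_norm_square)
  also have "\<dots> = of_real (\<integral>x. (norm (a x))\<^sup>2 \<partial>M)" by (rule integral_complex_of_real)
  finally show ?thesis by (simp add: L2.nrm_def L2.ip_def L2_norm_def)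
qed

lemma L1_le_nrm:
  assumes "a \<in> bounded_measurable M" shows "(\<integral>x. norm (a x) \<partial>M) \<le> L2.nrm a"
proof -
  have nA: "(\<lambda>x. complex_of_real (norm (a x))) \<in> bounded_measurable M"
    using assms by (auto simp: bounded_measurable_def)
  have "(\<integral>x. norm (a x) \<partial>M) = Re (\<integral>x. complex_of_real (norm (a x)) \<partial>M)" by (simp add: integral_complex_of_real)
  also have "\<dots> \<le> norm (\<integral>x. complex_of_real (norm (a x)) \<partial>M)" by (rule complex_Re_le_cmod)
  also have "\<dots> \<le> L2.nrm (\<lambda>x. complex_of_real (norm (a x)))" by (rule L2.norm_tau_le[OF nA])
  also have "\<dots> = L2.nrm a" using assms nA by (simp add: nrm_eq_L2_norm L2_norm_def)
  finally show ?thesis .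
qed

lemma nrm_tendsto_0_of_AE:
  assumes h: "\<And>n. h n \<in> bounded_measurable M" "\<And>n x. norm (h n x) \<le> K" and ae: "AE x in M. (\<lambda>n. h n x) \<longlonglongrightarrow> 0"
  shows "(\<lambda>n. L2.nrm (h n)) \<longlonglongrightarrow> 0"
proof -
  have [measurable]: "h n \<in> borel_measurable M" for n using h by (simp add: bounded_measurable_def)
  have "(\<lambda>n. \<integral>x. (norm (h n x))\<^sup>2 \<partial>M) \<longlonglongrightarrow> (\<integral>x. 0 \<partial>M)"
  proof (rule integral_dominated_convergence[where w = "\<lambda>x. K\<^sup>2"])
    show "AE x in M. (\<lambda>n. (norm (h n x))\<^sup>2) \<longlonglongrightarrow> 0"
      using ae
    proof eventually_elim
      case (elim x)
      then have "(\<lambda>n. (norm (h n x))\<^sup>2) \<longlonglongrightarrow> (norm (0::complex))\<^sup>2" by (intro tendsto_intros)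
      then show ?case by simp
    qed
    show "AE x in M. norm ((norm (h n x))\<^sup>2) \<le> K\<^sup>2" for n
      using h(2) by (auto intro!: power_mono)
  qed auto
  then have "(\<lambda>n. sqrt (\<integral>x. (norm (h n x))\<^sup>2 \<partial>M)) \<longlonglongrightarrow> sqrt 0" by (intro tendsto_real_sqrt) simp
  then show ?thesis using h by (simp add: nrm_eq_L2_norm L2_norm_def)
qed

text \<open>The \<open>L2\<close> norm dominates the \<open>L1\<close> norm, a sequence that is
  Cauchy in \<open>L1\<close> has a subsequence converging almost everywhere, and dominated
  convergence leads back to \<open>L2\<close>.\<close>

lemma L2_complete:
  assumes h: "\<And>n. h n \<in> bounded_measurable M" "\<And>n x. norm (h n x) \<le> K"
    and Cauchy: "\<And>\<epsilon>. 0 < \<epsilon> \<Longrightarrow> \<exists>N. \<forall>n\<ge>N. \<forall>m\<ge>N. L2.nrm (\<lambda>x. h n x - h m x) \<le> \<epsilon>"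
  obtains G where "G \<in> bounded_measurable M" "(\<lambda>n. L2.nrm (\<lambda>x. h n x - G x)) \<longlonglongrightarrow> 0"
proof -
  have hm [measurable]: "h n \<in> borel_measurable M" for n using h by (simp add: bounded_measurable_def)
  have dA: "(\<lambda>x. h n x - h m x) \<in> bounded_measurable M" for n m by (intro L2.A_intros h)
  obtain r where r: "strict_mono r" and aeC: "AE x in M. Cauchy (\<lambda>i. h (r i) x)"
  proof (rule cauchy_L1_AE_cauchy_subseq[of M h])
    show "integrable M (h n)" for n by (rule bounded_measurable_integrable[OF h(1)])
    fix \<epsilon> :: real assume \<epsilon>: "0 < \<epsilon>"
    then obtain N where N: "\<forall>n\<ge>N. \<forall>m\<ge>N. L2.nrm (\<lambda>x. h n x - h m x) \<le> \<epsilon> / 2" using Cauchy[of "\<epsilon> / 2"] by auto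
    have "(\<integral>x. norm (h i x - h j x) \<partial>M) < \<epsilon>" if "N \<le> i" "N \<le> j" for i j
      using L1_le_nrm[OF dA, of i j] N[rule_format, OF that] \<epsilon> by linarith
    then show "\<exists>N. \<forall>i\<ge>N. \<forall>j\<ge>N. (\<integral>x. norm (h i x - h j x) \<partial>M) < \<epsilon>" by blast
  qed
  define G0 where "G0 x = lim (\<lambda>i. h (r i) x)" for x
  have [measurable]: "G0 \<in> borel_measurable M" unfolding G0_def[abs_def] by (rule borel_measurable_lim_metric) measurable
  \<comment> \<open>Off the set of convergence \<open>lim\<close> is arbitrary; resetting values of
    norm above \<open>K\<close> to \<open>0\<close> bounds the limit everywhere.\<close>
  define G where "G x = (if norm (G0 x) \<le> K then G0 x else 0)" for x
  have [measurable]: "G \<in> borel_measurable M" unfolding G_def[abs_def] by measurable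
  have K0: "0 \<le> K" using h(2) norm_ge_zero order_trans by blast
  have GK: "norm (G x) \<le> K" for x using K0 by (simp add: G_def)
  have GA: "G \<in> bounded_measurable M" using GK by (auto simp: bounded_measurable_def)
  have "AE x in M. (\<lambda>i. h (r i) x - G x) \<longlonglongrightarrow> 0"
    using aeC
  proof eventually_elim
    case (elim x)
    then have "(\<lambda>i. h (r i) x) \<longlonglongrightarrow> G0 x"
      unfolding G0_def using Cauchy_convergent_iff convergent_LIMSEQ_iff by blast
    moreover from this have "norm (G0 x) \<le> K"
      using h(2) by (intro LIMSEQ_le_const2[OF tendsto_norm]) auto
    ultimately have "(\<lambda>i. h (r i) x) \<longlonglongrightarrow> G x" by (simp add: G_def)
    then show ?case by (rule LIM_zero)
  qed
  moreover have "norm (h n x - G x) \<le> K + K" for n x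
    using h(2)[of n x] GK[of x] by (meson norm_triangle_le_diff add_mono)
  moreover have hG: "(\<lambda>x. h n x - G x) \<in> bounded_measurable M" for n by (intro L2.A_intros h GA)
  ultimately have sub: "(\<lambda>i. L2.nrm (\<lambda>x. h (r i) x - G x)) \<longlonglongrightarrow> 0"
    by (intro nrm_tendsto_0_of_AE) auto
  have "(\<lambda>n. L2.nrm (\<lambda>x. h n x - G x)) \<longlonglongrightarrow> 0"
  proof (rule LIMSEQ_I)
    fix \<epsilon> :: real assume \<epsilon>: "0 < \<epsilon>"
    obtain N where N: "\<forall>n\<ge>N. \<forall>m\<ge>N. L2.nrm (\<lambda>x. h n x - h m x) \<le> \<epsilon> / 3" using Cauchy[of "\<epsilon> / 3"] \<epsilon> by auto
    have "\<forall>\<^sub>F i in sequentially. L2.nrm (\<lambda>x. h (r i) x - G x) < \<epsilon> / 3"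
      using \<epsilon> by (intro order_tendstoD(2)[OF sub]) simp
    then have "\<forall>\<^sub>F i in sequentially. N \<le> i \<and> L2.nrm (\<lambda>x. h (r i) x - G x) < \<epsilon> / 3"
      by (intro eventually_conj eventually_ge_at_top)
    then obtain i where i: "N \<le> i" "L2.nrm (\<lambda>x. h (r i) x - G x) < \<epsilon> / 3"
      using eventually_happens'[OF sequentially_bot] by blast
    have ri: "N \<le> r i" using i(1) seq_suble[OF r, of i] by linarith
    have "norm (L2.nrm (\<lambda>x. h n x - G x) - 0) < \<epsilon>" if "N \<le> n" for n
    proof -
      have "L2.nrm (\<lambda>x. h n x - G x) \<le> L2.nrm (\<lambda>x. h n x - h (r i) x) + L2.nrm (\<lambda>x. h (r i) x - G x)"
        by (intro L2.nrm_diff_triangle h GA)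
      also have "\<dots> < \<epsilon>" using N[rule_format, OF that ri] i(2) \<epsilon> by linarith
      finally show ?thesis using L2.nrm_ge_0[OF hG] by simp
    qed
    then show "\<exists>no. \<forall>n\<ge>no. norm (L2.nrm (\<lambda>x. h n x - G x) - 0) < \<epsilon>" by blast
  qed
  then show ?thesis using that GA by blast
qed

end

section \<open>From a measure preserving system to an invertible one\<close>

context measure_preserving_system
begin

text \<open>The transformation need not be invertible. An element of the direct limit of
  \<open>L\<^sup>\<infinity> \<rightarrow> L\<^sup>\<infinity> \<rightarrow> \<dots>\<close> along composition with \<open>T\<close> is represented by a family indexed by \<open>\<int>\<close> that is
  compatible with \<open>T\<close> from some index on; translation of the index is the invertible shift.\<close>

definition germs :: "(int \<times> 'a \<Rightarrow> complex) set" where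
  "germs = {a. (\<exists>C. \<forall>z. norm (a z) \<le> C) \<and>
     (\<exists>n0. \<forall>n\<ge>n0. (\<lambda>x. a (n, x)) \<in> borel_measurable M \<and> (\<forall>x\<in>space M. a (n + 1, x) = a (n, T x)))}"

definition gshift :: "int \<Rightarrow> int \<times> 'a \<Rightarrow> int \<times> 'a" where
  "gshift m z = (fst z + m, snd z)"

text \<open>The integrals are constant from some index on, because \<open>T\<close> preserves the
  measure; \<open>lim\<close> picks that constant without naming the index.\<close>

definition gmean :: "(int \<times> 'a \<Rightarrow> complex) \<Rightarrow> complex" where
  "gmean a = lim (\<lambda>n. \<integral>x. a (int n, x) \<partial>M)"

lemma integral_comp_T: "g \<in> borel_measurable M \<Longrightarrow> (\<integral>x. g (T x) \<partial>M) = (\<integral>x. g x \<partial>M)" for g :: "'a \<Rightarrow> complex"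
  using integral_distr[OF measurable_T, of g] distr_T by simp

lemma germsE:
  assumes "a \<in> germs"
  obtains C n0 where "\<And>z. norm (a z) \<le> C" "\<And>n. n0 \<le> n \<Longrightarrow> (\<lambda>x. a (n, x)) \<in> borel_measurable M"
    "\<And>n x. n0 \<le> n \<Longrightarrow> x \<in> space M \<Longrightarrow> a (n + 1, x) = a (n, T x)"
  using assms unfolding germs_def by blast

lemma shift_algebra_germs: "shift_algebra germs gshift"
proof
  fix a b assume a: "a \<in> germs" and b: "b \<in> germs"
  obtain C n0 where 1: "\<And>z. norm (a z) \<le> C" "\<And>n. n0 \<le> n \<Longrightarrow> (\<lambda>x. a (n, x)) \<in> borel_measurable M"
    "\<And>n x. n0 \<le> n \<Longrightarrow> x \<in> space M \<Longrightarrow> a (n + 1, x) = a (n, T x)" by (rule germsE[OF a]) blast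
  obtain C' n0' where 2: "\<And>z. norm (b z) \<le> C'" "\<And>n. n0' \<le> n \<Longrightarrow> (\<lambda>x. b (n, x)) \<in> borel_measurable M"
    "\<And>n x. n0' \<le> n \<Longrightarrow> x \<in> space M \<Longrightarrow> b (n + 1, x) = b (n, T x)" by (rule germsE[OF b]) blast
  have "norm (a z + b z) \<le> C + C'" for z using 1(1) 2(1) by (intro norm_triangle_le add_mono)
  moreover have "\<forall>n\<ge>max n0 n0'. (\<lambda>x. a (n, x) + b (n, x)) \<in> borel_measurable M \<and> (\<forall>x\<in>space M. a (n + 1, x) + b (n + 1, x) = a (n, T x) + b (n, T x))"
    using 1 2 by auto
  ultimately show "(\<lambda>z. a z + b z) \<in> germs" unfolding germs_def by blast
  have "norm (a z * b z) \<le> C * C'" for z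
    unfolding norm_mult using 1(1) 2(1) norm_ge_zero order_trans by (intro mult_mono) blast+
  moreover have "\<forall>n\<ge>max n0 n0'. (\<lambda>x. a (n, x) * b (n, x)) \<in> borel_measurable M \<and> (\<forall>x\<in>space M. a (n + 1, x) * b (n + 1, x) = a (n, T x) * b (n, T x))"
    using 1 2 by auto
  ultimately show "(\<lambda>z. a z * b z) \<in> germs" unfolding germs_def by blast
next
  fix a assume a: "a \<in> germs"
  obtain C n0 where 1: "\<And>z. norm (a z) \<le> C" "\<And>n. n0 \<le> n \<Longrightarrow> (\<lambda>x. a (n, x)) \<in> borel_measurable M"
    "\<And>n x. n0 \<le> n \<Longrightarrow> x \<in> space M \<Longrightarrow> a (n + 1, x) = a (n, T x)" by (rule germsE[OF a]) blast
  show "\<exists>C. \<forall>z. norm (a z) \<le> C" using 1(1) by blast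
  have "\<forall>n\<ge>n0. (\<lambda>x. cnj (a (n, x))) \<in> borel_measurable M \<and> (\<forall>x\<in>space M. cnj (a (n + 1, x)) = cnj (a (n, T x)))"
    using 1 by auto
  then show "(\<lambda>z. cnj (a z)) \<in> germs" unfolding germs_def using 1(1) by auto
  fix m
  have "\<forall>n\<ge>n0 - m. (\<lambda>x. a (n + m, x)) \<in> borel_measurable M \<and> (\<forall>x\<in>space M. a (n + 1 + m, x) = a (n + m, T x))"
    using 1(2) 1(3)[of "n + m" for n] by (auto simp: algebra_simps)
  moreover have "\<forall>z. norm (a (gshift m z)) \<le> C" using 1(1) by blast
  ultimately show "(\<lambda>z. a (gshift m z)) \<in> germs" unfolding germs_def by (auto simp: gshift_def)
next
  show "(\<lambda>z. c) \<in> germs" for c unfolding germs_def by auto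
qed (auto simp: gshift_def)

lemma gmean_eventually:
  assumes "a \<in> germs"
  obtains N where "\<And>n. N \<le> n \<Longrightarrow> (\<lambda>x. a (int n, x)) \<in> bounded_measurable M"
    "\<And>n. N \<le> n \<Longrightarrow> (\<integral>x. a (int n, x) \<partial>M) = gmean a"
proof -
  obtain C n0 where 1: "\<And>z. norm (a z) \<le> C" "\<And>n. n0 \<le> n \<Longrightarrow> (\<lambda>x. a (n, x)) \<in> borel_measurable M"
    "\<And>n x. n0 \<le> n \<Longrightarrow> x \<in> space M \<Longrightarrow> a (n + 1, x) = a (n, T x)" by (rule germsE[OF assms]) blast
  define N where "N = nat n0"
  have N: "n0 \<le> int n" if "N \<le> n" for n using that by (simp add: N_def)
  have "(\<integral>x. a (int (N + d), x) \<partial>M) = (\<integral>x. a (int N, x) \<partial>M)" for d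
  proof (induction d)
    case (Suc d)
    have "(\<integral>x. a (int (N + Suc d), x) \<partial>M) = (\<integral>x. a (int (N + d), T x) \<partial>M)"
      using 1(3)[OF N[of "N + d"]] by (intro Bochner_Integration.integral_cong) (auto simp: add.commute)
    also have "\<dots> = (\<integral>x. a (int (N + d), x) \<partial>M)"
      using integral_comp_T[OF 1(2)[OF N[of "N + d"]]] by simp
    finally show ?case using Suc by simp
  qed simp
  then have const: "(\<integral>x. a (int n, x) \<partial>M) = (\<integral>x. a (int N, x) \<partial>M)" if "N \<le> n" for n
    using le_Suc_ex[OF that] by auto
  then have "(\<lambda>n. \<integral>x. a (int n, x) \<partial>M) \<longlonglongrightarrow> (\<integral>x. a (int N, x) \<partial>M)"
    by (intro tendsto_eventually eventually_sequentiallyI[of N])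
  then have gm: "gmean a = (\<integral>x. a (int N, x) \<partial>M)" unfolding gmean_def by (rule limI)
  show ?thesis
  proof (rule that[of N])
    fix n assume n: "N \<le> n"
    show "(\<lambda>x. a (int n, x)) \<in> bounded_measurable M"
      unfolding bounded_measurable_def using 1(1) 1(2)[OF N[OF n]] by blast
    show "(\<integral>x. a (int n, x) \<partial>M) = gmean a" unfolding gm by (rule const[OF n])
  qed
qed

lemma gmean_common:
  assumes "a \<in> germs" "b \<in> germs"
  obtains n where "(\<lambda>x. a (int n, x)) \<in> bounded_measurable M" "(\<integral>x. a (int n, x) \<partial>M) = gmean a"
    "(\<lambda>x. b (int n, x)) \<in> bounded_measurable M" "(\<integral>x. b (int n, x) \<partial>M) = gmean b"
proof -
  obtain N where N: "\<And>n. N \<le> n \<Longrightarrow> (\<lambda>x. a (int n, x)) \<in> bounded_measurable M"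
    "\<And>n. N \<le> n \<Longrightarrow> (\<integral>x. a (int n, x) \<partial>M) = gmean a" using gmean_eventually[OF assms(1)] by blast
  obtain N' where N': "\<And>n. N' \<le> n \<Longrightarrow> (\<lambda>x. b (int n, x)) \<in> bounded_measurable M"
    "\<And>n. N' \<le> n \<Longrightarrow> (\<integral>x. b (int n, x) \<partial>M) = gmean b" using gmean_eventually[OF assms(2)] by blast
  show ?thesis using N[of "max N N'"] N'[of "max N N'"] that by simp
qed

lemma gmean_common3:
  assumes "a \<in> germs" "b \<in> germs" "c \<in> germs"
  obtains n where "(\<lambda>x. a (int n, x)) \<in> bounded_measurable M" "(\<integral>x. a (int n, x) \<partial>M) = gmean a"
    "(\<lambda>x. b (int n, x)) \<in> bounded_measurable M" "(\<integral>x. b (int n, x) \<partial>M) = gmean b"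
    "(\<lambda>x. c (int n, x)) \<in> bounded_measurable M" "(\<integral>x. c (int n, x) \<partial>M) = gmean c"
proof -
  obtain N where N: "\<And>n. N \<le> n \<Longrightarrow> (\<lambda>x. a (int n, x)) \<in> bounded_measurable M"
    "\<And>n. N \<le> n \<Longrightarrow> (\<integral>x. a (int n, x) \<partial>M) = gmean a" using gmean_eventually[OF assms(1)] by blast
  obtain N' where N': "\<And>n. N' \<le> n \<Longrightarrow> (\<lambda>x. b (int n, x)) \<in> bounded_measurable M"
    "\<And>n. N' \<le> n \<Longrightarrow> (\<integral>x. b (int n, x) \<partial>M) = gmean b" using gmean_eventually[OF assms(2)] by blast
  obtain N'' where N'': "\<And>n. N'' \<le> n \<Longrightarrow> (\<lambda>x. c (int n, x)) \<in> bounded_measurable M"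
    "\<And>n. N'' \<le> n \<Longrightarrow> (\<integral>x. c (int n, x) \<partial>M) = gmean c" using gmean_eventually[OF assms(3)] by blast
  show ?thesis
    using N[of "max N (max N' N'')"] N'[of "max N (max N' N'')"] N''[of "max N (max N' N'')"] that by simp
qed

lemma invariant_mean_gmean: "invariant_mean germs gshift gmean"
proof -
  interpret shift_algebra germs gshift by (rule shift_algebra_germs)
  show ?thesis
  proof
    fix a assume a: "a \<in> germs"
    fix c
    obtain n where n: "(\<lambda>x. a (int n, x)) \<in> bounded_measurable M" "(\<integral>x. a (int n, x) \<partial>M) = gmean a"
      "(\<integral>x. c * a (int n, x) \<partial>M) = gmean (\<lambda>z. c * a z)"
      using gmean_common[OF a scale_A[OF a, of c]] by blast
    have "(\<integral>x. c * a (int n, x) \<partial>M) = c * (\<integral>x. a (int n, x) \<partial>M)" by simp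
    then show "gmean (\<lambda>z. c * a z) = c * gmean a" unfolding n(2,3) .
    obtain n where "(\<integral>x. a (int n, x) \<partial>M) = gmean a" "(\<integral>x. cnj (a (int n, x)) \<partial>M) = gmean (\<lambda>z. cnj (a z))"
      using gmean_common[OF a cnj_A[OF a]] by blast
    then show "gmean (\<lambda>z. cnj (a z)) = cnj (gmean a)" by (metis Bochner_Integration.integral_cnj)
    show "0 \<le> Re (gmean a)" if "\<And>w. Im (a w) = 0" "\<And>w. 0 \<le> Re (a w)"
    proof -
      obtain n where "(\<lambda>x. a (int n, x)) \<in> bounded_measurable M" "(\<integral>x. a (int n, x) \<partial>M) = gmean a"
        using gmean_common[OF a a] by blast
      then show ?thesis using L2.tau_pos[of "\<lambda>x. a (int n, x)"] that by simp
    qed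
    show "gmean (\<lambda>z. a (gshift m z)) = gmean a" for m
    proof -
      obtain N where "\<And>n. N \<le> n \<Longrightarrow> (\<lambda>x. a (int n, x)) \<in> bounded_measurable M"
        and N: "\<And>n. N \<le> n \<Longrightarrow> (\<integral>x. a (int n, x) \<partial>M) = gmean a"
        by (rule gmean_eventually[OF a]) (rule that)
      obtain N' where "\<And>n. N' \<le> n \<Longrightarrow> (\<lambda>x. a (gshift m (int n, x))) \<in> bounded_measurable M"
        and N': "\<And>n. N' \<le> n \<Longrightarrow> (\<integral>x. a (gshift m (int n, x)) \<partial>M) = gmean (\<lambda>z. a (gshift m z))"
        by (rule gmean_eventually[OF shift_A[OF a, of m]]) (rule that)
      define n where "n = N' + N + nat \<bar>m\<bar>"
      have "int n + m = int (nat (int n + m))" "N \<le> nat (int n + m)" "N' \<le> n" by (auto simp: n_def)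
      then show ?thesis using N[of "nat (int n + m)"] N'[of n] by (simp add: gshift_def)
    qed
    fix b assume b: "b \<in> germs"
    obtain n where n: "(\<lambda>x. a (int n, x)) \<in> bounded_measurable M" "(\<integral>x. a (int n, x) \<partial>M) = gmean a"
      "(\<lambda>x. b (int n, x)) \<in> bounded_measurable M" "(\<integral>x. b (int n, x) \<partial>M) = gmean b"
      "(\<integral>x. a (int n, x) + b (int n, x) \<partial>M) = gmean (\<lambda>z. a z + b z)"
      using gmean_common3[OF a b add_A[OF a b]] by blast
    have "(\<integral>x. a (int n, x) + b (int n, x) \<partial>M) = (\<integral>x. a (int n, x) \<partial>M) + (\<integral>x. b (int n, x) \<partial>M)"
      using n(1,3) by (intro Bochner_Integration.integral_add bounded_measurable_integrable)
    then show "gmean (\<lambda>z. a z + b z) = gmean a + gmean b" unfolding n(2,4,5) .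
  next
    obtain n where "(\<integral>x. (1::complex) \<partial>M) = gmean (\<lambda>z. 1)"
      using gmean_common[OF const_A[of 1] const_A[of 1]] by blast
    then show "gmean (\<lambda>z. 1) = 1" by (simp add: prob_space)
  qed
qed

end

lemma invariant_mean_amplify:
  assumes "invariant_mean A \<sigma> \<tau>"
  shows "invariant_mean (amplify A) (amplify_shift \<sigma>) (\<lambda>a. \<tau> (\<lambda>w. a (w, 0)))"
proof -
  interpret invariant_mean A \<sigma> \<tau> by fact
  have sl: "a \<in> amplify A \<Longrightarrow> (\<lambda>w. a (w, 0)) \<in> A" for a by (simp add: amplify_def)
  show ?thesis
    by (intro invariant_mean.intro shift_algebra_amplify invariant_mean_axioms.intro)
      (auto simp: amplify_shift_def intro: tau_add tau_scale tau_cnj tau_pos tau_one tau_shift sl)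
qed

text \<open>Walsh's theorem for the forms \<open>cform \<omega>\<close> with nonempty
  \<open>\<omega>\<close>, all carrying the same function \<open>u\<close>.\<close>

lemma cubic_mean_amplify:
  assumes "shift_algebra A \<sigma>" and im: "invariant_mean (amplify A) (amplify_shift \<sigma>) \<tau>"
  shows "cubic_mean (amplify A) (amplify_shift \<sigma>) \<tau>"
proof -
  interpret base: shift_algebra A \<sigma> by fact
  interpret im: invariant_mean "amplify A" "amplify_shift \<sigma>" \<tau> by fact
  show ?thesis
  proof
    fix u and \<epsilon> :: real and k :: nat assume u: "im.real_bdd u" and \<epsilon>: "0 < \<epsilon>"
    interpret amplified_forms A \<sigma> cform "box k" by standard (auto simp: cform_add mono_box)
    have dc: "im.dual_cube k W u = folner_avg (Pow {..<k} - {{}}) W (\<lambda>_. u)" for W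
      by (simp add: im.dual_cube_def folner_avg_def)
    obtain N where "\<forall>W W'. folner (box k) N W \<longrightarrow> folner (box k) N W' \<longrightarrow> W \<subseteq> (\<Union>n. box k n) \<longrightarrow> W' \<subseteq> (\<Union>n. box k n) \<longrightarrow>
      im.nrm (\<lambda>w. folner_avg (Pow {..<k} - {{}}) W (\<lambda>_. u) w - folner_avg (Pow {..<k} - {{}}) W' (\<lambda>_. u) w) \<le> \<epsilon>"
      using folner_avg_uniformly_Cauchy[OF im _ im.real_bddD(1)[OF u] \<epsilon>, of "Pow {..<k} - {{}}"] by auto
    then show "\<exists>N. \<forall>W W'. lattice_folner k N W \<longrightarrow> lattice_folner k N W' \<longrightarrow>
      im.nrm (\<lambda>w. im.dual_cube k W u w - im.dual_cube k W' u w) \<le> \<epsilon>"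
      unfolding dc lattice_folner_def Union_box by (intro exI[of _ N]) blast
  qed
qed

sublocale measure_preserving_system \<subseteq>
  G: cubic_mean "amplify germs" "amplify_shift gshift" "\<lambda>a. gmean (\<lambda>w. a (w, 0))"
  by (intro cubic_mean_amplify shift_algebra_germs invariant_mean_amplify invariant_mean_gmean)

lemma norm_e [simp]: "norm (e \<theta>) = 1"
  by transfer (simp add: norm_exp_eq_Re)

lemma e_uminus: "e (- \<theta>) = cnj (e \<theta>)"
  by transfer (simp add: exp_cnj)

section \<open>Transfer between germs and the original system\<close>

context measure_preserving_system
begin

lemma measurable_T_pow [measurable]: "T ^^ n \<in> measurable M M"
proof (induction n)
  case (Suc n)
  then show ?case unfolding funpow.simps by (rule measurable_comp[OF _ measurable_T])
qed (simp add: id_def)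

lemma distr_T_pow: "distr M M (T ^^ n) = M"
proof (induction n)
  case 0
  show ?case using distr_id[of M] by (simp add: id_def)
next
  case (Suc n)
  have "distr M M (T ^^ Suc n) = distr (distr M M (T ^^ n)) M T"
    unfolding funpow.simps by (rule distr_distr[symmetric, OF measurable_T measurable_T_pow])
  then show ?case by (simp only: Suc distr_T)
qed

lemma integral_comp_T_pow: "g \<in> borel_measurable M \<Longrightarrow> (\<integral>x. g ((T ^^ n) x) \<partial>M) = (\<integral>x. g x \<partial>M)" for g :: "'a \<Rightarrow> complex"
  using integral_distr[OF measurable_T_pow, of g n] distr_T_pow by simp

lemma bounded_measurable_comp_T_pow:
  assumes "g \<in> bounded_measurable M" shows "(\<lambda>x. g ((T ^^ n) x)) \<in> bounded_measurable M"
  using assms measurable_compose[OF measurable_T_pow, of g borel n] by (auto simp: bounded_measurable_def)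

lemma nrm_comp_T_pow:
  assumes g: "g \<in> bounded_measurable M" shows "L2.nrm (\<lambda>x. g ((T ^^ n) x)) = L2.nrm g"
  using integral_comp_T_pow[OF bounded_measurableD[OF L2.mult_A[OF g L2.cnj_A[OF g]]], of n]
  by (simp add: L2.nrm_def L2.ip_def)

text \<open>The mean sees only slice \<open>0\<close> at large indices. There \<open>h\<close> is a
  forward orbit of \<open>g\<close>, and invariance of \<open>M\<close> removes the iterate. A
  general \<open>n0\<close> is allowed because a germ may be compatible with \<open>T\<close> only
  from some index on.\<close>

lemma G_nrm:
  assumes h: "h \<in> amplify germs" and g: "g \<in> bounded_measurable M"
    and eq: "\<And>n x. n0 \<le> n \<Longrightarrow> x \<in> space M \<Longrightarrow> h ((n, x), 0) = g ((T ^^ nat (n - n0)) x)"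
  shows "G.nrm h = L2.nrm g"
proof -
  define a where "a w = h (w, 0) * cnj (h (w, 0))" for w
  have "(\<lambda>z. h z * cnj (h z)) \<in> amplify germs" by (intro G.A_intros h)
  then have aA: "a \<in> germs" by (simp add: amplify_def a_def[abs_def])
  obtain N where "\<And>n. N \<le> n \<Longrightarrow> (\<lambda>x. a (int n, x)) \<in> bounded_measurable M"
    and N: "\<And>n. N \<le> n \<Longrightarrow> (\<integral>x. a (int n, x) \<partial>M) = gmean a" by (rule gmean_eventually[OF aA]) (rule that)
  define n where "n = N + nat \<bar>n0\<bar>"
  define m where "m = nat (int n - n0)"
  have "n0 \<le> int n" by (simp add: n_def)
  then have "(\<integral>x. a (int n, x) \<partial>M) = (\<integral>x. g ((T ^^ m) x) * cnj (g ((T ^^ m) x)) \<partial>M)"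
    by (intro Bochner_Integration.integral_cong) (auto simp: a_def eq m_def)
  also have "\<dots> = (\<integral>x. g x * cnj (g x) \<partial>M)"
    by (rule integral_comp_T_pow[OF bounded_measurableD[OF L2.mult_A[OF g L2.cnj_A[OF g]]]])
  finally have "gmean a = (\<integral>x. g x * cnj (g x) \<partial>M)" using N[of n] by (simp add: n_def)
  then show ?thesis by (simp add: G.nrm_def G.ip_def L2.nrm_def L2.ip_def a_def[abs_def])
qed

definition mavg :: "complex \<Rightarrow> nat \<Rightarrow> (nat \<Rightarrow> 'a \<Rightarrow> complex) \<Rightarrow> nat \<Rightarrow> 'a \<Rightarrow> complex" where
  "mavg z k f L = (\<lambda>x. (\<Sum>l\<in>{1..L}. z ^ l * (\<Prod>j\<in>{1..k}. f j ((T ^^ (j * l)) x))) / of_nat L)"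

lemma mavg_bounded_measurable:
  assumes "\<And>j. j \<in> {1..k} \<Longrightarrow> f j \<in> bounded_measurable M"
  shows "mavg z k f L \<in> bounded_measurable M"
  unfolding mavg_def
  by (intro L2.A_intros bounded_measurable_comp_T_pow assms)

text \<open>At negative indices \<open>nat\<close> gives the exponent \<open>0\<close>; apart from
  the bound, membership in \<open>germs\<close> constrains only large indices.\<close>

definition germ :: "('a \<Rightarrow> complex) \<Rightarrow> (int \<times> 'a) \<times> nat \<Rightarrow> complex" where
  "germ f z = f ((T ^^ nat (fst (fst z))) (snd (fst z)))"

lemma germ_unit_bdd:
  assumes f: "L2.unit_bdd f" shows "G.unit_bdd (germ f)"
proof -
  have fb: "f \<in> bounded_measurable M" "\<And>x. norm (f x) \<le> 1" using L2.unit_bddD[OF f] by auto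
  have "(\<lambda>x. f ((T ^^ nat n) x)) \<in> borel_measurable M" for n
    using bounded_measurable_comp_T_pow[OF fb(1)] by (rule bounded_measurableD)
  moreover have "f ((T ^^ nat (n + 1)) x) = f ((T ^^ nat n) (T x))" if "0 \<le> n" for n :: int and x
  proof -
    have "nat (n + 1) = Suc (nat n)" using that by simp
    then show ?thesis by (simp only: funpow_Suc_right comp_def)
  qed
  ultimately have "\<forall>n\<ge>0. (\<lambda>x. f ((T ^^ nat n) x)) \<in> borel_measurable M \<and> (\<forall>x\<in>space M. f ((T ^^ nat (n + 1)) x) = f ((T ^^ nat n) (T x)))"
    by blast
  then have "(\<lambda>w. f ((T ^^ nat (fst w)) (snd w))) \<in> germs"
    unfolding germs_def fst_conv snd_conv mem_Collect_eq using fb(2) by blast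
  then have "germ f \<in> amplify germs"
    unfolding amplify_def germ_def[abs_def] using fb(2) by (auto intro!: exI[of _ 1])
  then show ?thesis unfolding G.unit_bdd_def using fb(2) by (simp add: germ_def)
qed

lemma G_S: "G.S m a ((n, x), i) = a ((n + m, x), i)"
  by (simp add: G.S_def amplify_shift_def gshift_def)

lemma lavg_germ:
  assumes "0 \<le> n"
  shows "G.lavg z k (\<lambda>j. germ (f j)) L ((n, x), i) = mavg z k f L ((T ^^ nat (n - 0)) x)"
proof -
  have "germ (f j) ((n + int j * int l, x), i) = f j ((T ^^ (j * l)) ((T ^^ nat n) x))" for j l
  proof -
    have "nat (n + int j * int l) = j * l + nat n" using assms by (simp add: nat_add_distrib flip: of_nat_mult)
    then show ?thesis by (simp add: germ_def funpow_add)
  qed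
  then show ?thesis by (simp add: G.lavg_def G.linprod_def mavg_def G_S)
qed

theorem mavg_Cauchy:
  assumes f: "\<And>j. j \<in> {1..k} \<Longrightarrow> L2.unit_bdd (f j)" and \<epsilon>: "0 < \<epsilon>"
  shows "\<exists>N. \<forall>n\<ge>N. \<forall>m\<ge>N. L2.nrm (\<lambda>x. mavg 1 k f n x - mavg 1 k f m x) \<le> \<epsilon>"
proof -
  let ?g = "\<lambda>j. germ (f j)"
  have g: "G.unit_bdd (?g j)" if "j \<in> {1..k}" for j using f[OF that] by (rule germ_unit_bdd)
  have fb: "f j \<in> bounded_measurable M" if "j \<in> {1..k}" for j using f[OF that] by (rule L2.unit_bddD)
  have lA: "G.lavg 1 k ?g n \<in> amplify germs" for n using g by (intro G.lavg_A G.unit_bddD(1)) auto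
  have eq: "G.nrm (\<lambda>w. G.lavg 1 k ?g n w - G.lavg 1 k ?g m w) = L2.nrm (\<lambda>x. mavg 1 k f n x - mavg 1 k f m x)" for n m
  proof (rule G_nrm[where ?n0.0 = 0])
    show "(\<lambda>w. G.lavg 1 k ?g n w - G.lavg 1 k ?g m w) \<in> amplify germs" by (intro G.A_intros lA)
    show "(\<lambda>x. mavg 1 k f n x - mavg 1 k f m x) \<in> bounded_measurable M"
      by (intro L2.A_intros mavg_bounded_measurable fb)
  qed (simp only: lavg_germ)
  have "\<forall>\<^sub>F p in sequentially \<times>\<^sub>F sequentially. G.nrm (\<lambda>w. G.lavg 1 k ?g (fst p) w - G.lavg 1 k ?g (snd p) w) < \<epsilon>"
    using order_tendstoD(2)[OF G.lavg_Cauchy[of k ?g, OF g] \<epsilon>] by blast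
  then obtain P Q where PQ: "eventually P sequentially" "eventually Q sequentially"
    "\<And>n m. P n \<Longrightarrow> Q m \<Longrightarrow> G.nrm (\<lambda>w. G.lavg 1 k ?g n w - G.lavg 1 k ?g m w) < \<epsilon>"
    unfolding eventually_prod_filter by auto
  then obtain N1 N2 where "\<And>n. N1 \<le> n \<Longrightarrow> P n" "\<And>n. N2 \<le> n \<Longrightarrow> Q n" unfolding eventually_sequentially by blast
  then have "\<forall>n\<ge>max N1 N2. \<forall>m\<ge>max N1 N2. L2.nrm (\<lambda>x. mavg 1 k f n x - mavg 1 k f m x) \<le> \<epsilon>"
    using PQ(3) unfolding eq by (auto intro!: less_imp_le)
  then show ?thesis by blast
qed

lemma AE_zero_of_nrm:
  assumes "a \<in> bounded_measurable M" "L2.nrm a = 0" shows "AE x in M. a x = 0"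
proof -
  have aa: "(\<lambda>x. complex_of_real ((norm (a x))\<^sup>2)) \<in> bounded_measurable M"
    using L2.mult_A[OF assms(1) L2.cnj_A[OF assms(1)]] by (simp only: complex_norm_square)
  have "integrable M (\<lambda>x. Re (complex_of_real ((norm (a x))\<^sup>2)))"
    using bounded_measurable_integrable[OF aa] by (rule integrable_Re)
  then have "integrable M (\<lambda>x. (norm (a x))\<^sup>2)" by (simp only: Re_complex_of_real)
  moreover have "(\<integral>x. (norm (a x))\<^sup>2 \<partial>M) = 0" using assms by (simp add: nrm_eq_L2_norm L2_norm_def)
  ultimately have "AE x in M. (norm (a x))\<^sup>2 = 0" by (simp add: integral_nonneg_eq_0_iff_AE)
  then show ?thesis by simp
qed

lemma mavg_null_1:
  assumes g: "L2.unit_bdd g" and \<theta>: "- \<theta> \<notin> discrete_spectrum M T"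
  shows "(\<lambda>L. L2.nrm (mavg (e \<theta>) 1 (\<lambda>_. g) L)) \<longlonglongrightarrow> 0"
proof -
  define z where "z = e \<theta>"
  have z: "norm z = 1" by (simp add: z_def)
  define B where "B L = mavg z 1 (\<lambda>_. g) L" for L
  have gb: "g \<in> bounded_measurable M" "\<And>x. norm (g x) \<le> 1" using L2.unit_bddD[OF g] by auto
  have BA: "B L \<in> bounded_measurable M" for L unfolding B_def by (intro mavg_bounded_measurable gb)
  have B: "B L x = (\<Sum>l\<in>{1..L}. z ^ l * g ((T ^^ l) x)) / of_nat L" for L x by (simp add: B_def mavg_def)
  have zg: "norm (z ^ l * g ((T ^^ l) x)) \<le> 1" for l x using z gb(2) by (simp add: norm_mult norm_power)
  have B1: "norm (B L x) \<le> 1" for L x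
  proof -
    have "norm (\<Sum>l\<in>{1..L}. z ^ l * g ((T ^^ l) x)) \<le> (\<Sum>l\<in>{1..L}. 1)" using zg by (intro sum_norm_le) auto
    then show ?thesis unfolding B by (cases "L = 0") (simp_all add: norm_divide field_simps)
  qed
  have gg: "G.unit_bdd (germ g)" by (rule germ_unit_bdd[OF g])
  have GL: "G.nrm (\<lambda>w. G.orbit_avg z (germ g) n w - G.orbit_avg z (germ g) m w) = L2.nrm (\<lambda>x. B n x - B m x)" for n m
  proof (rule G_nrm[where ?n0.0 = 0])
    show "(\<lambda>w. G.orbit_avg z (germ g) n w - G.orbit_avg z (germ g) m w) \<in> amplify germs"
      by (intro G.A_intros G.orbit_avg_A G.unit_bddD(1)[OF gg])
    show "(\<lambda>x. B n x - B m x) \<in> bounded_measurable M" by (intro L2.A_intros BA)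
    have "G.orbit_avg z (germ g) L = G.lavg z 1 (\<lambda>j. germ g) L" for L
      by (simp add: G.orbit_avg_def G.lavg_def G.linprod_def)
    then show "G.orbit_avg z (germ g) n ((i, x), 0) - G.orbit_avg z (germ g) m ((i, x), 0) =
       B n ((T ^^ nat (i - 0)) x) - B m ((T ^^ nat (i - 0)) x)" if "0 \<le> i" for i x
      using lavg_germ[OF that, of z 1 "\<lambda>_. g"] by (simp add: B_def)
  qed
  obtain F where FA: "F \<in> bounded_measurable M" and F: "(\<lambda>n. L2.nrm (\<lambda>x. B n x - F x)) \<longlonglongrightarrow> 0"
  proof (rule L2_complete[of B 1])
    fix \<epsilon> :: real assume "0 < \<epsilon>"
    then obtain N where "\<And>n m. N \<le> n \<Longrightarrow> N \<le> m \<Longrightarrow> G.nrm (\<lambda>w. G.orbit_avg z (germ g) n w - G.orbit_avg z (germ g) m w) \<le> \<epsilon>"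
      using G.orbit_avg_Cauchy[OF gg z] by blast
    then show "\<exists>N. \<forall>n\<ge>N. \<forall>m\<ge>N. L2.nrm (\<lambda>x. B n x - B m x) \<le> \<epsilon>" unfolding GL by blast
  qed (use BA B1 in auto)
  have FT: "(\<lambda>x. F (T x)) \<in> bounded_measurable M" using bounded_measurable_comp_T_pow[OF FA, of 1] by simp
  have BT: "(\<lambda>x. B L (T x)) \<in> bounded_measurable M" for L using bounded_measurable_comp_T_pow[OF BA, of L 1] by simp
  let ?E = "\<lambda>x. z * F (T x) - F x"
  \<comment> \<open>In both terms of \<open>?E\<close> the limit \<open>F\<close> is replaced by
    \<open>B L\<close>, at equal cost because composition with \<open>T\<close> preserves the norm.
    For \<open>B L\<close> itself the difference telescopes.\<close>
  have "L2.nrm ?E \<le> 2 / real L + 2 * L2.nrm (\<lambda>x. B L x - F x)" if L: "0 < L" for L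
  proof -
    have d1: "L2.nrm (\<lambda>x. z * B L (T x) - B L x) \<le> 2 / L"
    proof (rule L2.nrm_le_bdd)
      show "(\<lambda>x. z * B L (T x) - B L x) \<in> bounded_measurable M" by (intro L2.A_intros BT BA)
      fix x
      have "z * B L (T x) = (\<Sum>l\<in>{1..L}. z ^ (l + 1) * g ((T ^^ (l + 1)) x)) / of_nat L"
        by (simp add: B sum_distrib_left mult.assoc funpow_swap1)
      then have "norm (z * B L (T x) - B L x) = norm ((\<Sum>l\<in>{1..L}. z ^ l * g ((T ^^ l) x)) - (\<Sum>l\<in>{1..L}. z ^ (l + 1) * g ((T ^^ (l + 1)) x))) / L"
        unfolding B[of L x] by (simp only: diff_divide_distrib[symmetric] norm_divide norm_of_nat norm_minus_commute)
      also have "\<dots> \<le> 2 * real 1 / L" using norm_sum_shift_le[of "\<lambda>l. z ^ l * g ((T ^^ l) x)" L 1] zg by (intro divide_right_mono) auto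
      finally show "norm (z * B L (T x) - B L x) \<le> 2 / L" by simp
    qed
    have d2: "L2.nrm (\<lambda>x. z * F (T x) - z * B L (T x)) = L2.nrm (\<lambda>x. B L x - F x)"
    proof -
      have "L2.nrm (\<lambda>x. z * F (T x) - z * B L (T x)) = L2.nrm (\<lambda>x. F (T x) - B L (T x))"
        using L2.nrm_scale[OF L2.diff_A[OF FT BT], of z L] z by (simp add: right_diff_distrib)
      also have "\<dots> = L2.nrm (\<lambda>x. F x - B L x)"
        using nrm_comp_T_pow[OF L2.diff_A[OF FA BA], of 1 L] by simp
      finally show ?thesis using L2.nrm_minus_commute[OF FA BA] by simp
    qed
    have "L2.nrm ?E \<le> L2.nrm (\<lambda>x. z * F (T x) - z * B L (T x)) + L2.nrm (\<lambda>x. z * B L (T x) - F x)"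
      by (intro L2.nrm_diff_triangle L2.scale_A FT BT FA)
    also have "L2.nrm (\<lambda>x. z * B L (T x) - F x) \<le> L2.nrm (\<lambda>x. z * B L (T x) - B L x) + L2.nrm (\<lambda>x. B L x - F x)"
      by (intro L2.nrm_diff_triangle L2.scale_A BT BA FA)
    finally show ?thesis using d1 d2 by linarith
  qed
  then have "\<forall>\<^sub>F L in sequentially. L2.nrm ?E \<le> 2 / real L + 2 * L2.nrm (\<lambda>x. B L x - F x)"
    by (intro eventually_sequentiallyI[of 1]) auto
  moreover have "(\<lambda>L. 2 / real L + 2 * L2.nrm (\<lambda>x. B L x - F x)) \<longlonglongrightarrow> 0 + 2 * 0"
    by (intro tendsto_add tendsto_mult F tendsto_const lim_const_over_n)
  ultimately have "L2.nrm ?E \<le> 0 + 2 * 0"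
    by (intro tendsto_lowerbound[of "\<lambda>L. 2 / real L + 2 * L2.nrm (\<lambda>x. B L x - F x)" _ sequentially]) simp_all
  then have "L2.nrm ?E \<le> 0" by simp
  moreover have EA: "?E \<in> bounded_measurable M" by (intro L2.A_intros FT FA)
  ultimately have "L2.nrm ?E = 0" using L2.nrm_ge_0[OF EA] by linarith
  then have ae: "AE x in M. ?E x = 0" by (rule AE_zero_of_nrm[OF EA])
  have "AE x in M. F x = 0"
  proof (rule ccontr)
    assume ne: "\<not> (AE x in M. F x = 0)"
    have "AE x in M. F (T x) = e (- \<theta>) * F x"
      using ae
    proof eventually_elim
      case (elim x)
      have "cnj z * z = 1" using z by (metis complex_norm_square mult.commute of_real_1 one_power2)
      then have "F (T x) = cnj z * (z * F (T x))" by (simp add: mult.assoc[symmetric])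
      also have "z * F (T x) = F x" using elim by simp
      finally show ?case by (simp only: e_uminus z_def)
    qed
    moreover have "F \<in> L2 M"
    proof -
      have "integrable M (\<lambda>x. Re (F x * cnj (F x)))"
        by (intro integrable_Re bounded_measurable_integrable L2.mult_A L2.cnj_A FA)
      then have "integrable M (\<lambda>x. (norm (F x))\<^sup>2)" by (simp only: complex_norm_square[symmetric] Re_complex_of_real)
      then show ?thesis using FA by (simp add: L2_def bounded_measurableD)
    qed
    ultimately have "- \<theta> \<in> discrete_spectrum M T" using ne unfolding discrete_spectrum_def by blast
    then show False using \<theta> by simp
  qed
  then have "(\<integral>x. F x * cnj (F x) \<partial>M) = (\<integral>x. 0 \<partial>M)"
    using FA by (intro integral_cong_AE) (auto simp: bounded_measurableD)
  then have F0: "L2.nrm F = 0" by (simp add: L2.nrm_def L2.ip_def)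
  have "L2.nrm (B n) \<le> L2.nrm (\<lambda>x. B n x - F x)" for n
    using L2.nrm_triangle[OF L2.diff_A[OF BA FA] FA, of n] F0 by simp
  then show ?thesis unfolding z_def[symmetric] B_def[symmetric]
    using F by (rule tendsto_0_squeeze[rotated]) (rule L2.nrm_ge_0[OF BA])
qed

theorem mavg_null:
  assumes f: "\<And>j. j \<in> {1..k} \<Longrightarrow> L2.unit_bdd (f j)" and k: "0 < k" and \<theta>: "- \<theta> \<notin> discrete_spectrum M T"
  shows "(\<lambda>L. L2.nrm (mavg (e \<theta>) k f L)) \<longlonglongrightarrow> 0"
proof -
  let ?z = "e \<theta>"
  have null: "G.null_weights sequentially (\<lambda>L. {1..L}) (\<lambda>L l. ?z ^ l / of_nat L) k"
  proof (rule G.lavg_null[OF norm_e k])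
    \<comment> \<open>Every function of the amplified algebra has to be treated. For the norm only
      its slice \<open>0\<close> counts, and from \<open>n0\<close> on this germ is the orbit of a
      function \<open>g\<close> on the space.\<close>
    fix u assume u: "G.unit_bdd u"
    define a where "a w = u (w, 0)" for w
    have "a \<in> germs" using G.unit_bddD(1)[OF u] by (simp add: amplify_def a_def[abs_def])
    then obtain n0 where am: "\<And>n. n0 \<le> n \<Longrightarrow> (\<lambda>x. a (n, x)) \<in> borel_measurable M"
      and aT: "\<And>n x. n0 \<le> n \<Longrightarrow> x \<in> space M \<Longrightarrow> a (n + 1, x) = a (n, T x)" unfolding germs_def by blast
    define g where "g x = a (n0, x)" for x
    have g1: "norm (g x) \<le> 1" for x using G.unit_bddD(2)[OF u] by (simp add: g_def a_def)
    then have gA: "g \<in> bounded_measurable M" using am[of n0] by (auto simp: bounded_measurable_def g_def[abs_def])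
    have g: "L2.unit_bdd g" using g1 gA by (simp add: L2.unit_bdd_def)
    have ag: "a (n0 + int d, x) = g ((T ^^ d) x)" if "x \<in> space M" for d x
      using that
    proof (induction d arbitrary: x)
      case (Suc d)
      have "a (n0 + int (Suc d), x) = a (n0 + int d, T x)" using aT[of "n0 + int d" x] Suc.prems by (simp add: algebra_simps)
      also have "\<dots> = g ((T ^^ d) (T x))" using Suc measurable_space[OF measurable_T] by blast
      finally show ?case by (simp add: funpow_swap1)
    qed (simp add: g_def)
    have "G.nrm (G.lavg ?z 1 (\<lambda>_. u) L) = L2.nrm (mavg ?z 1 (\<lambda>_. g) L)" for L
    proof (rule G_nrm[where ?n0.0 = n0])
      show "G.lavg ?z 1 (\<lambda>_. u) L \<in> amplify germs" by (intro G.lavg_A G.unit_bddD(1)[OF u])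
      show "mavg ?z 1 (\<lambda>_. g) L \<in> bounded_measurable M" by (intro mavg_bounded_measurable gA)
      fix n x assume n: "n0 \<le> n" and x: "x \<in> space M"
      have "u ((n + int l, x), 0) = g ((T ^^ l) ((T ^^ nat (n - n0)) x))" for l
      proof -
        have "n + int l = n0 + int (l + nat (n - n0))" using n by simp
        then have "u ((n + int l, x), 0) = g ((T ^^ (l + nat (n - n0))) x)" using ag[OF x] by (metis a_def)
        then show ?thesis by (simp add: funpow_add)
      qed
      then show "G.lavg ?z 1 (\<lambda>_. u) L ((n, x), 0) = mavg ?z 1 (\<lambda>_. g) L ((T ^^ nat (n - n0)) x)"
        by (simp add: G.lavg_def G.linprod_def mavg_def G_S)
    qed
    then show "(\<lambda>L. G.nrm (G.lavg ?z 1 (\<lambda>_. u) L)) \<longlonglongrightarrow> 0" using mavg_null_1[OF g \<theta>] by simp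
  qed
  let ?g = "\<lambda>j. germ (f j)"
  have g: "G.unit_bdd (?g j)" if "j \<in> {1..k}" for j using f[OF that] by (rule germ_unit_bdd)
  have "G.nrm (G.lavg ?z k ?g L) = L2.nrm (mavg ?z k f L)" for L
  proof (rule G_nrm[where ?n0.0 = 0])
    show "G.lavg ?z k ?g L \<in> amplify germs" using g by (intro G.lavg_A G.unit_bddD(1)) auto
    show "mavg ?z k f L \<in> bounded_measurable M" using f by (intro mavg_bounded_measurable L2.unit_bddD(1)) auto
  qed (rule lavg_germ)
  moreover have "(\<lambda>L. G.nrm (G.lavg ?z k ?g L)) \<longlonglongrightarrow> 0"
    by (rule null[unfolded G.null_weights_def G.wavg_phase, rule_format]) (rule g)
  ultimately show ?thesis by simp
qed

end

section \<open>Besicovitch almost periodic sequences\<close>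

lemma e_add: "e (\<theta> + \<theta>') = e \<theta> * e \<theta>'"
  by transfer (simp add: exp_add[symmetric] distrib_left)

lemma e_zero [simp]: "e 0 = 1"
  by transfer simp

lemma exp_2_pi_i_eq_1_iff: "exp (2 * pi * \<i> * complex_of_real x) = 1 \<longleftrightarrow> x \<in> \<int>"
proof -
  have "exp (2 * pi * \<i> * complex_of_real x) = 1 \<longleftrightarrow> (\<exists>n::int. 2 * pi * x = of_int (2 * n) * pi)"
    by (simp add: exp_eq_1)
  also have "\<dots> \<longleftrightarrow> x \<in> \<int>" by (auto simp: Ints_def)
  finally show ?thesis .
qed

lemma e_eq_1_iff: "e \<theta> = 1 \<longleftrightarrow> \<theta> = 0"
  by transfer (simp only: exp_2_pi_i_eq_1_iff diff_zero)

lemma circle_mult_Suc: "circle_mult (Suc n) \<theta> = \<theta> + circle_mult n \<theta>"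
  by transfer (simp add: algebra_simps)

lemma circle_mult_0: "circle_mult 0 \<theta> = 0"
  by transfer simp

lemma e_circle_mult: "e (circle_mult n \<theta>) = e \<theta> ^ n"
  by (induction n) (simp_all add: circle_mult_0 circle_mult_Suc e_add)

lemma average_diff: "average (\<lambda>n. u n - v n) N = average u N - average v N"
  and average_scale: "average (\<lambda>n. c * u n) N = c * average u N"
  and average_sum: "average (\<lambda>n. \<Sum>i\<in>I. g i n) N = (\<Sum>i\<in>I. average (g i) N)"
  unfolding average_def
  by (simp_all add: sum.distrib add_divide_distrib sum_subtractf diff_divide_distrib sum_distrib_left
      sum_divide_distrib sum.swap[of _ I])

lemma norm_average_le: "norm (average u N) \<le> (\<Sum>n = 1..N. norm (u n)) / real N"
  unfolding average_def by (simp add: norm_divide divide_right_mono norm_sum)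

lemma average_e_tendsto: "average (\<lambda>n. e \<theta> ^ n) \<longlonglongrightarrow> (if \<theta> = 0 then 1 else 0)"
proof (cases "\<theta> = 0")
  case True
  have "average (\<lambda>n. e \<theta> ^ n) N = 1" if "1 \<le> N" for N using True that by (simp add: average_def)
  then have "average (\<lambda>n. e \<theta> ^ n) \<longlonglongrightarrow> 1"
    by (intro tendsto_eventually eventually_sequentiallyI[of 1])
  then show ?thesis using True by simp
next
  case False
  then have ne: "e \<theta> \<noteq> 1" by (simp add: e_eq_1_iff)
  let ?z = "e \<theta>"
  have "(1 - ?z) * (\<Sum>n = 1..N. ?z ^ n) = ?z - ?z ^ Suc N" for N
  proof (induction N)
    case (Suc N)
    have "(1 - ?z) * (\<Sum>n = 1..Suc N. ?z ^ n) = (1 - ?z) * (\<Sum>n = 1..N. ?z ^ n) + (1 - ?z) * ?z ^ Suc N"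
      by (simp add: distrib_left)
    also have "\<dots> = ?z - ?z ^ Suc (Suc N)" unfolding Suc.IH by (simp add: algebra_simps)
    finally show ?case .
  qed simp
  then have sum: "(\<Sum>n = 1..N. ?z ^ n) = (?z - ?z ^ Suc N) / (1 - ?z)" for N
    using ne by (metis eq_iff_diff_eq_0 nonzero_mult_div_cancel_left)
  have "norm (average (\<lambda>n. ?z ^ n) N) \<le> (2 / norm (1 - ?z)) / N" for N
  proof -
    have "norm (?z - ?z ^ Suc N) \<le> 2"
      using norm_triangle_ineq4[of ?z "?z ^ Suc N"] by (simp add: norm_power norm_mult)
    then show ?thesis unfolding average_def sum norm_divide norm_of_nat by (intro divide_right_mono) auto
  qed
  then have "average (\<lambda>n. ?z ^ n) \<longlonglongrightarrow> 0"
    by (intro Lim_null_comparison[OF _ lim_const_over_n] always_eventually allI)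
  then show ?thesis using False by simp
qed

text \<open>An inductive form of trigonometric polynomials, convenient for closure under products,
  conjugation and real polynomials.\<close>

inductive_set trig :: "(nat \<Rightarrow> complex) set" where
  trig_char: "(\<lambda>n. c * e \<theta> ^ n) \<in> trig"
| trig_add: "\<rho> \<in> trig \<Longrightarrow> \<rho>' \<in> trig \<Longrightarrow> (\<lambda>n. \<rho> n + \<rho>' n) \<in> trig"

lemma trig_const: "(\<lambda>n. c) \<in> trig"
  using trig_char[of c 0] by simp

lemma trig_sum: "finite I \<Longrightarrow> (\<And>i. i \<in> I \<Longrightarrow> \<rho> i \<in> trig) \<Longrightarrow> (\<lambda>n. \<Sum>i\<in>I. \<rho> i n) \<in> trig"
  by (induction I rule: finite_induct) (auto intro: trig_const trig_add)

lemma trig_polynomial_trig: "trig_polynomial \<rho> \<Longrightarrow> \<rho> \<in> trig"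
  unfolding trig_polynomial_def e_circle_mult by (auto intro!: trig_sum trig_char)

lemma trig_mult: "\<rho> \<in> trig \<Longrightarrow> \<rho>' \<in> trig \<Longrightarrow> (\<lambda>n. \<rho> n * \<rho>' n) \<in> trig"
proof (induction rule: trig.induct)
  case (trig_char c \<theta>)
  then show ?case
  proof (induction rule: trig.induct)
    case (trig_char c' \<theta>')
    show ?case using trig.trig_char[of "c * c'" "\<theta> + \<theta>'"] by (simp add: e_add power_mult_distrib mult_ac)
  next
    case (trig_add \<rho> \<rho>')
    then show ?case using trig.trig_add[OF trig_add.IH] by (simp add: distrib_left)
  qed
next
  case (trig_add \<rho>1 \<rho>2)
  then show ?case using trig.trig_add[OF trig_add.IH] by (simp add: distrib_right)
qed

lemma trig_cnj: "\<rho> \<in> trig \<Longrightarrow> (\<lambda>n. cnj (\<rho> n)) \<in> trig"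
proof (induction rule: trig.induct)
  case (trig_char c \<theta>)
  show ?case using trig.trig_char[of "cnj c" "- \<theta>"] by (simp add: e_uminus)
qed (auto intro: trig.trig_add)

lemma trig_scale: "\<rho> \<in> trig \<Longrightarrow> (\<lambda>n. c * \<rho> n) \<in> trig"
  by (rule trig_mult[OF trig_const])

lemma trig_Re: "\<rho> \<in> trig \<Longrightarrow> (\<lambda>n. of_real (Re (\<rho> n))) \<in> trig"
proof -
  assume "\<rho> \<in> trig"
  then have "(\<lambda>n. (1 / 2) * (\<rho> n + cnj (\<rho> n))) \<in> trig" by (intro trig_scale trig_add trig_cnj)
  moreover have "(1 / 2) * (\<rho> n + cnj (\<rho> n)) = of_real (Re (\<rho> n))" for n by (simp add: complex_eq_iff)
  ultimately show ?thesis by simp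
qed

lemma trig_real_polynomial:
  fixes p :: "real \<Rightarrow> real"
  assumes "real_polynomial_function p" "\<rho> \<in> trig"
  shows "(\<lambda>n. of_real (p (Re (\<rho> n)))) \<in> trig"
  using assms(1)
proof (induction rule: real_polynomial_function.induct)
  case (linear p)
  have "p x = x * p 1" for x using linear_scale[OF bounded_linear.linear[OF linear], of x 1] by simp
  then have "(\<lambda>n. of_real (p (Re (\<rho> n)))) = (\<lambda>n. of_real (p 1) * complex_of_real (Re (\<rho> n)))"
    by (metis mult.commute of_real_mult)
  then show ?case using trig_scale[OF trig_Re[OF assms(2)], of "of_real (p 1)"] by simp
qed (auto intro: trig_const trig_add trig_mult)

lemma trig_bounded: "\<rho> \<in> trig \<Longrightarrow> \<exists>B. \<forall>n. norm (\<rho> n) \<le> B"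
proof (induction rule: trig.induct)
  case (trig_char c \<theta>)
  then show ?case by (auto simp: norm_mult norm_power)
next
  case (trig_add \<rho> \<rho>')
  then obtain B B' where "\<And>n. norm (\<rho> n) \<le> B" "\<And>n. norm (\<rho>' n) \<le> B'" by auto
  then have "\<forall>n. norm (\<rho> n + \<rho>' n) \<le> B + B'" by (intro allI norm_triangle_le add_mono)
  then show ?case by blast
qed

text \<open>Equal frequencies are merged, so that each frequency can be kept or dropped as a
  whole.\<close>

lemma trig_normal_form: "\<rho> \<in> trig \<Longrightarrow> \<exists>\<Theta> c. finite \<Theta> \<and> \<rho> = (\<lambda>n. \<Sum>\<theta>\<in>\<Theta>. c \<theta> * e \<theta> ^ n)"
proof (induction rule: trig.induct)
  case (trig_char c \<theta>)
  then show ?case by (intro exI[of _ "{\<theta>}"] exI[of _ "\<lambda>_. c"]) simp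
next
  case (trig_add \<rho> \<rho>')
  then obtain \<Theta> c \<Theta>' c' where 1: "finite \<Theta>" "\<rho> = (\<lambda>n. \<Sum>\<theta>\<in>\<Theta>. c \<theta> * e \<theta> ^ n)"
    and 2: "finite \<Theta>'" "\<rho>' = (\<lambda>n. \<Sum>\<theta>\<in>\<Theta>'. c' \<theta> * e \<theta> ^ n)" by auto
  define d where "d \<theta> = (if \<theta> \<in> \<Theta> then c \<theta> else 0) + (if \<theta> \<in> \<Theta>' then c' \<theta> else 0)" for \<theta>
  have "(\<Sum>\<theta>\<in>\<Theta> \<union> \<Theta>'. (if \<theta> \<in> \<Theta> then c \<theta> else 0) * e \<theta> ^ n) = (\<Sum>\<theta>\<in>\<Theta>. c \<theta> * e \<theta> ^ n)" for n
    by (rule sum.mono_neutral_cong_right) (use 1 2 in auto)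
  moreover have "(\<Sum>\<theta>\<in>\<Theta> \<union> \<Theta>'. (if \<theta> \<in> \<Theta>' then c' \<theta> else 0) * e \<theta> ^ n) = (\<Sum>\<theta>\<in>\<Theta>'. c' \<theta> * e \<theta> ^ n)" for n
    by (rule sum.mono_neutral_cong_right) (use 1 2 in auto)
  ultimately have "(\<lambda>n. \<rho> n + \<rho>' n) = (\<lambda>n. \<Sum>\<theta>\<in>\<Theta> \<union> \<Theta>'. d \<theta> * e \<theta> ^ n)"
    unfolding 1(2) 2(2) d_def distrib_right sum.distrib by simp
  then show ?case using 1 2 by blast
qed

text \<open>Truncating a trigonometric polynomial by a polynomial in its real and imaginary parts keeps it
  almost periodic, gives a bound independent of the polynomial, and so turns \<open>L\<^sup>1\<close>-closeness into
  \<open>L\<^sup>2\<close>-closeness.\<close>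

lemma trig_truncate:
  assumes \<rho>: "\<rho> \<in> trig" and \<phi>: "\<And>n. norm (\<phi> n) \<le> R" and \<delta>: "0 < \<delta>" and R: "0 \<le> R"
  obtains \<rho>' where "\<rho>' \<in> trig" "\<And>n. norm (\<phi> n - \<rho>' n) \<le> 2 * (norm (\<phi> n - \<rho> n) + \<delta>)"
    "\<And>n. norm (\<rho>' n) \<le> 2 * (R + \<delta>)"
proof -
  obtain B where B: "\<And>n. norm (\<rho> n) \<le> B" using trig_bounded[OF \<rho>] by blast
  obtain p :: "real \<Rightarrow> real" where p: "real_polynomial_function p" "\<And>x. \<bar>x\<bar> \<le> B \<Longrightarrow> \<bar>p x - clip R x\<bar> \<le> \<delta>"
    using clip_polynomial[OF \<delta>] by blast
  have close: "\<bar>x - p y\<bar> \<le> \<bar>x - y\<bar> + \<delta>" "\<bar>p y\<bar> \<le> R + \<delta>" if "\<bar>x\<bar> \<le> R" "\<bar>y\<bar> \<le> B" for x y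
    using p(2)[OF that(2)] clip_id[OF that(1)] clip_Lipschitz[of R x y] clip_bound[OF R, of y] by linarith+
  define \<rho>' where "\<rho>' n = of_real (p (Re (\<rho> n))) + \<i> * of_real (p (Im (\<rho> n)))" for n
  have tr: "\<rho>' \<in> trig"
  proof -
    have "(\<lambda>n. of_real (p (Re (\<rho> n))) + \<i> * of_real (p (Re (- \<i> * \<rho> n)))) \<in> trig"
      by (intro trig_add trig_scale trig_real_polynomial p \<rho>)
    then show ?thesis by (simp add: \<rho>'_def[abs_def])
  qed
  have parts: "\<bar>Re (\<phi> n)\<bar> \<le> R" "\<bar>Im (\<phi> n)\<bar> \<le> R" "\<bar>Re (\<rho> n)\<bar> \<le> B" "\<bar>Im (\<rho> n)\<bar> \<le> B" for n
    using abs_Re_le_cmod[of "\<phi> n"] abs_Im_le_cmod[of "\<phi> n"] abs_Re_le_cmod[of "\<rho> n"] abs_Im_le_cmod[of "\<rho> n"]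
      \<phi>[of n] B[of n] by linarith+
  show ?thesis
  proof (rule that[OF tr])
    fix n
    have "norm (\<phi> n - \<rho>' n) \<le> \<bar>Re (\<phi> n - \<rho>' n)\<bar> + \<bar>Im (\<phi> n - \<rho>' n)\<bar>" by (rule cmod_le)
    also have "\<dots> = \<bar>Re (\<phi> n) - p (Re (\<rho> n))\<bar> + \<bar>Im (\<phi> n) - p (Im (\<rho> n))\<bar>" by (simp add: \<rho>'_def)
    also have "\<dots> \<le> (\<bar>Re (\<phi> n - \<rho> n)\<bar> + \<delta>) + (\<bar>Im (\<phi> n - \<rho> n)\<bar> + \<delta>)"
      using close(1)[OF parts(1,3)[of n]] close(1)[OF parts(2,4)[of n]] by simp
    also have "\<dots> \<le> (norm (\<phi> n - \<rho> n) + \<delta>) + (norm (\<phi> n - \<rho> n) + \<delta>)"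
      by (intro add_mono abs_Re_le_cmod abs_Im_le_cmod order_refl)
    also have "\<dots> = 2 * (norm (\<phi> n - \<rho> n) + \<delta>)" by simp
    finally show "norm (\<phi> n - \<rho>' n) \<le> 2 * (norm (\<phi> n - \<rho> n) + \<delta>)" .
    have "norm (\<rho>' n) \<le> \<bar>Re (\<rho>' n)\<bar> + \<bar>Im (\<rho>' n)\<bar>" by (rule cmod_le)
    also have "\<dots> \<le> 2 * (R + \<delta>)"
      using close(2)[OF parts(1,3)[of n]] close(2)[OF parts(2,4)[of n]] by (simp add: \<rho>'_def)
    finally show "norm (\<rho>' n) \<le> 2 * (R + \<delta>)" .
  qed
qed

lemma seq_spectrum_null:
  assumes "\<theta> \<notin> seq_spectrum \<phi>"
  shows "average (\<lambda>n. \<phi> n * cnj (e \<theta> ^ n)) \<longlonglongrightarrow> 0"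
proof -
  have eq: "e (- circle_mult n \<theta>) = cnj (e \<theta> ^ n)" for n
    by (simp add: e_uminus e_circle_mult)
  let ?x = "\<lambda>N. norm (average (\<lambda>n. \<phi> n * cnj (e \<theta> ^ n)) N)"
  have le: "limsup (\<lambda>N. ereal (?x N)) \<le> 0" using assms by (simp add: seq_spectrum_def eq not_less)
  have "?x \<longlonglongrightarrow> 0"
  proof (rule LIMSEQ_I)
    fix r :: real assume r: "0 < r"
    then have "limsup (\<lambda>N. ereal (?x N)) < ereal r" using le by (simp add: le_less_trans)
    then have "\<forall>\<^sub>F N in sequentially. ereal (?x N) < ereal r" by (rule Limsup_lessD)
    then show "\<exists>no. \<forall>n\<ge>no. norm (?x n - 0) < r" by (auto simp: eventually_sequentially)
  qed
  then show ?thesis by (rule tendsto_norm_zero_cancel)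
qed

text \<open>Dropping the frequencies outside the spectrum of \<open>\<phi>\<close> does not increase the \<open>L\<^sup>2\<close>-distance
  to \<open>\<phi>\<close>: the dropped part is asymptotically orthogonal to the new difference.\<close>

lemma drop_frequencies:
  assumes \<Theta>: "finite \<Theta>1" "finite \<Theta>2" "\<Theta>1 \<inter> \<Theta>2 = {}" and null: "\<And>\<theta>. \<theta> \<in> \<Theta>2 \<Longrightarrow> \<theta> \<notin> seq_spectrum \<phi>"
    and \<epsilon>: "0 < \<epsilon>"
  shows "\<forall>\<^sub>F N in sequentially. (\<Sum>n = 1..N. (norm (\<phi> n - (\<Sum>\<theta>\<in>\<Theta>1. c \<theta> * e \<theta> ^ n)))\<^sup>2) / N \<le>
    (\<Sum>n = 1..N. (norm (\<phi> n - (\<Sum>\<theta>\<in>\<Theta>1 \<union> \<Theta>2. c \<theta> * e \<theta> ^ n)))\<^sup>2) / N + \<epsilon>"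
proof -
  define \<rho>1 where "\<rho>1 n = (\<Sum>\<theta>\<in>\<Theta>1. c \<theta> * e \<theta> ^ n)" for n
  define \<rho>2 where "\<rho>2 n = (\<Sum>\<theta>\<in>\<Theta>2. c \<theta> * e \<theta> ^ n)" for n
  have un: "(\<Sum>\<theta>\<in>\<Theta>1 \<union> \<Theta>2. c \<theta> * e \<theta> ^ n) = \<rho>1 n + \<rho>2 n" for n
    unfolding \<rho>1_def \<rho>2_def using \<Theta> by (rule sum.union_disjoint)
  have orth: "average (\<lambda>n. (\<phi> n - \<rho>1 n) * cnj (\<rho>2 n)) \<longlonglongrightarrow> 0"
  proof -
    \<comment> \<open>Neither part correlates with \<theta>: \<phi> because \<theta> lies outside
      its spectrum, and \<open>\<rho>1\<close> because \<theta> is not among its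
      frequencies.\<close>
    have one: "average (\<lambda>n. (\<phi> n - \<rho>1 n) * cnj (e \<theta> ^ n)) \<longlonglongrightarrow> 0" if \<theta>: "\<theta> \<in> \<Theta>2" for \<theta>
    proof -
      have "average (\<lambda>n. \<rho>1 n * cnj (e \<theta> ^ n)) = (\<lambda>N. \<Sum>\<theta>'\<in>\<Theta>1. c \<theta>' * average (\<lambda>n. e (\<theta>' - \<theta>) ^ n) N)"
      proof
        fix N
        have "e (\<theta>' - \<theta>) ^ n = e \<theta>' ^ n * cnj (e \<theta> ^ n)" for \<theta>' n
          using e_add[of \<theta>' "- \<theta>"] by (simp add: e_uminus power_mult_distrib)
        then show "average (\<lambda>n. \<rho>1 n * cnj (e \<theta> ^ n)) N = (\<Sum>\<theta>'\<in>\<Theta>1. c \<theta>' * average (\<lambda>n. e (\<theta>' - \<theta>) ^ n) N)"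
          unfolding average_scale[symmetric] average_sum[symmetric]
          by (simp add: \<rho>1_def sum_distrib_right mult.assoc)
      qed
      moreover have "(\<lambda>N. \<Sum>\<theta>'\<in>\<Theta>1. c \<theta>' * average (\<lambda>n. e (\<theta>' - \<theta>) ^ n) N) \<longlonglongrightarrow> (\<Sum>\<theta>'\<in>\<Theta>1. c \<theta>' * (if \<theta>' - \<theta> = 0 then 1 else 0))"
        by (intro tendsto_sum tendsto_mult tendsto_const average_e_tendsto)
      moreover have "(\<Sum>\<theta>'\<in>\<Theta>1. c \<theta>' * (if \<theta>' - \<theta> = 0 then 1 else 0)) = 0"
        by (rule sum.neutral) (use \<theta> \<Theta>(3) in auto)
      ultimately have "average (\<lambda>n. \<rho>1 n * cnj (e \<theta> ^ n)) \<longlonglongrightarrow> 0" by simp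
      from tendsto_diff[OF seq_spectrum_null[OF null[OF \<theta>]] this]
      have "(\<lambda>N. average (\<lambda>n. \<phi> n * cnj (e \<theta> ^ n)) N - average (\<lambda>n. \<rho>1 n * cnj (e \<theta> ^ n)) N) \<longlonglongrightarrow> 0 - 0" .
      then show ?thesis by (simp add: average_diff[symmetric] left_diff_distrib)
    qed
    have "average (\<lambda>n. (\<phi> n - \<rho>1 n) * cnj (\<rho>2 n)) = (\<lambda>N. \<Sum>\<theta>\<in>\<Theta>2. cnj (c \<theta>) * average (\<lambda>n. (\<phi> n - \<rho>1 n) * cnj (e \<theta> ^ n)) N)"
      unfolding average_scale[symmetric] average_sum[symmetric]
      by (simp add: \<rho>2_def sum_distrib_left mult.left_commute)
    moreover have "(\<lambda>N. \<Sum>\<theta>\<in>\<Theta>2. cnj (c \<theta>) * average (\<lambda>n. (\<phi> n - \<rho>1 n) * cnj (e \<theta> ^ n)) N) \<longlonglongrightarrow> (\<Sum>\<theta>\<in>\<Theta>2. cnj (c \<theta>) * 0)"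
      by (intro tendsto_sum tendsto_mult tendsto_const one)
    ultimately show ?thesis by (simp only: mult_zero_right sum.neutral_const)
  qed
  \<comment> \<open>The expanded square with \<open>(norm d)\<^sup>2\<close> discarded.\<close>
  have sq: "(norm (a - b))\<^sup>2 \<le> (norm (a - (b + d)))\<^sup>2 + 2 * Re ((a - b) * cnj d)" for a b d :: complex
    unfolding cmod_power2 by (simp add: power2_eq_square algebra_simps)
  have "\<forall>\<^sub>F N in sequentially. norm (average (\<lambda>n. (\<phi> n - \<rho>1 n) * cnj (\<rho>2 n)) N) < \<epsilon> / 2"
    by (rule order_tendstoD(2)[OF tendsto_norm_zero[OF orth]]) (use \<epsilon> in simp)
  then show ?thesis
  proof eventually_elim
    case (elim N)
    have "(\<Sum>n = 1..N. (norm (\<phi> n - \<rho>1 n))\<^sup>2) / N \<le>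
      (\<Sum>n = 1..N. (norm (\<phi> n - (\<rho>1 n + \<rho>2 n)))\<^sup>2 + 2 * Re ((\<phi> n - \<rho>1 n) * cnj (\<rho>2 n))) / N"
      by (intro divide_right_mono sum_mono sq) auto
    also have "\<dots> = (\<Sum>n = 1..N. (norm (\<phi> n - (\<rho>1 n + \<rho>2 n)))\<^sup>2) / N + 2 * Re (average (\<lambda>n. (\<phi> n - \<rho>1 n) * cnj (\<rho>2 n)) N)"
      by (simp only: average_def sum.distrib add_divide_distrib sum_distrib_left[symmetric] Re_divide_of_nat Re_sum times_divide_eq_right)
    also have "Re (average (\<lambda>n. (\<phi> n - \<rho>1 n) * cnj (\<rho>2 n)) N) \<le> \<epsilon> / 2"
      using elim complex_Re_le_cmod[of "average (\<lambda>n. (\<phi> n - \<rho>1 n) * cnj (\<rho>2 n)) N"] by linarith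
    finally show ?case unfolding un \<rho>1_def[symmetric] by simp
  qed
qed

text \<open>Dropping frequencies relies on orthogonality and hence on squares, whereas almost
  periodicity is stated with first powers. Truncation gives the way to squares, Cauchy-Schwarz the
  way back.\<close>

theorem besicovitch_spectral_approximation:
  assumes bap: "besicovitch_almost_periodic \<phi>" and \<epsilon>: "0 < \<epsilon>"
  obtains \<Theta> c where "finite \<Theta>" "\<Theta> \<subseteq> seq_spectrum \<phi>"
    "\<forall>\<^sub>F N in sequentially. (\<Sum>n = 1..N. norm (\<phi> n - (\<Sum>\<theta>\<in>\<Theta>. c \<theta> * e \<theta> ^ n))) / real N \<le> \<epsilon>"
proof -
  obtain R where R: "0 < R" "\<And>n. norm (\<phi> n) \<le> R"
    using bap unfolding besicovitch_almost_periodic_def bounded_pos by auto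
  \<comment> \<open>The distance of \<open>\<phi> n\<close> and \<open>\<rho> n\<close> is at most
    \<open>3 * R + 2\<close> and at most
    \<open>2 * (norm (\<phi> n - \<rho>0 n) + \<delta>)\<close>. The product of these bounds has
    mean at most \<open>K * \<delta>\<close>, which takes up half of
    \<open>\<epsilon>\<^sup>2\<close>.\<close>
  define K where "K = 4 * (3 * R + 2)"
  have K: "0 < K" using R by (simp add: K_def)
  define \<delta> where "\<delta> = min 1 (\<epsilon>\<^sup>2 / (2 * K))"
  have \<delta>: "0 < \<delta>" "\<delta> \<le> 1" using \<epsilon> K by (simp_all add: \<delta>_def)
  have "\<delta> \<le> \<epsilon>\<^sup>2 / (2 * K)" by (simp add: \<delta>_def)
  then have K\<delta>: "K * \<delta> \<le> \<epsilon>\<^sup>2 / 2" using K by (simp add: field_simps)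
  obtain \<rho>0 where tp: "trig_polynomial \<rho>0" and ls: "limsup (\<lambda>N. ereal ((\<Sum>n = 1..N. norm (\<phi> n - \<rho>0 n)) / real N)) < ereal \<delta>"
    using bap \<delta>(1) unfolding besicovitch_almost_periodic_def by blast
  have \<rho>0: "\<rho>0 \<in> trig" using tp by (rule trig_polynomial_trig)
  obtain \<rho> where \<rho>: "\<rho> \<in> trig" "\<And>n. norm (\<phi> n - \<rho> n) \<le> 2 * (norm (\<phi> n - \<rho>0 n) + \<delta>)" "\<And>n. norm (\<rho> n) \<le> 2 * (R + \<delta>)"
    using trig_truncate[of \<rho>0 \<phi> R \<delta> thesis, OF \<rho>0 R(2) \<delta>(1)] R(1) by (simp add: less_imp_le)
  obtain \<Theta> c where \<Theta>: "finite \<Theta>" and \<rho>eq: "\<rho> = (\<lambda>n. \<Sum>\<theta>\<in>\<Theta>. c \<theta> * e \<theta> ^ n)"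
    using trig_normal_form[OF \<rho>(1)] by blast
  define \<Theta>1 where "\<Theta>1 = \<Theta> \<inter> seq_spectrum \<phi>"
  define \<Theta>2 where "\<Theta>2 = \<Theta> - seq_spectrum \<phi>"
  have un: "\<Theta>1 \<union> \<Theta>2 = \<Theta>" by (auto simp: \<Theta>1_def \<Theta>2_def)
  have "\<forall>\<^sub>F N in sequentially. (\<Sum>n = 1..N. (norm (\<phi> n - (\<Sum>\<theta>\<in>\<Theta>1. c \<theta> * e \<theta> ^ n)))\<^sup>2) / N \<le>
    (\<Sum>n = 1..N. (norm (\<phi> n - (\<Sum>\<theta>\<in>\<Theta>1 \<union> \<Theta>2. c \<theta> * e \<theta> ^ n)))\<^sup>2) / N + \<epsilon>\<^sup>2 / 2"
    using \<Theta> \<epsilon> by (intro drop_frequencies) (auto simp: \<Theta>1_def \<Theta>2_def)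
  moreover have "\<forall>\<^sub>F N in sequentially. ereal ((\<Sum>n = 1..N. norm (\<phi> n - \<rho>0 n)) / real N) < ereal \<delta>"
    using ls by (rule Limsup_lessD)
  moreover have "\<forall>\<^sub>F N::nat in sequentially. 0 < N" by (rule eventually_gt_at_top)
  ultimately have "\<forall>\<^sub>F N in sequentially. (\<Sum>n = 1..N. norm (\<phi> n - (\<Sum>\<theta>\<in>\<Theta>1. c \<theta> * e \<theta> ^ n))) / real N \<le> \<epsilon>"
  proof eventually_elim
    case (elim N)
    have b: "(norm (\<phi> n - \<rho> n))\<^sup>2 \<le> (3 * R + 2) * (2 * (norm (\<phi> n - \<rho>0 n) + \<delta>))" for n
    proof -
      have "norm (\<phi> n - \<rho> n) \<le> R + 2 * (R + \<delta>)"
        by (rule order_trans[OF norm_triangle_ineq4 add_mono[OF R(2) \<rho>(3)]])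
      also have "\<dots> \<le> 3 * R + 2" using \<delta> by simp
      finally have "norm (\<phi> n - \<rho> n) \<le> 3 * R + 2" .
      then show ?thesis unfolding power2_eq_square using \<rho>(2)[of n] R by (intro mult_mono) auto
    qed
    have "(\<Sum>n = 1..N. (norm (\<phi> n - \<rho> n))\<^sup>2) / N \<le> (\<Sum>n = 1..N. (3 * R + 2) * (2 * (norm (\<phi> n - \<rho>0 n) + \<delta>))) / N"
      by (intro divide_right_mono sum_mono b) simp
    also have "\<dots> = (3 * R + 2) * 2 * ((\<Sum>n = 1..N. norm (\<phi> n - \<rho>0 n)) / N + \<delta>)"
    proof -
      have "(\<Sum>n = 1..N. (3 * R + 2) * (2 * (norm (\<phi> n - \<rho>0 n) + \<delta>))) = (3 * R + 2) * 2 * ((\<Sum>n = 1..N. norm (\<phi> n - \<rho>0 n)) + N * \<delta>)"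
        by (simp only: sum_distrib_left[symmetric] sum.distrib mult.assoc) simp
      moreover have "((\<Sum>n = 1..N. norm (\<phi> n - \<rho>0 n)) + N * \<delta>) / N = (\<Sum>n = 1..N. norm (\<phi> n - \<rho>0 n)) / N + \<delta>"
        using elim(3) by (simp add: add_divide_distrib)
      ultimately show ?thesis by (simp only: times_divide_eq_right[symmetric])
    qed
    also have "\<dots> \<le> (3 * R + 2) * 2 * (\<delta> + \<delta>)" using elim(2) R by (intro mult_left_mono add_right_mono) auto
    also have "\<dots> = K * \<delta>" by (simp add: K_def)
    finally have "(\<Sum>n = 1..N. (norm (\<phi> n - (\<Sum>\<theta>\<in>\<Theta>1. c \<theta> * e \<theta> ^ n)))\<^sup>2) / N \<le> \<epsilon>\<^sup>2"
      using elim(1) K\<delta> unfolding un \<rho>eq by linarith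
    moreover have "((\<Sum>n = 1..N. norm (\<phi> n - (\<Sum>\<theta>\<in>\<Theta>1. c \<theta> * e \<theta> ^ n))) / N)\<^sup>2 \<le> (\<Sum>n = 1..N. (norm (\<phi> n - (\<Sum>\<theta>\<in>\<Theta>1. c \<theta> * e \<theta> ^ n)))\<^sup>2) / N"
    proof -
      have "(\<Sum>n = 1..N. norm (\<phi> n - (\<Sum>\<theta>\<in>\<Theta>1. c \<theta> * e \<theta> ^ n)))\<^sup>2 / (real N)\<^sup>2 \<le> (\<Sum>n = 1..N. (norm (\<phi> n - (\<Sum>\<theta>\<in>\<Theta>1. c \<theta> * e \<theta> ^ n)))\<^sup>2) * N / (real N)\<^sup>2"
        using sum_squared_le_sum_of_squares[of "\<lambda>n. norm (\<phi> n - (\<Sum>\<theta>\<in>\<Theta>1. c \<theta> * e \<theta> ^ n))" "{1..N}"]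
        by (intro divide_right_mono) simp_all
      then show ?thesis using elim(3) by (simp add: power_divide power2_eq_square)
    qed
    ultimately have "((\<Sum>n = 1..N. norm (\<phi> n - (\<Sum>\<theta>\<in>\<Theta>1. c \<theta> * e \<theta> ^ n))) / N)\<^sup>2 \<le> \<epsilon>\<^sup>2" by (rule order_trans[rotated])
    then show ?case by (rule power2_le_imp_le[OF _ less_imp_le[OF \<epsilon>]])
  qed
  then show ?thesis using that[of \<Theta>1 c] \<Theta> by (auto simp: \<Theta>1_def)
qed

section \<open>The weighted averages\<close>

context measure_preserving_system
begin

definition weighted_avg :: "(nat \<Rightarrow> complex) \<Rightarrow> nat \<Rightarrow> (nat \<Rightarrow> 'a \<Rightarrow> complex) \<Rightarrow> nat \<Rightarrow> 'a \<Rightarrow> complex" where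
  "weighted_avg u k g N = (\<lambda>x. average (\<lambda>n. u n * (\<Prod>j\<in>{1..k}. g j ((T ^^ (j * n)) x))) N)"

lemma weighted_avg_bounded_measurable:
  assumes "\<And>j. j \<in> {1..k} \<Longrightarrow> g j \<in> bounded_measurable M"
  shows "weighted_avg u k g N \<in> bounded_measurable M"
  unfolding weighted_avg_def average_def by (intro L2.A_intros bounded_measurable_comp_T_pow assms)

lemma weighted_avg_char: "weighted_avg (\<lambda>n. e \<theta> ^ n) k g N = mavg (e \<theta>) k g N"
  by (simp add: weighted_avg_def mavg_def average_def)

lemma nrm_weighted_avg_le:
  assumes g: "\<And>j. j \<in> {1..k} \<Longrightarrow> L2.unit_bdd (g j)"
  shows "L2.nrm (weighted_avg u k g N) \<le> (\<Sum>n = 1..N. norm (u n)) / real N"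
proof (rule L2.nrm_le_bdd)
  show "weighted_avg u k g N \<in> bounded_measurable M"
    using g by (intro weighted_avg_bounded_measurable L2.unit_bddD(1)) auto
  fix x
  have P: "norm (\<Prod>j\<in>{1..k}. g j ((T ^^ (j * n)) x)) \<le> 1" for n
    using g by (intro norm_prod_le_1 L2.unit_bddD(2)) auto
  have "norm (weighted_avg u k g N x) \<le> (\<Sum>n = 1..N. norm (u n * (\<Prod>j\<in>{1..k}. g j ((T ^^ (j * n)) x)))) / real N"
    unfolding weighted_avg_def by (rule norm_average_le)
  also have "\<dots> \<le> (\<Sum>n = 1..N. norm (u n)) / real N"
    unfolding norm_mult by (intro divide_right_mono sum_mono mult_left_le P) auto
  finally show "norm (weighted_avg u k g N x) \<le> (\<Sum>n = 1..N. norm (u n)) / real N" .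
qed

lemma weighted_avg_diff:
  "weighted_avg (\<lambda>n. u n - v n) k g N = (\<lambda>x. weighted_avg u k g N x - weighted_avg v k g N x)"
  by (simp add: weighted_avg_def left_diff_distrib average_diff)

lemma weighted_avg_trig:
  "weighted_avg (\<lambda>n. \<Sum>\<theta>\<in>\<Theta>. c \<theta> * e \<theta> ^ n) k g N = (\<lambda>x. \<Sum>\<theta>\<in>\<Theta>. c \<theta> * mavg (e \<theta>) k g N x)"
  unfolding weighted_avg_char[symmetric]
  by (simp add: weighted_avg_def average_scale[symmetric] average_sum[symmetric] sum_distrib_right mult.assoc)

lemma trig_weighted_limit:
  fixes c :: "circle \<Rightarrow> complex"
  assumes g: "\<And>j. j \<in> {1..k} \<Longrightarrow> L2.unit_bdd (g j)" and k: "0 < k"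
    and F: "F \<in> bounded_measurable M" "(\<lambda>N. L2.nrm (\<lambda>x. mavg 1 k g N x - F x)) \<longlonglongrightarrow> 0"
    and \<Theta>: "finite \<Theta>" "\<And>\<theta>. \<theta> \<in> \<Theta> \<Longrightarrow> \<theta> \<noteq> 0 \<Longrightarrow> - \<theta> \<notin> discrete_spectrum M T"
  defines "c0 \<equiv> (if 0 \<in> \<Theta> then c 0 else 0)" and "\<rho> \<equiv> \<lambda>n. \<Sum>\<theta>\<in>\<Theta>. c \<theta> * e \<theta> ^ n"
  shows "average \<rho> \<longlonglongrightarrow> c0" "(\<lambda>N. L2.nrm (\<lambda>x. weighted_avg \<rho> k g N x - c0 * F x)) \<longlonglongrightarrow> 0"
proof -
  have gb: "g j \<in> bounded_measurable M" if "j \<in> {1..k}" for j using g[OF that] by (rule L2.unit_bddD)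
  have mA: "mavg z k g N \<in> bounded_measurable M" for z N by (intro mavg_bounded_measurable gb)
  have c0: "(\<Sum>\<theta>\<in>\<Theta>. c \<theta> * (if \<theta> = 0 then y else 0)) = c0 * y" for y
  proof -
    have "(\<Sum>\<theta>\<in>\<Theta>. c \<theta> * (if \<theta> = 0 then y else 0)) = (\<Sum>\<theta>\<in>\<Theta>. if \<theta> = 0 then c 0 * y else 0)"
      by (intro sum.cong) auto
    then show ?thesis using \<Theta>(1) by (simp add: sum.delta c0_def)
  qed
  have "average \<rho> = (\<lambda>N. \<Sum>\<theta>\<in>\<Theta>. c \<theta> * average (\<lambda>n. e \<theta> ^ n) N)"
    unfolding \<rho>_def average_scale[symmetric] average_sum[symmetric] ..
  moreover have "(\<lambda>N. \<Sum>\<theta>\<in>\<Theta>. c \<theta> * average (\<lambda>n. e \<theta> ^ n) N) \<longlonglongrightarrow> (\<Sum>\<theta>\<in>\<Theta>. c \<theta> * (if \<theta> = 0 then 1 else 0))"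
    by (intro tendsto_sum tendsto_mult tendsto_const average_e_tendsto)
  ultimately show "average \<rho> \<longlonglongrightarrow> c0" using c0[of 1] by simp
  define F' where "F' \<theta> x = (if \<theta> = 0 then F x else 0)" for \<theta> :: circle and x
  have F'A: "F' \<theta> \<in> bounded_measurable M" for \<theta>
    unfolding F'_def[abs_def] using F(1) L2.const_A[of 0] by (cases "\<theta> = 0") auto
  have lim: "(\<lambda>N. L2.nrm (\<lambda>x. mavg (e \<theta>) k g N x - F' \<theta> x)) \<longlonglongrightarrow> 0" if "\<theta> \<in> \<Theta>" for \<theta>
  proof (cases "\<theta> = 0")
    case True
    then show ?thesis using F(2) by (simp add: F'_def)
  next
    case False
    then show ?thesis using mavg_null[OF g k \<Theta>(2)[OF that False]] by (simp add: F'_def)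
  qed
  have le: "L2.nrm (\<lambda>x. weighted_avg \<rho> k g N x - c0 * F x) \<le> (\<Sum>\<theta>\<in>\<Theta>. norm (c \<theta>) * L2.nrm (\<lambda>x. mavg (e \<theta>) k g N x - F' \<theta> x))" for N
  proof -
    have "(\<lambda>x. weighted_avg \<rho> k g N x - c0 * F x) = (\<lambda>x. \<Sum>\<theta>\<in>\<Theta>. c \<theta> * (mavg (e \<theta>) k g N x - F' \<theta> x))"
      unfolding \<rho>_def weighted_avg_trig F'_def c0[symmetric] by (simp add: right_diff_distrib sum_subtractf)
    then have "L2.nrm (\<lambda>x. weighted_avg \<rho> k g N x - c0 * F x) \<le> (\<Sum>\<theta>\<in>\<Theta>. L2.nrm (\<lambda>x. c \<theta> * (mavg (e \<theta>) k g N x - F' \<theta> x)))"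
      by (simp only:) (intro L2.nrm_sum L2.A_intros mA F'A)
    also have "\<dots> = (\<Sum>\<theta>\<in>\<Theta>. norm (c \<theta>) * L2.nrm (\<lambda>x. mavg (e \<theta>) k g N x - F' \<theta> x))"
      by (intro sum.cong refl L2.nrm_scale L2.A_intros mA F'A)
    finally show ?thesis .
  qed
  have "(\<lambda>N. \<Sum>\<theta>\<in>\<Theta>. norm (c \<theta>) * L2.nrm (\<lambda>x. mavg (e \<theta>) k g N x - F' \<theta> x)) \<longlonglongrightarrow> (\<Sum>\<theta>\<in>\<Theta>. norm (c \<theta>) * 0)"
    by (intro tendsto_sum tendsto_mult tendsto_const lim)
  then have lim0: "(\<lambda>N. \<Sum>\<theta>\<in>\<Theta>. norm (c \<theta>) * L2.nrm (\<lambda>x. mavg (e \<theta>) k g N x - F' \<theta> x)) \<longlonglongrightarrow> 0" by simp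
  have "0 \<le> L2.nrm (\<lambda>x. weighted_avg \<rho> k g N x - c0 * F x)" for N
    by (intro L2.nrm_ge_0 L2.diff_A L2.scale_A F weighted_avg_bounded_measurable gb)
  then show "(\<lambda>N. L2.nrm (\<lambda>x. weighted_avg \<rho> k g N x - c0 * F x)) \<longlonglongrightarrow> 0"
    by (rule tendsto_0_squeeze[OF _ le lim0])
qed

text \<open>Existence of the mean of \<phi> is part of the claim. The coefficients \<open>c0\<close>
  at frequency \<open>0\<close> of the approximations locate it up to \<open>2 * \<epsilon>\<close>,
  and the same \<open>c0\<close> serves for the weighted averages.\<close>

lemma weighted_limit:
  assumes g: "\<And>j. j \<in> {1..k} \<Longrightarrow> L2.unit_bdd (g j)" and k: "0 < k"
    and F: "F \<in> bounded_measurable M" "(\<lambda>N. L2.nrm (\<lambda>x. mavg 1 k g N x - F x)) \<longlonglongrightarrow> 0"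
    and bap: "besicovitch_almost_periodic \<phi>"
    and spec: "discrete_spectrum M T \<inter> group_closure (seq_spectrum \<phi>) = {0}"
  obtains c where "average \<phi> \<longlonglongrightarrow> c" "(\<lambda>N. L2.nrm (\<lambda>x. weighted_avg \<phi> k g N x - c * F x)) \<longlonglongrightarrow> 0"
proof -
  have gb: "g j \<in> bounded_measurable M" if "j \<in> {1..k}" for j using g[OF that] by (rule L2.unit_bddD)
  have wA: "weighted_avg u k g N \<in> bounded_measurable M" for u N by (intro weighted_avg_bounded_measurable gb)
  have approx: "\<exists>c0. (\<forall>\<^sub>F N in sequentially. norm (average \<phi> N - c0) \<le> 2 * \<epsilon>) \<and>
      (\<forall>\<^sub>F N in sequentially. L2.nrm (\<lambda>x. weighted_avg \<phi> k g N x - c0 * F x) \<le> 2 * \<epsilon>)" if \<epsilon>: "0 < \<epsilon>" for \<epsilon>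
  proof -
    obtain \<Theta> c where \<Theta>: "finite \<Theta>" "\<Theta> \<subseteq> seq_spectrum \<phi>"
      and close: "\<forall>\<^sub>F N in sequentially. (\<Sum>n = 1..N. norm (\<phi> n - (\<Sum>\<theta>\<in>\<Theta>. c \<theta> * e \<theta> ^ n))) / real N \<le> \<epsilon>"
      using besicovitch_spectral_approximation[OF bap \<epsilon>] by blast
    have nspec: "- \<theta> \<notin> discrete_spectrum M T" if "\<theta> \<in> \<Theta>" "\<theta> \<noteq> 0" for \<theta>
    proof
      assume "- \<theta> \<in> discrete_spectrum M T"
      \<comment> \<open>The eigenvalue that could obstruct the limit belongs to
        \<open>- \<theta>\<close>, which lies in the generated subgroup together with
        \<theta>.\<close>
      moreover have "- \<theta> \<in> group_closure (seq_spectrum \<phi>)"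
        using that \<Theta>(2) by (auto intro: group_closure.base)
      ultimately have "- \<theta> = 0" using spec by blast
      then show False using that(2) by simp
    qed
    define \<rho> where "\<rho> n = (\<Sum>\<theta>\<in>\<Theta>. c \<theta> * e \<theta> ^ n)" for n
    define c0 where "c0 = (if 0 \<in> \<Theta> then c 0 else 0)"
    note lim = trig_weighted_limit[OF g k F \<Theta>(1) nspec, of c, folded \<rho>_def[abs_def] c0_def]
    have "\<forall>\<^sub>F N in sequentially. norm (average \<rho> N - c0) < \<epsilon>"
      by (rule order_tendstoD(2)[OF tendsto_norm_zero[OF LIM_zero[OF lim(1)]] \<epsilon>])
    then have 1: "\<forall>\<^sub>F N in sequentially. norm (average \<phi> N - c0) \<le> 2 * \<epsilon>"
      using close
    proof eventually_elim
      case (elim N)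
      have "norm (average \<phi> N - average \<rho> N) \<le> \<epsilon>"
        using norm_average_le[of "\<lambda>n. \<phi> n - \<rho> n" N] elim(2) by (simp add: average_diff \<rho>_def[abs_def])
      then show ?case using elim(1) norm_triangle_ineq[of "average \<phi> N - average \<rho> N" "average \<rho> N - c0"] by simp
    qed
    have "\<forall>\<^sub>F N in sequentially. L2.nrm (\<lambda>x. weighted_avg \<rho> k g N x - c0 * F x) < \<epsilon>"
      by (rule order_tendstoD(2)[OF lim(2) \<epsilon>])
    then have 2: "\<forall>\<^sub>F N in sequentially. L2.nrm (\<lambda>x. weighted_avg \<phi> k g N x - c0 * F x) \<le> 2 * \<epsilon>"
      using close
    proof eventually_elim
      case (elim N)
      have "L2.nrm (\<lambda>x. weighted_avg \<phi> k g N x - weighted_avg \<rho> k g N x) \<le> \<epsilon>"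
        using nrm_weighted_avg_le[of k g "\<lambda>n. \<phi> n - \<rho> n" N, OF g] elim(2) by (simp add: weighted_avg_diff \<rho>_def[abs_def])
      moreover have "L2.nrm (\<lambda>x. weighted_avg \<phi> k g N x - c0 * F x) \<le>
        L2.nrm (\<lambda>x. weighted_avg \<phi> k g N x - weighted_avg \<rho> k g N x) + L2.nrm (\<lambda>x. weighted_avg \<rho> k g N x - c0 * F x)"
        by (intro L2.nrm_diff_triangle wA L2.scale_A F)
      ultimately show ?case using elim(1) by linarith
    qed
    show ?thesis using 1 2 by blast
  qed
  have "Cauchy (average \<phi>)"
  proof (rule metric_CauchyI)
    fix r :: real assume r: "0 < r"
    then obtain c0 where "\<forall>\<^sub>F N in sequentially. norm (average \<phi> N - c0) \<le> 2 * (r / 6)" using approx[of "r / 6"] by auto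
    then obtain N0 where N0: "\<And>N. N0 \<le> N \<Longrightarrow> norm (average \<phi> N - c0) \<le> r / 3" by (auto simp: eventually_sequentially)
    have "dist (average \<phi> m) (average \<phi> n) < r" if "N0 \<le> m" "N0 \<le> n" for m n
      using N0[OF that(1)] N0[OF that(2)] dist_triangle2[of "average \<phi> m" "average \<phi> n" c0] r
      by (simp add: dist_norm)
    then show "\<exists>N0. \<forall>m\<ge>N0. \<forall>n\<ge>N0. dist (average \<phi> m) (average \<phi> n) < r" by blast
  qed
  then obtain c where c: "average \<phi> \<longlonglongrightarrow> c" using Cauchy_convergent convergent_def by blast
  have "(\<lambda>N. L2.nrm (\<lambda>x. weighted_avg \<phi> k g N x - c * F x)) \<longlonglongrightarrow> 0"
  \<comment> \<open>Exchanging \<open>c0\<close> for the limit \<open>c\<close> costs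
    \<open>norm (c - c0) * L2.nrm F\<close>, on top of the approximation error
    \<open>2 * \<epsilon>\<close>.\<close>
  proof (rule tendsto_0_of_le[where c = "2 + 2 * L2.nrm F"])
    have F0: "0 \<le> L2.nrm F" by (rule L2.nrm_ge_0[OF F(1)])
    then show "0 < 2 + 2 * L2.nrm F" by simp
    show "0 \<le> L2.nrm (\<lambda>x. weighted_avg \<phi> k g N x - c * F x)" for N
      by (intro L2.nrm_ge_0 L2.A_intros wA F)
    fix \<epsilon> :: real assume \<epsilon>: "0 < \<epsilon>"
    obtain c0 where c0: "\<forall>\<^sub>F N in sequentially. norm (average \<phi> N - c0) \<le> 2 * \<epsilon>"
      and W: "\<forall>\<^sub>F N in sequentially. L2.nrm (\<lambda>x. weighted_avg \<phi> k g N x - c0 * F x) \<le> 2 * \<epsilon>"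
      using approx[OF \<epsilon>] by blast
    have cc: "norm (c - c0) \<le> 2 * \<epsilon>"
      by (rule tendsto_upperbound[OF tendsto_norm[OF tendsto_diff[OF c tendsto_const]] c0]) simp
    show "\<forall>\<^sub>F N in sequentially. L2.nrm (\<lambda>x. weighted_avg \<phi> k g N x - c * F x) \<le> (2 + 2 * L2.nrm F) * \<epsilon>"
      using W
    proof eventually_elim
      case (elim N)
      have "L2.nrm (\<lambda>x. weighted_avg \<phi> k g N x - c * F x) \<le>
         L2.nrm (\<lambda>x. weighted_avg \<phi> k g N x - c0 * F x) + L2.nrm (\<lambda>x. c0 * F x - c * F x)"
        by (intro L2.nrm_diff_triangle wA L2.scale_A F)
      also have "L2.nrm (\<lambda>x. c0 * F x - c * F x) = norm (c - c0) * L2.nrm F"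
        using L2.nrm_scale[OF F(1), of "c0 - c"] by (simp add: left_diff_distrib norm_minus_commute)
      also have "\<dots> \<le> 2 * \<epsilon> * L2.nrm F" using cc F0 by (rule mult_right_mono)
      finally show ?case using elim by (simp add: algebra_simps)
    qed
  qed
  then show ?thesis using that c by blast
qed

section \<open>From almost everywhere bounded functions to bounded ones\<close>

lemma L2_tendsto_of_AE_eq:
  assumes a: "\<And>N. a N \<in> borel_measurable M" "\<And>N. AE x in M. a N x = b N x"
    and b: "\<And>N. b N \<in> bounded_measurable M" "G \<in> bounded_measurable M"
    and lim: "(\<lambda>N. L2.nrm (\<lambda>x. b N x - G x)) \<longlonglongrightarrow> 0"
  shows "L2_tendsto M a G"
proof -
  have sq: "integrable M (\<lambda>x. (norm (h x))\<^sup>2)" if h: "h \<in> bounded_measurable M" for h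
  proof -
    have "integrable M (\<lambda>x. Re (h x * cnj (h x)))"
      by (intro integrable_Re bounded_measurable_integrable L2.mult_A L2.cnj_A h)
    then show ?thesis by (simp only: complex_norm_square[symmetric] Re_complex_of_real)
  qed
  have [measurable]: "a N \<in> borel_measurable M" "b N \<in> borel_measurable M" "G \<in> borel_measurable M" for N
    using a b by (auto intro: bounded_measurableD)
  have "a N \<in> L2 M" for N
  proof -
    have "integrable M (\<lambda>x. (norm (a N x))\<^sup>2) \<longleftrightarrow> integrable M (\<lambda>x. (norm (b N x))\<^sup>2)"
      using a(2)[of N] by (intro integrable_cong_AE) auto
    then show ?thesis using sq[OF b(1)] by (simp add: L2_def)
  qed
  moreover have "G \<in> L2 M" using sq[OF b(2)] by (simp add: L2_def)
  moreover have "L2_norm M (\<lambda>x. a N x - G x) = L2.nrm (\<lambda>x. b N x - G x)" for N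
  proof -
    have "(\<integral>x. (norm (a N x - G x))\<^sup>2 \<partial>M) = (\<integral>x. (norm (b N x - G x))\<^sup>2 \<partial>M)"
      using a(2)[of N] by (intro integral_cong_AE) auto
    then show ?thesis using nrm_eq_L2_norm[OF L2.diff_A[OF b(1) b(2)], of N] by (simp add: L2_norm_def)
  qed
  ultimately show ?thesis unfolding L2_tendsto_def using lim by simp
qed

text \<open>The exceptional null set of each \<open>f j\<close> is pulled back along all iterates of
  \<open>T\<close>. The measure is preserved and the iterates are countably many, so one null set
  serves for all \<open>n\<close> and \<open>j\<close>.\<close>

lemma Linfty_normalize:
  assumes f: "\<And>j. j \<in> {1..k} \<Longrightarrow> f j \<in> Linfty M"
  obtains C g where "0 < C" "\<And>j. j \<in> {1..k} \<Longrightarrow> L2.unit_bdd (g j)"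
    "AE x in M. \<forall>n. \<forall>j\<in>{1..k}. f j ((T ^^ (j * n)) x) = of_real C * g j ((T ^^ (j * n)) x)"
proof -
  have fm: "f j \<in> borel_measurable M" if "j \<in> {1..k}" for j using f[OF that] by (simp add: Linfty_def)
  have "\<forall>j. \<exists>C. j \<in> {1..k} \<longrightarrow> (AE x in M. norm (f j x) \<le> C)" using f by (auto simp: Linfty_def)
  then obtain D where D: "\<And>j. j \<in> {1..k} \<Longrightarrow> AE x in M. norm (f j x) \<le> D j" by metis
  define C where "C = 1 + (\<Sum>j\<in>{1..k}. \<bar>D j\<bar>)"
  have C: "0 < C" unfolding C_def by (simp add: add_pos_nonneg sum_nonneg)
  have DC: "D j \<le> C" if "j \<in> {1..k}" for j
    using member_le_sum[OF that, of "\<lambda>j. \<bar>D j\<bar>"] abs_ge_self[of "D j"] by (simp add: C_def)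
  define g where "g j x = (if norm (f j x) \<le> C then f j x / of_real C else 0)" for j x
  have g1: "norm (g j x) \<le> 1" for j x using C by (simp add: g_def norm_divide)
  have g: "L2.unit_bdd (g j)" if "j \<in> {1..k}" for j
  proof -
    have [measurable]: "f j \<in> borel_measurable M" by (rule fm[OF that])
    have "g j \<in> borel_measurable M" unfolding g_def[abs_def] by measurable
    then have "g j \<in> bounded_measurable M" using g1 by (auto simp: bounded_measurable_def)
    then show ?thesis using g1 by (simp add: L2.unit_bdd_def)
  qed
  have "AE x in M. f j ((T ^^ m) x) = of_real C * g j ((T ^^ m) x)" if j: "j \<in> {1..k}" for j m
  proof -
    have "AE x in M. f j x = of_real C * g j x"
      using D[OF j] by eventually_elim (use DC[OF j] C in \<open>auto simp: g_def\<close>)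
    then have "AE x in distr M M (T ^^ m). f j x = of_real C * g j x" unfolding distr_T_pow .
    then show ?thesis by (rule AE_distrD[OF measurable_T_pow])
  qed
  then have "AE x in M. \<forall>n. \<forall>j\<in>{1..k}. f j ((T ^^ (j * n)) x) = of_real C * g j ((T ^^ (j * n)) x)"
    by (simp add: AE_all_countable AE_ball_countable)
  then show ?thesis using that C g by blast
qed

end

theorem theorem2p7:
  fixes \<phi> :: "nat \<Rightarrow> complex"
    and M :: "'a measure" and T :: "'a \<Rightarrow> 'a"
    and k :: nat and f :: "nat \<Rightarrow> 'a \<Rightarrow> complex"
  assumes "besicovitch_almost_periodic \<phi>"
    and "measure_preserving_system M T"
    and "discrete_spectrum M T \<inter> group_closure (seq_spectrum \<phi>) = {0}"
    and "k \<ge> 1"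
    and "\<And>j. j \<in> {1..k} \<Longrightarrow> f j \<in> Linfty M"
  shows "\<exists>(c :: complex) (F :: 'a \<Rightarrow> complex).
      average \<phi> \<longlonglongrightarrow> c \<and>
      L2_tendsto M (\<lambda>N x. average (\<lambda>n. \<Prod>j = 1..k. koopman T (j * n) (f j) x) N) F \<and>
      L2_tendsto M (\<lambda>N x. average (\<lambda>n. \<phi> n * (\<Prod>j = 1..k. koopman T (j * n) (f j) x)) N)
        (\<lambda>x. c * F x)"
proof -
  interpret measure_preserving_system M T by fact
  have k: "0 < k" using assms(4) by simp
  obtain C g where C: "0 < C" and g: "\<And>j. j \<in> {1..k} \<Longrightarrow> L2.unit_bdd (g j)"
    and ae: "AE x in M. \<forall>n. \<forall>j\<in>{1..k}. f j ((T ^^ (j * n)) x) = of_real C * g j ((T ^^ (j * n)) x)"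
    using Linfty_normalize[of k f thesis, OF assms(5)] by blast
  have gb: "g j \<in> bounded_measurable M" if "j \<in> {1..k}" for j using g[OF that] by (rule L2.unit_bddD)
  have mA: "mavg 1 k g N \<in> bounded_measurable M" for N by (intro mavg_bounded_measurable gb)
  have w1: "weighted_avg (\<lambda>n. 1) k g N = mavg 1 k g N" for N using weighted_avg_char[of 0 k g N] by simp
  have m1: "norm (mavg 1 k g N x) \<le> 1" for N x
  proof -
    have "norm (\<Sum>l\<in>{1..N}. \<Prod>j\<in>{1..k}. g j ((T ^^ (j * l)) x)) \<le> (\<Sum>l\<in>{1..N}. 1)"
      using g by (intro sum_norm_le norm_prod_le_1 L2.unit_bddD(2)) auto
    then show ?thesis unfolding mavg_def by (cases "N = 0") (simp_all add: norm_divide field_simps)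
  qed
  obtain F where F: "F \<in> bounded_measurable M" "(\<lambda>N. L2.nrm (\<lambda>x. mavg 1 k g N x - F x)) \<longlonglongrightarrow> 0"
    using L2_complete[OF mA m1 mavg_Cauchy[OF g]] by blast
  obtain c where c: "average \<phi> \<longlonglongrightarrow> c" and W: "(\<lambda>N. L2.nrm (\<lambda>x. weighted_avg \<phi> k g N x - c * F x)) \<longlonglongrightarrow> 0"
    using weighted_limit[OF g k F assms(1,3)] by blast
  \<comment> \<open>Each of the \<open>k\<close> functions was divided by \<open>C\<close>, so the
    products differ by \<open>C ^ k\<close>.\<close>
  define D where "D = complex_of_real C ^ k"
  \<comment> \<open>Stated for a general weight \<open>u\<close>, to be used for the constant
    \<open>1\<close> and for \<phi>.\<close>
  have lim: "L2_tendsto M (\<lambda>N x. average (\<lambda>n. u n * (\<Prod>j = 1..k. koopman T (j * n) (f j) x)) N) (\<lambda>x. D * G x)"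
    if G: "G \<in> bounded_measurable M" "(\<lambda>N. L2.nrm (\<lambda>x. weighted_avg u k g N x - G x)) \<longlonglongrightarrow> 0" for u G
  proof (rule L2_tendsto_of_AE_eq)
    have wA: "weighted_avg u k g N \<in> bounded_measurable M" for N by (intro weighted_avg_bounded_measurable gb)
    show "(\<lambda>x. D * weighted_avg u k g N x) \<in> bounded_measurable M" for N by (intro L2.scale_A wA)
    show "(\<lambda>x. D * G x) \<in> bounded_measurable M" by (intro L2.scale_A G)
    have "(\<lambda>x. f j ((T ^^ m) x)) \<in> borel_measurable M" if "j \<in> {1..k}" for j m
      using assms(5)[OF that] by (intro measurable_compose[OF measurable_T_pow]) (simp add: Linfty_def)
    then show "(\<lambda>x. average (\<lambda>n. u n * (\<Prod>j = 1..k. koopman T (j * n) (f j) x)) N) \<in> borel_measurable M" for N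
      unfolding average_def koopman_def comp_def
      by (intro borel_measurable_divide borel_measurable_sum borel_measurable_times borel_measurable_prod borel_measurable_const)
    show "AE x in M. average (\<lambda>n. u n * (\<Prod>j = 1..k. koopman T (j * n) (f j) x)) N = D * weighted_avg u k g N x" for N
      using ae
    proof eventually_elim
      case (elim x)
      have "(\<Prod>j = 1..k. koopman T (j * n) (f j) x) = D * (\<Prod>j\<in>{1..k}. g j ((T ^^ (j * n)) x))" for n
      proof -
        have "(\<Prod>j = 1..k. koopman T (j * n) (f j) x) = (\<Prod>j\<in>{1..k}. of_real C * g j ((T ^^ (j * n)) x))"
          using elim by (intro prod.cong) (auto simp: koopman_def)
        then show ?thesis by (simp add: prod.distrib D_def)
      qed
      then show ?case by (simp add: weighted_avg_def average_scale[symmetric] mult.left_commute)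
    qed
    have "L2.nrm (\<lambda>x. D * weighted_avg u k g N x - D * G x) = norm D * L2.nrm (\<lambda>x. weighted_avg u k g N x - G x)" for N
      using L2.nrm_scale[OF L2.diff_A[OF wA G(1)], of D N] by (simp add: right_diff_distrib)
    moreover have "(\<lambda>N. norm D * L2.nrm (\<lambda>x. weighted_avg u k g N x - G x)) \<longlonglongrightarrow> norm D * 0"
      by (intro tendsto_mult tendsto_const G)
    ultimately show "(\<lambda>N. L2.nrm (\<lambda>x. D * weighted_avg u k g N x - D * G x)) \<longlonglongrightarrow> 0" by simp
  qed
  have "L2_tendsto M (\<lambda>N x. average (\<lambda>n. \<Prod>j = 1..k. koopman T (j * n) (f j) x) N) (\<lambda>x. D * F x)"
    using lim[of F "\<lambda>n. 1"] F by (simp add: w1)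
  moreover have "L2_tendsto M (\<lambda>N x. average (\<lambda>n. \<phi> n * (\<Prod>j = 1..k. koopman T (j * n) (f j) x)) N) (\<lambda>x. c * (D * F x))"
    using lim[OF L2.scale_A[OF F(1), of c] W] by (simp add: mult.left_commute)
  ultimately show ?thesis using c by blast
qed

end
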